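(* (Central limit theorem with law of large numbers.) Let $\{(X_i,Y_i)\}_{i=1}^{\infty}$ be a sequence of $\mathbb{R}^d\times\mathbb{R}^d$-valued random vectors on a sublinear expectation space $(\Omega,\mathcal{H},\mathbb{E})$. Assume that, for each $i=1,2,\dots$, $(X_{i+1},Y_{i+1})\overset{d}{=}(X_i,Y_i)$ and $(X_{i+1},Y_{i+1})$ is independent from $((X_1,Y_1),\dots,(X_i,Y_i))$, and that $\mathbb{E}[X_1]=\mathbb{E}[-X_1]=0$. Put $$\bar S_n:=\sum_{i=1}^n\Big(\frac{X_i}{\sqrt n}+\frac{Y_i}{n}\Big).$$ Then $\{\bar S_n\}$ converges in law to $X+\eta$, i.e. $$\lim_{n\to\infty}\mathbb{E}[\varphi(\bar S_n)]=\mathbb{E}[\varphi(X+\eta)]$$ for all $\varphi\in C(\mathbb{R}^d)$ satisfying a linear growth condition $|\varphi(x)|\le C(1+|x|)$, where the pair $(X,\eta)$ is $G$-distributed with associated sublinear function $G:\mathbb{R}^d\times\mathbb{S}(d)\to\mathbb{R}$, $$G(p,A):=\mathbb{E}\big[\langle p,Y_1\rangle+\tfrac12\langle AX_1,X_1\rangle\big],\qquad A\in\mathbb{S}(d),\ p\in\mathbb{R}^d,$$ that is, $\mathbb{E}[\langle p,\eta\rangle+\frac12\langle AX,X\rangle]=G(p,A)$ for all $(p,A)$. (Thus, if $\varphi\in C_{l.Lip}(\mathbb{R}^d)$, $\mathbb{E}[\varphi(X+\eta)]=v(1,0)$, where $v$ is the unique viscosity solution, of polynomial growth, of $\partial_tv-G(D_xv,D_x^2v)=0$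 on $(0,\infty)\times\mathbb{R}^d$, $v|_{t=0}=\varphi$.)
   Context: $\mathbb{S}(d)$ is the space of symmetric $d\times d$ real matrices. $C_{l.Lip}(\mathbb{R}^n)$ is the space of functions $\varphi:\mathbb{R}^n\to\mathbb{R}$ with $|\varphi(x)-\varphi(y)|\le C(1+|x|^m+|y|^m)|x-y|$ for some $C>0$, $m\in\mathbb{N}$ depending on $\varphi$. Sublinear expectation space $(\Omega,\mathcal{H},\mathbb{E})$: $\Omega$ is a set; $\mathcal{H}$ is a linear space of real functions on $\Omega$ containing the constants, with $|X|\in\mathcal{H}$ if $X\in\mathcal{H}$, and $\varphi(X_1,\dots,X_n)\in\mathcal{H}$ whenever $X_1,\dots,X_n\in\mathcal{H}$ and $\varphi\in C_{l.Lip}(\mathbb{R}^n)$; $\mathbb{E}:\mathcal{H}\to\mathbb{R}$ satisfies: $X\ge Y\Rightarrow\mathbb{E}[X]\ge\mathbb{E}[Y]$; $\mathbb{E}[c]=c$ for $c\in\mathbb{R}$; $\mathbb{E}[X+Y]\le\mathbb{E}[X]+\mathbb{E}[Y]$; $\mathbb{E}[\lambda X]=\lambda\mathbb{E}[X]$ for $\lambda\ge0$. An $n$-dimensional random vector is an element of $\mathcal{H}^n$; $\mathbb{E}$ of a vector is taken componentwise. Two $n$-dimensional random vectors $X_1,X_2$ on sublinear expectation spaces with expectations $\mathbb{E}_1,\mathbb{E}_2$ are identically distributed, $X_1\overset{d}{=}X_2$, if $\mathbb{E}_1[\varphi(X_1)]=\mathbb{E}_2[\varphi(X_2)]$ for all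 $\varphi\in C_{l.Lip}(\mathbb{R}^n)$. $Y\in\mathcal{H}^n$ is independent from $X\in\mathcal{H}^m$ if $\mathbb{E}[\varphi(X,Y)]=\mathbb{E}[\mathbb{E}[\varphi(x,Y)]_{x=X}]$ for all $\varphi\in C_{l.Lip}(\mathbb{R}^{m+n})$. An independent copy of a random vector $Z$ is a random vector $\bar Z\overset{d}{=}Z$ independent from $Z$ (realized, if necessary, on a product space). A pair $(X,\eta)$ of $d$-dimensional random vectors is $G$-distributed if $(aX+b\bar X,a^2\eta+b^2\bar\eta)\overset{d}{=}(\sqrt{a^2+b^2}X,(a^2+b^2)\eta)$ for all $a,b\ge0$, where $(\bar X,\bar\eta)$ is an independent copy of $(X,\eta)$; i.e. $\mathbb{E}[\mathbb{E}[\varphi(ax+bX,a^2y+b^2\eta)]_{(x,y)=(X,\eta)}]=\mathbb{E}[\varphi(\sqrt{a^2+b^2}X,(a^2+b^2)\eta)]$ for all $\varphi\in C_{l.Lip}(\mathbb{R}^{2d})$. The law of such a pair is determined by $G(p,A)=\mathbb{E}[\frac12\langle AX,X\rangle+\langle p,\eta\rangle]$. Standing assumption: the space $(\Omega,\mathcal{H},\mathbb{E})$ carries the pair $(X,\eta)$ in question (otherwise $\mathbb{E}[\varphi(X+\eta)]$ is read on another sublinear expectation space carrying it). Convention: for $X\in\mathcal{H}^d$ and $\varphi$ continuous of linear growth, $\mathbb{E}[\varphi(X)]$ is the value of the continuous extension of $\mathbb{E}$ to the completion of $\mathcal{H}$ (modulo null elements) under $\mathbb{E}[|\cdot|]$;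 that is, $\mathbb{E}[\varphi(X)]=\lim_k\mathbb{E}[\varphi_k(X)]$ for any $\varphi_k\in C_{l.Lip}(\mathbb{R}^d)$ such that $|\varphi-\varphi_k|\le\psi_k$ with $\psi_k\in C_{l.Lip}(\mathbb{R}^d)$ and $\mathbb{E}[\psi_k(X)]\to0$. *)

theory Defs
  imports "HOL-Analysis.Analysis"
begin

section \<open>Test functions\<close>

text \<open>
  The space of locally Lipschitz functions of polynomial growth. The norm is a parameter, so
  that besides Euclidean spaces (\<open>N = norm\<close>) also \<open>n\<close>-tuples with varying \<open>n\<close> are covered. A tuple
  is a function on an index type of which only the indices in a finite set \<open>I\<close> matter; it is
  measured by the Euclidean seminorm \<open>tuple_norm I\<close>. If \<open>x\<close> and \<open>y\<close> agree on \<open>I\<close>, then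
  \<open>tuple_norm I (x - y) = 0\<close>, so members of \<open>C_lLip (tuple_norm I)\<close> depend only on
  the coordinates in \<open>I\<close>.
\<close>

definition C_lLip :: "('a::minus \<Rightarrow> real) \<Rightarrow> ('a \<Rightarrow> real) set" where
  "C_lLip N = {\<phi>. \<exists>C>0. \<exists>m::nat. \<forall>x y.
      \<bar>\<phi> x - \<phi> y\<bar> \<le> C * (1 + N x ^ m + N y ^ m) * N (x - y)}"

definition tuple_norm :: "'i set \<Rightarrow> ('i \<Rightarrow> 'a::real_normed_vector) \<Rightarrow> real" where
  "tuple_norm I x = L2_set (\<lambda>i. norm (x i)) I"

definition pair_norm :: "('a \<Rightarrow> real) \<Rightarrow> ('b \<Rightarrow> real) \<Rightarrow> 'a \<times> 'b \<Rightarrow> real" where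
  "pair_norm N M z = sqrt ((N (fst z))\<^sup>2 + (M (snd z))\<^sup>2)"

lemma pair_norm_norm: "pair_norm norm norm = norm"
  by (simp add: fun_eq_iff pair_norm_def norm_prod_def)


section \<open>Sublinear expectation spaces\<close>

text \<open>
  The sample space is the type \<open>'w\<close>. The functional \<open>E\<close> is total, but only its values on \<open>H\<close>
  are constrained.
\<close>

locale sublinear_expectation =
  fixes H :: "('w \<Rightarrow> real) set" and E :: "('w \<Rightarrow> real) \<Rightarrow> real"
  assumes const_in: "(\<lambda>_. c) \<in> H"
    and add_in: "U \<in> H \<Longrightarrow> V \<in> H \<Longrightarrow> (\<lambda>\<omega>. U \<omega> + V \<omega>) \<in> H"
    and scale_in: "U \<in> H \<Longrightarrow> (\<lambda>\<omega>. c * U \<omega>) \<in> H"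
    and abs_in: "U \<in> H \<Longrightarrow> (\<lambda>\<omega>. \<bar>U \<omega>\<bar>) \<in> H"
    and compose_in:
      "(\<And>i. i \<in> {1..n} \<Longrightarrow> Z i \<in> H) \<Longrightarrow> \<phi> \<in> C_lLip (tuple_norm {1..n::nat}) \<Longrightarrow>
         (\<lambda>\<omega>. \<phi> (\<lambda>i. Z i \<omega>)) \<in> H"
    and mono: "U \<in> H \<Longrightarrow> V \<in> H \<Longrightarrow> (\<And>\<omega>. V \<omega> \<le> U \<omega>) \<Longrightarrow> E V \<le> E U"
    and const: "E (\<lambda>_. c) = c"
    and subadd: "U \<in> H \<Longrightarrow> V \<in> H \<Longrightarrow> E (\<lambda>\<omega>. U \<omega> + V \<omega>) \<le> E U + E V"
    and pos_homog: "U \<in> H \<Longrightarrow> 0 \<le> c \<Longrightarrow> E (\<lambda>\<omega>. c * U \<omega>) = c * E U"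

definition random_vector :: "('w \<Rightarrow> real) set \<Rightarrow> ('w \<Rightarrow> 'a::euclidean_space) \<Rightarrow> bool" where
  "random_vector H Z \<longleftrightarrow> (\<forall>b\<in>Basis. (\<lambda>\<omega>. Z \<omega> \<bullet> b) \<in> H)"

definition vec_expectation :: "(('w \<Rightarrow> real) \<Rightarrow> real) \<Rightarrow> ('w \<Rightarrow> real ^ 'd) \<Rightarrow> real ^ 'd" where
  "vec_expectation E Z = (\<chi> i. E (\<lambda>\<omega>. Z \<omega> $ i))"

definition same_law ::
  "(('w \<Rightarrow> real) \<Rightarrow> real) \<Rightarrow> ('w \<Rightarrow> 'a::euclidean_space) \<Rightarrow>
   (('v \<Rightarrow> real) \<Rightarrow> real) \<Rightarrow> ('v \<Rightarrow> 'a) \<Rightarrow> bool" where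
  "same_law E1 Z1 E2 Z2 \<longleftrightarrow>
     (\<forall>\<phi> \<in> C_lLip norm. E1 (\<lambda>\<omega>. \<phi> (Z1 \<omega>)) = E2 (\<lambda>\<omega>. \<phi> (Z2 \<omega>)))"

text \<open>
  \<open>independent_from N E Z W\<close>: the vector \<open>W\<close> is independent from \<open>Z\<close>, where \<open>N\<close> is the norm
  on the value space of \<open>Z\<close>. The notion is not symmetric in \<open>Z\<close> and \<open>W\<close>.
\<close>

definition independent_from ::
  "('a::minus \<Rightarrow> real) \<Rightarrow> (('w \<Rightarrow> real) \<Rightarrow> real) \<Rightarrow>
   ('w \<Rightarrow> 'a) \<Rightarrow> ('w \<Rightarrow> 'b::euclidean_space) \<Rightarrow> bool" where
  "independent_from N E Z W \<longleftrightarrow>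
     (\<forall>\<phi> \<in> C_lLip (pair_norm N norm).
        E (\<lambda>\<omega>. \<phi> (Z \<omega>, W \<omega>)) = E (\<lambda>\<omega>. E (\<lambda>\<omega>'. \<phi> (Z \<omega>, W \<omega>'))))"

text \<open>
  The iterated expectation on the left-hand side is the expectation of
  \<open>\<phi> (a X + b X1, a\<^sup>2 \<eta> + b\<^sup>2 \<eta>1)\<close> for an independent copy \<open>(X1, \<eta>1)\<close> of \<open>(X, \<eta>)\<close>, so that the
  copy itself need not be realised; see \<open>G_distributed_independent_copy\<close> below.
\<close>

definition G_distributed ::
  "(('w \<Rightarrow> real) \<Rightarrow> real) \<Rightarrow> ('w \<Rightarrow> real ^ 'd) \<Rightarrow> ('w \<Rightarrow> real ^ 'd) \<Rightarrow> bool" where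
  "G_distributed E X \<eta> \<longleftrightarrow>
     (\<forall>a\<ge>0. \<forall>b\<ge>0. \<forall>\<phi> \<in> C_lLip norm.
        E (\<lambda>\<omega>. E (\<lambda>\<omega>'. \<phi> (a *\<^sub>R X \<omega> + b *\<^sub>R X \<omega>', a\<^sup>2 *\<^sub>R \<eta> \<omega> + b\<^sup>2 *\<^sub>R \<eta> \<omega>')))
        = E (\<lambda>\<omega>. \<phi> (sqrt (a\<^sup>2 + b\<^sup>2) *\<^sub>R X \<omega>, (a\<^sup>2 + b\<^sup>2) *\<^sub>R \<eta> \<omega>)))"

lemma one_plus_power_le:
  fixes s :: real
  assumes "0 \<le> s"
  shows "(1 + s) ^ m \<le> 2 ^ m * (1 + s ^ m)"
proof -
  have "(1 + s) ^ m \<le> (2 * max 1 s) ^ m"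
    using assms by (intro power_mono) auto
  also have "\<dots> = 2 ^ m * max 1 s ^ m"
    by (simp add: power_mult_distrib)
  also have "\<dots> \<le> 2 ^ m * (1 + s ^ m)"
    using assms by (intro mult_left_mono) (auto simp: max_def)
  finally show ?thesis .
qed

lemma C_lLip_affine:
  fixes L :: "'a::real_normed_vector \<Rightarrow> 'b::real_normed_vector"
  assumes \<phi>: "\<phi> \<in> C_lLip norm" and L: "bounded_linear L"
  shows "(\<lambda>x. \<phi> (L x + c)) \<in> C_lLip norm"
proof -
  obtain C m where C: "C > 0"
    and b: "\<And>x y. \<bar>\<phi> x - \<phi> y\<bar> \<le> C * (1 + norm x ^ m + norm y ^ m) * norm (x - y)"
    using \<phi> unfolding C_lLip_def by blast
  obtain K where K: "K > 0" "\<And>x. norm (L x) \<le> norm x * K"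
    using bounded_linear.pos_bounded[OF L] by blast
  define D where "D = 1 + K + norm c"
  define M where "M = (2 * D) ^ m"
  have D: "D \<ge> 1" using K by (simp add: D_def)
  have M: "M \<ge> 1" unfolding M_def using D by (intro one_le_power) auto
  have g: "norm (L x + c) ^ m \<le> M * (1 + norm x ^ m)" for x
  proof -
    have "norm (L x + c) \<le> norm x * K + norm c"
      using K(2)[of x] norm_triangle_ineq[of "L x" c] by linarith
    also have "\<dots> \<le> D * (1 + norm x)"
      using K(1) by (simp add: D_def algebra_simps)
    finally have "norm (L x + c) ^ m \<le> (D * (1 + norm x)) ^ m"
      by (intro power_mono) auto
    also have "\<dots> = D ^ m * (1 + norm x) ^ m"
      by (simp add: power_mult_distrib)
    also have "\<dots> \<le> D ^ m * (2 ^ m * (1 + norm x ^ m))"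
      using D by (intro mult_left_mono one_plus_power_le) auto
    also have "\<dots> = M * (1 + norm x ^ m)"
      by (simp add: M_def power_mult_distrib)
    finally show ?thesis .
  qed
  have "\<bar>\<phi> (L x + c) - \<phi> (L y + c)\<bar> \<le> (3 * C * M * K) * (1 + norm x ^ m + norm y ^ m) * norm (x - y)"
    for x y
  proof -
    have d: "norm ((L x + c) - (L y + c)) \<le> norm (x - y) * K"
      using K(2)[of "x - y"] bounded_linear.linear[OF L] by (simp add: linear_diff)
    have "1 + norm (L x + c) ^ m + norm (L y + c) ^ m \<le> 1 + M * (1 + norm x ^ m) + M * (1 + norm y ^ m)"
      using g[of x] g[of y] by linarith
    also have "\<dots> \<le> 3 * M + M * norm x ^ m + M * norm y ^ m"
      using M by (simp add: algebra_simps)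
    also have "\<dots> \<le> 3 * M + 3 * (M * norm x ^ m) + 3 * (M * norm y ^ m)"
      using M by (intro add_mono) auto
    finally have s: "1 + norm (L x + c) ^ m + norm (L y + c) ^ m \<le> 3 * M * (1 + norm x ^ m + norm y ^ m)"
      by (simp add: algebra_simps)
    have "\<bar>\<phi> (L x + c) - \<phi> (L y + c)\<bar>
        \<le> C * (1 + norm (L x + c) ^ m + norm (L y + c) ^ m) * norm ((L x + c) - (L y + c))"
      by (rule b)
    also have "\<dots> \<le> C * (3 * M * (1 + norm x ^ m + norm y ^ m)) * (norm (x - y) * K)"
      using C M by (intro mult_mono mult_left_mono s d) (auto intro!: mult_nonneg_nonneg add_nonneg_nonneg)
    finally show ?thesis by (simp add: mult_ac)
  qed
  moreover have "3 * C * M * K > 0" using C M K by simp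
  ultimately show ?thesis unfolding C_lLip_def by blast
qed

lemma G_distributed_independent_copy:
  fixes X \<eta> X1 \<eta>1 :: "'w \<Rightarrow> real ^ 'd"
  assumes law: "same_law E (\<lambda>\<omega>. (X1 \<omega>, \<eta>1 \<omega>)) E (\<lambda>\<omega>. (X \<omega>, \<eta> \<omega>))"
    and ind: "independent_from norm E (\<lambda>\<omega>. (X \<omega>, \<eta> \<omega>)) (\<lambda>\<omega>. (X1 \<omega>, \<eta>1 \<omega>))"
  shows "G_distributed E X \<eta> \<longleftrightarrow>
    (\<forall>a\<ge>0. \<forall>b\<ge>0. same_law E (\<lambda>\<omega>. (a *\<^sub>R X \<omega> + b *\<^sub>R X1 \<omega>, a\<^sup>2 *\<^sub>R \<eta> \<omega> + b\<^sup>2 *\<^sub>R \<eta>1 \<omega>))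
       E (\<lambda>\<omega>. (sqrt (a\<^sup>2 + b\<^sup>2) *\<^sub>R X \<omega>, (a\<^sup>2 + b\<^sup>2) *\<^sub>R \<eta> \<omega>)))"
proof -
  have "E (\<lambda>\<omega>. \<phi> (a *\<^sub>R X \<omega> + b *\<^sub>R X1 \<omega>, a\<^sup>2 *\<^sub>R \<eta> \<omega> + b\<^sup>2 *\<^sub>R \<eta>1 \<omega>))
      = E (\<lambda>\<omega>. E (\<lambda>\<omega>'. \<phi> (a *\<^sub>R X \<omega> + b *\<^sub>R X \<omega>', a\<^sup>2 *\<^sub>R \<eta> \<omega> + b\<^sup>2 *\<^sub>R \<eta> \<omega>')))"
    if \<phi>: "\<phi> \<in> C_lLip norm" for a b and \<phi> :: "(real ^ 'd) \<times> (real ^ 'd) \<Rightarrow> real"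
  proof -
    define L1 :: "((real ^ 'd) \<times> (real ^ 'd)) \<times> ((real ^ 'd) \<times> (real ^ 'd)) \<Rightarrow> _"
      where "L1 z = (a *\<^sub>R fst (fst z) + b *\<^sub>R fst (snd z), a\<^sup>2 *\<^sub>R snd (fst z) + b\<^sup>2 *\<^sub>R snd (snd z))" for z
    define L2 :: "(real ^ 'd) \<times> (real ^ 'd) \<Rightarrow> _"
      where "L2 z = (b *\<^sub>R fst z, b\<^sup>2 *\<^sub>R snd z)" for z
    have l1: "bounded_linear L1" and l2: "bounded_linear L2"
      unfolding L1_def L2_def
      by (rule linear_conv_bounded_linear[THEN iffD1], rule linearI,
          simp add: algebra_simps, simp add: algebra_simps)+
    have "E (\<lambda>\<omega>. (\<lambda>z. \<phi> (L1 z + 0)) ((X \<omega>, \<eta> \<omega>), (X1 \<omega>, \<eta>1 \<omega>)))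
        = E (\<lambda>\<omega>. E (\<lambda>\<omega>'. (\<lambda>z. \<phi> (L1 z + 0)) ((X \<omega>, \<eta> \<omega>), (X1 \<omega>', \<eta>1 \<omega>'))))"
      using ind C_lLip_affine[OF \<phi> l1, of 0]
      unfolding independent_from_def pair_norm_norm by (rule bspec)
    moreover have "E (\<lambda>\<omega>'. (\<lambda>z. \<phi> (L2 z + (a *\<^sub>R x, a\<^sup>2 *\<^sub>R y))) (X1 \<omega>', \<eta>1 \<omega>'))
        = E (\<lambda>\<omega>'. (\<lambda>z. \<phi> (L2 z + (a *\<^sub>R x, a\<^sup>2 *\<^sub>R y))) (X \<omega>', \<eta> \<omega>'))" for x y
      using law[unfolded same_law_def] C_lLip_affine[OF \<phi> l2, of "(a *\<^sub>R x, a\<^sup>2 *\<^sub>R y)"]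
      by (rule bspec)
    ultimately show ?thesis
      by (simp add: L1_def L2_def add.commute)
  qed
  then show ?thesis
    unfolding G_distributed_def same_law_def by auto
qed

definition G_function ::
  "(('w \<Rightarrow> real) \<Rightarrow> real) \<Rightarrow> ('w \<Rightarrow> real ^ 'd) \<Rightarrow> ('w \<Rightarrow> real ^ 'd) \<Rightarrow>
   real ^ 'd \<Rightarrow> real ^ 'd ^ 'd \<Rightarrow> real" where
  "G_function E X Y p A = E (\<lambda>\<omega>. p \<bullet> Y \<omega> + 1/2 * ((A *v X \<omega>) \<bullet> X \<omega>))"


section \<open>Extension of the expectation to functions of linear growth\<close>

text \<open>
  \<open>ext_expectation_is E Z \<phi> v\<close>: some approximation of \<open>\<phi>\<close> by test functions, with an error whose
  expectation under the law of \<open>Z\<close> vanishes, gives the limit value \<open>v\<close>. The value does not depend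
  on the approximation (\<open>ext_expectation_is_unique\<close>), it exists for every continuous
  \<open>\<phi>\<close> of linear growth (\<open>ext_expectation_is_ext_expectation\<close>), and it is the original expectation
  on test functions (\<open>ext_expectation_C_lLip\<close>).
\<close>

definition ext_expectation_is ::
  "(('w \<Rightarrow> real) \<Rightarrow> real) \<Rightarrow> ('w \<Rightarrow> 'a::euclidean_space) \<Rightarrow> ('a \<Rightarrow> real) \<Rightarrow> real \<Rightarrow> bool" where
  "ext_expectation_is E Z \<phi> v \<longleftrightarrow>
     (\<exists>\<Phi> \<Psi> :: nat \<Rightarrow> 'a \<Rightarrow> real.
        (\<forall>k. \<Phi> k \<in> C_lLip norm \<and> \<Psi> k \<in> C_lLip norm) \<and>
        (\<forall>k x. \<bar>\<phi> x - \<Phi> k x\<bar> \<le> \<Psi> k x) \<and>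
        (\<lambda>k. E (\<lambda>\<omega>. \<Psi> k (Z \<omega>))) \<longlonglongrightarrow> 0 \<and>
        (\<lambda>k. E (\<lambda>\<omega>. \<Phi> k (Z \<omega>))) \<longlonglongrightarrow> v)"

definition ext_expectation ::
  "(('w \<Rightarrow> real) \<Rightarrow> real) \<Rightarrow> ('w \<Rightarrow> 'a::euclidean_space) \<Rightarrow> ('a \<Rightarrow> real) \<Rightarrow> real" where
  "ext_expectation E Z \<phi> = (THE v. ext_expectation_is E Z \<phi> v)"

context sublinear_expectation
begin

lemma comp_in:
  fixes Z :: "'w \<Rightarrow> 'a::euclidean_space"
  assumes Z: "random_vector H Z" and \<phi>: "\<phi> \<in> C_lLip norm"
  shows "(\<lambda>\<omega>. \<phi> (Z \<omega>)) \<in> H"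
proof -
  obtain C m where C: "C > 0"
    and b: "\<And>x y. \<bar>\<phi> x - \<phi> y\<bar> \<le> C * (1 + norm x ^ m + norm y ^ m) * norm (x - y)"
    using \<phi> unfolding C_lLip_def by blast
  define n where "n = DIM('a)"
  obtain e :: "nat \<Rightarrow> 'a" where e: "bij_betw e {1..n} Basis"
    using ex_bij_betw_nat_finite_1[OF finite_Basis] unfolding n_def by blast
  define emb :: "(nat \<Rightarrow> real) \<Rightarrow> 'a" where "emb x = (\<Sum>i\<in>{1..n}. x i *\<^sub>R e i)" for x
  define f where "f = the_inv_into {1..n} e"
  have fe: "f (e i) = i" if "i \<in> {1..n}" for i
    using that e unfolding f_def bij_betw_def by (auto intro: the_inv_into_f_f)
  have emb_alt: "emb x = (\<Sum>b\<in>Basis. x (f b) *\<^sub>R b)" for x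
    unfolding emb_def sum.reindex_bij_betw[OF e, symmetric]
    by (intro sum.cong) (auto simp: fe)
  have emb_inner: "emb x \<bullet> e i = x i" if "i \<in> {1..n}" for x i
  proof -
    have "e i \<in> Basis" using e that by (auto simp: bij_betw_def)
    then show ?thesis using fe[OF that] by (simp add: emb_alt)
  qed
  have nrm: "norm (emb x) = tuple_norm {1..n} x" for x
  proof -
    have "norm (emb x) = L2_set (\<lambda>b. emb x \<bullet> b) Basis"
      using euclidean_dist_l2[of "emb x" 0] by (simp add: L2_set_def)
    also have "\<dots> = sqrt (\<Sum>i\<in>{1..n}. (emb x \<bullet> e i)\<^sup>2)"
      unfolding L2_set_def by (simp add: sum.reindex_bij_betw[OF e, symmetric])
    also have "\<dots> = tuple_norm {1..n} x"
      unfolding tuple_norm_def L2_set_def using emb_inner by simp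
    finally show ?thesis .
  qed
  have diff: "emb (x - y) = emb x - emb y" for x y
    by (simp add: emb_def algebra_simps sum_subtractf)
  have "\<bar>\<phi> (emb x) - \<phi> (emb y)\<bar> \<le>
      C * (1 + tuple_norm {1..n} x ^ m + tuple_norm {1..n} y ^ m) * tuple_norm {1..n} (x - y)" for x y
    using b[of "emb x" "emb y"] by (simp only: nrm[symmetric] diff)
  then have mem: "(\<lambda>x. \<phi> (emb x)) \<in> C_lLip (tuple_norm {1..n})"
    using C unfolding C_lLip_def by blast
  have "(\<lambda>\<omega>. \<phi> (emb (\<lambda>i. Z \<omega> \<bullet> e i))) \<in> H"
  proof (rule compose_in[where Z = "\<lambda>i \<omega>. Z \<omega> \<bullet> e i", OF _ mem])
    fix i assume "i \<in> {1..n}"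
    then have "e i \<in> Basis" using e by (auto simp: bij_betw_def)
    then show "(\<lambda>\<omega>. Z \<omega> \<bullet> e i) \<in> H" using Z by (auto simp: random_vector_def)
  qed
  moreover have "emb (\<lambda>i. Z \<omega> \<bullet> e i) = Z \<omega>" for \<omega>
    unfolding emb_def
    using sum.reindex_bij_betw[OF e, of "\<lambda>b. (Z \<omega> \<bullet> b) *\<^sub>R b"] by (simp add: euclidean_representation)
  ultimately show ?thesis by simp
qed

lemma abs_diff_le:
  assumes "U \<in> H" "V \<in> H" "W \<in> H" and le: "\<And>\<omega>. \<bar>U \<omega> - V \<omega>\<bar> \<le> W \<omega>"
  shows "\<bar>E U - E V\<bar> \<le> E W"
proof -
  have 1: "U \<omega> \<le> V \<omega> + W \<omega>" "V \<omega> \<le> U \<omega> + W \<omega>" for \<omega>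
    using le[of \<omega>] by linarith+
  have "E U \<le> E (\<lambda>\<omega>. V \<omega> + W \<omega>)" "E V \<le> E (\<lambda>\<omega>. U \<omega> + W \<omega>)"
    using assms(1-3) 1 by (auto intro!: mono add_in)
  moreover have "E (\<lambda>\<omega>. V \<omega> + W \<omega>) \<le> E V + E W" "E (\<lambda>\<omega>. U \<omega> + W \<omega>) \<le> E U + E W"
    using assms(1-3) by (auto intro!: subadd)
  ultimately show ?thesis by linarith
qed

lemma ext_expectation_is_unique:
  assumes Z: "random_vector H Z"
    and v: "ext_expectation_is E Z \<phi> v" and w: "ext_expectation_is E Z \<phi> w"
  shows "v = w"
proof -
  obtain \<Phi> \<Psi> where 1: "\<And>k. \<Phi> k \<in> C_lLip norm" "\<And>k. \<Psi> k \<in> C_lLip norm"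
      "\<And>k x. \<bar>\<phi> x - \<Phi> k x\<bar> \<le> \<Psi> k x"
      "(\<lambda>k. E (\<lambda>\<omega>. \<Psi> k (Z \<omega>))) \<longlonglongrightarrow> 0" "(\<lambda>k. E (\<lambda>\<omega>. \<Phi> k (Z \<omega>))) \<longlonglongrightarrow> v"
    using v unfolding ext_expectation_is_def by blast
  obtain \<Phi>' \<Psi>' where 2: "\<And>k. \<Phi>' k \<in> C_lLip norm" "\<And>k. \<Psi>' k \<in> C_lLip norm"
      "\<And>k x. \<bar>\<phi> x - \<Phi>' k x\<bar> \<le> \<Psi>' k x"
      "(\<lambda>k. E (\<lambda>\<omega>. \<Psi>' k (Z \<omega>))) \<longlonglongrightarrow> 0" "(\<lambda>k. E (\<lambda>\<omega>. \<Phi>' k (Z \<omega>))) \<longlonglongrightarrow> w"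
    using w unfolding ext_expectation_is_def by blast
  have le: "\<bar>E (\<lambda>\<omega>. \<Phi> k (Z \<omega>)) - E (\<lambda>\<omega>. \<Phi>' k (Z \<omega>))\<bar> \<le> E (\<lambda>\<omega>. \<Psi> k (Z \<omega>)) + E (\<lambda>\<omega>. \<Psi>' k (Z \<omega>))" for k
  proof -
    have "\<bar>\<Phi> k (Z \<omega>) - \<Phi>' k (Z \<omega>)\<bar> \<le> \<Psi> k (Z \<omega>) + \<Psi>' k (Z \<omega>)" for \<omega>
      using 1(3)[where x = "Z \<omega>"] 2(3)[where x = "Z \<omega>"] by (smt (verit))
    then have "\<bar>E (\<lambda>\<omega>. \<Phi> k (Z \<omega>)) - E (\<lambda>\<omega>. \<Phi>' k (Z \<omega>))\<bar> \<le> E (\<lambda>\<omega>. \<Psi> k (Z \<omega>) + \<Psi>' k (Z \<omega>))"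
      by (intro abs_diff_le add_in comp_in[OF Z] 1 2)
    also have "\<dots> \<le> E (\<lambda>\<omega>. \<Psi> k (Z \<omega>)) + E (\<lambda>\<omega>. \<Psi>' k (Z \<omega>))"
      by (intro subadd comp_in[OF Z] 1 2)
    finally show ?thesis .
  qed
  have lim: "(\<lambda>k. E (\<lambda>\<omega>. \<Psi> k (Z \<omega>)) + E (\<lambda>\<omega>. \<Psi>' k (Z \<omega>))) \<longlonglongrightarrow> 0"
    using tendsto_add[OF 1(4) 2(4)] by simp
  have "(\<lambda>k. E (\<lambda>\<omega>. \<Phi> k (Z \<omega>)) - E (\<lambda>\<omega>. \<Phi>' k (Z \<omega>))) \<longlonglongrightarrow> 0"
    by (rule Lim_null_comparison[OF _ lim]) (simp add: le)
  moreover have "(\<lambda>k. E (\<lambda>\<omega>. \<Phi> k (Z \<omega>)) - E (\<lambda>\<omega>. \<Phi>' k (Z \<omega>))) \<longlonglongrightarrow> v - w"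
    by (intro tendsto_diff 1 2)
  ultimately have "0 = v - w" by (rule LIMSEQ_unique)
  then show ?thesis by simp
qed

lemma C_lLip_zero: "(\<lambda>_::'a::real_normed_vector. 0) \<in> C_lLip norm"
  unfolding C_lLip_def by (auto intro!: exI[of _ 1])

lemma ext_expectation_C_lLip:
  assumes Z: "random_vector H Z" and \<phi>: "\<phi> \<in> C_lLip norm"
  shows "ext_expectation E Z \<phi> = E (\<lambda>\<omega>. \<phi> (Z \<omega>))"
proof -
  have lim: "ext_expectation_is E Z \<phi> (E (\<lambda>\<omega>. \<phi> (Z \<omega>)))"
    unfolding ext_expectation_is_def
    by (rule exI[of _ "\<lambda>_. \<phi>"], rule exI[of _ "\<lambda>_ _. 0"]) (simp add: \<phi> C_lLip_zero const)
  show ?thesis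
    unfolding ext_expectation_def by (rule the_equality[where P = "ext_expectation_is E Z \<phi>", OF lim ext_expectation_is_unique[OF Z _ lim]])
qed

lemma ext_expectation_is_ext_expectation:
  fixes \<phi> :: "'a::euclidean_space \<Rightarrow> real"
  assumes Z: "random_vector H Z" and cont: "continuous_on UNIV \<phi>"
    and bound: "\<And>x. \<bar>\<phi> x\<bar> \<le> C * (1 + norm x)"
  shows "ext_expectation_is E Z \<phi> (ext_expectation E Z \<phi>)"
proof -
  define K where "K k = real (Suc k)" for k
  have K: "K k \<ge> 1" for k by (simp add: K_def)
  have C: "C \<ge> 0" using bound[of 0] by simp
  have "\<exists>g. real_polynomial_function g \<and> (\<forall>x\<in>cball 0 (K k). \<bar>\<phi> x - g x\<bar> < 1 / K k)" for k
    using Stone_Weierstrass_real_polynomial_function[OF compact_cball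
        continuous_on_subset[OF cont subset_UNIV], of "1 / K k" 0 "K k"] K[of k]
    by (metis less_le_trans zero_less_divide_1_iff zero_less_one)
  then obtain g where g: "\<And>k. real_polynomial_function (g k)"
    and gb: "\<And>k x. norm x \<le> K k \<Longrightarrow> \<bar>\<phi> x - g k x\<bar> < 1 / K k"
    by (metis mem_cball_0)
  define P where "P k = closest_point (cball (0::'a) (K k))" for k
  have ne: "cball (0::'a) (K k) \<noteq> {}" for k using K[of k] by auto
  have Pn: "norm (P k x) \<le> K k" for k x
    using closest_point_in_set[OF closed_cball ne, of k x] by (simp add: P_def)
  have Pl: "norm (P k x - P k y) \<le> norm (x - y)" for k x y
    using closest_point_lipschitz[OF convex_cball closed_cball ne] by (simp add: P_def dist_norm)
  have Pid: "P k x = x" if "norm x \<le> K k" for k x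
    using that by (simp add: P_def closest_point_self)
  define \<Phi> where "\<Phi> k x = g k (P k x)" for k x
  define q where "q x = 2 * C * (norm x + (norm x)\<^sup>2) + 1" for x :: 'a
  define \<Psi> where "\<Psi> k x = (1 / K k) * q x" for k x
  have lip: "\<exists>L M. 0 \<le> L \<and> 0 \<le> M \<and> (\<forall>x. norm x \<le> r \<longrightarrow> \<bar>p x\<bar> \<le> M) \<and>
      (\<forall>x y. norm x \<le> r \<longrightarrow> norm y \<le> r \<longrightarrow> \<bar>p x - p y\<bar> \<le> L * norm (x - y))"
    if "real_polynomial_function p" for r and p :: "'a \<Rightarrow> real"
    using that
  proof induction
    case (linear f)
    obtain B where B: "B > 0" "\<And>x. norm (f x) \<le> norm x * B"
      using bounded_linear.pos_bounded[OF linear] by blast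
    have "\<bar>f x\<bar> \<le> \<bar>r\<bar> * B" if "norm x \<le> r" for x
      using order_trans[OF B(2)[of x] mult_right_mono[of "norm x" "\<bar>r\<bar>" B]] that B(1) by simp
    moreover have "\<bar>f x - f y\<bar> \<le> B * norm (x - y)" for x y
      using B(2)[of "x - y"] linear_diff[OF bounded_linear.linear[OF linear]] by (simp add: mult.commute)
    ultimately show ?case using B(1) by (intro exI[of _ B] exI[of _ "\<bar>r\<bar> * B"]) auto
  next
    case (const c)
    show ?case by (intro exI[of _ 0] exI[of _ "\<bar>c\<bar>"]) auto
  next
    case (add f h)
    then obtain L M L' M' where
      1: "0 \<le> L" "0 \<le> M" "\<And>x. norm x \<le> r \<Longrightarrow> \<bar>f x\<bar> \<le> M"
        "\<And>x y. norm x \<le> r \<Longrightarrow> norm y \<le> r \<Longrightarrow> \<bar>f x - f y\<bar> \<le> L * norm (x - y)" and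
      2: "0 \<le> L'" "0 \<le> M'" "\<And>x. norm x \<le> r \<Longrightarrow> \<bar>h x\<bar> \<le> M'"
        "\<And>x y. norm x \<le> r \<Longrightarrow> norm y \<le> r \<Longrightarrow> \<bar>h x - h y\<bar> \<le> L' * norm (x - y)"
      by metis
    have "\<bar>f x + h x\<bar> \<le> M + M'" if "norm x \<le> r" for x
      using 1(3)[OF that] 2(3)[OF that] by linarith
    moreover have "\<bar>f x + h x - (f y + h y)\<bar> \<le> (L + L') * norm (x - y)"
      if "norm x \<le> r" "norm y \<le> r" for x y
      using 1(4)[OF that] 2(4)[OF that] unfolding distrib_right by linarith
    ultimately show ?case
      using 1(1,2) 2(1,2) by (intro exI[of _ "L + L'"] exI[of _ "M + M'"]) auto
  next
    case (mult f h)
    then obtain L M L' M' where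
      1: "0 \<le> L" "0 \<le> M" "\<And>x. norm x \<le> r \<Longrightarrow> \<bar>f x\<bar> \<le> M"
        "\<And>x y. norm x \<le> r \<Longrightarrow> norm y \<le> r \<Longrightarrow> \<bar>f x - f y\<bar> \<le> L * norm (x - y)" and
      2: "0 \<le> L'" "0 \<le> M'" "\<And>x. norm x \<le> r \<Longrightarrow> \<bar>h x\<bar> \<le> M'"
        "\<And>x y. norm x \<le> r \<Longrightarrow> norm y \<le> r \<Longrightarrow> \<bar>h x - h y\<bar> \<le> L' * norm (x - y)"
      by metis
    have "\<bar>f x * h x\<bar> \<le> M * M'" if "norm x \<le> r" for x
      using 1(2) 1(3)[OF that] 2(3)[OF that] by (simp add: abs_mult mult_mono)
    moreover have "\<bar>f x * h x - f y * h y\<bar> \<le> (M * L' + L * M') * norm (x - y)"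
      if "norm x \<le> r" "norm y \<le> r" for x y
    proof -
      have "\<bar>f x * h x - f y * h y\<bar> = \<bar>f x * (h x - h y) + (f x - f y) * h y\<bar>"
        by (simp add: algebra_simps)
      also have "\<dots> \<le> \<bar>f x\<bar> * \<bar>h x - h y\<bar> + \<bar>f x - f y\<bar> * \<bar>h y\<bar>"
        by (metis abs_mult abs_triangle_ineq)
      also have "\<dots> \<le> M * (L' * norm (x - y)) + (L * norm (x - y)) * M'"
        using 1(1,2) 1(3)[OF that(1)] 1(4)[OF that] 2(3)[OF that(2)] 2(4)[OF that]
        by (intro add_mono mult_mono) auto
      finally show ?thesis by (simp add: algebra_simps)
    qed
    ultimately show ?case
      using 1(1,2) 2(1,2) by (intro exI[of _ "M * L' + L * M'"] exI[of _ "M * M'"]) auto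
  qed
  have \<Phi>_in: "\<Phi> k \<in> C_lLip norm" for k
  proof -
    obtain L where L: "L \<ge> 0"
      "\<And>x y. norm x \<le> K k \<Longrightarrow> norm y \<le> K k \<Longrightarrow> \<bar>g k x - g k y\<bar> \<le> L * norm (x - y)"
      using lip[OF g[of k], of "K k"] by blast
    have "\<bar>\<Phi> k x - \<Phi> k y\<bar> \<le> (L + 1) * (1 + norm x ^ 0 + norm y ^ 0) * norm (x - y)" for x y
    proof -
      have "\<bar>\<Phi> k x - \<Phi> k y\<bar> \<le> L * norm (P k x - P k y)"
        unfolding \<Phi>_def by (intro L(2) Pn)
      also have "\<dots> \<le> L * norm (x - y)"
        by (intro mult_left_mono Pl L)
      also have "\<dots> \<le> ((L + 1) * 3) * norm (x - y)"
        using L(1) by (intro mult_right_mono) auto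
      finally show ?thesis by simp
    qed
    moreover have "L + 1 > 0" using L(1) by simp
    ultimately show ?thesis unfolding C_lLip_def by blast
  qed
  have scaled_in: "(\<lambda>x. c * q x) \<in> C_lLip norm" for c
  proof -
    have "\<bar>c * q x - c * q y\<bar> \<le> (2 * C * \<bar>c\<bar> + 1) * (1 + norm x ^ 1 + norm y ^ 1) * norm (x - y)"
      for x y
    proof -
      have "c * q x - c * q y = (2 * C * c) * (1 + norm x + norm y) * (norm x - norm y)"
        by (simp add: q_def power2_eq_square algebra_simps)
      then have "\<bar>c * q x - c * q y\<bar> = (2 * C * \<bar>c\<bar>) * (1 + norm x + norm y) * \<bar>norm x - norm y\<bar>"
        using C by (simp add: abs_mult)
      also have "\<dots> \<le> (2 * C * \<bar>c\<bar> + 1) * (1 + norm x + norm y) * norm (x - y)"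
        using C norm_triangle_ineq3[of x y] by (intro mult_mono) auto
      finally show ?thesis by simp
    qed
    moreover have "2 * C * \<bar>c\<bar> + 1 > 0" using C by (simp add: add_nonneg_pos)
    ultimately show ?thesis unfolding C_lLip_def by blast
  qed
  have q_in: "q \<in> C_lLip norm" using scaled_in[of 1] by simp
  have \<Psi>_in: "\<Psi> k \<in> C_lLip norm" for k
    unfolding \<Psi>_def by (rule scaled_in)
  have dom: "\<bar>\<phi> x - \<Phi> k x\<bar> \<le> \<Psi> k x" for k x
  proof (cases "norm x \<le> K k")
    case True
    have "\<bar>\<phi> x - \<Phi> k x\<bar> \<le> 1 / K k * 1"
      using gb[OF True] by (simp add: \<Phi>_def Pid[OF True])
    also have "\<dots> \<le> \<Psi> k x"
      unfolding \<Psi>_def q_def using K[of k] C by (intro mult_left_mono) auto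
    finally show ?thesis .
  next
    case False
    have "\<bar>\<phi> x - \<Phi> k x\<bar> \<le> \<bar>\<phi> x\<bar> + \<bar>\<phi> (P k x)\<bar> + 1 / K k"
      using gb[OF Pn[of k x]] unfolding \<Phi>_def by linarith
    also have "\<dots> \<le> C * (1 + norm x) + C * (1 + norm x) + 1 / K k"
    proof -
      have "C * (1 + norm (P k x)) \<le> C * (1 + norm x)"
        using C Pn[of k x] False by (intro mult_left_mono) auto
      then show ?thesis using bound[of x] bound[of "P k x"] by linarith
    qed
    also have "\<dots> = 2 * C * (1 + norm x) + 1 / K k" by simp
    also have "\<dots> \<le> 2 * C * (1 + norm x) * (norm x / K k) + 1 / K k"
      using False C K[of k]
        mult_left_mono[of 1 "norm x / K k" "2 * C * (1 + norm x)"] by simp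
    also have "\<dots> = \<Psi> k x"
      using K[of k] by (simp add: \<Psi>_def q_def field_simps power2_eq_square)
    finally show ?thesis .
  qed
  define r where "r k = E (\<lambda>\<omega>. \<Psi> k (Z \<omega>))" for k
  define a where "a k = E (\<lambda>\<omega>. \<Phi> k (Z \<omega>))" for k
  have "r = (\<lambda>k. 1 / K k * E (\<lambda>\<omega>. q (Z \<omega>)))"
  proof
    show "r k = (1 / K k) * E (\<lambda>\<omega>. q (Z \<omega>))" for k
      unfolding r_def \<Psi>_def using K[of k] by (intro pos_homog comp_in[OF Z q_in]) auto
  qed
  moreover have "(\<lambda>k. 1 / K k * E (\<lambda>\<omega>. q (Z \<omega>))) \<longlonglongrightarrow> 0"
    unfolding K_def using tendsto_mult_left_zero[OF LIMSEQ_inverse_real_of_nat]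
    by (simp add: inverse_eq_divide)
  ultimately have r: "r \<longlonglongrightarrow> 0"
    by (simp only:)
  have ar: "\<bar>a j - a k\<bar> \<le> r j + r k" for j k
  proof -
    have "\<bar>\<Phi> j x - \<Phi> k x\<bar> \<le> \<Psi> j x + \<Psi> k x" for x
      using dom[of x j] dom[of x k] by linarith
    then have "\<bar>a j - a k\<bar> \<le> E (\<lambda>\<omega>. \<Psi> j (Z \<omega>) + \<Psi> k (Z \<omega>))"
      unfolding a_def by (intro abs_diff_le add_in comp_in[OF Z] \<Phi>_in \<Psi>_in)
    also have "\<dots> \<le> r j + r k"
      unfolding r_def by (intro subadd comp_in[OF Z] \<Psi>_in)
    finally show ?thesis .
  qed
  have "Cauchy a"
  proof (rule metric_CauchyI)
    fix e :: real assume "e > 0"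
    then obtain N where N: "\<And>k. k \<ge> N \<Longrightarrow> \<bar>r k\<bar> < e / 2"
      using LIMSEQ_D[OF r, of "e / 2"] by auto
    have "dist (a j) (a k) < e" if "j \<ge> N" "k \<ge> N" for j k
      using ar[of j k] N[OF that(1)] N[OF that(2)] unfolding dist_real_def by linarith
    then show "\<exists>M. \<forall>m\<ge>M. \<forall>n\<ge>M. dist (a m) (a n) < e" by blast
  qed
  then obtain v where "a \<longlonglongrightarrow> v"
    using Cauchy_convergent_iff convergent_def by blast
  then have lim: "ext_expectation_is E Z \<phi> v"
    unfolding ext_expectation_is_def using \<Phi>_in \<Psi>_in dom r
    by (intro exI[of _ \<Phi>] exI[of _ \<Psi>]) (simp add: r_def[abs_def] a_def[abs_def])
  show ?thesis
    unfolding ext_expectation_def by (rule theI[where P = "ext_expectation_is E Z \<phi>", OF lim ext_expectation_is_unique[OF Z _ lim]])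
qed

end


section \<open>Viscosity solutions of the G-heat equation\<close>

text \<open>
  \<open>C12_test \<psi> \<psi>t p A\<close>: the function \<open>\<psi>\<close> is of class \<open>C\<^sup>1\<^sup>,\<^sup>2\<close> on \<open>(0,\<infinity>) \<times> \<real>\<^sup>d\<close> with time derivative \<open>\<psi>t\<close>,
  spatial gradient \<open>p\<close> and spatial Hessian \<open>A\<close>. The latter is symmetric because it is continuous,
  so the values of \<open>G\<close> at non-symmetric matrices play no role below.
\<close>

definition C12_test ::
  "(real \<Rightarrow> real ^ 'd \<Rightarrow> real) \<Rightarrow> (real \<Rightarrow> real ^ 'd \<Rightarrow> real) \<Rightarrow>
   (real \<Rightarrow> real ^ 'd \<Rightarrow> real ^ 'd) \<Rightarrow> (real \<Rightarrow> real ^ 'd \<Rightarrow> real ^ 'd ^ 'd) \<Rightarrow> bool" where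
  "C12_test \<psi> \<psi>t p A \<longleftrightarrow>
     (\<forall>t>0. \<forall>x.
        ((\<lambda>s. \<psi> s x) has_real_derivative \<psi>t t x) (at t) \<and>
        ((\<lambda>y. \<psi> t y) has_derivative (\<lambda>h. p t x \<bullet> h)) (at x) \<and>
        ((\<lambda>y. p t y) has_derivative (\<lambda>h. A t x *v h)) (at x)) \<and>
     continuous_on ({0<..} \<times> UNIV) (\<lambda>(t, x). \<psi>t t x) \<and>
     continuous_on ({0<..} \<times> UNIV) (\<lambda>(t, x). p t x) \<and>
     continuous_on ({0<..} \<times> UNIV) (\<lambda>(t, x). A t x)"

definition viscosity_subsolution ::
  "(real ^ 'd \<Rightarrow> real ^ 'd ^ 'd \<Rightarrow> real) \<Rightarrow> (real \<Rightarrow> real ^ 'd \<Rightarrow> real) \<Rightarrow> bool" where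
  "viscosity_subsolution G v \<longleftrightarrow>
     (\<forall>\<psi> \<psi>t p A. C12_test \<psi> \<psi>t p A \<longrightarrow>
        (\<forall>t>0. \<forall>x.
           (\<forall>\<^sub>F (s, y) in nhds (t, x). v s y - \<psi> s y \<le> v t x - \<psi> t x) \<longrightarrow>
           \<psi>t t x - G (p t x) (A t x) \<le> 0))"

definition viscosity_supersolution ::
  "(real ^ 'd \<Rightarrow> real ^ 'd ^ 'd \<Rightarrow> real) \<Rightarrow> (real \<Rightarrow> real ^ 'd \<Rightarrow> real) \<Rightarrow> bool" where
  "viscosity_supersolution G v \<longleftrightarrow>
     (\<forall>\<psi> \<psi>t p A. C12_test \<psi> \<psi>t p A \<longrightarrow>
        (\<forall>t>0. \<forall>x.
           (\<forall>\<^sub>F (s, y) in nhds (t, x). v s y - \<psi> s y \<ge> v t x - \<psi> t x) \<longrightarrow>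
           \<psi>t t x - G (p t x) (A t x) \<ge> 0))"

text \<open>
  Polynomial growth is understood in the space variable, uniformly on bounded time intervals.
  Values at negative times are irrelevant.
\<close>

definition G_heat_solution ::
  "(real ^ 'd \<Rightarrow> real ^ 'd ^ 'd \<Rightarrow> real) \<Rightarrow> (real ^ 'd \<Rightarrow> real) \<Rightarrow>
   (real \<Rightarrow> real ^ 'd \<Rightarrow> real) \<Rightarrow> bool" where
  "G_heat_solution G \<phi> v \<longleftrightarrow>
     continuous_on ({0..} \<times> UNIV) (\<lambda>(t, x). v t x) \<and>
     (\<forall>T>0. \<exists>C. \<exists>m::nat. \<forall>t\<in>{0..T}. \<forall>x. \<bar>v t x\<bar> \<le> C * (1 + norm x ^ m)) \<and>
     viscosity_subsolution G v \<and> viscosity_supersolution G v \<and>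
     (\<forall>x. v 0 x = \<phi> x)"

end

theory Submission
  imports Defs "HOL-Probability.Probability"
begin

text \<open>
  Independence turns the expectation of a function of \<open>S_n\<close> into an \<open>n\<close>-fold iterate of the one-step
  functional \<open>f \<mapsto> E (f (\<surd>h X + h Y))\<close> with \<open>h = 1/n\<close>. Such functionals are sublinear and commute with
  translations, so by Jensen's inequality mollifying the iterates, by averaging along coordinate
  segments, yields smooth functions that dominate the next iterate. Hence two schemes with the same generator
  \<open>G\<close> have the same limit, without any regularity theory for the equation. The scheme of a
  \<open>G\<close>-distributed pair \<open>(X, \<eta>)\<close> is an exact semigroup, so the limit is \<open>E (\<phi> (X + \<eta>))\<close>.

  Mollification in space and time makes the semigroup a smooth supersolution of \<open>\<partial>\<^sub>t v = G (D v, D\<^sup>2 v)\<close>, so it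
  dominates every viscosity subsolution. For supersolutions \<open>G\<close> is written as a supremum of linear
  generators; a supersolution dominates the Gaussian semigroup of each of them, hence every control
  policy that is piecewise constant in time, and these policies converge to the semigroup by the
  comparison of schemes. A weight \<open>\<kappa> e\<^bsup>K t\<^esup> (1 + |x|\<^sup>2)\<^bsup>n + 2\<^esup>\<close> absorbs polynomial growth and
  allows the initial value to be replaced by a Lipschitz one.
\<close>

text \<open>Sublinearity gives Jensen's inequality in one direction only: mollifying yields
  functions that dominate the next step, not functions that stay below it. Between two schemes this
  suffices, because their roles can be exchanged. A viscosity supersolution offers no such exchange;
  hence the detour through linear generators, for which a change of sign turns supersolutions into
  subsolutions. The mollification parameter \<epsilon> is fixed before the step \<open>h\<close>.
  The derivative bounds blow up as \<epsilon> tends to 0, but they are uniform over all functions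
  with a given Lipschitz constant, and every step preserves that constant because it commutes with
  translations. Increments have size \<open>sqrt h\<close>, so a cubic Taylor remainder costs
  \<open>h * sqrt h\<close> per step and \<open>T * sqrt h\<close> over \<open>T / h\<close> steps.
  Comparison at infinity requires that a maximum be attained. The basic comparison results therefore
  assume that the solution is bounded by \<open>C - (norm x)\<^sup>2\<close> on the appropriate
  side, and the weight supplies this bound later at arbitrarily small cost.\<close>

lemma lipschitz_realI:
  fixes f :: "'a::real_normed_vector \<Rightarrow> real"
  assumes "\<And>x y. \<bar>f x - f y\<bar> \<le> L * norm (x - y)" "0 \<le> L"
  shows "L-lipschitz_on UNIV f"
  using assms by (intro lipschitz_onI) (auto simp: dist_norm)

lemma lipschitz_realD:
  fixes f :: "'a::real_normed_vector \<Rightarrow> real"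
  assumes "L-lipschitz_on UNIV f"
  shows "\<bar>f x - f y\<bar> \<le> L * norm (x - y)"
  using lipschitz_on_normD[OF assms, of x y] by simp

definition Lip :: "('a::real_normed_vector \<Rightarrow> real) \<Rightarrow> bool" where
  "Lip f \<longleftrightarrow> (\<exists>L. L-lipschitz_on UNIV f)"

lemma LipI: "L-lipschitz_on UNIV f \<Longrightarrow> Lip f"
  by (auto simp: Lip_def)

lemma Lip_const: "Lip (\<lambda>_. c)"
  using LipI lipschitz_on_constant by blast

lemma Lip_add: "Lip f \<Longrightarrow> Lip g \<Longrightarrow> Lip (\<lambda>x. f x + g x)"
  unfolding Lip_def using lipschitz_on_add by blast

lemma Lip_cmult: "Lip f \<Longrightarrow> Lip (\<lambda>x. c * f x)"
  unfolding Lip_def using lipschitz_on_cmult_real by blast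

lemma Lip_diff: "Lip f \<Longrightarrow> Lip g \<Longrightarrow> Lip (\<lambda>x. f x - g x)"
  unfolding Lip_def using lipschitz_on_diff by blast

lemma Lip_uminus: "Lip f \<Longrightarrow> Lip (\<lambda>x. - f x)"
  using Lip_cmult[of f "-1"] by simp

lemma lipschitz_shift:
  fixes f :: "'a::real_normed_vector \<Rightarrow> real"
  assumes "L-lipschitz_on UNIV f"
  shows "L-lipschitz_on UNIV (\<lambda>y. f (x + y))"
proof (rule lipschitz_realI)
  show "\<bar>f (x + u) - f (x + v)\<bar> \<le> L * norm (u - v)" for u v
    using lipschitz_realD[OF assms, of "x + u" "x + v"] by simp
qed (rule lipschitz_on_nonneg[OF assms])

lemma Lip_shift: "Lip f \<Longrightarrow> Lip (\<lambda>y. f (x + y))"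
  using lipschitz_shift by (auto simp: Lip_def)

lemma lipschitz_norm: "1-lipschitz_on UNIV (norm :: 'a::real_normed_vector \<Rightarrow> real)"
  by (rule lipschitz_realI) (auto simp: norm_triangle_ineq3)

lemma Lip_continuous: "Lip f \<Longrightarrow> continuous_on S f"
  unfolding Lip_def using lipschitz_on_continuous_on continuous_on_subset by blast


section \<open>Averages along line segments\<close>

text \<open>Shifting the integrand by \<open>k\<close> only exchanges a piece of length
  \<open>\<bar>k\<bar>\<close> at each end of the unit interval, and there \<open>f\<close> is
  within \<open>m\<close> of \<open>f 1\<close> and \<open>f 0\<close>. Moving averages of
  continuous functions thus become differentiable with an explicit error.\<close>

lemma integral_shift_error:
  fixes f :: "real \<Rightarrow> real"
  assumes c: "continuous_on UNIV f"
    and m0: "\<And>s. \<bar>s\<bar> \<le> \<bar>k\<bar> \<Longrightarrow> \<bar>f s - f 0\<bar> \<le> m"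
    and m1: "\<And>s. \<bar>s\<bar> \<le> \<bar>k\<bar> \<Longrightarrow> \<bar>f (1 + s) - f 1\<bar> \<le> m"
  shows "\<bar>integral {0..1} (\<lambda>s. f (s + k)) - integral {0..1} f - k * (f 1 - f 0)\<bar> \<le> 2 * m * \<bar>k\<bar>"
proof -
  define a b where "a = - \<bar>k\<bar> - 1" and "b = \<bar>k\<bar> + 2"
  obtain g where g: "\<And>x. x \<in> {a..b} \<Longrightarrow> (g has_vector_derivative f x) (at x within {a..b})"
    using antiderivative_continuous[OF continuous_on_subset[OF c, of "{a..b}"]] by auto
  have ftc: "integral {u..v} f = g v - g u" if "u \<le> v" "{u..v} \<subseteq> {a..b}" for u v
    using that by (intro integral_unique fundamental_theorem_of_calculus)
      (auto intro: has_vector_derivative_within_subset[OF g])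
  have sh: "integral {0..1} (\<lambda>s. f (s + k)) = g (1 + k) - g k"
  proof -
    have "integral {0..1} (\<lambda>s. f (s + k)) = integral {k..1 + k} f"
      using integral_shift_Icc_real[of 0 1 f k] by (simp add: o_def add.commute)
    also have "\<dots> = g (1 + k) - g k"
      by (rule ftc) (auto simp: a_def b_def)
    finally show ?thesis .
  qed
  \<comment> \<open>Mean value inequality for \<open>g x - x * f c\<close>, whose derivative
    \<open>f x - f c\<close> is at most \<open>m\<close> in absolute value.\<close>
  have loc: "\<bar>g (c + k) - g c - k * f c\<bar> \<le> m * \<bar>k\<bar>"
    if c: "c \<in> {0..1}" and m: "\<And>s. \<bar>s\<bar> \<le> \<bar>k\<bar> \<Longrightarrow> \<bar>f (c + s) - f c\<bar> \<le> m" for c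
  proof -
    let ?S = "{c - \<bar>k\<bar>..c + \<bar>k\<bar>}"
    have S: "?S \<subseteq> {a..b}" using c by (auto simp: a_def b_def)
    have "norm ((g (c + k) - (c + k) * f c) - (g c - c * f c)) \<le> m * norm ((c + k) - c)"
    proof (rule differentiable_bound[of ?S "\<lambda>x. g x - x * f c" "\<lambda>x. (*) (f x - f c)"])
      fix x assume x: "x \<in> ?S"
      have "(g has_vector_derivative f x) (at x within ?S)"
        using has_vector_derivative_within_subset[OF g S] x S by blast
      then have "(g has_real_derivative f x) (at x within ?S)"
        by (simp add: has_real_derivative_iff_has_vector_derivative)
      then have "((\<lambda>x. g x - x * f c) has_real_derivative f x - f c) (at x within ?S)"
        by (auto intro!: derivative_eq_intros)
      then show "((\<lambda>x. g x - x * f c) has_derivative (*) (f x - f c)) (at x within ?S)"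
        by (simp add: has_field_derivative_def)
      have "\<bar>f x - f c\<bar> \<le> m" using m[of "x - c"] x by auto
      then show "onorm ((*) (f x - f c)) \<le> m"
        by (intro onorm_bound) (auto simp: abs_mult intro: mult_right_mono
              order_trans[OF abs_ge_zero])
    qed auto
    then show ?thesis by (simp add: algebra_simps)
  qed
  have "integral {0..1} f = g 1 - g 0"
    by (rule ftc) (auto simp: a_def b_def)
  then show ?thesis
    using loc[of 0] loc[of 1] m0 m1 sh by (simp add: algebra_simps abs_le_iff)
qed

text \<open>Averaging gains one derivative in direction \<open>v\<close>: moving the base point
  along \<open>v\<close> changes only the ends of the segment, so the derivative is the difference
  \<open>f (x + v) - f x\<close>. Derivatives of mollified functions are therefore finite
  differences.\<close>

definition avg :: "'a::real_normed_vector \<Rightarrow> ('a \<Rightarrow> real) \<Rightarrow> 'a \<Rightarrow> real" where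
  "avg v f x = integral {0..1} (\<lambda>s. f (x + s *\<^sub>R v))"

lemma Lip_integrable_segment:
  assumes "Lip f"
  shows "(\<lambda>s. f (x + s *\<^sub>R v)) integrable_on {0..1::real}"
  by (intro integrable_continuous_real continuous_on_compose2[OF Lip_continuous[OF assms, of UNIV]]
      continuous_intros) auto

lemma avg_const: "avg v (\<lambda>_. c) = (\<lambda>_. c)"
  by (simp add: avg_def fun_eq_iff)

lemma avg_add: "Lip f \<Longrightarrow> Lip g \<Longrightarrow> avg v (\<lambda>x. f x + g x) = (\<lambda>x. avg v f x + avg v g x)"
  unfolding avg_def by (auto simp: fun_eq_iff intro!: integral_add Lip_integrable_segment)

lemma avg_cmult: "avg v (\<lambda>x. c * f x) = (\<lambda>x. c * avg v f x)"
  by (simp add: avg_def fun_eq_iff)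

lemma avg_mono: "Lip f \<Longrightarrow> Lip g \<Longrightarrow> (\<And>x. f x \<le> g x) \<Longrightarrow> avg v f x \<le> avg v g x"
  unfolding avg_def by (intro integral_le Lip_integrable_segment) auto

lemma avg_shift: "avg v (\<lambda>y. f (z + y)) = (\<lambda>x. avg v f (z + x))"
  by (simp add: avg_def fun_eq_iff add.assoc)

text \<open>Common frame for segment averages, translations and Gaussian averages: Markov operators
  that commute with translations. Only Lipschitz functions are constrained, which settles
  integrability.\<close>

definition averaging :: "(('a::real_normed_vector \<Rightarrow> real) \<Rightarrow> 'a \<Rightarrow> real) \<Rightarrow> bool" where
  "averaging T \<longleftrightarrow>
     (\<forall>c. T (\<lambda>_. c) = (\<lambda>_. c)) \<and>
     (\<forall>f g. Lip f \<longrightarrow> Lip g \<longrightarrow> T (\<lambda>x. f x + g x) = (\<lambda>x. T f x + T g x)) \<and>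
     (\<forall>f c. Lip f \<longrightarrow> T (\<lambda>x. c * f x) = (\<lambda>x. c * T f x)) \<and>
     (\<forall>f g x. Lip f \<longrightarrow> Lip g \<longrightarrow> (\<forall>x. f x \<le> g x) \<longrightarrow> T f x \<le> T g x) \<and>
     (\<forall>f z. Lip f \<longrightarrow> T (\<lambda>y. f (z + y)) = (\<lambda>x. T f (z + x)))"

context
  fixes T :: "('a::real_normed_vector \<Rightarrow> real) \<Rightarrow> 'a \<Rightarrow> real"
  assumes T: "averaging T"
begin

lemma averaging_const: "T (\<lambda>_. c) = (\<lambda>_. c)"
  and averaging_add: "Lip f \<Longrightarrow> Lip g \<Longrightarrow> T (\<lambda>x. f x + g x) = (\<lambda>x. T f x + T g x)"
  and averaging_cmult: "Lip f \<Longrightarrow> T (\<lambda>x. c * f x) = (\<lambda>x. c * T f x)"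
  and averaging_mono: "Lip f \<Longrightarrow> Lip g \<Longrightarrow> (\<And>x. f x \<le> g x) \<Longrightarrow> T f x \<le> T g x"
  and averaging_shift: "Lip f \<Longrightarrow> T (\<lambda>y. f (z + y)) = (\<lambda>x. T f (z + x))"
  using T unfolding averaging_def by blast+

lemma averaging_diff:
  assumes "Lip f" "Lip g"
  shows "T (\<lambda>x. f x - g x) = (\<lambda>x. T f x - T g x)"
  using averaging_add[OF assms(1) Lip_cmult[OF assms(2), of "-1"]] averaging_cmult[OF assms(2), of "-1"]
  by simp

lemma averaging_bound:
  assumes "Lip f" "\<And>x. \<bar>f x\<bar> \<le> c"
  shows "\<bar>T f x\<bar> \<le> c"
proof -
  have "f x \<le> c" "- c \<le> f x" for x using assms(2)[of x] by linarith+
  then have "T f x \<le> T (\<lambda>_. c) x" "T (\<lambda>_. - c) x \<le> T f x"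
    by (auto intro!: averaging_mono assms Lip_const)
  then show ?thesis by (simp add: averaging_const)
qed

lemma averaging_dist:
  assumes "Lip f" "Lip g" "\<And>x. \<bar>f x - g x\<bar> \<le> c"
  shows "\<bar>T f x - T g x\<bar> \<le> c"
  using averaging_bound[OF Lip_diff[OF assms(1,2)] assms(3)] assms by (simp add: averaging_diff)

text \<open>An increment of \<open>T f\<close> is the difference at 0 of \<open>T\<close> applied to
  two translates of \<open>f\<close>, and these are uniformly \<open>L * norm (x - y)\<close>
  apart.\<close>

lemma averaging_lipschitz:
  assumes "L-lipschitz_on UNIV f"
  shows "L-lipschitz_on UNIV (T f)"
proof (rule lipschitz_realI)
  have "\<bar>T (\<lambda>z. f (x + z)) 0 - T (\<lambda>z. f (y + z)) 0\<bar> \<le> L * norm (x - y)" for x y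
  proof (rule averaging_dist)
    show "\<bar>f (x + z) - f (y + z)\<bar> \<le> L * norm (x - y)" for z
      using lipschitz_realD[OF assms, of "x + z" "y + z"] by simp
  qed (use lipschitz_shift[OF assms] LipI in blast)+
  then show "\<bar>T f x - T f y\<bar> \<le> L * norm (x - y)" for x y
    using LipI[OF assms] by (simp add: averaging_shift)
qed (rule lipschitz_on_nonneg[OF assms])

lemma averaging_Lip: "Lip f \<Longrightarrow> Lip (T f)"
  using averaging_lipschitz by (auto simp: Lip_def)

text \<open>Differentiation under \<open>T\<close>: by linearity and translation invariance the
  remainder of \<open>T f\<close> is \<open>T\<close> applied to the remainder of \<open>f\<close>,
  so the uniform bound is inherited.\<close>

lemma averaging_partial:
  assumes f: "Lip f" and g: "Lip g"
    and b: "\<And>x. \<bar>f (x + u) - f x - k * g x\<bar> \<le> c"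
  shows "\<bar>T f (x + u) - T f x - k * T g x\<bar> \<le> c"
proof -
  have eq: "T (\<lambda>x. (f (u + x) - f x) - k * g x) = (\<lambda>x. (T f (u + x) - T f x) - k * T g x)"
    by (simp add: averaging_diff averaging_cmult averaging_shift f g Lip_shift Lip_diff Lip_cmult)
  have "\<bar>T (\<lambda>x. (f (u + x) - f x) - k * g x) x\<bar> \<le> c"
    by (rule averaging_bound, intro Lip_diff Lip_cmult Lip_shift f g) (use b in \<open>simp add: add.commute\<close>)
  then show ?thesis unfolding eq by (simp only: add.commute)
qed

end

lemma averaging_avg: "averaging (avg v)"
  unfolding averaging_def by (auto simp: avg_const avg_add avg_cmult avg_shift avg_mono)

lemma averaging_id: "averaging (\<lambda>f. f)"
  unfolding averaging_def by auto

lemma averaging_compose: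
  assumes T: "averaging T" and U: "averaging U"
  shows "averaging (\<lambda>f. T (U f))"
  unfolding averaging_def
proof (intro conjI allI impI)
  fix f g :: "'a \<Rightarrow> real" and c x z
  note [simp] = averaging_Lip[OF U]
  show "T (U (\<lambda>_. c)) = (\<lambda>_. c)" by (simp add: averaging_const[OF U] averaging_const[OF T])
  assume f: "Lip f"
  show "T (U (\<lambda>x. c * f x)) = (\<lambda>x. c * T (U f) x)"
    using f by (simp add: averaging_cmult[OF U] averaging_cmult[OF T])
  show "T (U (\<lambda>y. f (z + y))) = (\<lambda>x. T (U f) (z + x))"
    using f by (simp add: averaging_shift[OF U] averaging_shift[OF T])
  assume g: "Lip g"
  show "T (U (\<lambda>x. f x + g x)) = (\<lambda>x. T (U f) x + T (U g) x)"
    using f g by (simp add: averaging_add[OF U] averaging_add[OF T])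
  assume "\<forall>x. f x \<le> g x"
  then show "T (U f) x \<le> T (U g) x"
    using f g averaging_mono[OF U f g] by (intro averaging_mono[OF T]) auto
qed

lemma avg_close:
  assumes "L-lipschitz_on UNIV f"
  shows "\<bar>avg v f x - f x\<bar> \<le> L * norm v"
proof -
  have L: "L \<ge> 0" by (rule lipschitz_on_nonneg[OF assms])
  have "\<bar>integral {0..1::real} (\<lambda>s. f (x + s *\<^sub>R v) - f x)\<bar> \<le> integral {0..1::real} (\<lambda>s. L * norm v)"
  proof (rule integral_norm_bound_integral[where 'a = real, simplified])
    fix s :: real assume s: "s \<in> {0..1}"
    have "\<bar>f (x + s *\<^sub>R v) - f x\<bar> \<le> L * norm (s *\<^sub>R v)"
      using lipschitz_realD[OF assms, of "x + s *\<^sub>R v" x] by simp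
    also have "\<dots> \<le> L * norm v" using s L by (intro mult_left_mono) (auto simp: mult_left_le_one_le)
    finally show "\<bar>f (x + s *\<^sub>R v) - f x\<bar> \<le> L * norm v" .
  qed (intro integrable_diff Lip_integrable_segment LipI[OF assms] integrable_const_ivl)+
  moreover have "integral {0..1::real} (\<lambda>s. f (x + s *\<^sub>R v) - f x) = avg v f x - f x"
    unfolding avg_def
    by (subst integral_diff) (simp_all add: Lip_integrable_segment LipI[OF assms] integrable_const_ivl)
  ultimately show ?thesis by simp
qed

text \<open>On an end piece of parameter length \<open>\<bar>k\<bar>\<close> the integrand varies by
  at most \<open>L * norm v * \<bar>k\<bar>\<close>; the factor 2 counts the two ends.\<close>

lemma avg_partial:
  assumes f: "L-lipschitz_on UNIV f"
  shows "\<bar>avg v f (x + k *\<^sub>R v) - avg v f x - k * (f (x + v) - f x)\<bar> \<le> 2 * L * norm v * k\<^sup>2"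
proof -
  have L: "L \<ge> 0" by (rule lipschitz_on_nonneg[OF f])
  let ?h = "\<lambda>s::real. f (x + s *\<^sub>R v)"
  have b: "\<bar>?h (c + s) - ?h c\<bar> \<le> L * norm v * \<bar>k\<bar>" if "\<bar>s\<bar> \<le> \<bar>k\<bar>" for c s
  proof -
    have "\<bar>?h (c + s) - ?h c\<bar> \<le> L * norm (s *\<^sub>R v)"
      using lipschitz_realD[OF f, of "x + (c + s) *\<^sub>R v" "x + c *\<^sub>R v"] by (simp add: algebra_simps)
    also have "\<dots> \<le> L * norm v * \<bar>k\<bar>"
      using that L by (simp add: mult.assoc mult.commute[of "norm v"] mult_left_mono mult_right_mono)
    finally show ?thesis .
  qed
  have c: "continuous_on UNIV ?h"
    by (intro continuous_on_compose2[OF Lip_continuous[OF LipI[OF f], of UNIV]] continuous_intros) auto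
  have "\<bar>integral {0..1} (\<lambda>s. ?h (s + k)) - integral {0..1} ?h - k * (?h 1 - ?h 0)\<bar>
      \<le> 2 * (L * norm v * \<bar>k\<bar>) * \<bar>k\<bar>"
    using b[of _ 0] b[of _ 1] by (intro integral_shift_error c) (auto simp: add.commute)
  then show ?thesis
    by (simp add: avg_def algebra_simps power2_eq_square)
qed

section \<open>Mollification\<close>

fun mol :: "'a::real_normed_vector list \<Rightarrow> ('a \<Rightarrow> real) \<Rightarrow> 'a \<Rightarrow> real" where
  "mol [] f = f"
| "mol (v # vs) f = avg v (mol vs f)"

text \<open>The derivative of \<open>mol vs f\<close> along \<open>u\<close>: the outermost average
  in direction \<open>u\<close> is differentiated by the difference formula, the averages outside it
  are kept. The value 0 for the empty list is a default, never reached when \<open>u\<close> occurs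
  in the list.\<close>

fun dmol :: "'a::real_normed_vector \<Rightarrow> 'a list \<Rightarrow> ('a \<Rightarrow> real) \<Rightarrow> 'a \<Rightarrow> real" where
  "dmol u [] f = (\<lambda>_. 0)"
| "dmol u (v # vs) f =
     (if v = u then (\<lambda>x. mol vs f (v + x) - mol vs f x) else avg v (dmol u vs f))"

lemma averaging_mol: "averaging (mol vs)"
proof (induction vs)
  case Nil
  show ?case using averaging_id by simp
next
  case (Cons v vs)
  show ?case using averaging_compose[OF averaging_avg Cons] by simp
qed

lemma mol_close:
  assumes "L-lipschitz_on UNIV f"
  shows "\<bar>mol vs f x - f x\<bar> \<le> L * sum_list (map norm vs)"
proof (induction vs arbitrary: x)
  case (Cons v vs)
  have "\<bar>avg v (mol vs f) x - mol vs f x\<bar> \<le> L * norm v"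
    by (intro avg_close averaging_lipschitz[OF averaging_mol] assms)
  then show ?case using Cons[of x] by (simp add: algebra_simps)
qed simp

lemma dmol_lipschitz:
  assumes f: "L-lipschitz_on UNIV f"
  shows "(2 * L)-lipschitz_on UNIV (dmol u vs f)"
proof (induction vs)
  case Nil
  show ?case using lipschitz_on_nonneg[OF f] by (auto intro!: lipschitz_realI)
next
  case (Cons v vs)
  have "L-lipschitz_on UNIV (mol vs f)"
    by (intro averaging_lipschitz[OF averaging_mol] f)
  then have "(L + L)-lipschitz_on UNIV (\<lambda>x. mol vs f (v + x) - mol vs f x)"
    by (intro lipschitz_on_diff lipschitz_shift)
  then show ?case using averaging_lipschitz[OF averaging_avg Cons] by (cases "v = u") simp_all
qed

lemma dmol_bound:
  assumes f: "L-lipschitz_on UNIV f"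
  shows "\<bar>dmol u vs f x\<bar> \<le> L * norm u"
proof (induction vs arbitrary: x)
  case Nil
  show ?case using lipschitz_on_nonneg[OF f] by simp
next
  case (Cons v vs)
  have "L-lipschitz_on UNIV (mol vs f)"
    by (intro averaging_lipschitz[OF averaging_mol] f)
  from lipschitz_realD[OF this, of "v + x" x] show ?case
    using averaging_bound[OF averaging_avg LipI[OF dmol_lipschitz[OF f]] Cons] by (cases "v = u") simp_all
qed

text \<open>Continuity of the derivative with respect to uniform convergence of \<open>f\<close>. It
  later transfers continuity in time from the semigroup to its mollified space derivatives.\<close>

lemma dmol_dist:
  assumes f: "Lip f" and g: "Lip g" and c: "\<And>x. \<bar>f x - g x\<bar> \<le> c"
  shows "\<bar>dmol u vs f x - dmol u vs g x\<bar> \<le> 2 * c"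
proof (induction vs arbitrary: x)
  case Nil
  show ?case using c[of 0] by simp
next
  case (Cons v vs)
  have "\<bar>mol vs f y - mol vs g y\<bar> \<le> c" for y
    by (intro averaging_dist[OF averaging_mol] f g c)
  from this[of "v + x"] this[of x]
  have "\<bar>(mol vs f (v + x) - mol vs f x) - (mol vs g (v + x) - mol vs g x)\<bar> \<le> 2 * c"
    by linarith
  moreover have "Lip (dmol u vs f)" "Lip (dmol u vs g)"
    using f g dmol_lipschitz unfolding Lip_def by blast+
  ultimately show ?case
    using Cons averaging_dist[OF averaging_avg, of "dmol u vs f" "dmol u vs g" "2 * c" v x]
    by (cases "v = u") simp_all
qed

text \<open>At the outermost occurrence of \<open>u\<close> this is \<open>avg_partial\<close> for
  the remaining mollified function; the averages outside it preserve the estimate by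
  \<open>averaging_partial\<close>.\<close>

lemma dmol_partial:
  assumes f: "L-lipschitz_on UNIV f" and u: "u \<in> set vs"
  shows "\<bar>mol vs f (x + k *\<^sub>R u) - mol vs f x - k * dmol u vs f x\<bar> \<le> 2 * L * norm u * k\<^sup>2"
  using u
proof (induction vs arbitrary: x)
  case (Cons v vs)
  have m: "L-lipschitz_on UNIV (mol vs f)"
    by (intro averaging_lipschitz[OF averaging_mol] f)
  show ?case
  proof (cases "v = u")
    case True
    then show ?thesis using avg_partial[OF m, of v x k] by (simp add: add.commute)
  next
    case False
    then have "u \<in> set vs" using Cons.prems by simp
    then show ?thesis
      using False averaging_partial[OF averaging_avg LipI[OF m] LipI[OF dmol_lipschitz[OF f]] Cons.IH]
      by simp
  qed
qed simp

section \<open>Taylor expansions and twice differentiable mollifiers\<close>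

lemma norm_axis: "norm (axis i x :: real ^ 'd) = \<bar>x\<bar>"
  by (rule power2_eq_imp_eq, simp only: power2_norm_eq_inner) (auto simp: inner_axis_axis power2_eq_square)

text \<open>Coordinates are changed one at a time. Each change costs \<open>C * h\<^sup>2\<close>
  from the one-dimensional expansion, and a term with \<open>L\<close> for evaluating the partial
  derivative at an intermediate point instead of \<open>x\<close>.\<close>

lemma partials_expansion:
  fixes g :: "real ^ 'd \<Rightarrow> real" and C L :: real
  assumes part: "\<And>i x h. \<bar>g (x + axis i h) - g x - h * q i x\<bar> \<le> C * h\<^sup>2"
    and lip: "\<And>i. L-lipschitz_on UNIV (q i)" and C: "C \<ge> 0"
  shows "\<bar>g (x + z) - g x - (\<chi> i. q i x) \<bullet> z\<bar> \<le> CARD('d) * (C + L) * (norm z)\<^sup>2"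
proof -
  have L: "L \<ge> 0" using lipschitz_on_nonneg[OF lip] .
  \<comment> \<open>\<open>w S\<close> keeps the coordinates of \<open>z\<close> in
    \<open>S\<close>, so induction over \<open>S\<close> walks from \<open>x\<close> to
    \<open>x + z\<close>.\<close>
  define w where "w S = (\<chi> i. if i \<in> S then z $ i else 0)" for S
  have nw: "norm (w S) \<le> norm z" for S
    by (rule norm_le_componentwise_cart) (auto simp: w_def)
  have "\<bar>g (x + w S) - g x - (\<Sum>i\<in>S. q i x * z $ i)\<bar> \<le> card S * ((C + L) * (norm z)\<^sup>2)" for S :: "'d set"
    using finite[of S]
  proof (induction S rule: finite_induct)
    case empty
    have "w {} = 0" by (simp add: w_def vec_eq_iff)
    then show ?case by simp
  next
    case (insert i S)
    have w: "w (insert i S) = w S + axis i (z $ i)"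
      using insert.hyps by (auto simp: w_def vec_eq_iff axis_def)
    have zi: "\<bar>z $ i\<bar> \<le> norm z" by (rule component_le_norm_cart)
    have "(z $ i)\<^sup>2 \<le> (norm z)\<^sup>2" using power_mono[OF zi, of 2] by simp
    then have "C * (z $ i)\<^sup>2 \<le> C * (norm z)\<^sup>2" using C by (rule mult_left_mono)
    then have 1: "\<bar>g (x + w S + axis i (z $ i)) - g (x + w S) - z $ i * q i (x + w S)\<bar> \<le> C * (norm z)\<^sup>2"
      using part[of "x + w S" i "z $ i"] by linarith
    have "\<bar>q i (x + w S) - q i x\<bar> \<le> L * norm z"
      using lipschitz_realD[OF lip, of i "x + w S" x] nw[of S] mult_left_mono[OF nw L, of S] by simp
    then have "\<bar>z $ i\<bar> * \<bar>q i (x + w S) - q i x\<bar> \<le> norm z * (L * norm z)"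
      using zi by (intro mult_mono) auto
    moreover have "z $ i * q i (x + w S) - q i x * z $ i = z $ i * (q i (x + w S) - q i x)"
      by (simp add: algebra_simps)
    ultimately have 2: "\<bar>z $ i * q i (x + w S) - q i x * z $ i\<bar> \<le> L * (norm z)\<^sup>2"
      by (simp only: abs_mult power2_eq_square mult.left_commute)
    have s: "(\<Sum>j\<in>insert i S. q j x * z $ j) = q i x * z $ i + (\<Sum>j\<in>S. q j x * z $ j)"
      using insert.hyps by simp
    have "\<bar>g (x + w (insert i S)) - g x - (\<Sum>j\<in>insert i S. q j x * z $ j)\<bar>
      \<le> C * (norm z)\<^sup>2 + L * (norm z)\<^sup>2 + card S * ((C + L) * (norm z)\<^sup>2)"
      unfolding w s add.assoc[symmetric] using 1 2 insert.IH by linarith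
    also have "\<dots> = card (insert i S) * ((C + L) * (norm z)\<^sup>2)"
      using insert.hyps by (simp add: algebra_simps)
    finally show ?case .
  qed
  from this[of UNIV] show ?thesis
    by (simp add: w_def inner_vec_def mult.assoc)
qed

lemma has_derivative_quadratic_error:
  assumes D: "bounded_linear D"
    and b: "\<And>z. norm (g (x + z) - g x - D z) \<le> C * (norm z)\<^sup>2"
  shows "(g has_derivative D) (at x)"
proof -
  have "(\<lambda>z. norm (g (x + z) - g x - D z) / norm z) \<midarrow>0\<rightarrow> 0"
  proof (rule Lim_null_comparison)
    show "\<forall>\<^sub>F z in at 0. norm (norm (g (x + z) - g x - D z) / norm z) \<le> C * norm z"
      unfolding eventually_at_filter using b by (auto simp: divide_simps power2_eq_square mult.assoc)
    show "(\<lambda>z. C * norm z) \<midarrow>0\<rightarrow> 0" by (auto intro!: tendsto_eq_intros)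
  qed
  then show ?thesis using D by (simp add: has_derivative_at)
qed

text \<open>Along the segment, the second-order remainder of \<open>g\<close> has as derivative the
  first-order remainder of \<open>p\<close>, tested with \<open>z\<close>. A free bound
  \<open>B\<close> serves both the cubic remainder of mollified functions and the weaker one of
  \<open>C12_test\<close> functions.\<close>

lemma taylor_second_order:
  fixes g :: "real ^ 'd \<Rightarrow> real"
  assumes g: "\<And>x. (g has_derivative (\<lambda>h. p x \<bullet> h)) (at x)"
    and p: "\<And>s. s \<in> {0..1} \<Longrightarrow> norm (p (x + s *\<^sub>R z) - p x - A *v (s *\<^sub>R z)) \<le> B"
  shows "\<bar>g (x + z) - g x - p x \<bullet> z - (A *v z) \<bullet> z / 2\<bar> \<le> B * norm z"
proof -
  let ?r = "\<lambda>s::real. g (x + s *\<^sub>R z) - s * (p x \<bullet> z) - s\<^sup>2 * ((A *v z) \<bullet> z / 2)"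
  let ?r' = "\<lambda>s::real. (p (x + s *\<^sub>R z) - p x - A *v (s *\<^sub>R z)) \<bullet> z"
  have "norm (?r 1 - ?r 0) \<le> B * norm z * norm (1 - 0 :: real)"
  proof (rule differentiable_bound[of "{0..1}" ?r "\<lambda>s. (*) (?r' s)"])
    fix s :: real assume s: "s \<in> {0..1}"
    have "((\<lambda>s. g (x + s *\<^sub>R z)) has_derivative (\<lambda>h. p (x + s *\<^sub>R z) \<bullet> (h *\<^sub>R z))) (at s within {0..1})"
      by (rule has_derivative_compose[where g = g and f = "\<lambda>s. x + s *\<^sub>R z", OF _ g])
        (auto intro!: derivative_eq_intros)
    then have "((\<lambda>s. g (x + s *\<^sub>R z)) has_real_derivative p (x + s *\<^sub>R z) \<bullet> z) (at s within {0..1})"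
      unfolding has_field_derivative_def by (rule has_derivative_eq_rhs) (simp add: fun_eq_iff mult.commute)
    then have "(?r has_real_derivative p (x + s *\<^sub>R z) \<bullet> z - 1 * (p x \<bullet> z) - 2 * s * ((A *v z) \<bullet> z / 2)) (at s within {0..1})"
      by (intro derivative_intros) (auto intro!: derivative_eq_intros)
    moreover have "p (x + s *\<^sub>R z) \<bullet> z - 1 * (p x \<bullet> z) - 2 * s * ((A *v z) \<bullet> z / 2) = ?r' s"
      by (simp add: inner_diff_left matrix_vector_mult_scaleR)
    ultimately have "(?r has_real_derivative ?r' s) (at s within {0..1})"
      by simp
    then show "(?r has_derivative (*) (?r' s)) (at s within {0..1})"
      by (simp add: has_field_derivative_def)
    have "\<bar>?r' s\<bar> \<le> norm (p (x + s *\<^sub>R z) - p x - A *v (s *\<^sub>R z)) * norm z"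
      by (rule Cauchy_Schwarz_ineq2)
    also have "\<dots> \<le> B * norm z"
      by (intro mult_right_mono p s) auto
    finally have "\<bar>?r' s\<bar> \<le> B * norm z" .
    then show "onorm ((*) (?r' s)) \<le> B * norm z"
      by (intro onorm_bound) (auto simp: abs_mult intro!: mult_right_mono order_trans[OF abs_ge_zero])
  qed auto
  then show ?thesis by (simp add: algebra_simps)
qed

text \<open>One constant \<open>K\<close> controls everything a consistency estimate needs:
  \<open>p\<close> and \<open>A\<close> act as gradient and Hessian, and the cubic remainder turns
  increments of size \<open>sqrt h\<close> into an error of order \<open>h * sqrt h\<close>.\<close>

definition C21 ::
  "real \<Rightarrow> (real ^ 'd \<Rightarrow> real) \<Rightarrow> (real ^ 'd \<Rightarrow> real ^ 'd) \<Rightarrow> (real ^ 'd \<Rightarrow> real ^ 'd ^ 'd) \<Rightarrow> bool" where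
  "C21 K g p A \<longleftrightarrow>
     K-lipschitz_on UNIV g \<and> K-lipschitz_on UNIV p \<and> K-lipschitz_on UNIV A \<and>
     (\<forall>x. norm (A x) \<le> K) \<and>
     (\<forall>x z. \<bar>g (x + z) - g x - p x \<bullet> z - (A x *v z) \<bullet> z / 2\<bar> \<le> K * (norm z) ^ 3)"

text \<open>An arbitrary enumeration of the axes, possibly with repetitions: only membership is
  used, and the length enters constants.\<close>

definition dirs :: "real \<Rightarrow> (real ^ 'd) list" where
  "dirs \<epsilon> = map (\<lambda>i. axis i \<epsilon>) (SOME is. set is = UNIV)"

definition partial :: "real \<Rightarrow> 'd \<Rightarrow> (real ^ 'd \<Rightarrow> real) \<Rightarrow> real ^ 'd \<Rightarrow> real" where
  "partial \<epsilon> i f = (\<lambda>x. 1 / \<epsilon> * dmol (axis i \<epsilon>) (dirs \<epsilon>) f x)"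

text \<open>Two rounds of averaging over all axes, since each round gains one Lipschitz derivative
  in every coordinate and the Hessian has to be Lipschitz.\<close>

definition smooth :: "real \<Rightarrow> (real ^ 'd \<Rightarrow> real) \<Rightarrow> real ^ 'd \<Rightarrow> real" where
  "smooth \<epsilon> f = mol (dirs \<epsilon>) (mol (dirs \<epsilon>) f)"

text \<open>The first derivative falls on the inner round of averages and leaves the outer one
  intact; the second derivative, in \<open>smooth_hess\<close>, uses up the outer round.\<close>

definition smooth_grad :: "real \<Rightarrow> (real ^ 'd \<Rightarrow> real) \<Rightarrow> real ^ 'd \<Rightarrow> real ^ 'd" where
  "smooth_grad \<epsilon> f x = (\<chi> i. mol (dirs \<epsilon>) (partial \<epsilon> i f) x)"

definition smooth_hess :: "real \<Rightarrow> (real ^ 'd \<Rightarrow> real) \<Rightarrow> real ^ 'd \<Rightarrow> real ^ 'd ^ 'd" where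
  "smooth_hess \<epsilon> f x = (\<chi> i j. partial \<epsilon> j (partial \<epsilon> i f) x)"

lemma axis_in_dirs: "axis i \<epsilon> \<in> set (dirs \<epsilon>)"
proof -
  have "\<exists>is::'a list. set is = UNIV" by (rule finite_list) simp
  then have "set (SOME is::'a list. set is = UNIV) = UNIV" by (rule someI_ex)
  then show ?thesis unfolding dirs_def by simp
qed

lemma averaging_smooth: "averaging (smooth \<epsilon>)"
  unfolding smooth_def[abs_def] by (rule averaging_compose[OF averaging_mol averaging_mol])

lemma dirs_length: "sum_list (map norm (dirs \<epsilon> :: (real ^ 'd) list)) = \<bar>\<epsilon>\<bar> * length (dirs 0 :: (real ^ 'd) list)"
proof -
  have "sum_list (map (\<lambda>i. norm (axis i \<epsilon> :: real ^ 'd)) is) = \<bar>\<epsilon>\<bar> * length is" for "is"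
    by (induction "is") (auto simp: norm_axis algebra_simps)
  then show ?thesis by (simp add: dirs_def o_def)
qed

lemma smooth_close:
  fixes f :: "real ^ 'd \<Rightarrow> real"
  assumes f: "L-lipschitz_on UNIV f"
  shows "\<bar>smooth \<epsilon> f x - f x\<bar> \<le> 2 * L * \<bar>\<epsilon>\<bar> * length (dirs 0 :: (real ^ 'd) list)"
  using mol_close[OF f, of "dirs \<epsilon>" x]
    mol_close[OF averaging_lipschitz[OF averaging_mol f], of "dirs \<epsilon>" "dirs \<epsilon>" x]
  unfolding smooth_def dirs_length by (simp add: algebra_simps)

context
  fixes \<epsilon> :: real assumes \<epsilon>: "\<epsilon> > 0"
begin

lemma partial_lipschitz:
  assumes "L-lipschitz_on UNIV f"
  shows "(2 * L / \<epsilon>)-lipschitz_on UNIV (partial \<epsilon> i f)"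
proof -
  have "(\<bar>1 / \<epsilon>\<bar> * (2 * L))-lipschitz_on UNIV (partial \<epsilon> i f)"
    unfolding partial_def by (intro lipschitz_on_cmult_real dmol_lipschitz assms)
  then show ?thesis using \<epsilon> by simp
qed

lemma partial_dist:
  assumes "Lip f" "Lip g" "\<And>x. \<bar>f x - g x\<bar> \<le> c"
  shows "\<bar>partial \<epsilon> i f x - partial \<epsilon> i g x\<bar> \<le> 2 * c / \<epsilon>"
proof -
  have "\<bar>partial \<epsilon> i f x - partial \<epsilon> i g x\<bar>
      = \<bar>dmol (axis i \<epsilon>) (dirs \<epsilon>) f x - dmol (axis i \<epsilon>) (dirs \<epsilon>) g x\<bar> / \<epsilon>"
    using \<epsilon> by (simp add: partial_def diff_divide_distrib[symmetric] abs_divide)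
  also have "\<dots> \<le> 2 * c / \<epsilon>"
    using dmol_dist[OF assms] \<epsilon> by (intro divide_right_mono) auto
  finally show ?thesis .
qed

lemma mol_partial:
  assumes f: "L-lipschitz_on UNIV f"
  shows "\<bar>mol (dirs \<epsilon>) f (x + axis i h) - mol (dirs \<epsilon>) f x - h * partial \<epsilon> i f x\<bar> \<le> 2 * L / \<epsilon> * h\<^sup>2"
proof -
  have "axis i h = (h / \<epsilon>) *\<^sub>R axis i \<epsilon>"
    using \<epsilon> by (simp add: axis_def vec_eq_iff)
  moreover have "2 * L * norm (axis i \<epsilon>) * (h / \<epsilon>)\<^sup>2 = 2 * L / \<epsilon> * h\<^sup>2"
    using \<epsilon> by (simp add: norm_axis power_divide power2_eq_square)
  ultimately show ?thesis
    using dmol_partial[OF f axis_in_dirs[of i \<epsilon>], where x = x and k = "h / \<epsilon>"] by (simp add: partial_def)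
qed

text \<open>Each differentiation costs a factor \<open>2 / \<epsilon>\<close>, so the constant
  depends on \<epsilon>, \<open>L\<close> and the dimension but not on \<open>f\<close>. The two
  additional quadratic remainders give differentiability of the mollified function and of its
  gradient.\<close>

lemma smooth_C21:
  fixes L :: real
  shows "\<exists>K\<ge>0. \<forall>f :: real ^ 'd \<Rightarrow> real. L-lipschitz_on UNIV f \<longrightarrow>
     C21 K (smooth \<epsilon> f) (smooth_grad \<epsilon> f) (smooth_hess \<epsilon> f) \<and>
     (\<forall>x z. \<bar>smooth \<epsilon> f (x + z) - smooth \<epsilon> f x - smooth_grad \<epsilon> f x \<bullet> z\<bar> \<le> K * (norm z)\<^sup>2) \<and>
     (\<forall>x z. norm (smooth_grad \<epsilon> f (x + z) - smooth_grad \<epsilon> f x - smooth_hess \<epsilon> f x *v z) \<le> K * (norm z)\<^sup>2)"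
proof (cases "L \<ge> 0")
  case False
  then show ?thesis using lipschitz_on_nonneg by blast
next
  case L: True
  define n where "n = real CARD('d)"
  define M where "M = 2 * L / \<epsilon>"
  define M2 where "M2 = 2 * M / \<epsilon>"
  define M3 where "M3 = 2 * M2 / \<epsilon>"
  have M: "M \<ge> 0" "M2 \<ge> 0" "M3 \<ge> 0" using L \<epsilon> by (auto simp: M_def M2_def M3_def)
  have n: "n \<ge> 0" by (simp add: n_def)
  \<comment> \<open>\<open>K1\<close> and \<open>K2\<close> are the remainder constants of
    \<open>partials_expansion\<close> for the function and its gradient; in \<open>K\<close> the
    products \<open>n * (n * _)\<close> pass from entries of the Hessian to its norm.\<close>
  define K1 where "K1 = n * (M + M)"
  define K2 where "K2 = n * (n * (M2 + M2))"
  define K where "K = L + n * M + n * (n * M2) + n * (n * M) + K1 + K2"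
  have K1: "K1 \<ge> 0" and K2: "K2 \<ge> 0" using M n by (auto simp: K1_def K2_def)
  have n1: "n * M \<ge> 0" "n * (n * M2) \<ge> 0" "n * (n * M) \<ge> 0" using M n by auto
  have K: "K \<ge> 0" "L \<le> K" "n * M \<le> K" "n * (n * M2) \<le> K" "n * (n * M) \<le> K" "K1 \<le> K" "K2 \<le> K"
    using L K1 K2 n1 by (auto simp: K_def)
  show ?thesis
  proof (intro exI[of _ K] conjI K(1) allI impI)
    fix f :: "real ^ 'd \<Rightarrow> real" assume f: "L-lipschitz_on UNIV f"
    have p1: "M-lipschitz_on UNIV (partial \<epsilon> i f)" for i
      using partial_lipschitz[OF f] by (simp add: M_def)
    have p2: "M2-lipschitz_on UNIV (partial \<epsilon> j (partial \<epsilon> i f))" for i j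
      using partial_lipschitz[OF p1] by (simp add: M2_def)
    have b2: "\<bar>partial \<epsilon> j (partial \<epsilon> i f) x\<bar> \<le> M" for i j x
      using dmol_bound[OF p1, of "axis j \<epsilon>" "dirs \<epsilon>" i x] \<epsilon>
      by (simp add: partial_def[of _ j] norm_axis abs_divide divide_le_eq)
    have g1: "M-lipschitz_on UNIV (mol (dirs \<epsilon>) (partial \<epsilon> i f))" for i
      by (intro averaging_lipschitz[OF averaging_mol] p1)
    have e1: "\<bar>smooth \<epsilon> f (x + z) - smooth \<epsilon> f x - smooth_grad \<epsilon> f x \<bullet> z\<bar> \<le> K1 * (norm z)\<^sup>2" for x z
      unfolding smooth_def smooth_grad_def K1_def n_def
    proof (rule partials_expansion[OF _ g1 M(1)])
      show "\<bar>mol (dirs \<epsilon>) (mol (dirs \<epsilon>) f) (x + axis i h) - mol (dirs \<epsilon>) (mol (dirs \<epsilon>) f) x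
          - h * mol (dirs \<epsilon>) (partial \<epsilon> i f) x\<bar> \<le> M * h\<^sup>2" for i x h
        using mol_partial[OF f] unfolding M_def
        by (intro averaging_partial[OF averaging_mol averaging_Lip[OF averaging_mol]] LipI[OF f] LipI[OF p1])
    qed
    have e2: "\<bar>mol (dirs \<epsilon>) (partial \<epsilon> i f) (x + z) - mol (dirs \<epsilon>) (partial \<epsilon> i f) x
        - (\<chi> j. partial \<epsilon> j (partial \<epsilon> i f) x) \<bullet> z\<bar> \<le> n * (M2 + M2) * (norm z)\<^sup>2" for i x z
      unfolding n_def
    proof (rule partials_expansion[OF _ p2 M(2)])
      show "\<bar>mol (dirs \<epsilon>) (partial \<epsilon> i f) (x + axis j h) - mol (dirs \<epsilon>) (partial \<epsilon> i f) x
          - h * partial \<epsilon> j (partial \<epsilon> i f) x\<bar> \<le> M2 * h\<^sup>2" for j x h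
        using mol_partial[OF p1] unfolding M2_def .
    qed
    have e3: "norm (smooth_grad \<epsilon> f (x + z) - smooth_grad \<epsilon> f x - smooth_hess \<epsilon> f x *v z) \<le> K2 * (norm z)\<^sup>2" for x z
    proof -
      have "norm (smooth_grad \<epsilon> f (x + z) - smooth_grad \<epsilon> f x - smooth_hess \<epsilon> f x *v z)
          \<le> (\<Sum>i\<in>UNIV. \<bar>(smooth_grad \<epsilon> f (x + z) - smooth_grad \<epsilon> f x - smooth_hess \<epsilon> f x *v z) $ i\<bar>)"
        by (rule norm_le_l1_cart)
      also have "\<dots> \<le> (\<Sum>i\<in>(UNIV::'d set). n * (M2 + M2) * (norm z)\<^sup>2)"
        using e2 by (intro sum_mono)
          (simp add: smooth_grad_def smooth_hess_def matrix_vector_mult_def inner_vec_def)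
      finally show ?thesis by (simp add: K2_def n_def mult.assoc)
    qed
    have lip_vec: "(n * c)-lipschitz_on UNIV h"
      if "\<And>i. c-lipschitz_on UNIV (\<lambda>x. h x $ i)" for c and h :: "real ^ 'd \<Rightarrow> real ^ 'd"
    proof (rule lipschitz_onI)
      show "dist (h x) (h y) \<le> n * c * dist x y" for x y
      proof -
        have "norm (h x - h y) \<le> (\<Sum>i\<in>UNIV. \<bar>(h x - h y) $ i\<bar>)" by (rule norm_le_l1_cart)
        also have "\<dots> \<le> (\<Sum>i\<in>(UNIV::'d set). c * norm (x - y))"
          using lipschitz_realD[OF that] by (intro sum_mono) simp
        finally show ?thesis by (simp add: dist_norm n_def)
      qed
      show "n * c \<ge> 0" using n lipschitz_on_nonneg[OF that] by simp
    qed
    have norm_mat: "norm B \<le> n * (n * c)" if "\<And>i j. \<bar>B $ i $ j\<bar> \<le> c" for c and B :: "real ^ 'd ^ 'd"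
    proof -
      have "norm B \<le> (\<Sum>i\<in>UNIV. norm (B $ i))"
        unfolding norm_vec_def by (rule L2_set_le_sum) simp
      also have "\<dots> \<le> (\<Sum>i\<in>(UNIV::'d set). n * c)"
      proof (rule sum_mono)
        fix i
        have "norm (B $ i) \<le> (\<Sum>j\<in>UNIV. \<bar>B $ i $ j\<bar>)" by (rule norm_le_l1_cart)
        also have "\<dots> \<le> (\<Sum>j\<in>(UNIV::'d set). c)" using that by (intro sum_mono)
        finally show "norm (B $ i) \<le> n * c" by (simp add: n_def)
      qed
      finally show ?thesis by (simp add: n_def)
    qed
    have g: "L-lipschitz_on UNIV (smooth \<epsilon> f)"
      by (intro averaging_lipschitz[OF averaging_smooth] f)
    have p: "(n * M)-lipschitz_on UNIV (smooth_grad \<epsilon> f)"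
      by (rule lip_vec) (simp add: smooth_grad_def g1)
    have A: "(n * (n * M2))-lipschitz_on UNIV (smooth_hess \<epsilon> f)"
    proof (rule lipschitz_onI)
      show "dist (smooth_hess \<epsilon> f x) (smooth_hess \<epsilon> f y) \<le> n * (n * M2) * dist x y" for x y
        using norm_mat[of "smooth_hess \<epsilon> f x - smooth_hess \<epsilon> f y" "M2 * norm (x - y)"]
          lipschitz_realD[OF p2] by (simp add: smooth_hess_def dist_norm mult.assoc)
    qed (rule n1)
    have bd: "norm (smooth_hess \<epsilon> f x) \<le> n * (n * M)" for x
      by (rule norm_mat) (simp add: smooth_hess_def b2)
    have der: "(smooth \<epsilon> f has_derivative (\<lambda>h. smooth_grad \<epsilon> f x \<bullet> h)) (at x)" for x
      by (rule has_derivative_quadratic_error[where C = K1]) (simp_all add: e1 bounded_linear_inner_right)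
    have tay: "\<bar>smooth \<epsilon> f (x + z) - smooth \<epsilon> f x - smooth_grad \<epsilon> f x \<bullet> z
        - (smooth_hess \<epsilon> f x *v z) \<bullet> z / 2\<bar> \<le> K2 * (norm z) ^ 3" for x z
    proof -
      have "norm (smooth_grad \<epsilon> f (x + s *\<^sub>R z) - smooth_grad \<epsilon> f x - smooth_hess \<epsilon> f x *v (s *\<^sub>R z))
          \<le> K2 * (norm z)\<^sup>2" if "s \<in> {0..1}" for s
      proof -
        have "norm (s *\<^sub>R z) \<le> norm z" using that by (simp add: mult_left_le_one_le)
        then have "K2 * (norm (s *\<^sub>R z))\<^sup>2 \<le> K2 * (norm z)\<^sup>2"
          using K2 by (intro mult_left_mono power_mono) auto
        with e3[of x "s *\<^sub>R z"] show ?thesis by linarith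
      qed
      from taylor_second_order[OF der this] show ?thesis by (simp add: eval_nat_numeral)
    qed
    show "C21 K (smooth \<epsilon> f) (smooth_grad \<epsilon> f) (smooth_hess \<epsilon> f)"
      unfolding C21_def
      using lipschitz_on_le[OF g] lipschitz_on_le[OF p] lipschitz_on_le[OF A] bd tay K
        order_trans[OF tay mult_right_mono[OF K(7)]] order_trans[OF bd K(5)] by auto
    show "\<bar>smooth \<epsilon> f (x + z) - smooth \<epsilon> f x - smooth_grad \<epsilon> f x \<bullet> z\<bar> \<le> K * (norm z)\<^sup>2" for x z
      using order_trans[OF e1 mult_right_mono[OF K(6)]] by simp
    show "norm (smooth_grad \<epsilon> f (x + z) - smooth_grad \<epsilon> f x - smooth_hess \<epsilon> f x *v z) \<le> K * (norm z)\<^sup>2" for x z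
      using order_trans[OF e3 mult_right_mono[OF K(7)]] by simp
  qed
qed

end

section \<open>Sublinear functionals on Lipschitz functions\<close>

text \<open>Covers laws of increments, Gaussian averages and suprema of these. Only finite
  subadditivity is assumed, no continuity along sequences of functions.\<close>

locale sublinear_functional =
  fixes F :: "('a::real_normed_vector \<Rightarrow> real) \<Rightarrow> real"
  assumes mono: "Lip f \<Longrightarrow> Lip g \<Longrightarrow> (\<And>x. f x \<le> g x) \<Longrightarrow> F f \<le> F g"
    and const: "F (\<lambda>_. c) = c"
    and subadd: "Lip f \<Longrightarrow> Lip g \<Longrightarrow> F (\<lambda>x. f x + g x) \<le> F f + F g"
    and homog: "Lip f \<Longrightarrow> 0 \<le> c \<Longrightarrow> F (\<lambda>x. c * f x) = c * F f"

text \<open>One step of the random walk whose increment has law \<open>F\<close>, as an operator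
  that commutes with translations.\<close>

definition conv :: "(('a::real_normed_vector \<Rightarrow> real) \<Rightarrow> real) \<Rightarrow> ('a \<Rightarrow> real) \<Rightarrow> 'a \<Rightarrow> real" where
  "conv F f x = F (\<lambda>y. f (x + y))"

context sublinear_functional
begin

lemma add_const:
  assumes "Lip f"
  shows "F (\<lambda>x. f x + c) = F f + c"
proof (rule antisym)
  show "F (\<lambda>x. f x + c) \<le> F f + c"
    using subadd[OF assms Lip_const[of c]] by (simp add: const)
  have "F (\<lambda>x. (f x + c) + - c) \<le> F (\<lambda>x. f x + c) + F (\<lambda>_. - c)"
    by (intro subadd Lip_add assms Lip_const)
  then show "F f + c \<le> F (\<lambda>x. f x + c)" by (simp add: const)
qed

lemma le_add:
  assumes "Lip f" "Lip g" "\<And>x. f x \<le> g x + c"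
  shows "F f \<le> F g + c"
  using mono[OF assms(1) Lip_add[OF assms(2) Lip_const[of c]] assms(3)] add_const[OF assms(2)] by simp

lemma dist:
  assumes "Lip f" "Lip g" "\<And>x. \<bar>f x - g x\<bar> \<le> c"
  shows "\<bar>F f - F g\<bar> \<le> c"
proof -
  have "f x \<le> g x + c" "g x \<le> f x + c" for x using assms(3)[of x] by linarith+
  from le_add[OF assms(1,2) this(1)] le_add[OF assms(2,1) this(2)] show ?thesis by linarith
qed

lemma conv_lipschitz:
  assumes "L-lipschitz_on UNIV f"
  shows "L-lipschitz_on UNIV (conv F f)"
proof (rule lipschitz_realI)
  show "\<bar>conv F f x - conv F f y\<bar> \<le> L * norm (x - y)" for x y
    unfolding conv_def
  proof (rule dist)
    show "\<bar>f (x + z) - f (y + z)\<bar> \<le> L * norm (x - y)" for z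
      using lipschitz_realD[OF assms, of "x + z" "y + z"] by simp
  qed (use lipschitz_shift[OF assms] LipI in blast)+
qed (rule lipschitz_on_nonneg[OF assms])

lemma conv_Lip: "Lip f \<Longrightarrow> Lip (conv F f)"
  using conv_lipschitz by (auto simp: Lip_def)

lemma conv_le_add:
  assumes "Lip f" "Lip g" "\<And>x. f x \<le> g x + c"
  shows "conv F f x \<le> conv F g x + c"
  unfolding conv_def by (intro le_add Lip_shift assms)

lemma conv_dist:
  assumes "Lip f" "Lip g" "\<And>x. \<bar>f x - g x\<bar> \<le> c"
  shows "\<bar>conv F f x - conv F g x\<bar> \<le> c"
  unfolding conv_def by (intro dist Lip_shift assms)

text \<open>Jensen's inequality for averages: the Riemann sums are controlled by finite subadditivity.\<close>

lemma integral_le: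
  fixes f :: "real \<Rightarrow> 'a \<Rightarrow> real"
  assumes lip: "\<And>s. s \<in> {0..1} \<Longrightarrow> L-lipschitz_on UNIV (f s)"
    and equi: "\<And>e. e > 0 \<Longrightarrow> \<exists>d>0. \<forall>s\<in>{0..1}. \<forall>r\<in>{0..1}. \<bar>s - r\<bar> \<le> d \<longrightarrow> (\<forall>x. \<bar>f s x - f r x\<bar> \<le> e)"
  shows "F (\<lambda>x. integral {0..1} (\<lambda>s. f s x)) \<le> integral {0..1} (\<lambda>s. F (f s))"
proof -
  have L: "L \<ge> 0" using lip[of 0] lipschitz_on_nonneg by auto
  have Lipf: "Lip (f s)" if "s \<in> {0..1}" for s using lip[OF that] LipI by blast
  \<comment> \<open>Stated for any \<open>g\<close> that is nonexpansive in the uniform distance of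
    the slices, to cover both \<open>\<lambda>s. f s x\<close> and
    \<open>\<lambda>s. F (f s)\<close>.\<close>
  have cont: "continuous_on {0..1} g"
    if g: "\<And>s r e. s \<in> {0..1} \<Longrightarrow> r \<in> {0..1} \<Longrightarrow> (\<And>x. \<bar>f s x - f r x\<bar> \<le> e) \<Longrightarrow> \<bar>g s - g r\<bar> \<le> e"
    for g :: "real \<Rightarrow> real"
    unfolding continuous_on_iff
  proof (intro ballI allI impI)
    fix x e :: real assume "x \<in> {0..1}" "e > 0"
    then obtain d where d: "d > 0"
      "\<And>s r x. s \<in> {0..1} \<Longrightarrow> r \<in> {0..1} \<Longrightarrow> \<bar>s - r\<bar> \<le> d \<Longrightarrow> \<bar>f s x - f r x\<bar> \<le> e / 2"
      using equi[of "e / 2"] by (metis half_gt_zero)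
    have "dist (g y) (g x) < e" if "y \<in> {0..1}" "dist y x < d" for y
    proof -
      have "\<bar>g y - g x\<bar> \<le> e / 2"
        using that \<open>x \<in> {0..1}\<close> by (intro g d(2)) (auto simp: dist_real_def)
      then show ?thesis using \<open>e > 0\<close> by (simp add: dist_real_def)
    qed
    then show "\<exists>d>0. \<forall>x'\<in>{0..1}. dist x' x < d \<longrightarrow> dist (g x') (g x) < e"
      using d(1) by blast
  qed
  have cf: "continuous_on {0..1} (\<lambda>s. f s x)" for x by (rule cont) blast
  have cF: "continuous_on {0..1} (\<lambda>s. F (f s))" by (rule cont) (intro dist Lipf)
  have int: "(\<lambda>s. f s x) integrable_on {a..b}" "(\<lambda>s. F (f s)) integrable_on {a..b}"
    if "0 \<le> a" "b \<le> 1" for a b x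
    using that continuous_on_subset[OF cf, of "{a..b}"] continuous_on_subset[OF cF, of "{a..b}"]
    by (auto intro!: integrable_continuous_real)
  have Lint: "Lip (\<lambda>x. integral {a..b} (\<lambda>s. f s x))" if ab: "0 \<le> a" "a \<le> b" "b \<le> 1" for a b
  proof (rule LipI, rule lipschitz_realI)
    fix x y
    have "\<bar>integral {a..b} (\<lambda>s. f s x - f s y)\<bar> \<le> integral {a..b} (\<lambda>s. L * norm (x - y))"
      using ab lipschitz_realD[OF lip]
      by (intro integral_norm_bound_integral[where 'a = real, simplified] integrable_diff int) auto
    also have "\<dots> = (b - a) * (L * norm (x - y))" using ab by simp
    also have "\<dots> \<le> 1 * (L * norm (x - y))" using ab L by (intro mult_right_mono) auto
    finally show "\<bar>integral {a..b} (\<lambda>s. f s x) - integral {a..b} (\<lambda>s. f s y)\<bar> \<le> L * norm (x - y)"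
      using int ab by (simp add: integral_diff)
  qed (rule L)
  have "F (\<lambda>x. integral {0..1} (\<lambda>s. f s x)) \<le> integral {0..1} (\<lambda>s. F (f s)) + 2 * e" if e: "e > 0" for e
  proof -
    obtain d where d: "d > 0"
      and D: "\<And>s r x. s \<in> {0..1} \<Longrightarrow> r \<in> {0..1} \<Longrightarrow> \<bar>s - r\<bar> \<le> d \<Longrightarrow> \<bar>f s x - f r x\<bar> \<le> e"
      using equi[OF e] by blast
    obtain n :: nat where n: "n > 0" "1 / n < d"
      using d by (metis inverse_eq_divide reals_Archimedean zero_less_Suc)
    \<comment> \<open>Freezing \<open>f\<close> at the left end of a cell costs \<open>e\<close> per
      unit length twice: once to take the integral out of \<open>F\<close>, once to restore the
      integral outside.\<close>
    have "F (\<lambda>x. integral {0..k / n} (\<lambda>s. f s x)) \<le> integral {0..k / n} (\<lambda>s. F (f s)) + 2 * e * (k / n)"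
      if "k \<le> n" for k :: nat
      using that
    proof (induction k)
      case 0
      show ?case by (simp add: const)
    next
      case (Suc k)
      define a b where "a = k / n" and "b = Suc k / n"
      have ab: "0 \<le> a" "a \<le> b" "b \<le> 1" "b - a = 1 / n"
        using Suc.prems n by (auto simp: a_def b_def divide_simps)
      have ba: "b - a > 0" using ab n by simp
      have near: "\<bar>f s x - f a x\<bar> \<le> e" if "s \<in> {a..b}" for s x
        using that ab n by (intro D) auto
      have a: "a \<in> {0..1}" using ab by auto
      have "F (\<lambda>x. integral {a..b} (\<lambda>s. f s x)) \<le> F (\<lambda>x. (b - a) * f a x) + (b - a) * e"
      proof (rule le_add[OF Lint Lip_cmult[OF Lipf[OF a]]])
        fix x
        have "integral {a..b} (\<lambda>s. f s x) \<le> integral {a..b} (\<lambda>s. f a x + e)"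
        proof (rule Henstock_Kurzweil_Integration.integral_le)
          show "f s x \<le> f a x + e" if "s \<in> {a..b}" for s using near[OF that, of x] by linarith
        qed (use ab int in auto)
        then show "integral {a..b} (\<lambda>s. f s x) \<le> (b - a) * f a x + (b - a) * e"
          using ab by (simp add: algebra_simps)
      qed (use ab in auto)
      also have "F (\<lambda>x. (b - a) * f a x) = (b - a) * F (f a)"
        using ba by (intro homog Lipf a) auto
      also have "(b - a) * F (f a) \<le> integral {a..b} (\<lambda>s. F (f s)) + (b - a) * e"
      proof -
        have "integral {a..b} (\<lambda>s. F (f a) - e) \<le> integral {a..b} (\<lambda>s. F (f s))"
        proof (rule Henstock_Kurzweil_Integration.integral_le)
          show "F (f a) - e \<le> F (f s)" if "s \<in> {a..b}" for s
            using dist[OF Lipf Lipf near, of s] that ab a by (auto simp: abs_le_iff)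
        qed (use ab int in auto)
        then show ?thesis using ab by (simp add: algebra_simps)
      qed
      finally have step: "F (\<lambda>x. integral {a..b} (\<lambda>s. f s x)) \<le> integral {a..b} (\<lambda>s. F (f s)) + 2 * e * (b - a)"
        by (simp add: algebra_simps)
      have "F (\<lambda>x. integral {0..b} (\<lambda>s. f s x))
          = F (\<lambda>x. integral {0..a} (\<lambda>s. f s x) + integral {a..b} (\<lambda>s. f s x))"
        using ab int by (simp add: Henstock_Kurzweil_Integration.integral_combine)
      also have "\<dots> \<le> F (\<lambda>x. integral {0..a} (\<lambda>s. f s x)) + F (\<lambda>x. integral {a..b} (\<lambda>s. f s x))"
        using ab by (intro subadd Lint) auto
      also have "\<dots> \<le> integral {0..a} (\<lambda>s. F (f s)) + 2 * e * a
          + (integral {a..b} (\<lambda>s. F (f s)) + 2 * e * (b - a))"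
        using Suc step by (intro add_mono) (auto simp: a_def)
      also have "\<dots> = integral {0..b} (\<lambda>s. F (f s)) + 2 * e * b"
        using Henstock_Kurzweil_Integration.integral_combine[OF ab(1,2) int(2)] ab
        by (simp add: algebra_simps)
      finally show ?case by (simp only: b_def)
    qed
    from this[of n] n show ?thesis by simp
  qed
  note * = this
  show ?thesis
  proof (rule field_le_epsilon)
    fix e :: real assume "e > 0"
    then show "F (\<lambda>x. integral {0..1} (\<lambda>s. f s x)) \<le> integral {0..1} (\<lambda>s. F (f s)) + e"
      using *[of "e / 2"] by simp
  qed
qed

text \<open>Jensen's inequality for the translates of \<open>f\<close> along the segment; they are
  equicontinuous in the parameter because \<open>f\<close> is Lipschitz.\<close>

lemma conv_avg_le:
  assumes "Lip f"
  shows "conv F (avg v f) x \<le> avg v (conv F f) x"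
proof -
  obtain L where L: "L-lipschitz_on UNIV f" using assms by (auto simp: Lip_def)
  have L0: "L \<ge> 0" by (rule lipschitz_on_nonneg[OF L])
  let ?f = "\<lambda>s y. f ((x + s *\<^sub>R v) + y)"
  have "F (\<lambda>y. integral {0..1} (\<lambda>s. ?f s y)) \<le> integral {0..1} (\<lambda>s. F (?f s))"
  proof (rule integral_le[where L = L])
    show "L-lipschitz_on UNIV (?f s)" for s by (rule lipschitz_shift[OF L])
    fix e :: real assume e: "e > 0"
    define c where "c = L * norm v + 1"
    have c: "c > 0" using L0 by (simp add: c_def add_nonneg_pos)
    have "\<bar>?f s y - ?f r y\<bar> \<le> e" if "\<bar>s - r\<bar> \<le> e / c" for s r y
    proof -
      have "\<bar>?f s y - ?f r y\<bar> \<le> L * norm ((s - r) *\<^sub>R v)"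
        using lipschitz_realD[OF L, of "(x + s *\<^sub>R v) + y" "(x + r *\<^sub>R v) + y"] by (simp add: algebra_simps)
      also have "\<dots> = L * norm v * \<bar>s - r\<bar>" by simp
      also have "\<dots> \<le> c * (e / c)"
        using that c L0 by (intro mult_mono) (auto simp: c_def)
      finally show ?thesis using c by simp
    qed
    then show "\<exists>d>0. \<forall>s\<in>{0..1}. \<forall>r\<in>{0..1}. \<bar>s - r\<bar> \<le> d \<longrightarrow> (\<forall>y. \<bar>?f s y - ?f r y\<bar> \<le> e)"
      using e c by (intro exI[of _ "e / c"]) auto
  qed
  then show ?thesis by (simp add: conv_def avg_def algebra_simps)
qed

lemma conv_mol_le:
  assumes "Lip f"
  shows "conv F (mol vs f) x \<le> mol vs (conv F f) x"
proof (induction vs arbitrary: x)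
  case (Cons v vs)
  have m: "Lip (mol vs f)" by (intro averaging_Lip[OF averaging_mol] assms)
  have "conv F (avg v (mol vs f)) x \<le> avg v (conv F (mol vs f)) x"
    by (rule conv_avg_le[OF m])
  also have "\<dots> \<le> avg v (mol vs (conv F f)) x"
    by (intro avg_mono conv_Lip m averaging_Lip[OF averaging_mol] assms Cons)
  finally show ?case by simp
qed simp

end

context sublinear_functional begin

lemma conv_smooth_le:
  fixes f :: "'a \<Rightarrow> real"
  assumes "Lip f"
  shows "conv F (mol vs (mol us f)) x \<le> mol vs (mol us (conv F f)) x"
proof -
  have m: "Lip (mol us f)" by (intro averaging_Lip[OF averaging_mol] assms)
  have "conv F (mol vs (mol us f)) x \<le> mol vs (conv F (mol us f)) x"
    by (rule conv_mol_le[OF m])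
  also have "\<dots> \<le> mol vs (mol us (conv F f)) x"
    by (intro averaging_mono[OF averaging_mol] conv_mol_le conv_Lip m assms averaging_Lip[OF averaging_mol])
  finally show ?thesis .
qed

end

section \<open>Consistent one-step schemes and their comparison\<close>

lemma C21_shift:
  assumes "C21 K g p A"
  shows "C21 K (\<lambda>y. g (x + y)) (\<lambda>y. p (x + y)) (\<lambda>y. A (x + y))"
proof -
  have lip: "K-lipschitz_on UNIV (\<lambda>y. h (x + y))" if "K-lipschitz_on UNIV h"
    for h :: "real ^ 'a \<Rightarrow> 'b::metric_space"
    using lipschitz_onD[OF that] lipschitz_on_nonneg[OF that]
    by (intro lipschitz_onI) (auto intro!: order_trans[OF lipschitz_onD[OF that]])
  show ?thesis
    using assms unfolding C21_def by (auto intro!: lip simp: add.assoc[symmetric])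
qed

text \<open>
  \<open>has_generator F G\<close>: the one-step functionals \<open>F h\<close> are consistent, to order \<open>h\<^bsup>3/2\<^esup>\<close>, with
  \<open>\<partial>\<^sub>t u = G (D u, D\<^sup>2 u)\<close>, uniformly on classes of smooth functions.
\<close>

definition has_generator ::
  "(real \<Rightarrow> (real ^ 'd \<Rightarrow> real) \<Rightarrow> real) \<Rightarrow> (real ^ 'd \<Rightarrow> real ^ 'd ^ 'd \<Rightarrow> real) \<Rightarrow> bool" where
  "has_generator F G \<longleftrightarrow>
     (\<forall>K. \<exists>C. \<forall>g p A. C21 K g p A \<longrightarrow>
        (\<forall>h. 0 < h \<and> h \<le> 1 \<longrightarrow> \<bar>F h g - g 0 - h * G (p 0) (A 0)\<bar> \<le> C * h * sqrt h))"

lemma has_generatorD: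
  fixes F :: "real \<Rightarrow> (real ^ 'd \<Rightarrow> real) \<Rightarrow> real"
  assumes "has_generator F G"
  obtains C where "C \<ge> 0" "\<And>g p A h x. C21 K g p A \<Longrightarrow> 0 < h \<Longrightarrow> h \<le> 1 \<Longrightarrow>
      \<bar>conv (F h) g x - g x - h * G (p x) (A x)\<bar> \<le> C * h * sqrt h"
proof -
  obtain C where C: "\<And>g p A h. C21 K g p A \<Longrightarrow> 0 < h \<Longrightarrow> h \<le> 1 \<Longrightarrow>
      \<bar>F h g - g 0 - h * G (p 0) (A 0)\<bar> \<le> C * h * sqrt h"
    using assms unfolding has_generator_def by metis
  show ?thesis
  proof (rule that[of "\<bar>C\<bar>"])
    fix g :: "real ^ 'd \<Rightarrow> real" and p A h x assume g: "C21 K g p A" and h: "0 < h" "h \<le> (1::real)"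
    have "\<bar>conv (F h) g x - g x - h * G (p x) (A x)\<bar> \<le> C * h * sqrt h"
      using C[OF C21_shift[OF g, of x] h] by (simp add: conv_def)
    also have "\<dots> \<le> \<bar>C\<bar> * h * sqrt h"
      using h by (intro mult_right_mono) auto
    finally show "\<bar>conv (F h) g x - g x - h * G (p x) (A x)\<bar> \<le> \<bar>C\<bar> * h * sqrt h" .
  qed simp
qed

locale generated_family =
  fixes F :: "real \<Rightarrow> (real ^ 'd \<Rightarrow> real) \<Rightarrow> real" and G :: "real ^ 'd \<Rightarrow> real ^ 'd ^ 'd \<Rightarrow> real"
  assumes sublinear: "0 \<le> h \<Longrightarrow> sublinear_functional (F h)"
    and generator: "has_generator F G"
begin

lemma iterate_lipschitz:
  assumes "L-lipschitz_on UNIV f" "0 \<le> h"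
  shows "L-lipschitz_on UNIV ((conv (F h) ^^ n) f)"
  using assms by (induction n) (auto intro: sublinear_functional.conv_lipschitz[OF sublinear])

end

text \<open>
  Mollifying the iterates of \<open>F\<close> gives, by Jensen's inequality, a sequence \<open>g k\<close> of uniformly smooth
  functions with \<open>conv (F h) (g k) \<le> g (Suc k)\<close>. On smooth functions \<open>F h\<close> and \<open>F' h\<close> differ by
  \<open>O(h\<^bsup>3/2\<^esup>)\<close>, so the \<open>g k\<close> dominate the iterates of \<open>F'\<close> up to \<open>O(h\<^bsup>1/2\<^esup>)\<close>.
\<close>

lemma generated_families_one_sided:
  fixes F F' :: "real \<Rightarrow> (real ^ 'd \<Rightarrow> real) \<Rightarrow> real"
  assumes F: "generated_family F G" and F': "generated_family F' G" and e: "e > 0"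
  shows "\<exists>h0>0. \<forall>h n f x. 0 < h \<and> h \<le> h0 \<and> real n * h \<le> T \<and> L-lipschitz_on UNIV f \<longrightarrow>
           (conv (F' h) ^^ n) f x \<le> (conv (F h) ^^ n) f x + e"
proof (cases "L \<ge> 0")
  case False
  then have "\<not> L-lipschitz_on UNIV f" for f :: "real ^ 'd \<Rightarrow> real"
    using lipschitz_on_nonneg by blast
  then show ?thesis by (intro exI[of _ 1]) auto
next
  case L: True
  interpret F: generated_family F G by (rule F)
  interpret F': generated_family F' G by (rule F')
  define l where "l = real (length (dirs 0 :: (real ^ 'd) list))"
  \<comment> \<open>Makes one mollification move an \<open>L\<close>-Lipschitz function by at most
    \<open>e / 4\<close>; the summand 1 covers \<open>L * l = 0\<close>.\<close>
  define \<epsilon> where "\<epsilon> = e / (8 * (L * l + 1))"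
  have Ll: "L * l \<ge> 0" using L by (simp add: l_def)
  have \<epsilon>: "\<epsilon> > 0" using e Ll by (auto simp: \<epsilon>_def)
  have \<epsilon>e: "2 * L * \<epsilon> * l \<le> e / 4"
  proof -
    have "2 * L * \<epsilon> * l = e / 4 * (L * l / (L * l + 1))" using Ll by (simp add: \<epsilon>_def divide_simps)
    also have "\<dots> \<le> e / 4 * 1" using e Ll by (intro mult_left_mono) auto
    finally show ?thesis by simp
  qed
  obtain K where K: "\<And>f :: real ^ 'd \<Rightarrow> real. L-lipschitz_on UNIV f \<Longrightarrow>
      C21 K (smooth \<epsilon> f) (smooth_grad \<epsilon> f) (smooth_hess \<epsilon> f)"
    using smooth_C21[OF \<epsilon>, of L] by blast
  obtain C where C: "C \<ge> 0" "\<And>g p A h x. C21 K g p A \<Longrightarrow> 0 < h \<Longrightarrow> h \<le> 1 \<Longrightarrow>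
      \<bar>conv (F h) g x - g x - h * G (p x) (A x)\<bar> \<le> C * h * sqrt h"
    using has_generatorD[OF F.generator, of K] by blast
  obtain C' where C': "C' \<ge> 0" "\<And>g p A h x. C21 K g p A \<Longrightarrow> 0 < h \<Longrightarrow> h \<le> 1 \<Longrightarrow>
      \<bar>conv (F' h) g x - g x - h * G (p x) (A x)\<bar> \<le> C' * h * sqrt h"
    using has_generatorD[OF F'.generator, of K] by blast
  \<comment> \<open>At most \<open>T / h\<close> steps accumulate an error of
    \<open>D * sqrt h\<close>, and \<open>h0\<close> makes this at most \<open>e / 2\<close>; the
    summand 1 keeps \<open>D\<close> positive.\<close>
  define D where "D = (C + C') * \<bar>T\<bar> + 1"
  have D: "D > 0" using C C' by (simp add: D_def add_nonneg_pos)
  define h0 where "h0 = min 1 ((e / (2 * D))\<^sup>2)"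
  show ?thesis
  proof (intro exI[of _ h0] conjI allI impI)
    show "h0 > 0" using e D by (simp add: h0_def)
    fix h n f x
    assume asm: "0 < h \<and> h \<le> h0 \<and> real n * h \<le> T \<and> L-lipschitz_on UNIV (f :: real ^ 'd \<Rightarrow> real)"
    then have h: "0 < h" "h \<le> 1" and f: "L-lipschitz_on UNIV f" and nT: "real n * h \<le> T"
      by (auto simp: h0_def)
    have sq: "sqrt h \<le> e / (2 * D)"
    proof -
      have "sqrt h \<le> sqrt ((e / (2 * D))\<^sup>2)" using asm by (intro real_sqrt_le_mono) (auto simp: h0_def)
      then show ?thesis using e D by simp
    qed
    interpret Fh: sublinear_functional "F h" using F.sublinear h by simp
    interpret Fh': sublinear_functional "F' h" using F'.sublinear h by simp
    \<comment> \<open>The other scheme \<open>w\<close> starts from the mollified datum. The budget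
      \<open>e\<close> splits into \<open>e / 4\<close> for mollifying the datum,
      \<open>e / 2\<close> for the steps and \<open>e / 4\<close> for mollifying the final
      iterate.\<close>
    define u where "u k = (conv (F h) ^^ k) f" for k
    define g where "g k = smooth \<epsilon> (u k)" for k
    define w where "w k = (conv (F' h) ^^ k) (smooth \<epsilon> f)" for k
    have u: "L-lipschitz_on UNIV (u k)" for k
      unfolding u_def using F.iterate_lipschitz[OF f] h by simp
    have gl: "L-lipschitz_on UNIV (g k)" for k
      unfolding g_def by (intro averaging_lipschitz[OF averaging_smooth] u)
    have sf: "L-lipschitz_on UNIV (smooth \<epsilon> f)"
      by (intro averaging_lipschitz[OF averaging_smooth] f)
    have wl: "L-lipschitz_on UNIV (w k)" for k
      unfolding w_def using F'.iterate_lipschitz[OF sf] h by simp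
    have close: "\<bar>smooth \<epsilon> q x - q x\<bar> \<le> e / 4" if "L-lipschitz_on UNIV q" for q :: "real ^ 'd \<Rightarrow> real" and x
      by (rule order_trans[OF _ \<epsilon>e]) (use smooth_close[OF that, of \<epsilon> x] \<epsilon> in \<open>simp add: l_def\<close>)
    have step: "conv (F' h) (g k) x \<le> g (Suc k) x + (C + C') * h * sqrt h" for k x
    proof -
      have "conv (F' h) (g k) x \<le> conv (F h) (g k) x + (C + C') * h * sqrt h"
        using C(2)[OF K[OF u] h, of k x] C'(2)[OF K[OF u] h, of k x] unfolding g_def
        by (simp add: abs_le_iff algebra_simps)
      moreover have "conv (F h) (g k) x \<le> g (Suc k) x"
        using Fh.conv_smooth_le[OF LipI[OF u]] by (simp add: g_def u_def smooth_def)
      ultimately show ?thesis by linarith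
    qed
    have iter: "w k x \<le> g k x + real k * ((C + C') * h * sqrt h)" for k x
    proof (induction k arbitrary: x)
      case 0
      show ?case by (simp add: w_def g_def u_def)
    next
      case (Suc k)
      have "w (Suc k) x \<le> conv (F' h) (g k) x + real k * ((C + C') * h * sqrt h)"
        using Fh'.conv_le_add[OF LipI[OF wl[of k]] LipI[OF gl[of k]] Suc] by (simp add: w_def)
      then show ?case using step[of k x] by (simp add: algebra_simps)
    qed
    have err: "real n * ((C + C') * h * sqrt h) \<le> e / 2"
    proof -
      have "real n * ((C + C') * h * sqrt h) = (C + C') * (real n * h) * sqrt h" by simp
      also have "\<dots> \<le> (C + C') * \<bar>T\<bar> * sqrt h"
        using C C' nT h by (intro mult_right_mono mult_left_mono) auto
      also have "\<dots> \<le> D * (e / (2 * D))"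
        using sq D h e by (intro mult_mono) (auto simp: D_def)
      finally show ?thesis using D by simp
    qed
    have "(conv (F' h) ^^ n) f x \<le> w n x + e / 4"
    proof -
      have "(conv (F' h) ^^ k) f y \<le> w k y + e / 4" for k y
      proof (induction k arbitrary: y)
        case 0
        have "f y \<le> smooth \<epsilon> f y + e / 4" using close[OF f, of y] by linarith
        then show ?case by (simp add: w_def)
      next
        case (Suc k)
        have "L-lipschitz_on UNIV ((conv (F' h) ^^ k) f)"
          using F'.iterate_lipschitz[OF f] h by simp
        then show ?case
          using Fh'.conv_le_add[OF LipI LipI[OF wl[of k]] Suc] by (simp add: w_def)
      qed
      then show ?thesis .
    qed
    moreover have "g n x \<le> u n x + e / 4"
      using close[OF u, of n x] unfolding g_def by linarith
    ultimately show "(conv (F' h) ^^ n) f x \<le> (conv (F h) ^^ n) f x + e"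
      using iter[of n x] err by (simp add: u_def)
  qed
qed

text \<open>The hypotheses are symmetric in \<open>F\<close> and \<open>F'\<close>, so the one-sided
  estimate applies in both directions, each time mollifying the iterates of the dominating
  scheme.\<close>

theorem generated_families_agree:
  fixes F F' :: "real \<Rightarrow> (real ^ 'd \<Rightarrow> real) \<Rightarrow> real"
  assumes F: "generated_family F G" and F': "generated_family F' G" and f: "L-lipschitz_on UNIV f"
    and T: "T > 0"
  shows "(\<lambda>n. (conv (F' (T / n)) ^^ n) f x - (conv (F (T / n)) ^^ n) f x) \<longlonglongrightarrow> 0"
proof (rule LIMSEQ_I)
  fix r :: real assume r: "r > 0"
  then have e: "r / 2 > 0" by simp
  obtain h1 where h1: "h1 > 0" "\<And>h n f x. 0 < h \<Longrightarrow> h \<le> h1 \<Longrightarrow> real n * h \<le> T \<Longrightarrow> L-lipschitz_on UNIV f \<Longrightarrow>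
         (conv (F' h) ^^ n) f x \<le> (conv (F h) ^^ n) f x + r / 2"
    using generated_families_one_sided[OF F F' e, of T L] by blast
  obtain h2 where h2: "h2 > 0" "\<And>h n f x. 0 < h \<Longrightarrow> h \<le> h2 \<Longrightarrow> real n * h \<le> T \<Longrightarrow> L-lipschitz_on UNIV f \<Longrightarrow>
         (conv (F h) ^^ n) f x \<le> (conv (F' h) ^^ n) f x + r / 2"
    using generated_families_one_sided[OF F' F e, of T L] by blast
  obtain N :: nat where N: "N > 0" "T / min h1 h2 < N"
    by (metis reals_Archimedean2 gr0I not_less_zero of_nat_0 less_trans of_nat_less_iff zero_less_Suc lessI)
  have "norm ((conv (F' (T / n)) ^^ n) f x - (conv (F (T / n)) ^^ n) f x - 0) < r" if "n \<ge> N" for n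
  proof -
    have n: "n > 0" using that N by simp
    have "T / min h1 h2 < n" using N that by (simp add: less_le_trans)
    moreover have m: "min h1 h2 > 0" using h1(1) h2(1) by simp
    ultimately have "T / n < min h1 h2"
      using n T by (simp only: divide_less_eq mult.commute of_nat_0_less_iff if_True)
    then have "T / n \<le> h1" "T / n \<le> h2" by auto
    moreover have "T / n > 0" "real n * (T / n) \<le> T" using n T by auto
    ultimately show ?thesis
      using h1(2)[of "T / n" n f x] h2(2)[of "T / n" n f x] f r by (simp add: abs_less_iff)
  qed
  then show "\<exists>N. \<forall>n\<ge>N. norm ((conv (F' (T / n)) ^^ n) f x - (conv (F (T / n)) ^^ n) f x - 0) < r"
    by blast
qed

section \<open>Comparison with smooth strict supersolutions\<close>

text \<open>Squaring makes the positive part continuously differentiable at \<open>T\<close>, as a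
  time penalty inside a test function must be.\<close>

lemma DERIV_square_positive_part:
  "((\<lambda>s. N * (max 0 (s - T))\<^sup>2) has_real_derivative 2 * N * max 0 (t - T)) (at t)" for N T t :: real
proof -
  have "((\<lambda>s::real. (max 0 s)\<^sup>2) has_real_derivative 2 * max 0 r) (at r)" for r
  proof (cases "r = 0")
    case True
    have "((\<lambda>h. (max 0 h)\<^sup>2 / h) \<longlongrightarrow> 0) (at (0::real))"
    proof (rule Lim_null_comparison)
      show "\<forall>\<^sub>F h in at 0. norm ((max 0 h)\<^sup>2 / h) \<le> \<bar>h\<bar>" for h :: real
        unfolding eventually_at_filter by (auto simp: max_def power2_eq_square)
      show "(abs \<longlongrightarrow> 0) (at (0::real))" using tendsto_rabs_zero[OF tendsto_ident_at] .
    qed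
    then show ?thesis using True by (simp add: DERIV_def)
  next
    case False
    then consider "r > 0" | "r < 0" by linarith
    then show ?thesis
    proof cases
      case 1
      have "((\<lambda>s. s\<^sup>2) has_real_derivative 2 * r) (at r)" by (auto intro!: derivative_eq_intros)
      then have "((\<lambda>s. (max 0 s)\<^sup>2) has_real_derivative 2 * r) (at r)"
        by (rule has_field_derivative_transform_within_open[of _ _ _ "{0<..}"]) (use 1 in \<open>auto simp: max_def\<close>)
      then show ?thesis using 1 by (simp add: max_def)
    next
      case 2
      have "((\<lambda>s. 0) has_real_derivative 0) (at r)" by simp
      then have "((\<lambda>s. (max 0 s)\<^sup>2) has_real_derivative 0) (at r)"
        by (rule has_field_derivative_transform_within_open[of _ _ _ "{..<0}"]) (use 2 in \<open>auto simp: max_def\<close>)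
      then show ?thesis using 2 by (simp add: max_def)
    qed
  qed
  moreover have "((\<lambda>s. s - T) has_real_derivative 1) (at t)"
    by (auto intro!: derivative_eq_intros)
  ultimately have "((\<lambda>s. (max 0 (s - T))\<^sup>2) has_real_derivative 2 * max 0 (t - T) * 1) (at t)"
    by (rule DERIV_chain2[where f = "\<lambda>s. (max 0 s)\<^sup>2" and g = "\<lambda>s. s - T"])
  from DERIV_cmult[OF this, of N] show ?thesis by (simp add: mult_ac)
qed

lemma C12_test_add_time:
  assumes \<psi>: "C12_test \<psi> \<psi>t p A"
    and \<theta>: "\<And>t. t > 0 \<Longrightarrow> (\<theta> has_real_derivative \<theta>' t) (at t)" and c: "continuous_on {0<..} \<theta>'"
  shows "C12_test (\<lambda>t x. \<psi> t x + \<theta> t) (\<lambda>t x. \<psi>t t x + \<theta>' t) p A"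
proof -
  have "continuous_on ({0<..} \<times> UNIV) (\<lambda>z :: real \<times> (real ^ 'a). \<theta>' (fst z))"
    by (rule continuous_on_compose2[OF c]) (auto intro!: continuous_intros)
  then show ?thesis
    using \<psi> \<theta> unfolding C12_test_def
    by (auto intro!: derivative_eq_intros continuous_on_add simp: case_prod_unfold)
qed

text \<open>
  The penalty \<open>N * (max 0 (t - T))\<^sup>2\<close> keeps the maximum point away from the upper end of the time
  interval, where the test function has to be compared on both sides.
\<close>

lemma subsolution_le_strict_supersolution:
  fixes u :: "real \<Rightarrow> real ^ 'd \<Rightarrow> real"
  assumes sub: "viscosity_subsolution G u" and a: "0 \<le> a"
    and cu: "continuous_on ({0..} \<times> UNIV) (\<lambda>(t, x). u t x)"
    and growth: "\<And>t x. t \<in> {a..T + 1} \<Longrightarrow> u t x \<le> C - (norm x)\<^sup>2"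
    and test: "C12_test \<psi> \<psi>t p A"
    and cp: "continuous_on ({0..} \<times> UNIV) (\<lambda>(t, x). \<psi> t x)"
    and lower: "\<And>t x. t \<in> {a..T + 1} \<Longrightarrow> \<psi> t x \<ge> - C' * (1 + norm x)"
    and strict: "\<And>t x. t > a \<Longrightarrow> G (p t x) (A t x) < \<psi>t t x"
    and init: "\<And>x. u a x \<le> \<psi> a x"
    and t: "t \<in> {a..T}"
  shows "u t x \<le> \<psi> t x"
proof (rule ccontr)
  assume "\<not> u t x \<le> \<psi> t x"
  \<comment> \<open>The penalty equals \<open>N\<close> at time \<open>T + 1\<close>. This beats
    \<open>C - (norm y)\<^sup>2 + C' * (1 + norm y)\<close> for every \<open>y\<close>, because
    \<open>C' * norm y\<close> is at most \<open>C'\<^sup>2 + (norm y)\<^sup>2\<close>.\<close>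
  define N where "N = \<bar>C\<bar> + \<bar>C'\<bar> + C'\<^sup>2"
  define \<theta> where "\<theta> s = N * (max 0 (s - T))\<^sup>2" for s
  define w where "w s y = u s y - (\<psi> s y + \<theta> s)" for s y
  have N: "N \<ge> 0" by (simp add: N_def)
  have \<theta>0: "\<theta> s \<ge> 0" for s using N by (simp add: \<theta>_def)
  have wpos: "w t x > 0" using \<open>\<not> _\<close> t by (simp add: w_def \<theta>_def)
  have wle: "w s y \<le> C - (norm y)\<^sup>2 + C' * (1 + norm y) - \<theta> s" if "s \<in> {a..T + 1}" for s y
    using growth[OF that, of y] lower[OF that, of y] by (simp add: w_def)
  \<comment> \<open>Outside this ball the quadratic decay makes \<open>w\<close> negative, so a
    positive maximum over the ball is global; the summand \<open>norm x\<close> keeps the point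
    \<open>x\<close> inside.\<close>
  define R where "R = \<bar>C\<bar> + 2 * \<bar>C'\<bar> + 2 + norm x"
  have out: "w s y < 0" if s: "s \<in> {a..T + 1}" and y: "norm y > R" for s y
  proof -
    have 1: "norm y > 1" using y norm_ge_zero[of x] unfolding R_def by linarith
    have "R * norm y \<le> (norm y)\<^sup>2" using y by (simp add: power2_eq_square mult_right_mono)
    moreover have "(\<bar>C\<bar> + 2 * \<bar>C'\<bar> + 2) * norm y \<le> R * norm y"
      unfolding R_def by (intro mult_right_mono) auto
    moreover have "\<bar>C\<bar> * 1 \<le> \<bar>C\<bar> * norm y" "\<bar>C'\<bar> * 1 \<le> \<bar>C'\<bar> * norm y"
      using 1 by (simp_all only: mult_left_mono less_imp_le abs_ge_zero)
    moreover have "C' * (1 + norm y) \<le> \<bar>C'\<bar> * (1 + norm y)" by (intro mult_right_mono) auto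
    ultimately have "C - (norm y)\<^sup>2 + C' * (1 + norm y) < 0"
      using 1 by (simp add: algebra_simps)
    then show ?thesis using wle[OF s, of y] \<theta>0[of s] by linarith
  qed
  have top: "w (T + 1) y \<le> 0" for y
  proof -
    have "C' * norm y \<le> C'\<^sup>2 + (norm y)\<^sup>2"
    proof -
      have "2 * (C' * norm y) \<le> C'\<^sup>2 + (norm y)\<^sup>2"
        using sum_squares_bound[of C' "norm y"] by simp
      moreover have "0 \<le> C'\<^sup>2 + (norm y)\<^sup>2" by simp
      ultimately show ?thesis by linarith
    qed
    then have "C - (norm y)\<^sup>2 + C' * (1 + norm y) \<le> N"
      unfolding N_def by (simp add: algebra_simps abs_if)
    then show ?thesis using wle[of "T + 1" y] t by (simp add: \<theta>_def)
  qed
  have c\<theta>: "continuous_on ({0..} \<times> UNIV) (\<lambda>z :: real \<times> (real ^ 'd). \<theta> (fst z))"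
    unfolding \<theta>_def by (intro continuous_intros)
  have "continuous_on ({0..} \<times> UNIV) (\<lambda>z. w (fst z) (snd z))"
    unfolding w_def using cu cp c\<theta> by (intro continuous_intros) (simp_all add: case_prod_unfold)
  then have cw: "continuous_on ({a..T + 1} \<times> cball 0 R) (\<lambda>z. w (fst z) (snd z))"
    by (rule continuous_on_subset) (use a in auto)
  have xR: "norm x \<le> R" by (simp add: R_def)
  have "compact ({a..T + 1} \<times> cball (0 :: real ^ 'd) R)" by (intro compact_Times) auto
  moreover have mem: "(t, x) \<in> {a..T + 1} \<times> cball 0 R" using t xR by auto
  ultimately obtain z where z: "z \<in> {a..T + 1} \<times> cball 0 R"
    and zmax: "\<And>z'. z' \<in> {a..T + 1} \<times> cball 0 R \<Longrightarrow> w (fst z') (snd z') \<le> w (fst z) (snd z)"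
    using continuous_attains_sup[OF _ _ cw] by blast
  obtain s y where sy: "z = (s, y)" by (cases z)
  have pos: "w s y > 0" using zmax[OF mem] wpos sy by simp
  \<comment> \<open>Positivity of the maximum excludes the initial time by \<open>init\<close> and
    the final time by the penalty.\<close>
  have "w a y \<le> 0" using init[of y] \<theta>0[of a] by (simp add: w_def)
  then have "s \<noteq> a" "s \<noteq> T + 1" using pos top[of y] by auto
  then have s: "a < s" "s < T + 1" using z sy by auto
  let ?\<psi> = "\<lambda>t x. \<psi> t x + \<theta> t" and ?\<theta>' = "\<lambda>s. 2 * N * max 0 (s - T)"
  have test': "C12_test ?\<psi> (\<lambda>t x. \<psi>t t x + ?\<theta>' t) p A"
    using DERIV_square_positive_part unfolding \<theta>_def
    by (intro C12_test_add_time test) (auto intro!: continuous_intros)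
  have "\<forall>\<^sub>F (r, q) in nhds (s, y). u r q - ?\<psi> r q \<le> u s y - ?\<psi> s y"
  proof -
    have "open ({a<..<T + 1} \<times> (UNIV :: (real ^ 'd) set))" by (intro open_Times) auto
    then have "\<forall>\<^sub>F z in nhds (s, y). z \<in> {a<..<T + 1} \<times> UNIV"
      using s by (intro eventually_nhds_in_open) auto
    then show ?thesis
    proof eventually_elim
      case (elim z)
      obtain r q where z: "z = (r, q)" by (cases z)
      have r: "r \<in> {a..T + 1}" using elim z by auto
      have "w r q \<le> w s y"
      proof (cases "norm q \<le> R")
        case True
        then show ?thesis using zmax[of "(r, q)"] r sy by simp
      next
        case False
        then show ?thesis using out[OF r, of q] pos by simp
      qed
      then show ?case using z by (simp add: w_def)
    qed
  qed
  \<comment> \<open>The penalty has nonnegative time derivative, so it can only strengthen the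
    contradiction with strictness.\<close>
  then have "\<psi>t s y + ?\<theta>' s - G (p s y) (A s y) \<le> 0"
    using sub test' s(1) a unfolding viscosity_subsolution_def by (meson order_le_less_trans)
  moreover have "?\<theta>' s \<ge> 0" using N by simp
  ultimately show False using strict[OF s(1), of y] by linarith
qed


section \<open>Differentiability and continuity from Hoelder bounds\<close>

lemma DERIV_of_error_bound:
  fixes g :: "real \<Rightarrow> real"
  assumes "\<And>h. \<bar>h\<bar> \<le> 1 \<Longrightarrow> \<bar>g (t + h) - g t - h * D\<bar> \<le> C * (\<bar>h\<bar> * sqrt \<bar>h\<bar>)"
  shows "(g has_real_derivative D) (at t)"
proof -
  have "((\<lambda>h. (g (t + h) - g t) / h - D) \<longlongrightarrow> 0) (at 0)"
  proof (rule Lim_null_comparison)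
    have "norm ((g (t + h) - g t) / h - D) \<le> C * sqrt \<bar>h\<bar>" if "h \<noteq> 0" "\<bar>h\<bar> \<le> 1" for h
    proof -
      have "norm ((g (t + h) - g t) / h - D) = \<bar>g (t + h) - g t - h * D\<bar> / \<bar>h\<bar>"
      proof -
        have "(g (t + h) - g t) / h - D = (g (t + h) - g t - h * D) / h"
          using that(1) by (simp add: diff_divide_distrib)
        then show ?thesis by (simp only: real_norm_def abs_divide)
      qed
      also have "\<dots> \<le> C * (\<bar>h\<bar> * sqrt \<bar>h\<bar>) / \<bar>h\<bar>"
        by (intro divide_right_mono assms that) simp
      finally show ?thesis using that(1) by simp
    qed
    then show "\<forall>\<^sub>F h in at 0. norm ((g (t + h) - g t) / h - D) \<le> C * sqrt \<bar>h\<bar>"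
      unfolding eventually_at by (intro exI[of _ 1]) auto
    have "((\<lambda>h. C * sqrt \<bar>h\<bar>) \<longlongrightarrow> C * sqrt \<bar>0\<bar>) (at 0)"
      by (intro tendsto_intros)
    then show "((\<lambda>h. C * sqrt \<bar>h\<bar>) \<longlongrightarrow> 0) (at 0)" by simp
  qed
  then show ?thesis unfolding DERIV_def by (simp add: LIM_zero_iff)
qed

lemma continuous_on_Hoelder_Lipschitz:
  fixes q :: "real \<Rightarrow> 'a::real_normed_vector \<Rightarrow> real"
  assumes lip: "\<And>t. L-lipschitz_on UNIV (q t)"
    and hoel: "\<And>s t x. \<bar>s - t\<bar> \<le> 1 \<Longrightarrow> \<bar>q s x - q t x\<bar> \<le> C * sqrt \<bar>s - t\<bar>"
  shows "continuous_on S (\<lambda>z. q (fst z) (snd z))"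
proof -
  have "isCont (\<lambda>z. q (fst z) (snd z)) w" for w
    unfolding isCont_def
  proof (rule Lim_transform_within[where d = 1, OF _ zero_less_one])
    show "((\<lambda>z. q (fst z) (snd z)) \<longlongrightarrow> q (fst w) (snd w)) (at w)"
    proof (rule LIM_zero_cancel, rule Lim_null_comparison)
      have "norm (q (fst z) (snd z) - q (fst w) (snd w))
          \<le> L * norm (snd z - snd w) + C * sqrt \<bar>fst z - fst w\<bar>" if "dist z w < 1" for z
      proof -
        have "\<bar>fst z - fst w\<bar> \<le> 1"
          using dist_fst_le[of z w] that by (simp add: dist_real_def)
        from hoel[OF this, of "snd w"] lipschitz_realD[OF lip, of "fst z" "snd z" "snd w"]
        show ?thesis by simp
      qed
      then show "\<forall>\<^sub>F z in at w. norm (q (fst z) (snd z) - q (fst w) (snd w))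
          \<le> L * norm (snd z - snd w) + C * sqrt \<bar>fst z - fst w\<bar>"
        unfolding eventually_at by (intro exI[of _ 1]) auto
      have "((\<lambda>z. L * norm (snd z - snd w) + C * sqrt \<bar>fst z - fst w\<bar>) \<longlongrightarrow>
          L * norm (snd w - snd w) + C * sqrt \<bar>fst w - fst w\<bar>) (at w)"
        by (intro tendsto_intros)
      then show "((\<lambda>z. L * norm (snd z - snd w) + C * sqrt \<bar>fst z - fst w\<bar>) \<longlongrightarrow> 0) (at w)" by simp
    qed
  qed auto
  then show ?thesis by (simp add: continuous_at_imp_continuous_on)
qed

section \<open>Semigroups dominate viscosity subsolutions\<close>

text \<open>The assumption \<open>small\<close> is diffusive scaling. It yields Hoelder continuity
  of exponent 1/2 in time and, at \<open>h = 0\<close>, that \<open>F 0\<close> is evaluation at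
  0.\<close>

locale generated_semigroup = generated_family F G
  for F :: "real \<Rightarrow> (real ^ 'd \<Rightarrow> real) \<Rightarrow> real" and G +
  assumes semigroup: "0 \<le> s \<Longrightarrow> 0 \<le> t \<Longrightarrow> Lip f \<Longrightarrow> F (s + t) f = F s (conv (F t) f)"
    and small: "\<exists>\<kappa>. \<forall>h. 0 \<le> h \<and> h \<le> 1 \<longrightarrow> F h norm \<le> \<kappa> * sqrt h"
begin

definition \<kappa> :: real where "\<kappa> = (SOME \<kappa>. \<forall>h. 0 \<le> h \<and> h \<le> 1 \<longrightarrow> F h norm \<le> \<kappa> * sqrt h)"

lemma kappa: "0 \<le> h \<Longrightarrow> h \<le> 1 \<Longrightarrow> F h norm \<le> \<kappa> * sqrt h"
  using someI_ex[OF small] unfolding \<kappa>_def by blast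

lemma conv_close:
  assumes f: "L-lipschitz_on UNIV f" and h: "0 \<le> h" "h \<le> 1"
  shows "\<bar>conv (F h) f x - f x\<bar> \<le> L * \<kappa> * sqrt h"
proof -
  interpret Fh: sublinear_functional "F h" using sublinear h by simp
  have L: "L \<ge> 0" by (rule lipschitz_on_nonneg[OF f])
  have Ln: "Lip (\<lambda>y::real ^ 'd. L * norm y)" by (intro Lip_cmult LipI[OF lipschitz_norm])
  have nn: "F h (\<lambda>y. L * norm y) \<le> L * \<kappa> * sqrt h"
    using Fh.homog[OF LipI[OF lipschitz_norm] L] mult_left_mono[OF kappa[OF h] L] by (simp add: mult.assoc)
  have Lf: "Lip (\<lambda>y. f (x + y))" using LipI[OF f] by (rule Lip_shift)
  have le: "\<bar>f (x + y) - f x\<bar> \<le> L * norm y" for y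
    using lipschitz_realD[OF f, of "x + y" x] by simp
  have "f (x + y) \<le> L * norm y + f x" for y using le[of y] by linarith
  from Fh.le_add[OF Lf Ln this] nn have 1: "conv (F h) f x \<le> f x + L * \<kappa> * sqrt h"
    by (simp add: conv_def)
  have "F h (\<lambda>_. f x) \<le> F h (\<lambda>y. f (x + y) + L * norm y)"
  proof (intro Fh.mono Lip_add Lip_const Lf Ln)
    show "f x \<le> f (x + y) + L * norm y" for y using le[of y] by linarith
  qed
  also have "\<dots> \<le> F h (\<lambda>y. f (x + y)) + F h (\<lambda>y. L * norm y)" by (intro Fh.subadd Lf Ln)
  finally have "f x \<le> conv (F h) f x + L * \<kappa> * sqrt h"
    using nn by (simp add: conv_def Fh.const)
  with 1 show ?thesis by (simp add: abs_le_iff)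
qed

lemma conv_zero: "Lip f \<Longrightarrow> conv (F 0) f = f"
  using conv_close[of _ f 0] by (fastforce simp: Lip_def)

lemma conv_semigroup:
  assumes "0 \<le> s" "0 \<le> t" "Lip f"
  shows "conv (F (s + t)) f = conv (F s) (conv (F t) f)"
  using semigroup[OF assms(1,2) Lip_shift[OF assms(3)]]
  by (simp add: conv_def[abs_def] fun_eq_iff add.assoc)

lemma conv_power:
  assumes "0 \<le> h" "Lip f"
  shows "(conv (F h) ^^ n) f = conv (F (real n * h)) f"
proof (induction n)
  case 0
  show ?case by (simp add: conv_zero assms)
next
  case (Suc n)
  then show ?case using conv_semigroup[of h "real n * h" f] assms by (simp add: algebra_simps)
qed

text \<open>Freezing the semigroup at negative times lets time averages and two-sided time
  derivatives be treated without side conditions on \<open>t\<close>.\<close>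

definition P :: "real \<Rightarrow> (real ^ 'd \<Rightarrow> real) \<Rightarrow> real ^ 'd \<Rightarrow> real" where
  "P t f = conv (F (max 0 t)) f"

lemma P_lipschitz: "L-lipschitz_on UNIV f \<Longrightarrow> L-lipschitz_on UNIV (P t f)"
  unfolding P_def by (intro sublinear_functional.conv_lipschitz[OF sublinear]) auto

text \<open>By the semigroup law the later value is the earlier operator applied to a function
  uniformly close to \<open>f\<close>, and that operator is nonexpansive.\<close>

lemma P_Hoelder:
  assumes f: "L-lipschitz_on UNIV f" and st: "\<bar>s - t\<bar> \<le> 1"
  shows "\<bar>P s f x - P t f x\<bar> \<le> L * \<kappa> * sqrt \<bar>s - t\<bar>"
proof -
  have L: "L \<ge> 0" by (rule lipschitz_on_nonneg[OF f])
  have \<kappa>0: "\<kappa> \<ge> 0"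
  proof -
    interpret F1: sublinear_functional "F 1" using sublinear by simp
    have "F 1 (\<lambda>_. 0) \<le> F 1 norm"
      by (intro F1.mono Lip_const LipI[OF lipschitz_norm]) simp
    then show ?thesis using kappa[of 1] by (simp add: F1.const)
  qed
  have *: "\<bar>conv (F (a + h)) f x - conv (F a) f x\<bar> \<le> L * \<kappa> * sqrt h"
    if a: "0 \<le> a" and h: "0 \<le> h" "h \<le> 1" for a h
  proof -
    interpret Fa: sublinear_functional "F a" using sublinear a by simp
    interpret Fh: sublinear_functional "F h" using sublinear h by simp
    show ?thesis
      unfolding conv_semigroup[OF a h(1) LipI[OF f]]
      by (intro Fa.conv_dist conv_close[OF f h]) (auto intro: Fh.conv_Lip LipI[OF f])
  qed
  have **: "\<bar>P s f x - P t f x\<bar> \<le> L * \<kappa> * sqrt \<bar>s - t\<bar>" if "t \<le> s" "s - t \<le> 1" for s t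
  proof -
    have "\<bar>P s f x - P t f x\<bar> \<le> L * \<kappa> * sqrt (max 0 s - max 0 t)"
      using *[of "max 0 t" "max 0 s - max 0 t"] that by (simp add: P_def)
    also have "\<dots> \<le> L * \<kappa> * sqrt \<bar>s - t\<bar>"
      using L \<kappa>0 that by (intro mult_left_mono real_sqrt_le_mono) auto
    finally show ?thesis .
  qed
  show ?thesis
    using **[of t s] **[of s t] st by (cases "t \<le> s") (auto simp: abs_minus_commute)
qed

lemma P_continuous:
  assumes f: "L-lipschitz_on UNIV f"
  shows "continuous_on S (\<lambda>s. P (t + e * s) f x)"
proof -
  have "continuous_on UNIV (\<lambda>z. P (fst z) f (snd z))"
    by (rule continuous_on_Hoelder_Lipschitz[where q = "\<lambda>t. P t f", OF P_lipschitz[OF f] P_Hoelder[OF f]])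
  then have "continuous_on S (\<lambda>s. (\<lambda>z. P (fst z) f (snd z)) (t + e * s, x))"
    by (rule continuous_on_compose2) (auto intro!: continuous_intros)
  then show ?thesis by simp
qed

end

lemma continuous_on_averaging:
  fixes q :: "real \<Rightarrow> 'a::real_normed_vector \<Rightarrow> real"
  assumes T: "averaging T" and lip: "\<And>t. L-lipschitz_on UNIV (q t)"
    and hoel: "\<And>s t x. \<bar>s - t\<bar> \<le> 1 \<Longrightarrow> \<bar>q s x - q t x\<bar> \<le> C * sqrt \<bar>s - t\<bar>"
  shows "continuous_on S (\<lambda>(t, x). T (q t) x)"
  unfolding case_prod_unfold
  by (rule continuous_on_Hoelder_Lipschitz[where q = "\<lambda>t. T (q t)"])
    (rule averaging_lipschitz[OF T lip] averaging_dist[OF T LipI[OF lip] LipI[OF lip] hoel], assumption?)+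

section \<open>Mollification of the semigroup in time and space\<close>

context generated_semigroup
begin

text \<open>The average looks forward: for \<open>t \<ge> 0\<close> and \<epsilon> positive only
  nonnegative times occur, where the semigroup law holds.\<close>

definition tavg :: "real \<Rightarrow> (real ^ 'd \<Rightarrow> real) \<Rightarrow> real \<Rightarrow> real ^ 'd \<Rightarrow> real" where
  "tavg \<epsilon> f t x = integral {0..1} (\<lambda>s. P (t + \<epsilon> * s) f x)"

definition tavg_dot :: "real \<Rightarrow> (real ^ 'd \<Rightarrow> real) \<Rightarrow> real \<Rightarrow> real ^ 'd \<Rightarrow> real" where
  "tavg_dot \<epsilon> f t x = 1 / \<epsilon> * (P (t + \<epsilon>) f x - P t f x)"

context
  fixes f :: "real ^ 'd \<Rightarrow> real" and L \<epsilon> :: real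
  assumes f: "L-lipschitz_on UNIV f" and \<epsilon>: "0 < \<epsilon>" "\<epsilon> \<le> 1"
begin

lemma L_nonneg: "L \<ge> 0"
  by (rule lipschitz_on_nonneg[OF f])

lemma P_int: "(\<lambda>s. P (t + \<epsilon> * s) f x) integrable_on {0..1}"
  by (rule integrable_continuous_real[OF P_continuous[OF f]])

lemma tavg_bound:
  assumes "\<And>s. s \<in> {0..1} \<Longrightarrow> \<bar>P (t + \<epsilon> * s) f x - P (t' + \<epsilon> * s) f x'\<bar> \<le> c"
  shows "\<bar>tavg \<epsilon> f t x - tavg \<epsilon> f t' x'\<bar> \<le> c"
proof -
  have "\<bar>integral {0..1} (\<lambda>s. P (t + \<epsilon> * s) f x - P (t' + \<epsilon> * s) f x')\<bar> \<le> integral {0..1::real} (\<lambda>s. c)"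
    using assms by (intro integral_norm_bound_integral[where 'a = real, simplified] integrable_diff P_int) auto
  then show ?thesis unfolding tavg_def by (simp add: integral_diff P_int)
qed

lemma tavg_lipschitz: "L-lipschitz_on UNIV (tavg \<epsilon> f t)"
  using lipschitz_realD[OF P_lipschitz[OF f]] by (intro lipschitz_realI tavg_bound L_nonneg)

lemma tavg_Hoelder: "\<bar>s - t\<bar> \<le> 1 \<Longrightarrow> \<bar>tavg \<epsilon> f s x - tavg \<epsilon> f t x\<bar> \<le> L * \<kappa> * sqrt \<bar>s - t\<bar>"
  using P_Hoelder[OF f, of "s + \<epsilon> * r" "t + \<epsilon> * r" x for r] by (intro tavg_bound) simp

lemma tavg_close:
  shows "\<bar>tavg \<epsilon> f t x - P t f x\<bar> \<le> L * \<kappa> * sqrt \<epsilon>"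
proof -
  have L\<kappa>: "L * \<kappa> \<ge> 0"
    using order_trans[OF abs_ge_zero P_Hoelder[OF f, of 1 0 0]] by simp
  have b: "\<bar>P (t + \<epsilon> * s) f x - P t f x\<bar> \<le> L * \<kappa> * sqrt \<epsilon>" if s: "s \<in> {0..1}" for s
  proof -
    have es: "0 \<le> \<epsilon> * s" "\<epsilon> * s \<le> \<epsilon>" using s \<epsilon> by (auto simp: mult_left_le)
    then have "\<epsilon> * s \<le> 1" using \<epsilon> by linarith
    with es have "\<bar>P (t + \<epsilon> * s) f x - P t f x\<bar> \<le> L * \<kappa> * sqrt (\<epsilon> * s)"
      using P_Hoelder[OF f, of "t + \<epsilon> * s" t x] by simp
    also have "\<dots> \<le> L * \<kappa> * sqrt \<epsilon>"
      using es L\<kappa> by (intro mult_left_mono real_sqrt_le_mono)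
    finally show ?thesis .
  qed
  have "\<bar>integral {0..1} (\<lambda>s. P (t + \<epsilon> * s) f x - P t f x)\<bar> \<le> integral {0..1::real} (\<lambda>s. L * \<kappa> * sqrt \<epsilon>)"
    using b by (intro integral_norm_bound_integral[where 'a = real, simplified]
        integrable_diff P_int integrable_const_ivl) auto
  then show ?thesis
    unfolding tavg_def by (simp add: integral_diff P_int integrable_const_ivl)
qed

lemma tavg_dot_lipschitz: "(2 * L / \<epsilon>)-lipschitz_on UNIV (tavg_dot \<epsilon> f t)"
proof -
  have "(\<bar>1 / \<epsilon>\<bar> * (L + L))-lipschitz_on UNIV (tavg_dot \<epsilon> f t)"
    unfolding tavg_dot_def[abs_def]
    by (intro lipschitz_on_cmult_real lipschitz_on_diff P_lipschitz f)
  then show ?thesis using \<epsilon> by simp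
qed

lemma tavg_dot_Hoelder:
  assumes "\<bar>s - t\<bar> \<le> 1"
  shows "\<bar>tavg_dot \<epsilon> f s x - tavg_dot \<epsilon> f t x\<bar> \<le> 2 * L * \<kappa> / \<epsilon> * sqrt \<bar>s - t\<bar>"
proof -
  have "\<bar>tavg_dot \<epsilon> f s x - tavg_dot \<epsilon> f t x\<bar>
      = 1 / \<epsilon> * \<bar>(P (s + \<epsilon>) f x - P (t + \<epsilon>) f x) - (P s f x - P t f x)\<bar>"
    unfolding tavg_dot_def right_diff_distrib[symmetric] abs_mult using \<epsilon> by (simp add: algebra_simps)
  also have "\<dots> \<le> 1 / \<epsilon> * (2 * (L * \<kappa> * sqrt \<bar>s - t\<bar>))"
  proof (rule mult_left_mono)
    show "\<bar>(P (s + \<epsilon>) f x - P (t + \<epsilon>) f x) - (P s f x - P t f x)\<bar> \<le> 2 * (L * \<kappa> * sqrt \<bar>s - t\<bar>)"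
      using P_Hoelder[OF f, of "s + \<epsilon>" "t + \<epsilon>" x] P_Hoelder[OF f assms, of x] assms by simp
  qed (use \<epsilon> in simp)
  finally show ?thesis by simp
qed

text \<open>A time shift by \<open>h\<close> shifts the averaging parameter by
  \<open>h / \<epsilon>\<close>, so \<open>integral_shift_error\<close> applies; Hoelder continuity
  at the two ends gives the exponent 3/2.\<close>

lemma tavg_derivative:
  assumes h: "\<bar>h\<bar> \<le> 1"
  shows "\<bar>tavg \<epsilon> f (t + h) x - tavg \<epsilon> f t x - h * tavg_dot \<epsilon> f t x\<bar>
    \<le> 2 * L * \<kappa> / \<epsilon> * (\<bar>h\<bar> * sqrt \<bar>h\<bar>)"
proof -
  let ?g = "\<lambda>s. P (t + \<epsilon> * s) f x"
  have b: "\<bar>?g (a + s) - ?g a\<bar> \<le> L * \<kappa> * sqrt \<bar>h\<bar>" if "\<bar>s\<bar> \<le> \<bar>h / \<epsilon>\<bar>" for a s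
  proof -
    have L\<kappa>: "L * \<kappa> \<ge> 0"
      using order_trans[OF abs_ge_zero P_Hoelder[OF f, of 1 0 0]] by simp
    have es: "\<bar>\<epsilon> * s\<bar> \<le> \<bar>h\<bar>" using that \<epsilon> by (simp add: abs_mult abs_divide field_simps)
    have "\<bar>?g (a + s) - ?g a\<bar> \<le> L * \<kappa> * sqrt \<bar>\<epsilon> * s\<bar>"
      using P_Hoelder[OF f, of "t + \<epsilon> * (a + s)" "t + \<epsilon> * a" x] es h by (simp add: algebra_simps)
    also have "\<dots> \<le> L * \<kappa> * sqrt \<bar>h\<bar>"
      using es L\<kappa> by (intro mult_left_mono real_sqrt_le_mono)
    finally show ?thesis .
  qed
  have "\<bar>integral {0..1} (\<lambda>s. ?g (s + h / \<epsilon>)) - integral {0..1} ?g - h / \<epsilon> * (?g 1 - ?g 0)\<bar>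
      \<le> 2 * (L * \<kappa> * sqrt \<bar>h\<bar>) * \<bar>h / \<epsilon>\<bar>"
    using b[of _ 0] b[of _ 1] by (intro integral_shift_error P_continuous[OF f]) auto
  moreover have "integral {0..1} (\<lambda>s. ?g (s + h / \<epsilon>)) = tavg \<epsilon> f (t + h) x"
    unfolding tavg_def using \<epsilon> by (simp add: algebra_simps)
  moreover have "integral {0..1} ?g = tavg \<epsilon> f t x" by (simp add: tavg_def)
  moreover have "h / \<epsilon> * (?g 1 - ?g 0) = h * tavg_dot \<epsilon> f t x" by (simp add: tavg_dot_def)
  moreover have "2 * (L * \<kappa> * sqrt \<bar>h\<bar>) * \<bar>h / \<epsilon>\<bar> = 2 * L * \<kappa> / \<epsilon> * (\<bar>h\<bar> * sqrt \<bar>h\<bar>)"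
    using \<epsilon> by (simp add: abs_divide)
  ultimately show ?thesis by (simp only:)
qed

text \<open>Jensen's inequality in the time variable, followed by the semigroup law under the
  integral.\<close>

lemma conv_tavg_le:
  assumes h: "0 \<le> h" and t: "0 \<le> t"
  shows "conv (F h) (tavg \<epsilon> f t) x \<le> tavg \<epsilon> f (t + h) x"
proof -
  interpret Fh: sublinear_functional "F h" using sublinear h by simp
  have L\<kappa>: "L * \<kappa> \<ge> 0"
    using order_trans[OF abs_ge_zero P_Hoelder[OF f, of 1 0 0]] by simp
  let ?g = "\<lambda>s y. P (t + \<epsilon> * s) f (x + y)"
  have "F h (\<lambda>y. integral {0..1} (\<lambda>s. ?g s y)) \<le> integral {0..1} (\<lambda>s. F h (?g s))"
  proof (rule Fh.integral_le[where L = L])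
    show "L-lipschitz_on UNIV (?g s)" for s by (intro lipschitz_shift P_lipschitz f)
    fix e :: real assume e: "e > 0"
    \<comment> \<open>Inverts the Hoelder modulus,
      \<open>(L * \<kappa> + 1) * sqrt d \<le> e\<close>; the bound 1 stays in the range where that
      modulus is known.\<close>
    define d where "d = min 1 ((e / (L * \<kappa> + 1))\<^sup>2)"
    have d: "d > 0" using e L\<kappa> by (auto simp: d_def)
    have "\<bar>?g s y - ?g r y\<bar> \<le> e" if "\<bar>s - r\<bar> \<le> d" for s r y
    proof -
      have sr: "\<bar>\<epsilon> * s - \<epsilon> * r\<bar> \<le> d"
        using mult_mono[of \<epsilon> 1 "\<bar>s - r\<bar>" d] \<epsilon> that d
        by (simp add: right_diff_distrib[symmetric] abs_mult)
      then have "\<bar>?g s y - ?g r y\<bar> \<le> L * \<kappa> * sqrt \<bar>\<epsilon> * s - \<epsilon> * r\<bar>"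
        using P_Hoelder[OF f, of "t + \<epsilon> * s" "t + \<epsilon> * r" "x + y"] by (simp add: d_def)
      also have "\<dots> \<le> (L * \<kappa> + 1) * sqrt ((e / (L * \<kappa> + 1))\<^sup>2)"
        using sr L\<kappa> by (intro mult_mono real_sqrt_le_mono) (auto simp: d_def)
      also have "\<dots> = e" using e L\<kappa> by simp
      finally show ?thesis .
    qed
    then show "\<exists>d>0. \<forall>s\<in>{0..1}. \<forall>r\<in>{0..1}. \<bar>s - r\<bar> \<le> d \<longrightarrow> (\<forall>y. \<bar>?g s y - ?g r y\<bar> \<le> e)"
      using d by blast
  qed
  also have "integral {0..1} (\<lambda>s. F h (?g s)) = integral {0..1} (\<lambda>s. P (t + h + \<epsilon> * s) f x)"
  proof (rule Henstock_Kurzweil_Integration.integral_cong)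
    fix s :: real assume s: "s \<in> {0..1}"
    then have "0 \<le> t + \<epsilon> * s" using t \<epsilon> by simp
    then show "F h (?g s) = P (t + h + \<epsilon> * s) f x"
      using conv_semigroup[OF h, of "t + \<epsilon> * s" f] LipI[OF f] h
      by (simp add: P_def conv_def[of "F h"] fun_eq_iff algebra_simps max_def)
  qed
  finally show ?thesis by (simp add: conv_def tavg_def)
qed

text \<open>The time derivative passes through the spatial mollifier by linearity. The space
  derivatives are finite differences of \<open>tavg\<close>, so their continuity in time comes from
  that of \<open>tavg\<close>. The shift \<open>a\<close> moves the initial time.\<close>

lemma smooth_tavg_C12:
  "C12_test (\<lambda>t. smooth \<epsilon> (tavg \<epsilon> f (t - a))) (\<lambda>t. smooth \<epsilon> (tavg_dot \<epsilon> f (t - a)))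
     (\<lambda>t. smooth_grad \<epsilon> (tavg \<epsilon> f (t - a))) (\<lambda>t. smooth_hess \<epsilon> (tavg \<epsilon> f (t - a)))"
proof -
  obtain K where K: "\<And>u :: real ^ 'd \<Rightarrow> real. L-lipschitz_on UNIV u \<Longrightarrow>
      (\<forall>x z. \<bar>smooth \<epsilon> u (x + z) - smooth \<epsilon> u x - smooth_grad \<epsilon> u x \<bullet> z\<bar> \<le> K * (norm z)\<^sup>2) \<and>
      (\<forall>x z. norm (smooth_grad \<epsilon> u (x + z) - smooth_grad \<epsilon> u x - smooth_hess \<epsilon> u x *v z) \<le> K * (norm z)\<^sup>2)"
    using smooth_C21[OF \<epsilon>(1), of L] by blast
  note LV = LipI[OF tavg_lipschitz] and LD = LipI[OF tavg_dot_lipschitz]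
  have p1: "(2 * L / \<epsilon>)-lipschitz_on UNIV (partial \<epsilon> i (tavg \<epsilon> f (t - a)))" for i t
    by (rule partial_lipschitz[OF \<epsilon>(1) tavg_lipschitz])
  have h1: "\<bar>partial \<epsilon> i (tavg \<epsilon> f (s - a)) x - partial \<epsilon> i (tavg \<epsilon> f (t - a)) x\<bar> \<le> 2 * L * \<kappa> / \<epsilon> * sqrt \<bar>s - t\<bar>"
    if "\<bar>s - t\<bar> \<le> 1" for i s t x
    using partial_dist[OF \<epsilon>(1) LV LV tavg_Hoelder, of "s - a" "t - a" i x] that by (simp add: mult_ac)
  have p2: "(2 * (2 * L / \<epsilon>) / \<epsilon>)-lipschitz_on UNIV (partial \<epsilon> j (partial \<epsilon> i (tavg \<epsilon> f (t - a))))" for i j t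
    by (rule partial_lipschitz[OF \<epsilon>(1) p1])
  have h2: "\<bar>partial \<epsilon> j (partial \<epsilon> i (tavg \<epsilon> f (s - a))) x - partial \<epsilon> j (partial \<epsilon> i (tavg \<epsilon> f (t - a))) x\<bar>
      \<le> 2 * (2 * L * \<kappa> / \<epsilon>) / \<epsilon> * sqrt \<bar>s - t\<bar>" if "\<bar>s - t\<bar> \<le> 1" for i j s t x
    using partial_dist[OF \<epsilon>(1) LipI[OF p1] LipI[OF p1] h1[OF that], of j i x] by (simp add: mult_ac)
  show ?thesis
    unfolding C12_test_def
  proof (intro conjI allI impI)
    fix t :: real and x :: "real ^ 'd" assume "t > 0"
    have td: "\<bar>tavg \<epsilon> f (t + h - a) x - tavg \<epsilon> f (t - a) x - h * tavg_dot \<epsilon> f (t - a) x\<bar>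
        \<le> 2 * L * \<kappa> / \<epsilon> * (\<bar>h\<bar> * sqrt \<bar>h\<bar>)" if "\<bar>h\<bar> \<le> 1" for h x
      using tavg_derivative[OF that, of "t - a" x] by (simp add: diff_add_eq)
    show "((\<lambda>s. smooth \<epsilon> (tavg \<epsilon> f (s - a)) x) has_real_derivative smooth \<epsilon> (tavg_dot \<epsilon> f (t - a)) x) (at t)"
    proof (rule DERIV_of_error_bound)
      fix h :: real assume h: "\<bar>h\<bar> \<le> 1"
      let ?r = "\<lambda>x. tavg \<epsilon> f (t + h - a) x - tavg \<epsilon> f (t - a) x - h * tavg_dot \<epsilon> f (t - a) x"
      have "\<bar>smooth \<epsilon> ?r x\<bar> \<le> 2 * L * \<kappa> / \<epsilon> * (\<bar>h\<bar> * sqrt \<bar>h\<bar>)"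
        by (intro averaging_bound[OF averaging_smooth] Lip_diff Lip_cmult LV LD td h)
      moreover have "smooth \<epsilon> ?r x = smooth \<epsilon> (tavg \<epsilon> f (t + h - a)) x - smooth \<epsilon> (tavg \<epsilon> f (t - a)) x
          - h * smooth \<epsilon> (tavg_dot \<epsilon> f (t - a)) x"
        by (simp add: averaging_diff[OF averaging_smooth] averaging_cmult[OF averaging_smooth]
            LV LD Lip_diff Lip_cmult)
      ultimately show "\<bar>smooth \<epsilon> (tavg \<epsilon> f (t + h - a)) x - smooth \<epsilon> (tavg \<epsilon> f (t - a)) x
          - h * smooth \<epsilon> (tavg_dot \<epsilon> f (t - a)) x\<bar> \<le> 2 * L * \<kappa> / \<epsilon> * (\<bar>h\<bar> * sqrt \<bar>h\<bar>)"
        by simp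
    qed
    show "(smooth \<epsilon> (tavg \<epsilon> f (t - a)) has_derivative (\<lambda>h. smooth_grad \<epsilon> (tavg \<epsilon> f (t - a)) x \<bullet> h)) (at x)"
      by (rule has_derivative_quadratic_error[where C = K, OF bounded_linear_inner_right])
        (simp add: K[OF tavg_lipschitz])
    show "(smooth_grad \<epsilon> (tavg \<epsilon> f (t - a)) has_derivative (\<lambda>h. smooth_hess \<epsilon> (tavg \<epsilon> f (t - a)) x *v h)) (at x)"
      by (rule has_derivative_quadratic_error[where C = K, OF matrix_vector_mul_bounded_linear])
        (simp add: K[OF tavg_lipschitz])
  next
    show "continuous_on ({0<..} \<times> UNIV) (\<lambda>(t, x). smooth \<epsilon> (tavg_dot \<epsilon> f (t - a)) x)"
      by (rule continuous_on_averaging[OF averaging_smooth tavg_dot_lipschitz, where C = "2 * L * \<kappa> / \<epsilon>"])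
        (use tavg_dot_Hoelder[of "s - a" "t - a" for s t] in simp)
    show "continuous_on ({0<..} \<times> UNIV) (\<lambda>(t, x). smooth_grad \<epsilon> (tavg \<epsilon> f (t - a)) x)"
      using continuous_on_averaging[OF averaging_mol p1 h1]
      unfolding case_prod_unfold smooth_grad_def by (intro continuous_on_vec_lambda)
    show "continuous_on ({0<..} \<times> UNIV) (\<lambda>(t, x). smooth_hess \<epsilon> (tavg \<epsilon> f (t - a)) x)"
      using continuous_on_averaging[OF averaging_id p2 h2]
      unfolding case_prod_unfold smooth_hess_def by (intro continuous_on_vec_lambda)
  qed
qed

text \<open>Jensen's inequality in space and in time bounds one step from time \<open>t\<close> by
  the value at \<open>t + h\<close>. Expanding the step by the generator, dividing by
  \<open>h\<close> and letting \<open>h\<close> decrease to 0 gives the differential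
  inequality.\<close>

lemma smooth_tavg_supersolution:
  assumes t: "t > 0"
  shows "G (smooth_grad \<epsilon> (tavg \<epsilon> f t) x) (smooth_hess \<epsilon> (tavg \<epsilon> f t) x) \<le> smooth \<epsilon> (tavg_dot \<epsilon> f t) x"
proof -
  obtain K where K: "\<And>u :: real ^ 'd \<Rightarrow> real. L-lipschitz_on UNIV u \<Longrightarrow>
      C21 K (smooth \<epsilon> u) (smooth_grad \<epsilon> u) (smooth_hess \<epsilon> u)"
    using smooth_C21[OF \<epsilon>(1), of L] by blast
  obtain C where "C \<ge> 0" and C: "\<And>g p A h x. C21 K g p A \<Longrightarrow> 0 < h \<Longrightarrow> h \<le> 1 \<Longrightarrow>
      \<bar>conv (F h) g x - g x - h * G (p x) (A x)\<bar> \<le> C * h * sqrt h"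
    using has_generatorD[OF generator, of K] by blast
  let ?G = "G (smooth_grad \<epsilon> (tavg \<epsilon> f t) x) (smooth_hess \<epsilon> (tavg \<epsilon> f t) x)"
  let ?\<psi> = "\<lambda>t. smooth \<epsilon> (tavg \<epsilon> f t)"
  note LV = LipI[OF tavg_lipschitz]
  have le: "conv (F h) (?\<psi> t) x \<le> ?\<psi> (t + h) x" if "0 < h" for h
  proof -
    interpret Fh: sublinear_functional "F h" using sublinear that by simp
    have "conv (F h) (?\<psi> t) x \<le> smooth \<epsilon> (conv (F h) (tavg \<epsilon> f t)) x"
      unfolding smooth_def by (rule Fh.conv_smooth_le[OF LV])
    also have "\<dots> \<le> ?\<psi> (t + h) x"
      using t that by (intro averaging_mono[OF averaging_smooth] Fh.conv_Lip LV conv_tavg_le) auto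
    finally show ?thesis .
  qed
  have "?G \<le> (?\<psi> (t + h) x - ?\<psi> t x) / h + C * sqrt h" if h: "0 < h" "h \<le> 1" for h
  proof -
    have "h * ?G \<le> ?\<psi> (t + h) x - ?\<psi> t x + h * (C * sqrt h)"
      using C[OF K[OF tavg_lipschitz] h, of t x] le[OF h(1)] by (simp add: mult_ac)
    then show ?thesis using h by (simp add: field_simps)
  qed
  then have ev: "\<forall>\<^sub>F h in at_right 0. ?G \<le> (?\<psi> (t + h) x - ?\<psi> t x) / h + C * sqrt h"
    unfolding eventually_at_right_field by (intro exI[of _ 1]) auto
  have "((\<lambda>h. (?\<psi> (t + h) x - ?\<psi> t x) / h) \<longlongrightarrow> smooth \<epsilon> (tavg_dot \<epsilon> f t) x) (at 0)"
    using smooth_tavg_C12[of 0] t unfolding C12_test_def DERIV_def diff_0_right by blast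
  then have "((\<lambda>h. (?\<psi> (t + h) x - ?\<psi> t x) / h + C * sqrt h) \<longlongrightarrow> smooth \<epsilon> (tavg_dot \<epsilon> f t) x + C * sqrt 0) (at_right 0)"
    by (intro tendsto_intros) (simp add: filterlim_at_split)
  then show ?thesis
    using tendsto_lowerbound[OF _ ev] by simp
qed

end

text \<open>The mollified semigroup is raised by \<open>c \<epsilon>\<close> to start above
  \<open>f\<close> and by \<open>\<epsilon> * (s - a)\<close> to become a strict supersolution; both
  corrections vanish with \<epsilon>.\<close>

theorem subsolution_le:
  assumes sub: "viscosity_subsolution G u"
    and cu: "continuous_on ({0..} \<times> UNIV) (\<lambda>(t, x). u t x)"
    and growth: "\<And>s x. s \<in> {a..t + 1} \<Longrightarrow> u s x \<le> C - (norm x)\<^sup>2"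
    and f: "L-lipschitz_on UNIV f" and a: "0 \<le> a" and init: "\<And>x. u a x \<le> f x" and t: "a \<le> t"
  shows "u t x \<le> conv (F (t - a)) f x"
proof -
  have L: "L \<ge> 0" by (rule lipschitz_on_nonneg[OF f])
  define l where "l = real (length (dirs 0 :: (real ^ 'd) list))"
  \<comment> \<open>Error of the spatial mollification plus error of the time average.\<close>
  define c where "c \<epsilon> = 2 * L * \<epsilon> * l + L * \<kappa> * sqrt \<epsilon>" for \<epsilon>
  have main: "u t x \<le> conv (F (t - a)) f x + 2 * c \<epsilon> + \<epsilon> * (t - a)" if \<epsilon>: "0 < \<epsilon>" "\<epsilon> \<le> 1" for \<epsilon>
  proof -
    let ?V = "tavg \<epsilon> f"
    let ?\<psi> = "\<lambda>s y. smooth \<epsilon> (?V (s - a)) y + (\<epsilon> * (s - a) + c \<epsilon>)"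
    note Vl = tavg_lipschitz[OF f \<epsilon>]
    have close: "\<bar>smooth \<epsilon> (?V s) y - P s f y\<bar> \<le> c \<epsilon>" for s y
      using smooth_close[OF Vl, of \<epsilon> s y] tavg_close[OF f \<epsilon>, of s y] \<epsilon> by (simp add: c_def l_def)
    have c0: "c \<epsilon> \<ge> 0" using order_trans[OF abs_ge_zero close] .
    have cont: "continuous_on S (\<lambda>(s, y). smooth \<epsilon> (?V (s - a)) y)" for S
      by (rule continuous_on_averaging[OF averaging_smooth Vl, where C = "L * \<kappa>"])
        (use tavg_Hoelder[OF f \<epsilon>, of "s - a" "t - a" for s t] in simp)
    \<comment> \<open>A bound at the origin on a compact time interval, with the Lipschitz constant
      in space, gives the linear lower bound that the comparison requires.\<close>
    have "continuous_on {a..t + 1} (\<lambda>s. (\<lambda>(s, y). smooth \<epsilon> (?V (s - a)) y) (s, 0))"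
      by (rule continuous_on_compose2[OF cont[of UNIV]]) (auto intro!: continuous_intros)
    then have "bounded ((\<lambda>s. smooth \<epsilon> (?V (s - a)) 0) ` {a..t + 1})"
      by (intro compact_imp_bounded compact_continuous_image) auto
    then obtain B where B: "\<And>s. s \<in> {a..t + 1} \<Longrightarrow> \<bar>smooth \<epsilon> (?V (s - a)) 0\<bar> \<le> B"
      unfolding bounded_iff by (metis imageI real_norm_def)
    have "u t x \<le> ?\<psi> t x"
    proof (rule subsolution_le_strict_supersolution[OF sub a cu, where T = t and C = C and C' = "B + L"])
      show "C12_test ?\<psi> (\<lambda>s y. smooth \<epsilon> (tavg_dot \<epsilon> f (s - a)) y + \<epsilon>)
          (\<lambda>s. smooth_grad \<epsilon> (?V (s - a))) (\<lambda>s. smooth_hess \<epsilon> (?V (s - a)))"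
        by (rule C12_test_add_time[OF smooth_tavg_C12[OF f \<epsilon>]]) (auto intro!: derivative_eq_intros)
      show "continuous_on ({0..} \<times> UNIV) (\<lambda>(s, y). ?\<psi> s y)"
        using cont unfolding case_prod_unfold by (intro continuous_intros)
      show "u s y \<le> C - (norm y)\<^sup>2" if "s \<in> {a..t + 1}" for s y by (rule growth[OF that])
      show "- (B + L) * (1 + norm y) \<le> ?\<psi> s y" if s: "s \<in> {a..t + 1}" for s y
      proof -
        have "\<bar>smooth \<epsilon> (?V (s - a)) y - smooth \<epsilon> (?V (s - a)) 0\<bar> \<le> L * norm y"
          using lipschitz_realD[OF averaging_lipschitz[OF averaging_smooth Vl], of \<epsilon> "s - a" y 0] by simp
        moreover have "B \<ge> 0" using B[OF s] by linarith
        then have "(B + L) * (1 + norm y) \<ge> B + L * norm y" using L by (simp add: algebra_simps)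
        moreover have "\<epsilon> * (s - a) \<ge> 0" using \<epsilon> s by simp
        ultimately show ?thesis using B[OF s] c0 by (simp only: abs_le_iff mult_minus_left) linarith
      qed
      show "G (smooth_grad \<epsilon> (?V (s - a)) y) (smooth_hess \<epsilon> (?V (s - a)) y) < smooth \<epsilon> (tavg_dot \<epsilon> f (s - a)) y + \<epsilon>"
        if "s > a" for s y
        using smooth_tavg_supersolution[OF f \<epsilon>, of "s - a" y] that \<epsilon> by linarith
      show "u a y \<le> ?\<psi> a y" for y
        using init[of y] close[of 0 y] conv_zero[OF LipI[OF f]] by (simp add: P_def)
      show "t \<in> {a..t}" using t by simp
    qed
    then show ?thesis using close[of "t - a" x] t by (simp add: P_def)
  qed
  have ev: "\<forall>\<^sub>F \<epsilon> in at_right 0. u t x \<le> conv (F (t - a)) f x + 2 * c \<epsilon> + \<epsilon> * (t - a)"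
    unfolding eventually_at_right_field by (intro exI[of _ 1]) (use main in auto)
  have "((\<lambda>\<epsilon>. conv (F (t - a)) f x + 2 * c \<epsilon> + \<epsilon> * (t - a)) \<longlongrightarrow>
      conv (F (t - a)) f x + 2 * (2 * L * 0 * l + L * \<kappa> * sqrt 0) + 0 * (t - a)) (at_right 0)"
    unfolding c_def by (intro tendsto_intros)
  then show ?thesis
    using tendsto_lowerbound[OF _ ev] by simp
qed

end

section \<open>Quadratic forms bounded by the Frobenius norm\<close>

lemma norm_matrix_vector_mult_le: "norm (A *v z) \<le> norm A * norm z"
  for A :: "real ^ 'n ^ 'm"
proof -
  have "norm (A *v z) = L2_set (\<lambda>i. norm ((A *v z) $ i)) UNIV" by (simp add: norm_vec_def)
  also have "\<dots> \<le> L2_set (\<lambda>i. norm (A $ i) * norm z) UNIV"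
    by (intro L2_set_mono) (auto simp: matrix_vector_mul_component intro: Cauchy_Schwarz_ineq2)
  also have "\<dots> = norm A * norm z" by (simp add: L2_set_left_distrib[symmetric] norm_vec_def)
  finally show ?thesis .
qed

lemma quadratic_form_le:
  fixes A :: "real ^ 'n ^ 'n"
  shows "\<bar>(A *v z) \<bullet> w\<bar> \<le> norm A * norm z * norm w"
proof -
  have "\<bar>(A *v z) \<bullet> w\<bar> \<le> norm (A *v z) * norm w" by (rule Cauchy_Schwarz_ineq2)
  also have "\<dots> \<le> norm A * norm z * norm w"
    by (intro mult_right_mono norm_matrix_vector_mult_le) simp
  finally show ?thesis .
qed


section \<open>Gaussian semigroups\<close>

abbreviation (input) std_normal :: "real measure" where "std_normal \<equiv> std_normal_distribution"

interpretation N: prob_space std_normal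
  by (rule prob_space_normal_density) simp

interpretation NN: pair_prob_space std_normal std_normal ..

lemma prob_normal_UNIV: "N.prob UNIV = 1"
  using N.prob_space by simp

lemma integrable_normal_abs_power: "integrable std_normal (\<lambda>s. \<bar>s\<bar> ^ k)"
  using integrable_std_normal_moment_abs[of k] by (simp add: integrable_density)

lemma integrable_normal_bound:
  fixes g :: "real \<Rightarrow> real"
  assumes [measurable]: "g \<in> borel_measurable borel" and b: "\<And>s. \<bar>g s\<bar> \<le> A + B * \<bar>s\<bar>"
  shows "integrable std_normal g"
proof (rule Bochner_Integration.integrable_bound)
  show "integrable std_normal (\<lambda>s. A + B * \<bar>s\<bar>)"
    using integrable_normal_abs_power[of 1] by simp
  show "AE s in std_normal. norm (g s) \<le> norm (A + B * \<bar>s\<bar>)"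
    using b by (intro AE_I2) (auto intro: order_trans[OF _ abs_ge_self])
qed simp

lemma normal_moments:
  "(\<integral>s. s \<partial>std_normal) = 0" "integrable std_normal (\<lambda>s. s)"
  "(\<integral>s. s\<^sup>2 \<partial>std_normal) = 1" "integrable std_normal (\<lambda>s. s\<^sup>2)"
  using integral_std_normal_distribution_moment_odd[of 1] integrable_std_normal_distribution_moment[of 1]
    std_normal_distribution_even_moments[of 1]
  by simp_all

text \<open>Brownian motion along the line spanned by \<open>b\<close>. Composing such steps reaches
  every covariance using only the one-dimensional normal distribution, and \<open>b = 0\<close> is
  allowed.\<close>

definition gauss_step :: "'a::real_normed_vector \<Rightarrow> real \<Rightarrow> ('a \<Rightarrow> real) \<Rightarrow> 'a \<Rightarrow> real" where
  "gauss_step b t f x = (\<integral>s. f (x + (sqrt t * s) *\<^sub>R b) \<partial>std_normal)"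

lemma gauss_step_integrable:
  assumes "Lip f"
  shows "integrable std_normal (\<lambda>s. f (x + (c * s) *\<^sub>R b))"
proof -
  obtain L where L: "L-lipschitz_on UNIV f" using assms by (auto simp: Lip_def)
  show ?thesis
  proof (rule integrable_normal_bound)
    have "continuous_on UNIV (\<lambda>s. f (x + (c * s) *\<^sub>R b))"
      by (intro continuous_on_compose2[OF Lip_continuous[OF assms, of UNIV]] continuous_intros) auto
    then show "(\<lambda>s. f (x + (c * s) *\<^sub>R b)) \<in> borel_measurable borel"
      by (rule borel_measurable_continuous_onI)
    show "\<bar>f (x + (c * s) *\<^sub>R b)\<bar> \<le> \<bar>f x\<bar> + L * (\<bar>c\<bar> * norm b) * \<bar>s\<bar>" for s
      using lipschitz_realD[OF L, of "x + (c * s) *\<^sub>R b" x] by (simp add: abs_mult mult_ac)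
  qed
qed

lemma averaging_gauss_step: "averaging (gauss_step b t)"
  unfolding averaging_def gauss_step_def
  by (auto simp: fun_eq_iff gauss_step_integrable add.assoc prob_normal_UNIV intro!: integral_mono)

lemma gauss_step_close:
  assumes f: "L-lipschitz_on UNIV f" and t: "t \<ge> 0"
  shows "\<bar>gauss_step b t f x - f x\<bar> \<le> L * norm b * (\<integral>s. \<bar>s\<bar> \<partial>std_normal) * sqrt t"
proof -
  have "gauss_step b t f x - f x = (\<integral>s. f (x + (sqrt t * s) *\<^sub>R b) - f x \<partial>std_normal)"
    unfolding gauss_step_def using gauss_step_integrable[OF LipI[OF f]] prob_normal_UNIV by simp
  also have "\<bar>\<dots>\<bar> \<le> (\<integral>s. L * norm b * sqrt t * \<bar>s\<bar> \<partial>std_normal)"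
  proof (rule integral_abs_bound_integral)
    show "\<bar>f (x + (sqrt t * s) *\<^sub>R b) - f x\<bar> \<le> L * norm b * sqrt t * \<bar>s\<bar>" for s
      using lipschitz_realD[OF f, of "x + (sqrt t * s) *\<^sub>R b" x] t by (simp add: abs_mult mult_ac)
  qed (use gauss_step_integrable[OF LipI[OF f]] integrable_normal_abs_power[of 1] in auto)
  finally show ?thesis by (simp add: mult_ac)
qed

lemma pair_normal_integrable:
  fixes g :: "real \<times> real \<Rightarrow> real"
  assumes [measurable]: "g \<in> borel_measurable (borel \<Otimes>\<^sub>M borel)"
    and b: "\<And>u v. \<bar>g (u, v)\<bar> \<le> A + B * \<bar>u\<bar> + C * \<bar>v\<bar>"
  shows "integrable (std_normal \<Otimes>\<^sub>M std_normal) g"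
proof (rule Bochner_Integration.integrable_bound)
  have m: "integrable std_normal abs" using integrable_normal_abs_power[of 1] by simp
  have "integrable (std_normal \<Otimes>\<^sub>M std_normal) (\<lambda>z. \<bar>fst z\<bar>)"
    using NN.Fubini_integrable[of "\<lambda>z. \<bar>fst z\<bar>"] m by (simp add: prob_normal_UNIV)
  moreover have "integrable (std_normal \<Otimes>\<^sub>M std_normal) (\<lambda>z. \<bar>snd z\<bar>)"
    using NN.Fubini_integrable[of "\<lambda>z. \<bar>snd z\<bar>"] m by simp
  ultimately show "integrable (std_normal \<Otimes>\<^sub>M std_normal) (\<lambda>z. A + B * \<bar>fst z\<bar> + C * \<bar>snd z\<bar>)"
    by simp
  show "AE z in std_normal \<Otimes>\<^sub>M std_normal. norm (g z) \<le> norm (A + B * \<bar>fst z\<bar> + C * \<bar>snd z\<bar>)"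
    using b by (intro AE_I2) (auto intro: order_trans[OF _ abs_ge_self])
qed simp

lemma Lip_pair_normal_integrable:
  fixes f :: "'a::real_normed_vector \<Rightarrow> real"
  assumes "Lip f"
  shows "integrable (std_normal \<Otimes>\<^sub>M std_normal) (\<lambda>(u, v). f (x + (c * u) *\<^sub>R b + (d * v) *\<^sub>R e))"
proof -
  obtain L where L: "L-lipschitz_on UNIV f" using assms by (auto simp: Lip_def)
  have L0: "L \<ge> 0" by (rule lipschitz_on_nonneg[OF L])
  show ?thesis
  proof (rule pair_normal_integrable)
    have "continuous_on UNIV (\<lambda>z. f (x + (c * fst z) *\<^sub>R b + (d * snd z) *\<^sub>R e))"
      by (intro continuous_on_compose2[OF Lip_continuous[OF assms, of UNIV]] continuous_intros) auto
    then show "(\<lambda>(u, v). f (x + (c * u) *\<^sub>R b + (d * v) *\<^sub>R e)) \<in> borel_measurable (borel \<Otimes>\<^sub>M borel)"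
      unfolding borel_prod case_prod_unfold by (rule borel_measurable_continuous_onI)
    show "\<bar>case (u, v) of (u, v) \<Rightarrow> f (x + (c * u) *\<^sub>R b + (d * v) *\<^sub>R e)\<bar>
        \<le> \<bar>f x\<bar> + L * (\<bar>c\<bar> * norm b) * \<bar>u\<bar> + L * (\<bar>d\<bar> * norm e) * \<bar>v\<bar>" for u v
    proof -
      have "\<bar>f (x + (c * u) *\<^sub>R b + (d * v) *\<^sub>R e) - f x\<bar> \<le> L * norm ((c * u) *\<^sub>R b + (d * v) *\<^sub>R e)"
        using lipschitz_realD[OF L, of "x + (c * u) *\<^sub>R b + (d * v) *\<^sub>R e" x] by (simp add: add.assoc)
      also have "\<dots> \<le> L * (norm ((c * u) *\<^sub>R b) + norm ((d * v) *\<^sub>R e))"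
        by (intro mult_left_mono norm_triangle_ineq L0)
      also have "\<dots> = L * (\<bar>c\<bar> * norm b) * \<bar>u\<bar> + L * (\<bar>d\<bar> * norm e) * \<bar>v\<bar>"
        by (simp add: abs_mult algebra_simps)
      finally show ?thesis unfolding prod.case by linarith
    qed
  qed
qed

text \<open>Fubini's theorem: the two displacements are added in either order.\<close>

lemma gauss_step_commute:
  assumes "Lip f"
  shows "gauss_step b s (gauss_step c t f) = gauss_step c t (gauss_step b s f)"
proof
  fix x
  show "gauss_step b s (gauss_step c t f) x = gauss_step c t (gauss_step b s f) x"
    using NN.Fubini_integral[OF Lip_pair_normal_integrable[OF assms, of x "sqrt s" b "sqrt t" c]]
    by (simp add: gauss_step_def add_ac)
qed

lemma normal_scale_distr:
  assumes "\<sigma> > 0"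
  shows "distr std_normal borel (\<lambda>x. \<sigma> * x) = density lborel (normal_density 0 \<sigma>)"
proof -
  have "distributed std_normal lborel (\<lambda>x. x) std_normal_density"
    by (auto simp: distributed_def distr_id2)
  from N.normal_density_affine[OF this, of \<sigma> 0] assms
  have "distr std_normal lborel (\<lambda>x. \<sigma> * x) = density lborel (normal_density 0 \<sigma>)"
    by (simp add: distributed_def)
  then show ?thesis by (simp cong: distr_cong)
qed

lemma normal_scale:
  fixes h :: "real \<Rightarrow> real"
  assumes "\<sigma> > 0" and [measurable]: "h \<in> borel_measurable borel"
  shows "(\<integral>s. h (\<sigma> * s) \<partial>std_normal) = (\<integral>s. h s \<partial>density lborel (normal_density 0 \<sigma>))"
    and "integrable std_normal (\<lambda>s. h (\<sigma> * s)) \<longleftrightarrow> integrable (density lborel (normal_density 0 \<sigma>)) h"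
  unfolding normal_scale_distr[OF assms(1), symmetric]
  by (subst integral_distr integrable_distr_eq; simp)+

text \<open>Centered normal distributions convolve by adding variances. Time 0 is separated because
  a degenerate normal law has no density.\<close>

lemma gauss_step_semigroup:
  assumes f: "Lip f" and s: "0 \<le> s" and t: "0 \<le> t"
  shows "gauss_step b s (gauss_step b t f) = gauss_step b (s + t) f"
proof (cases "s = 0 \<or> t = 0")
  case True
  have "gauss_step b 0 g = g" for g by (simp add: gauss_step_def fun_eq_iff prob_normal_UNIV)
  then show ?thesis using True by auto
next
  case False
  then have st: "sqrt s > 0" "sqrt t > 0" using s t by auto
  let ?n = "\<lambda>\<sigma>. density lborel (normal_density 0 \<sigma>)"
  interpret S: prob_space "?n (sqrt s)" using st by (intro prob_space_normal_density)
  interpret T: prob_space "?n (sqrt t)" using st by (intro prob_space_normal_density)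
  interpret ST: pair_prob_space "?n (sqrt s)" "?n (sqrt t)" ..
  have conv: "?n (sqrt s) \<star> ?n (sqrt t) = ?n (sqrt (s + t))"
    using conv_normal_density_zero_mean[OF st] s t
    by (subst convolution_density) (auto simp: ennreal_mult' S.finite_measure_axioms T.finite_measure_axioms)
  show ?thesis
  proof
    fix x
    define h where "h w = f (x + w *\<^sub>R b)" for w
    have h: "Lip h"
    proof -
      obtain L where L: "L-lipschitz_on UNIV f" using f by (auto simp: Lip_def)
      have "\<bar>h u - h v\<bar> \<le> (L * norm b) * norm (u - v)" for u v
        using lipschitz_realD[OF L, of "x + u *\<^sub>R b" "x + v *\<^sub>R b"]
        by (simp add: h_def scaleR_left_diff_distrib[symmetric] mult_ac)
      then show ?thesis using lipschitz_on_nonneg[OF L] by (intro LipI[where L = "L * norm b"] lipschitz_realI) auto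
    qed
    have hm[measurable]: "h \<in> borel_measurable borel"
      using Lip_continuous[OF h] by (rule borel_measurable_continuous_onI)
    have "gauss_step b (s + t) f x = (\<integral>w. h w \<partial>?n (sqrt (s + t)))"
      using normal_scale[of "sqrt (s + t)" h] s t st by (simp add: gauss_step_def h_def)
    also have "\<dots> = (\<integral>z. h (fst z + snd z) \<partial>(?n (sqrt s) \<Otimes>\<^sub>M ?n (sqrt t)))"
      unfolding conv[symmetric] convolution_def
      by (subst integral_distr) (auto simp: case_prod_unfold)
    also have "\<dots> = (\<integral>u. \<integral>v. h (u + v) \<partial>?n (sqrt t) \<partial>?n (sqrt s))"
    proof -
      have "integrable std_normal (\<lambda>w. h (sqrt (s + t) * w))"
        using gauss_step_integrable[OF f, of x "sqrt (s + t)" b] by (simp add: h_def)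
      then have "integrable (?n (sqrt (s + t))) h"
        using normal_scale(2)[of "sqrt (s + t)" h] s t st by simp
      then have "integrable (?n (sqrt s) \<Otimes>\<^sub>M ?n (sqrt t)) (\<lambda>z. h (fst z + snd z))"
        unfolding conv[symmetric] convolution_def
        by (subst (asm) integrable_distr_eq) (auto simp: case_prod_unfold)
      from ST.integral_fst'[OF this] show ?thesis by simp
    qed
    also have "\<dots> = (\<integral>u. gauss_step b t f (x + u *\<^sub>R b) \<partial>?n (sqrt s))"
    proof (rule Bochner_Integration.integral_cong)
      fix u
      have "(\<lambda>v. h (u + v)) \<in> borel_measurable borel" by measurable
      from normal_scale(1)[OF st(2) this]
      show "(\<integral>v. h (u + v) \<partial>?n (sqrt t)) = gauss_step b t f (x + u *\<^sub>R b)"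
        by (simp add: gauss_step_def h_def scaleR_left_distrib add.assoc)
    qed simp
    also have "\<dots> = gauss_step b s (gauss_step b t f) x"
    proof -
      have "continuous_on UNIV (\<lambda>u. gauss_step b t f (x + u *\<^sub>R b))"
        by (intro continuous_on_compose2[OF Lip_continuous[OF averaging_Lip[OF averaging_gauss_step f], of UNIV]]
            continuous_intros) auto
      then have "(\<lambda>u. gauss_step b t f (x + u *\<^sub>R b)) \<in> borel_measurable borel"
        by (rule borel_measurable_continuous_onI)
      from normal_scale(1)[OF st(1) this] show ?thesis
        by (simp add: gauss_step_def[of b s])
    qed
    finally show "gauss_step b s (gauss_step b t f) x = gauss_step b (s + t) f x" by simp
  qed
qed

text \<open>The first-order Taylor term has mean 0, the second-order one has second moment 1, and
  the cubic remainder leaves the third absolute moment times \<open>t * sqrt t\<close>.\<close>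

lemma gauss_step_expansion:
  fixes g :: "real ^ 'd \<Rightarrow> real"
  assumes g: "C21 K g p A" and t: "t > 0"
  shows "\<bar>gauss_step b t g x - g x - t * ((A x *v b) \<bullet> b / 2)\<bar>
    \<le> K * norm b ^ 3 * (\<integral>s. \<bar>s\<bar> ^ 3 \<partial>std_normal) * (t * sqrt t)"
proof -
  let ?e = "\<lambda>s. g (x + (sqrt t * s) *\<^sub>R b) - g x - (sqrt t * s) * (p x \<bullet> b) - (t * s\<^sup>2) * ((A x *v b) \<bullet> b / 2)"
  have Lg: "Lip g" using g LipI unfolding C21_def by blast
  have ig: "integrable std_normal (\<lambda>s. g (x + (sqrt t * s) *\<^sub>R b))"
    by (rule gauss_step_integrable[OF Lg])
  have "(\<integral>s. ?e s \<partial>std_normal) = gauss_step b t g x - g x - t * ((A x *v b) \<bullet> b / 2)"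
    unfolding gauss_step_def using ig normal_moments prob_normal_UNIV by (simp del: divide_const_simps)
  moreover have "\<bar>\<integral>s. ?e s \<partial>std_normal\<bar> \<le> (\<integral>s. K * norm b ^ 3 * (t * sqrt t) * \<bar>s\<bar> ^ 3 \<partial>std_normal)"
  proof (rule integral_abs_bound_integral)
    show "integrable std_normal ?e"
      using ig normal_moments by (intro Bochner_Integration.integrable_diff) auto
    show "integrable std_normal (\<lambda>s. K * norm b ^ 3 * (t * sqrt t) * \<bar>s\<bar> ^ 3)"
      using integrable_normal_abs_power[of 3] by simp
    fix s
    have "\<bar>?e s\<bar> \<le> K * norm ((sqrt t * s) *\<^sub>R b) ^ 3"
    proof -
      have "\<bar>g (x + z) - g x - p x \<bullet> z - (A x *v z) \<bullet> z / 2\<bar> \<le> K * norm z ^ 3" for z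
        using g unfolding C21_def by blast
      note this[of "(sqrt t * s) *\<^sub>R b"]
      moreover have "(A x *v (c *\<^sub>R b)) \<bullet> (c *\<^sub>R b) / 2 = (c * c) * ((A x *v b) \<bullet> b / 2)" for c
        by (simp add: matrix_vector_mult_scaleR)
      moreover have "(sqrt t * s) * (sqrt t * s) = t * s\<^sup>2"
      proof -
        have "(sqrt t * s) * (sqrt t * s) = (sqrt t * sqrt t) * (s * s)" by (simp only: mult_ac)
        then show ?thesis using t by (simp add: power2_eq_square)
      qed
      ultimately show ?thesis by (simp only: inner_scaleR_right)
    qed
    also have "\<dots> = K * norm b ^ 3 * (t * sqrt t) * \<bar>s\<bar> ^ 3"
    proof -
      have "norm ((sqrt t * s) *\<^sub>R b) = norm b * (sqrt t * \<bar>s\<bar>)" using t by (simp add: abs_mult)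
      moreover have "sqrt t ^ 3 = t * sqrt t" using t by (simp add: eval_nat_numeral)
      ultimately show ?thesis by (simp only: power_mult_distrib mult.assoc)
    qed
    finally show "\<bar>?e s\<bar> \<le> K * norm b ^ 3 * (t * sqrt t) * \<bar>s\<bar> ^ 3" .
  qed
  ultimately show ?thesis by (simp add: mult_ac)
qed


text \<open>Transition operator of the process with drift \<open>\<mu>\<close> driven by independent
  Brownian motions along the directions in the list; \<open>gauss_gen\<close> is its generator, with
  covariance the sum of the rank-one matrices of these directions.\<close>

fun gauss :: "real ^ 'd \<Rightarrow> (real ^ 'd) list \<Rightarrow> real \<Rightarrow> (real ^ 'd \<Rightarrow> real) \<Rightarrow> real ^ 'd \<Rightarrow> real" where
  "gauss \<mu> [] t f = (\<lambda>x. f (t *\<^sub>R \<mu> + x))"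
| "gauss \<mu> (b # bs) t f = gauss_step b t (gauss \<mu> bs t f)"

fun gauss_gen :: "real ^ 'd \<Rightarrow> (real ^ 'd) list \<Rightarrow> real ^ 'd \<Rightarrow> real ^ 'd ^ 'd \<Rightarrow> real" where
  "gauss_gen \<mu> [] p A = p \<bullet> \<mu>"
| "gauss_gen \<mu> (b # bs) p A = (A *v b) \<bullet> b / 2 + gauss_gen \<mu> bs p A"

lemma averaging_translation: "averaging (\<lambda>f x. f (v + x))"
  unfolding averaging_def by (auto simp: fun_eq_iff algebra_simps)

lemma averaging_gauss: "averaging (gauss \<mu> bs t)"
proof (induction bs)
  case Nil
  show ?case using averaging_translation by simp
next
  case (Cons b bs)
  show ?case using averaging_compose[OF averaging_gauss_step Cons] by simp
qed

lemma gauss_step_gauss_commute: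
  "Lip f \<Longrightarrow> gauss_step b s (gauss \<mu> bs t f) = gauss \<mu> bs t (gauss_step b s f)"
proof (induction bs)
  case Nil
  then show ?case by (simp add: averaging_shift[OF averaging_gauss_step])
next
  case (Cons c bs)
  then show ?case
    by (simp add: gauss_step_commute[of _ b s c] averaging_Lip[OF averaging_gauss])
qed

text \<open>All factors commute, so those of the two times can be grouped by direction and merged
  one direction at a time.\<close>

lemma gauss_semigroup:
  assumes "Lip f" "0 \<le> s" "0 \<le> t"
  shows "gauss \<mu> bs s (gauss \<mu> bs t f) = gauss \<mu> bs (s + t) f"
proof (induction bs)
  case Nil
  show ?case by (simp add: fun_eq_iff algebra_simps)
next
  case (Cons b bs)
  note [simp] = averaging_Lip[OF averaging_gauss] averaging_Lip[OF averaging_gauss_step] assms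
  have "gauss \<mu> (b # bs) s (gauss \<mu> (b # bs) t f)
      = gauss_step b s (gauss_step b t (gauss \<mu> bs s (gauss \<mu> bs t f)))"
    by (simp add: gauss_step_gauss_commute[symmetric])
  then show ?case by (simp add: Cons gauss_step_semigroup)
qed

lemma gauss_close:
  assumes f: "L-lipschitz_on UNIV f" and t: "0 \<le> t"
  shows "\<bar>gauss \<mu> bs t f x - f x\<bar>
    \<le> L * (t * norm \<mu> + sqrt t * ((\<integral>s. \<bar>s\<bar> \<partial>std_normal) * sum_list (map norm bs)))"
proof (induction bs arbitrary: x)
  case Nil
  show ?case using lipschitz_realD[OF f, of "t *\<^sub>R \<mu> + x" x] t by simp
next
  case (Cons b bs)
  show ?case
    using gauss_step_close[OF averaging_lipschitz[OF averaging_gauss f] t, of b \<mu> bs t x] Cons[of x]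
    by (simp add: algebra_simps)
qed

text \<open>The generator applied to a \<open>C21\<close> function is itself Lipschitz, so a further
  Gaussian step of time \<open>h\<close> moves it only by a multiple of \<open>sqrt h\<close>. The
  constant depends on the directions only through their number and size.\<close>

lemma gauss_gen_lipschitz:
  fixes K R :: real
  assumes g: "C21 K g p A" and \<mu>: "norm \<mu> \<le> R" and bs: "\<forall>b\<in>set bs. norm b \<le> R"
  shows "(K * R + length bs * (K * R\<^sup>2))-lipschitz_on UNIV (\<lambda>x. gauss_gen \<mu> bs (p x) (A x))"
  using bs
proof (induction bs)
  case Nil
  have "\<bar>p x \<bullet> \<mu> - p y \<bullet> \<mu>\<bar> \<le> K * R * norm (x - y)" for x y
  proof -
    have "\<bar>p x \<bullet> \<mu> - p y \<bullet> \<mu>\<bar> \<le> norm (p x - p y) * norm \<mu>"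
      using Cauchy_Schwarz_ineq2[of "p x - p y" \<mu>] by (simp add: inner_diff_left)
    also have "\<dots> \<le> (K * norm (x - y)) * R"
      using g \<mu> lipschitz_on_normD[of K UNIV p x y] lipschitz_on_nonneg[of K UNIV p]
      unfolding C21_def by (intro mult_mono) auto
    finally show ?thesis by (simp add: mult_ac)
  qed
  moreover have "K * R \<ge> 0"
    using g \<mu> lipschitz_on_nonneg[of K UNIV p] order_trans[OF norm_ge_zero \<mu>] unfolding C21_def by auto
  ultimately show ?case by (auto intro!: lipschitz_realI)
next
  case (Cons b bs)
  have b: "norm b \<le> R" using Cons.prems by simp
  have "\<bar>(A x *v b) \<bullet> b / 2 - (A y *v b) \<bullet> b / 2\<bar> \<le> K * R\<^sup>2 * norm (x - y)" for x y
  proof -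
    have "\<bar>(A x *v b) \<bullet> b / 2 - (A y *v b) \<bullet> b / 2\<bar> = \<bar>((A x - A y) *v b) \<bullet> b\<bar> / 2"
      by (simp add: matrix_vector_mult_diff_rdistrib inner_diff_left diff_divide_distrib[symmetric] abs_divide)
    also have "\<dots> \<le> \<bar>((A x - A y) *v b) \<bullet> b\<bar>" by simp
    also have "\<dots> \<le> norm (A x - A y) * norm b * norm b" by (rule quadratic_form_le)
    also have "\<dots> \<le> (K * norm (x - y)) * R * R"
      using g b lipschitz_on_normD[of K UNIV A x y] lipschitz_on_nonneg[of K UNIV p] order_trans[OF norm_ge_zero b]
      unfolding C21_def by (intro mult_mono) auto
    finally show ?thesis by (simp add: power2_eq_square mult_ac)
  qed
  moreover have "K * R\<^sup>2 \<ge> 0"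
    using g lipschitz_on_nonneg[of K UNIV p] unfolding C21_def by auto
  ultimately have "(K * R\<^sup>2)-lipschitz_on UNIV (\<lambda>x. (A x *v b) \<bullet> b / 2)"
    by (intro lipschitz_realI)
  from lipschitz_on_add[OF this Cons.IH] Cons.prems show ?case
    by (simp add: algebra_simps)
qed

lemma C21_bounds:
  assumes "C21 K g p A"
  shows "K \<ge> 0" "norm (A x) \<le> K" "\<bar>g (x + z) - g x - p x \<bullet> z - (A x *v z) \<bullet> z / 2\<bar> \<le> K * norm z ^ 3"
  using assms lipschitz_on_nonneg[of K UNIV g] unfolding C21_def by auto

lemma C21_Lip: "C21 K g p A \<Longrightarrow> Lip g"
  unfolding C21_def using LipI by blast

lemma sqrt_bounds:
  assumes "0 \<le> h" "h \<le> (1::real)"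
  shows "h \<le> sqrt h" "h\<^sup>2 \<le> h * sqrt h" "h ^ 3 \<le> h * sqrt h"
proof -
  have "sqrt h * sqrt h \<le> sqrt h * 1" using assms by (intro mult_left_mono) auto
  then show 1: "h \<le> sqrt h" using assms by simp
  then show 2: "h\<^sup>2 \<le> h * sqrt h" using assms by (simp add: power2_eq_square mult_left_mono)
  have "h ^ 3 \<le> h\<^sup>2" using assms by (intro power_decreasing) auto
  with 2 show "h ^ 3 \<le> h * sqrt h" by linarith
qed

text \<open>One constant serves all drifts and directions bounded by \<open>R\<close>, because a
  supremum over them is taken later. Induction on the number of directions: the inner expansion is
  carried through one more Gaussian step.\<close>

lemma gauss_expansion:
  "\<exists>C\<ge>0. \<forall>(\<mu> :: real ^ 'd) bs g p A h x. length bs = n \<and> norm \<mu> \<le> R \<and> (\<forall>b\<in>set bs. norm b \<le> R) \<and>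
      C21 K g p A \<and> 0 < h \<and> h \<le> 1 \<longrightarrow>
      \<bar>gauss \<mu> bs h g x - g x - h * gauss_gen \<mu> bs (p x) (A x)\<bar> \<le> C * h * sqrt h"
proof (induction n)
  case 0
  show ?case
  proof (intro exI[of _ "\<bar>K\<bar> * R\<^sup>2 + \<bar>K\<bar> * \<bar>R\<bar> ^ 3"] conjI allI impI)
    fix \<mu> :: "real ^ 'd" and bs :: "(real ^ 'd) list" and g :: "real ^ 'd \<Rightarrow> real" and p A and h :: real and x
    assume asm: "length bs = 0 \<and> norm \<mu> \<le> R \<and> (\<forall>b\<in>set bs. norm b \<le> R) \<and>
      C21 K g p A \<and> 0 < h \<and> h \<le> 1"
    then have \<mu>: "norm \<mu> \<le> R" and g: "C21 K g p A" and h: "0 < h" "h \<le> 1" and bs: "bs = []" by auto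
    note K = C21_bounds[OF g]
    have R: "R \<ge> 0" using order_trans[OF norm_ge_zero \<mu>] .
    have "\<bar>(A x *v \<mu>) \<bullet> \<mu>\<bar> \<le> norm (A x) * norm \<mu> * norm \<mu>" by (rule quadratic_form_le)
    also have "\<dots> \<le> K * R * R" using K(1,2) \<mu> R by (intro mult_mono) auto
    finally have "\<bar>(A x *v \<mu>) \<bullet> \<mu>\<bar> / 2 \<le> K * R\<^sup>2" using K(1) by (simp add: power2_eq_square)
    then have "h\<^sup>2 * (\<bar>(A x *v \<mu>) \<bullet> \<mu>\<bar> / 2) \<le> (h * sqrt h) * (K * R\<^sup>2)"
      using sqrt_bounds(2)[of h] h K(1) by (intro mult_mono) auto
    then have 1: "\<bar>(A x *v (h *\<^sub>R \<mu>)) \<bullet> (h *\<^sub>R \<mu>) / 2\<bar> \<le> (h * sqrt h) * (K * R\<^sup>2)"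
      by (simp add: matrix_vector_mult_scaleR power2_eq_square abs_mult mult_ac)
    have "h ^ 3 * norm \<mu> ^ 3 \<le> (h * sqrt h) * R ^ 3"
      using sqrt_bounds(3)[of h] h \<mu> by (intro mult_mono power_mono) auto
    then have "K * norm (h *\<^sub>R \<mu>) ^ 3 \<le> (h * sqrt h) * (K * R ^ 3)"
    proof -
      assume *: "h ^ 3 * norm \<mu> ^ 3 \<le> (h * sqrt h) * R ^ 3"
      have "K * norm (h *\<^sub>R \<mu>) ^ 3 = K * (h ^ 3 * norm \<mu> ^ 3)"
        using h by (simp add: power_mult_distrib)
      also have "\<dots> \<le> K * ((h * sqrt h) * R ^ 3)" by (rule mult_left_mono[OF * K(1)])
      finally show ?thesis by (simp only: mult_ac)
    qed
    with 1 K(3)[of x "h *\<^sub>R \<mu>"]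
    have "\<bar>g (x + h *\<^sub>R \<mu>) - g x - p x \<bullet> (h *\<^sub>R \<mu>)\<bar> \<le> (h * sqrt h) * (K * R\<^sup>2) + (h * sqrt h) * (K * R ^ 3)"
      by linarith
    then show "\<bar>gauss \<mu> bs h g x - g x - h * gauss_gen \<mu> bs (p x) (A x)\<bar>
        \<le> (\<bar>K\<bar> * R\<^sup>2 + \<bar>K\<bar> * \<bar>R\<bar> ^ 3) * h * sqrt h"
      using K(1) R by (simp add: bs algebra_simps)
  qed simp
next
  case (Suc n)
  then obtain C where C: "C \<ge> 0" "\<And>(\<mu> :: real ^ 'd) bs g p A h x. length bs = n \<Longrightarrow> norm \<mu> \<le> R \<Longrightarrow> \<forall>b\<in>set bs. norm b \<le> R \<Longrightarrow>
      C21 K g p A \<Longrightarrow> 0 < h \<Longrightarrow> h \<le> 1 \<Longrightarrow>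
      \<bar>gauss \<mu> bs h g x - g x - h * gauss_gen \<mu> bs (p x) (A x)\<bar> \<le> C * h * sqrt h"
    by blast
  define m1 where "m1 = (\<integral>s. \<bar>s\<bar> \<partial>std_normal)"
  define m3 where "m3 = (\<integral>s. \<bar>s\<bar> ^ 3 \<partial>std_normal)"
  have m: "m1 \<ge> 0" "m3 \<ge> 0" by (auto simp: m1_def m3_def)
  define M where "M = \<bar>K\<bar> * \<bar>R\<bar> + n * (\<bar>K\<bar> * R\<^sup>2)"
  have M: "M \<ge> 0" by (simp add: M_def)
  \<comment> \<open>The summands are the cubic remainder of the new direction, the displacement of
    the inner generator by the new step, and the inductive error.\<close>
  define D where "D = \<bar>K\<bar> * \<bar>R\<bar> ^ 3 * m3 + M * \<bar>R\<bar> * m1 + C"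
  show ?case
  proof (intro exI[of _ D] conjI allI impI)
    show "D \<ge> 0" using C m M by (simp add: D_def)
    fix \<mu> :: "real ^ 'd" and bs' :: "(real ^ 'd) list" and g :: "real ^ 'd \<Rightarrow> real" and p A and h :: real and x
    assume asm: "length bs' = Suc n \<and> norm \<mu> \<le> R \<and> (\<forall>b\<in>set bs'. norm b \<le> R) \<and>
      C21 K g p A \<and> 0 < h \<and> h \<le> 1"
    then obtain b bs where bs': "bs' = b # bs" "length bs = n" by (auto simp: length_Suc_conv)
    have \<mu>: "norm \<mu> \<le> R" and g: "C21 K g p A" and h: "0 < h" "h \<le> 1" and b: "norm b \<le> R"
      and bs: "\<forall>b\<in>set bs. norm b \<le> R" using asm bs' by auto
    have R: "R \<ge> 0" using order_trans[OF norm_ge_zero b] .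
    note K = C21_bounds(1)[OF g]
    let ?\<Lambda> = "\<lambda>x. gauss_gen \<mu> bs (p x) (A x)"
    have \<Lambda>: "M-lipschitz_on UNIV ?\<Lambda>"
      using gauss_gen_lipschitz[OF g \<mu> bs] K R bs' by (simp add: M_def)
    note Lg = C21_Lip[OF g] and L\<Lambda> = LipI[OF \<Lambda>]
    have "\<bar>gauss_step b h (gauss \<mu> bs h g) x - gauss_step b h (\<lambda>x. g x + h * ?\<Lambda> x) x\<bar> \<le> C * h * sqrt h"
      using C(2)[OF bs'(2) \<mu> bs g h]
      by (intro averaging_dist[OF averaging_gauss_step] averaging_Lip[OF averaging_gauss] Lip_add Lip_cmult Lg L\<Lambda>)
        (simp add: algebra_simps)
    moreover have "gauss_step b h (\<lambda>x. g x + h * ?\<Lambda> x) x = gauss_step b h g x + h * gauss_step b h ?\<Lambda> x"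
      by (simp add: averaging_add[OF averaging_gauss_step] averaging_cmult[OF averaging_gauss_step] Lg L\<Lambda> Lip_cmult)
    moreover have "\<bar>gauss_step b h g x - g x - h * ((A x *v b) \<bullet> b / 2)\<bar> \<le> \<bar>K\<bar> * \<bar>R\<bar> ^ 3 * m3 * (h * sqrt h)"
    proof -
      have "K * norm b ^ 3 * m3 * (h * sqrt h) \<le> \<bar>K\<bar> * \<bar>R\<bar> ^ 3 * m3 * (h * sqrt h)"
        using h m b R by (intro mult_right_mono mult_mono power_mono) auto
      then show ?thesis using gauss_step_expansion[OF g h(1), of b x] by (simp add: m3_def)
    qed
    moreover have "\<bar>h * gauss_step b h ?\<Lambda> x - h * ?\<Lambda> x\<bar> \<le> M * \<bar>R\<bar> * m1 * (h * sqrt h)"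
    proof -
      have "\<bar>gauss_step b h ?\<Lambda> x - ?\<Lambda> x\<bar> \<le> M * norm b * m1 * sqrt h"
        using gauss_step_close[OF \<Lambda>, of h b x] h by (simp add: m1_def)
      also have "\<dots> \<le> M * \<bar>R\<bar> * m1 * sqrt h"
        using h m M b R by (intro mult_right_mono mult_mono) auto
      finally have "h * \<bar>gauss_step b h ?\<Lambda> x - ?\<Lambda> x\<bar> \<le> h * (M * \<bar>R\<bar> * m1 * sqrt h)"
        using h by (intro mult_left_mono) auto
      then show ?thesis using h by (simp add: right_diff_distrib[symmetric] abs_mult mult_ac)
    qed
    ultimately have "\<bar>gauss_step b h (gauss \<mu> bs h g) x - g x - h * ((A x *v b) \<bullet> b / 2) - h * ?\<Lambda> x\<bar>
        \<le> C * h * sqrt h + \<bar>K\<bar> * \<bar>R\<bar> ^ 3 * m3 * (h * sqrt h) + M * \<bar>R\<bar> * m1 * (h * sqrt h)"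
      by linarith
    then show "\<bar>gauss \<mu> bs' h g x - g x - h * gauss_gen \<mu> bs' (p x) (A x)\<bar> \<le> D * h * sqrt h"
      by (simp add: bs' D_def algebra_simps)
  qed
qed

lemma averaging_sublinear_functional:
  assumes "averaging T"
  shows "sublinear_functional (\<lambda>f. T f x)"
  using averaging_mono[OF assms] averaging_const[OF assms] averaging_add[OF assms] averaging_cmult[OF assms]
  by unfold_locales simp_all

lemma conv_gauss: "Lip f \<Longrightarrow> conv (\<lambda>f. gauss \<mu> bs t f 0) f = gauss \<mu> bs t f"
  unfolding conv_def by (simp add: averaging_shift[OF averaging_gauss])

lemma gauss_generated_semigroup:
  "generated_semigroup (\<lambda>t f. gauss \<mu> bs t f 0) (gauss_gen \<mu> bs)"
proof (intro generated_semigroup.intro generated_family.intro generated_semigroup_axioms.intro)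
  fix h :: real assume "0 \<le> h"
  show "sublinear_functional (\<lambda>f. gauss \<mu> bs h f 0)"
    by (rule averaging_sublinear_functional[OF averaging_gauss])
next
  define R where "R = norm \<mu> + sum_list (map norm bs)"
  have nn: "sum_list (map norm bs) \<ge> 0" by (intro sum_list_nonneg) auto
  have R: "norm \<mu> \<le> R" "\<forall>b\<in>set bs. norm b \<le> R"
    using nn member_le_sum_list[of _ "map norm bs"] by (fastforce simp: R_def intro: add_increasing)+
  show "has_generator (\<lambda>t f. gauss \<mu> bs t f 0) (gauss_gen \<mu> bs)"
    unfolding has_generator_def
  proof
    fix K
    from gauss_expansion[where n = "length bs" and R = R and K = K] obtain C where
      C: "\<And>g p A h x. C21 K g p A \<Longrightarrow> 0 < h \<Longrightarrow> h \<le> 1 \<Longrightarrow>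
        \<bar>gauss \<mu> bs h g x - g x - h * gauss_gen \<mu> bs (p x) (A x)\<bar> \<le> C * h * sqrt h"
      using R by blast
    then show "\<exists>C. \<forall>g p A. C21 K g p A \<longrightarrow> (\<forall>h. 0 < h \<and> h \<le> 1 \<longrightarrow>
        \<bar>gauss \<mu> bs h g 0 - g 0 - h * gauss_gen \<mu> bs (p 0) (A 0)\<bar> \<le> C * h * sqrt h)"
      by blast
  qed
next
  fix s t :: real and f :: "real ^ 'a \<Rightarrow> real" assume "0 \<le> s" "0 \<le> t" "Lip f"
  then show "gauss \<mu> bs (s + t) f 0 = gauss \<mu> bs s (conv (\<lambda>f. gauss \<mu> bs t f 0) f) 0"
    by (simp add: conv_gauss gauss_semigroup)
next
  define m where "m = (\<integral>s. \<bar>s\<bar> \<partial>std_normal) * sum_list (map norm bs)"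
  have "gauss \<mu> bs h norm 0 \<le> (norm \<mu> + m) * sqrt h" if "0 \<le> h" "h \<le> 1" for h
  proof -
    have "h * norm \<mu> \<le> sqrt h * norm \<mu>" using sqrt_bounds(1)[OF that] by (intro mult_right_mono) auto
    then show ?thesis
      using gauss_close[OF lipschitz_norm that(1), of \<mu> bs 0] by (simp add: m_def algebra_simps)
  qed
  then show "\<exists>\<kappa>. \<forall>h. 0 \<le> h \<and> h \<le> 1 \<longrightarrow> gauss \<mu> bs h norm 0 \<le> \<kappa> * sqrt h" by blast
qed

section \<open>Sublinear generators as suprema of Gaussian generators\<close>

text \<open>Finite-dimensional Hahn-Banach theorem: a hyperplane supporting the epigraph at
  \<open>(z, f z)\<close> is the graph of an affine function, and homogeneity removes its constant
  term.\<close>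

lemma sublinear_subgradient:
  fixes f :: "'a::euclidean_space \<Rightarrow> real"
  assumes add: "\<And>x y. f (x + y) \<le> f x + f y" and scale: "\<And>c x. c \<ge> 0 \<Longrightarrow> f (c *\<^sub>R x) = c * f x"
  obtains a where "\<And>x. a \<bullet> x \<le> f x" "a \<bullet> z = f z"
proof -
  define S where "S = {w :: 'a \<times> real. f (fst w) \<le> snd w}"
  have conv: "convex S"
  proof (rule convexI)
    fix x y and u v :: real assume xy: "x \<in> S" "y \<in> S" and uv: "0 \<le> u" "0 \<le> v" "u + v = 1"
    have "f (u *\<^sub>R fst x + v *\<^sub>R fst y) \<le> u * f (fst x) + v * f (fst y)"
      using add[of "u *\<^sub>R fst x" "v *\<^sub>R fst y"] uv by (simp add: scale)
    also have "\<dots> \<le> u * snd x + v * snd y"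
      using xy uv by (intro add_mono mult_left_mono) (auto simp: S_def)
    finally show "u *\<^sub>R x + v *\<^sub>R y \<in> S" by (simp add: S_def)
  qed
  have zS: "(z, f z) \<in> S" and zS1: "(z, f z + 1) \<in> S" by (auto simp: S_def)
  \<comment> \<open>Prolonging the vertical segment from \<open>(z, f z + 1)\<close> beyond
    \<open>(z, f z)\<close> leaves the epigraph at once.\<close>
  have "(z, f z) \<notin> rel_interior S"
  proof
    assume "(z, f z) \<in> rel_interior S"
    with convex_rel_interior_iff[OF conv, of "(z, f z)"] zS
    have "\<forall>x\<in>S. \<exists>e>1. (1 - e) *\<^sub>R x + e *\<^sub>R (z, f z) \<in> S" by (metis empty_iff)
    from bspec[OF this zS1] obtain e where e: "e > 1" "(1 - e) *\<^sub>R (z, f z + 1) + e *\<^sub>R (z, f z) \<in> S"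
      by (elim exE conjE)
    have "(1 - e) *\<^sub>R (z, f z + 1) + e *\<^sub>R (z, f z) = (z, f z + 1 - e)"
      by (simp add: algebra_simps)
    with e show False by (simp add: S_def)
  qed
  then obtain w where w: "w \<noteq> 0"
    and sup: "\<And>y. y \<in> S \<Longrightarrow> w \<bullet> (z, f z) \<le> w \<bullet> y"
    using supporting_hyperplane_rel_boundary[OF conv zS] by metis
  obtain \<alpha> \<beta> where w': "w = (\<alpha>, \<beta>)" by (cases w)
  have ineq: "\<alpha> \<bullet> z + \<beta> * f z \<le> \<alpha> \<bullet> x + \<beta> * r" if "f x \<le> r" for x r
    using sup[of "(x, r)"] that by (simp add: w' S_def)
  have "\<beta> \<ge> 0" using ineq[of z "f z + 1"] by (simp add: algebra_simps)
  \<comment> \<open>The hyperplane is not vertical because \<open>f\<close> is finite everywhere: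
    the point over \<open>z - \<alpha>\<close> would lie on the wrong side.\<close>
  moreover have "\<beta> \<noteq> 0"
  proof
    assume \<beta>: "\<beta> = 0"
    then have "\<alpha> \<bullet> z \<le> \<alpha> \<bullet> (z - \<alpha>)" using ineq[of "z - \<alpha>" "f (z - \<alpha>)"] by simp
    then have "\<alpha> \<bullet> \<alpha> \<le> 0" by (simp add: inner_diff_right)
    then have "\<alpha> = 0" using inner_gt_zero_iff[of \<alpha>] by linarith
    with \<beta> w show False by (simp add: w' zero_prod_def)
  qed
  ultimately have \<beta>: "\<beta> > 0" by simp
  define a where "a = (- 1 / \<beta>) *\<^sub>R \<alpha>"
  have sub: "f z + a \<bullet> (x - z) \<le> f x" for x
  proof -
    have "\<alpha> \<bullet> z + \<beta> * f z \<le> \<alpha> \<bullet> x + \<beta> * f x" by (rule ineq) simp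
    then have "(\<alpha> \<bullet> z - \<alpha> \<bullet> x) / \<beta> \<le> f x - f z"
      unfolding pos_divide_le_eq[OF \<beta>] by (simp add: algebra_simps)
    then show ?thesis by (simp add: a_def inner_diff_right diff_divide_distrib)
  qed
  \<comment> \<open>Testing the affine minorant at 0 and at \<open>2 *\<^sub>R z\<close> forces
    equality at \<open>z\<close>.\<close>
  have "f 0 = 0" using scale[of 0 0] by simp
  then have "f z \<le> a \<bullet> z" using sub[of 0] by simp
  moreover have "a \<bullet> z \<le> f z" using sub[of "2 *\<^sub>R z"] scale[of 2 z] by (simp add: inner_diff_right)
  ultimately have eq: "a \<bullet> z = f z" by simp
  have "a \<bullet> x \<le> f x" for x using sub[of x] eq by (simp add: inner_diff_right)
  then show ?thesis using eq that by blast
qed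

lemma matrix_inner_square: "(A *v b) \<bullet> c = (\<Sum>i\<in>UNIV. \<Sum>j\<in>UNIV. A $ i $ j * c $ i * b $ j)"
  for A :: "real ^ 'd ^ 'd"
  by (simp add: inner_vec_def matrix_vector_mult_def sum_distrib_right sum_distrib_left mult_ac)

text \<open>Cholesky elimination: subtracting the rank-one matrix built from row \<open>i\<close>
  clears that row and column, and the Schur complement stays positive semidefinite. The set
  \<open>S\<close> contains the indices of the rows not yet cleared.\<close>

lemma psd_decomposition_aux:
  fixes Q :: "real ^ 'd ^ 'd"
  assumes "finite S" and "\<And>i j. Q $ i $ j = Q $ j $ i" and "\<And>z. 0 \<le> (Q *v z) \<bullet> z"
    and "\<And>i j. i \<notin> S \<Longrightarrow> Q $ i $ j = 0"
  shows "\<exists>bs. length bs = card S \<and> (\<forall>A :: real ^ 'd ^ 'd. Q \<bullet> A = (\<Sum>b\<leftarrow>bs. (A *v b) \<bullet> b))"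
  using assms
proof (induction S arbitrary: Q rule: finite_induct)
  case empty
  have "Q = 0" using empty by (simp add: vec_eq_iff)
  then show ?case by (intro exI[of _ "[]"]) simp
next
  case (insert i S)
  note sym = insert.prems(1) and psd = insert.prems(2) and supp = insert.prems(3)
  have quad: "(Q *v (z + t *\<^sub>R axis i 1)) \<bullet> (z + t *\<^sub>R axis i 1)
      = (Q *v z) \<bullet> z + 2 * t * (Q $ i \<bullet> z) + t\<^sup>2 * Q $ i $ i" for z t
  proof -
    have a: "Q *v axis i 1 = Q $ i"
      using sym by (simp add: matrix_vector_mul_component vec_eq_iff inner_axis)
    have b: "(Q *v z) \<bullet> axis i 1 = Q $ i \<bullet> z" by (simp add: inner_axis matrix_vector_mul_component)
    show ?thesis
      by (simp add: matrix_vector_right_distrib matrix_vector_mult_scaleR inner_add_left inner_add_right a b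
          inner_axis matrix_vector_mul_component power2_eq_square algebra_simps)
  qed
  have qii: "Q $ i $ i \<ge> 0" using psd[of "axis i 1"] quad[of 0 1] by simp
  show ?case
  proof (cases "Q $ i $ i = 0")
    case True
    have "Q $ i $ j = 0" for j
    proof (rule ccontr)
      assume nz: "Q $ i $ j \<noteq> 0"
      \<comment> \<open>An affine function of \<open>t\<close> with nonzero slope cannot stay
        nonnegative.\<close>
      have "0 \<le> (Q *v axis j 1) \<bullet> axis j 1 + 2 * t * (Q $ i $ j)" for t
        using psd[of "axis j 1 + t *\<^sub>R axis i 1"] quad[of "axis j 1" t] True by (simp add: inner_axis)
      from this[of "- ((Q *v axis j 1) \<bullet> axis j 1 + 1) / (2 * Q $ i $ j)"] nz show False by (simp add: field_simps)
    qed
    then have "\<And>k j. k \<notin> S \<Longrightarrow> Q $ k $ j = 0" using supp by (metis insert_iff)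
    from insert.IH[OF sym psd this] obtain bs where
      "length bs = card S" "\<forall>A. Q \<bullet> A = (\<Sum>b\<leftarrow>bs. (A *v b) \<bullet> b)" by blast
    \<comment> \<open>Padding with the zero vector keeps the number of directions equal to the
      cardinality.\<close>
    then show ?thesis using insert.hyps by (intro exI[of _ "0 # bs"]) auto
  next
    case False
    then have pos: "Q $ i $ i > 0" using qii by simp
    define B where "B = (\<chi> j k. Q $ i $ j * Q $ i $ k / Q $ i $ i)"
    define b where "b = (1 / sqrt (Q $ i $ i)) *\<^sub>R (Q $ i)"
    have Bz: "(B *v z) \<bullet> z = (Q $ i \<bullet> z)\<^sup>2 / Q $ i $ i" for z
      unfolding matrix_inner_square by (simp add: B_def inner_vec_def power2_eq_square sum_product
          sum_divide_distrib mult_ac)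
    have "B $ j $ k = b $ j * b $ k" for j k using pos by (simp add: B_def b_def)
    then have BA: "B \<bullet> A = (A *v b) \<bullet> b" for A
      unfolding matrix_inner_square by (simp add: inner_vec_def mult_ac)
    have "\<exists>bs. length bs = card S \<and> (\<forall>A. (Q - B) \<bullet> A = (\<Sum>b\<leftarrow>bs. (A *v b) \<bullet> b))"
    proof (rule insert.IH)
      show "(Q - B) $ j $ k = (Q - B) $ k $ j" for j k using sym by (simp add: B_def mult.commute)
      show "(Q - B) $ j $ k = 0" if "j \<notin> S" for j k
        using supp[of j k] supp[of j i] sym[of j i] that pos by (cases "j = i") (auto simp: B_def)
      show "0 \<le> ((Q - B) *v z) \<bullet> z" for z
      proof -
        \<comment> \<open>The minimiser over \<open>t\<close> of the quadratic in
          \<open>quad\<close>.\<close>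
        let ?c = "- (Q $ i \<bullet> z) / Q $ i $ i"
        have "0 \<le> (Q *v z) \<bullet> z + 2 * ?c * (Q $ i \<bullet> z) + ?c\<^sup>2 * Q $ i $ i"
          using psd[of "z + ?c *\<^sub>R axis i 1"] quad[of z ?c] by simp
        also have "\<dots> = (Q *v z) \<bullet> z - (Q $ i \<bullet> z)\<^sup>2 / Q $ i $ i"
          using pos by (simp add: power2_eq_square field_simps)
        finally show ?thesis by (simp add: matrix_vector_mult_diff_rdistrib inner_diff_left Bz)
      qed
    qed
    then obtain bs where bs: "length bs = card S" "\<forall>A. (Q - B) \<bullet> A = (\<Sum>b\<leftarrow>bs. (A *v b) \<bullet> b)" by blast
    have "Q \<bullet> A = (\<Sum>b\<leftarrow>b # bs. (A *v b) \<bullet> b)" for A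
      using bs(2)[rule_format, of A] BA[of A] by (simp add: inner_diff_left)
    then show ?thesis using bs(1) insert.hyps by (intro exI[of _ "b # bs"]) auto
  qed
qed

lemma gauss_gen_sum: "gauss_gen \<mu> bs p A = p \<bullet> \<mu> + (\<Sum>b\<leftarrow>bs. (A *v b) \<bullet> b) / 2"
  by (induction bs) (auto simp: add_divide_distrib)

text \<open>Together with \<open>G_add\<close>, the condition \<open>G_neg\<close> is degenerate
  ellipticity; it also forces \<open>G\<close> to see only the symmetric part of a matrix.
  \<open>G_bound\<close> limits the drifts that can occur below \<open>G\<close>.\<close>

locale sublinear_generator =
  fixes G :: "real ^ 'd \<Rightarrow> real ^ 'd ^ 'd \<Rightarrow> real"
  assumes G_add: "G (p + q) (A + B) \<le> G p A + G q B"
    and G_scale: "c \<ge> 0 \<Longrightarrow> G (c *\<^sub>R p) (c *\<^sub>R A) = c * G p A"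
    and G_neg: "(\<And>z. (A *v z) \<bullet> z \<le> 0) \<Longrightarrow> G 0 A \<le> 0"
    and G_bound: "\<exists>C. \<forall>p. G p 0 \<le> C * norm p"
begin

text \<open>The linear generators below \<open>G\<close>, with the covariance encoded by a fixed
  number of directions so that the constants of \<open>gauss_expansion\<close> are uniform.\<close>

definition \<Theta> :: "((real ^ 'd) \<times> (real ^ 'd) list) set" where
  "\<Theta> = {(\<mu>, bs). length bs = CARD('d) \<and> (\<forall>p A. gauss_gen \<mu> bs p A \<le> G p A)}"

text \<open>The supremum is attained: a subgradient of \<open>G\<close> at \<open>(p, A)\<close> is
  a drift together with a matrix \<open>Q\<close>, and domination by \<open>G\<close> forces
  \<open>Q\<close> to be symmetric and positive semidefinite.\<close>

lemma representation: "\<exists>(\<mu>, bs)\<in>\<Theta>. gauss_gen \<mu> bs p A = G p A"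
proof -
  obtain a where a: "\<And>x. a \<bullet> x \<le> (case x of (p, A) \<Rightarrow> G p A)" "a \<bullet> (p, A) = (case (p, A) of (p, A) \<Rightarrow> G p A)"
    by (rule sublinear_subgradient[of "\<lambda>(p, A). G p A" "(p, A)"]) (auto simp: G_add G_scale split_beta)
  obtain \<mu> Q where aQ: "a = (\<mu>, Q)" by (cases a)
  have le: "\<mu> \<bullet> p + Q \<bullet> A \<le> G p A" for p A using a(1)[of "(p, A)"] by (simp add: aQ)
  have eq: "\<mu> \<bullet> p + Q \<bullet> A = G p A" using a(2) by (simp add: aQ)
  have neg: "Q \<bullet> B \<le> 0" if "\<And>z. (B *v z) \<bullet> z \<le> 0" for B
    using le[of 0 B] G_neg[OF that] by simp
  \<comment> \<open>Matrix units, used to read off single entries of \<open>Q\<close>.\<close>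
  define M where "M i j = (\<chi> k l. if k = i \<and> l = j then 1 else (0 :: real))" for i j :: 'd
  have QM: "Q \<bullet> M i j = Q $ i $ j" for i j
  proof -
    have "Q \<bullet> M i j = (\<Sum>k\<in>UNIV. \<Sum>l\<in>UNIV. if k = i then (if l = j then Q $ k $ l else 0) else 0)"
      unfolding inner_vec_def M_def by (intro sum.cong) auto
    also have "\<dots> = (\<Sum>k\<in>UNIV. if k = i then Q $ k $ j else 0)" by (intro sum.cong) auto
    finally show ?thesis by simp
  qed
  have Mz: "(M i j *v z) \<bullet> z = z $ i * z $ j" for i j z
  proof -
    have "(M i j *v z) \<bullet> z = (\<Sum>k\<in>UNIV. \<Sum>l\<in>UNIV. if k = i then (if l = j then z $ k * z $ l else 0) else 0)"
      unfolding matrix_inner_square M_def by (intro sum.cong) auto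
    also have "\<dots> = (\<Sum>k\<in>UNIV. if k = i then z $ k * z $ j else 0)" by (intro sum.cong) auto
    finally show ?thesis by simp
  qed
  \<comment> \<open>Antisymmetric matrices have vanishing quadratic form, so \<open>neg\<close>
    applies to both signs.\<close>
  have sym: "Q $ i $ j = Q $ j $ i" for i j
    using neg[of "M i j - M j i"] neg[of "M j i - M i j"]
    by (simp add: QM Mz matrix_vector_mult_diff_rdistrib inner_diff_left inner_diff_right)
  have psd: "0 \<le> (Q *v z) \<bullet> z" for z
  proof -
    \<comment> \<open>Minus the rank-one matrix of \<open>z\<close>: its pairing with
      \<open>Q\<close> is minus the quadratic form of \<open>Q\<close> at \<open>z\<close>.\<close>
    define B where "B = (\<chi> i j. - (z $ i * z $ j))"
    have "(B *v w) \<bullet> w = - ((z \<bullet> w)\<^sup>2)" for w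
      unfolding matrix_inner_square by (simp add: B_def inner_vec_def power2_eq_square sum_product sum_negf mult_ac)
    then have "Q \<bullet> B \<le> 0" by (intro neg) simp
    moreover have "Q \<bullet> B = - ((Q *v z) \<bullet> z)"
      unfolding matrix_inner_square by (simp add: B_def inner_vec_def sum_negf mult_ac)
    ultimately show ?thesis by simp
  qed
  \<comment> \<open>Decomposing \<open>2 *\<^sub>R Q\<close> compensates the factor 1/2 in
    \<open>gauss_gen\<close>.\<close>
  have "\<exists>bs. length bs = card (UNIV :: 'd set) \<and> (\<forall>A. (2 *\<^sub>R Q) \<bullet> A = (\<Sum>b\<leftarrow>bs. (A *v b) \<bullet> b))"
    using sym psd by (intro psd_decomposition_aux) (auto simp: scaleR_matrix_vector_assoc[symmetric])
  then obtain bs where bs: "length bs = CARD('d)" "\<And>A. 2 * (Q \<bullet> A) = (\<Sum>b\<leftarrow>bs. (A *v b) \<bullet> b)"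
    by auto
  have "gauss_gen \<mu> bs p A = \<mu> \<bullet> p + Q \<bullet> A" for p A
    using bs(2)[of A] by (simp add: gauss_gen_sum inner_commute[of p \<mu>])
  then show ?thesis using le eq bs(1) by (intro bexI[of _ "(\<mu>, bs)"]) (auto simp: \<Theta>_def)
qed

text \<open>Domination is tested with \<open>p = \<mu>\<close>, \<open>A = 0\<close> to bound the
  drift, and with \<open>p = 0\<close> and the identity matrix to bound the sum of the squared
  lengths of the directions.\<close>

lemma Theta_bounded: "\<exists>R. \<forall>(\<mu>, bs)\<in>\<Theta>. norm \<mu> \<le> R \<and> (\<forall>b\<in>set bs. norm b \<le> R)"
proof -
  obtain C where C: "\<And>p. G p 0 \<le> C * norm p" using G_bound by blast
  define R where "R = \<bar>C\<bar> + sqrt (2 * \<bar>G 0 (mat 1)\<bar>)"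
  have "norm \<mu> \<le> R \<and> (\<forall>b\<in>set bs. norm b \<le> R)" if "(\<mu>, bs) \<in> \<Theta>" for \<mu> bs
  proof
    have le: "gauss_gen \<mu> bs p A \<le> G p A" for p A using that by (auto simp: \<Theta>_def)
    have z: "(\<Sum>b\<leftarrow>bs. (0 *v b) \<bullet> b) = (0::real)" by (induction bs) auto
    have "norm \<mu> * norm \<mu> \<le> C * norm \<mu>"
      using le[of \<mu> 0] C[of \<mu>] by (simp add: gauss_gen_sum z flip: power2_norm_eq_inner power2_eq_square)
    then have "norm \<mu> \<le> \<bar>C\<bar>" by (cases "\<mu> = 0") auto
    then show "norm \<mu> \<le> R" by (simp add: R_def add_increasing2)
    show "\<forall>b\<in>set bs. norm b \<le> R"
    proof
      fix b assume "b \<in> set bs"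
      then have "b \<bullet> b \<le> (\<Sum>b\<leftarrow>bs. b \<bullet> b)"
        by (intro member_le_sum_list) auto
      then have "(norm b)\<^sup>2 \<le> 2 * \<bar>G 0 (mat 1)\<bar>"
        using le[of 0 "mat 1"] by (simp add: gauss_gen_sum power2_norm_eq_inner)
      then have "norm b \<le> sqrt (2 * \<bar>G 0 (mat 1)\<bar>)" by (rule real_le_rsqrt)
      then show "norm b \<le> R" by (simp add: R_def)
    qed
  qed
  then show ?thesis by blast
qed

lemma Theta_nonempty: "\<Theta> \<noteq> {}"
  using representation[of 0 0] by auto

text \<open>The best value when one element of \<open>\<Theta>\<close> is chosen and kept for time
  \<open>t\<close>; iteration allows a new choice at every grid time.\<close>

definition control :: "real \<Rightarrow> (real ^ 'd \<Rightarrow> real) \<Rightarrow> real" where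
  "control t f = (SUP (\<mu>, bs)\<in>\<Theta>. gauss \<mu> bs t f 0)"

lemma control_bdd:
  assumes "Lip f" "0 \<le> t"
  shows "bdd_above ((\<lambda>(\<mu>, bs). gauss \<mu> bs t f x) ` \<Theta>)"
proof -
  obtain L where L: "L-lipschitz_on UNIV f" using assms(1) by (auto simp: Lip_def)
  obtain R where R: "\<And>\<mu> bs. (\<mu>, bs) \<in> \<Theta> \<Longrightarrow> norm \<mu> \<le> R \<and> (\<forall>b\<in>set bs. norm b \<le> R)"
    using Theta_bounded by blast
  let ?m = "\<integral>s. \<bar>s\<bar> \<partial>std_normal"
  show ?thesis
  proof (rule bdd_aboveI2)
    fix \<theta> assume \<theta>: "\<theta> \<in> \<Theta>"
    obtain \<mu> bs where \<theta>': "\<theta> = (\<mu>, bs)" by (cases \<theta>)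
    have "sum_list (map norm bs) \<le> sum_list (map (\<lambda>_. R) bs)"
      using R[of \<mu> bs] \<theta> \<theta>' by (intro sum_list_mono) auto
    also have "\<dots> = CARD('d) * R" using \<theta> \<theta>' by (simp add: sum_list_triv \<Theta>_def)
    finally have "L * (t * norm \<mu> + sqrt t * (?m * sum_list (map norm bs)))
        \<le> L * (t * R + sqrt t * (?m * (CARD('d) * R)))"
      using assms(2) lipschitz_on_nonneg[OF L] R[of \<mu> bs] \<theta> \<theta>'
      by (intro mult_left_mono add_mono) auto
    with gauss_close[OF L assms(2), of \<mu> bs x]
    show "(case \<theta> of (\<mu>, bs) \<Rightarrow> gauss \<mu> bs t f x) \<le> f x + L * (t * R + sqrt t * (?m * (CARD('d) * R)))"
      by (simp add: \<theta>')
  qed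
qed

lemma control_upper: "Lip f \<Longrightarrow> 0 \<le> t \<Longrightarrow> (\<mu>, bs) \<in> \<Theta> \<Longrightarrow> gauss \<mu> bs t f 0 \<le> control t f"
  unfolding control_def using cSUP_upper[OF _ control_bdd, of "(\<mu>, bs)" f t 0] by simp

lemma control_least: "(\<And>\<mu> bs. (\<mu>, bs) \<in> \<Theta> \<Longrightarrow> gauss \<mu> bs t f 0 \<le> c) \<Longrightarrow> control t f \<le> c"
  unfolding control_def by (rule cSUP_least[OF Theta_nonempty]) auto

lemma control_sublinear:
  assumes t: "0 \<le> t"
  shows "sublinear_functional (control t)"
proof
  fix f g :: "real ^ 'd \<Rightarrow> real" and c :: real
  show "control t (\<lambda>_. c) = c"
    using Theta_nonempty by (simp add: control_def averaging_const[OF averaging_gauss] case_prod_unfold)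
  assume f: "Lip f"
  show "control t (\<lambda>x. c * f x) = c * control t f" if c: "0 \<le> c"
  proof (rule antisym)
    show "control t (\<lambda>x. c * f x) \<le> c * control t f"
      using control_upper[OF f t] c
      by (intro control_least) (simp add: averaging_cmult[OF averaging_gauss f] mult_left_mono)
    show "c * control t f \<le> control t (\<lambda>x. c * f x)"
    proof (cases "c = 0")
      case True
      then show ?thesis using \<open>control t (\<lambda>_. c) = c\<close> by simp
    next
      case False
      then have "control t f \<le> control t (\<lambda>x. c * f x) / c"
        using control_upper[OF Lip_cmult[OF f] t, of _ _ c] c
        by (intro control_least) (simp add: averaging_cmult[OF averaging_gauss f] field_simps)
      then show ?thesis using False c by (simp add: field_simps)
    qed
  qed
  assume g: "Lip g"
  show "control t (\<lambda>x. f x + g x) \<le> control t f + control t g"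
    using control_upper[OF f t] control_upper[OF g t]
    by (intro control_least) (simp add: averaging_add[OF averaging_gauss f g] add_mono)
  assume le: "\<And>x. f x \<le> g x"
  show "control t f \<le> control t g"
    using control_upper[OF g t] averaging_mono[OF averaging_gauss f g le]
    by (intro control_least) (blast intro: order_trans)
qed

text \<open>The upper bound uses that every element of \<open>\<Theta>\<close> lies below
  \<open>G\<close>, the lower one the element that attains \<open>G\<close> at
  \<open>(p 0, A 0)\<close>; the expansion error is uniform over \<open>\<Theta>\<close>.\<close>

lemma control_family: "generated_family control G"
proof (intro generated_family.intro control_sublinear)
  show "has_generator control G"
    unfolding has_generator_def
  proof
    fix K
    obtain R where R: "\<And>\<mu> bs. (\<mu>, bs) \<in> \<Theta> \<Longrightarrow> norm \<mu> \<le> R \<and> (\<forall>b\<in>set bs. norm b \<le> R)"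
      using Theta_bounded by blast
    from gauss_expansion[where n = "CARD('d)" and R = R and K = K] obtain C where
      C: "\<And>\<mu> bs g p A h x. length bs = CARD('d) \<Longrightarrow> norm (\<mu> :: real ^ 'd) \<le> R \<Longrightarrow> \<forall>b\<in>set bs. norm b \<le> R \<Longrightarrow>
        C21 K g p A \<Longrightarrow> 0 < h \<Longrightarrow> h \<le> 1 \<Longrightarrow>
        \<bar>gauss \<mu> bs h g x - g x - h * gauss_gen \<mu> bs (p x) (A x)\<bar> \<le> C * h * sqrt h"
      by blast
    have "\<bar>control h g - g 0 - h * G (p 0) (A 0)\<bar> \<le> C * h * sqrt h"
      if g: "C21 K g p A" and h: "0 < h" "h \<le> 1" for g p A h
    proof -
      have b: "\<bar>gauss \<mu> bs h g 0 - g 0 - h * gauss_gen \<mu> bs (p 0) (A 0)\<bar> \<le> C * h * sqrt h"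
        if "(\<mu>, bs) \<in> \<Theta>" for \<mu> bs
        using C[OF _ _ _ g h, of bs \<mu> 0] R[OF that] that by (simp add: \<Theta>_def)
      have "control h g \<le> g 0 + h * G (p 0) (A 0) + C * h * sqrt h"
      proof (rule control_least)
        fix \<mu> bs assume \<theta>: "(\<mu>, bs) \<in> \<Theta>"
        then have "h * gauss_gen \<mu> bs (p 0) (A 0) \<le> h * G (p 0) (A 0)"
          using h by (intro mult_left_mono) (auto simp: \<Theta>_def)
        then show "gauss \<mu> bs h g 0 \<le> g 0 + h * G (p 0) (A 0) + C * h * sqrt h"
          using b[OF \<theta>] by linarith
      qed
      moreover obtain \<mu> bs where \<theta>: "(\<mu>, bs) \<in> \<Theta>" "gauss_gen \<mu> bs (p 0) (A 0) = G (p 0) (A 0)"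
        using representation[of "p 0" "A 0"] by blast
      have "g 0 + h * G (p 0) (A 0) - C * h * sqrt h \<le> control h g"
        using b[OF \<theta>(1)] control_upper[OF C21_Lip[OF g] _ \<theta>(1), of h] h \<theta>(2) by simp
      ultimately show ?thesis by (simp add: abs_le_iff)
    qed
    then show "\<exists>C. \<forall>g p A. C21 K g p A \<longrightarrow> (\<forall>h. 0 < h \<and> h \<le> 1 \<longrightarrow>
        \<bar>control h g - g 0 - h * G (p 0) (A 0)\<bar> \<le> C * h * sqrt h)"
      by blast
  qed
qed

end


section \<open>Semigroups are dominated by viscosity supersolutions\<close>

lemma C12_test_uminus:
  assumes "C12_test \<psi> \<psi>t p A"
  shows "C12_test (\<lambda>t x. - \<psi> t x) (\<lambda>t x. - \<psi>t t x) (\<lambda>t x. - p t x) (\<lambda>t x. - A t x)"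
proof -
  have m: "(- B) *v z = - (B *v z)" for B :: "real ^ 'd ^ 'd" and z
    using matrix_vector_mult_diff_rdistrib[of 0 B z] by simp
  show ?thesis
    using assms unfolding C12_test_def case_prod_unfold m
    by (auto intro!: derivative_eq_intros continuous_intros simp: fun_eq_iff)
qed

text \<open>
  For each linear generator below \<open>G\<close>, the function \<open>- u\<close> is a subsolution of the corresponding linear
  equation, so \<open>u\<close> dominates the Gaussian semigroups and hence every control policy that is constant
  on the intervals of a time grid. By consistency, these policies approximate the semigroup of \<open>G\<close>.
\<close>

theorem supersolution_ge:
  assumes "generated_semigroup F G" and "sublinear_generator G"
    and super: "viscosity_supersolution G u"
    and cu: "continuous_on ({0..} \<times> UNIV) (\<lambda>(t, x). u t x)"
    and growth: "\<And>s x. s \<in> {0..t + 1} \<Longrightarrow> (norm x)\<^sup>2 - C \<le> u s x"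
    and f: "L-lipschitz_on UNIV f" and init: "\<And>x. f x \<le> u 0 x" and t: "0 \<le> t"
  shows "conv (F t) f x \<le> u t x"
proof -
  interpret F: generated_semigroup F G by fact
  interpret G: sublinear_generator G by fact
  have step: "gauss \<mu> bs (r - a) g x \<le> u r x"
    if \<theta>: "(\<mu>, bs) \<in> G.\<Theta>" and g: "M-lipschitz_on UNIV g" and a: "0 \<le> a" "a \<le> r" "r \<le> t"
      and le: "\<And>x. g x \<le> u a x" for \<mu> bs M g a r x
  proof -
    interpret P: generated_semigroup "\<lambda>t f. gauss \<mu> bs t f 0" "gauss_gen \<mu> bs"
      by (rule gauss_generated_semigroup)
    have "viscosity_subsolution (gauss_gen \<mu> bs) (\<lambda>t x. - u t x)"
      unfolding viscosity_subsolution_def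
    proof (intro allI impI)
      fix \<psi> \<psi>t p A and t :: real and x
      assume \<psi>: "C12_test \<psi> \<psi>t p A" and t: "t > 0"
        and max: "\<forall>\<^sub>F (s, y) in nhds (t, x). - u s y - \<psi> s y \<le> - u t x - \<psi> t x"
      have "\<forall>\<^sub>F (s, y) in nhds (t, x). u s y - - \<psi> s y \<ge> u t x - - \<psi> t x"
        using max by eventually_elim (auto simp: algebra_simps)
      then have "- \<psi>t t x - G (- p t x) (- A t x) \<ge> 0"
        using super C12_test_uminus[OF \<psi>] t unfolding viscosity_supersolution_def by blast
      moreover have "gauss_gen \<mu> bs (- p t x) (- A t x) \<le> G (- p t x) (- A t x)"
        using \<theta> by (auto simp: G.\<Theta>_def)
      \<comment> \<open>Linearity is essential here: a merely sublinear generator would not let the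
        sign through.\<close>
      moreover have "gauss_gen \<mu> bs (- p t x) (- A t x) = - gauss_gen \<mu> bs (p t x) (A t x)"
      proof -
        have m: "(- B) *v z = - (B *v z)" for B :: "real ^ 'a ^ 'a" and z
          using matrix_vector_mult_diff_rdistrib[of 0 B z] by simp
        show ?thesis by (induction bs) (simp_all add: m)
      qed
      ultimately show "\<psi>t t x - gauss_gen \<mu> bs (p t x) (A t x) \<le> 0" by linarith
    qed
    moreover have "continuous_on ({0..} \<times> UNIV) (\<lambda>(t, x). - u t x)"
      using cu unfolding case_prod_unfold by (rule continuous_on_minus)
    moreover have "- u s x \<le> C - (norm x)\<^sup>2" if "s \<in> {a..r + 1}" for s x
      using growth[of s x] that a by simp
    moreover have "M-lipschitz_on UNIV (\<lambda>x. - g x)" using g by simp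
    ultimately have "- u r x \<le> conv (\<lambda>f. gauss \<mu> bs (r - a) f 0) (\<lambda>x. - g x) x"
      using a le by (intro P.subsolution_le) auto
    also have "\<dots> = gauss \<mu> bs (r - a) (\<lambda>x. - g x) x"
      using LipI[OF g] by (simp add: conv_gauss Lip_uminus)
    also have "\<dots> = - gauss \<mu> bs (r - a) g x"
      using averaging_cmult[OF averaging_gauss LipI[OF g], of \<mu> bs "r - a" "-1"] by simp
    finally show ?thesis by simp
  qed
  \<comment> \<open>The bound of \<open>step\<close> holds for each choice, hence for the supremum;
    the iterate at one grid time is the Lipschitz datum from which the next interval
    restarts.\<close>
  have iterate: "(conv (G.control h) ^^ k) f x \<le> u (k * h) x" if "k * h \<le> t" and h: "h \<ge> 0" for k h x
    using that(1)
  proof (induction k arbitrary: x)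
    case 0
    show ?case using init by simp
  next
    case (Suc k)
    let ?g = "(conv (G.control h) ^^ k) f"
    have g: "L-lipschitz_on UNIV ?g"
      using generated_family.iterate_lipschitz[OF G.control_family f h] .
    have "G.control h (\<lambda>y. ?g (x + y)) \<le> u (Suc k * h) x"
    proof (rule G.control_least)
      fix \<mu> bs assume \<theta>: "(\<mu>, bs) \<in> G.\<Theta>"
      have "gauss \<mu> bs (Suc k * h - k * h) ?g x \<le> u (Suc k * h) x"
      proof (intro step[OF \<theta> g])
        have "k * h \<le> t" using Suc.prems h by (simp add: algebra_simps)
        then show "?g x \<le> u (k * h) x" for x by (rule Suc.IH)
      qed (use h Suc.prems in \<open>auto simp: algebra_simps\<close>)
      moreover have "Suc k * h - k * h = h" by (simp add: algebra_simps)
      ultimately show "gauss \<mu> bs h (\<lambda>y. ?g (x + y)) 0 \<le> u (Suc k * h) x"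
        by (simp only: averaging_shift[OF averaging_gauss LipI[OF g]] add_0_right)
    qed
    then show ?case by (simp only: funpow.simps o_apply conv_def[of "G.control h" ?g])
  qed
  show ?thesis
  proof (cases "t = 0")
    case True
    then show ?thesis using init[of x] F.conv_zero[OF LipI[OF f]] by simp
  next
    case False
    then have t: "t > 0" using t by simp
    have "(\<lambda>n. (conv (G.control (t / n)) ^^ n) f x - (conv (F (t / n)) ^^ n) f x) \<longlonglongrightarrow> 0"
      by (rule generated_families_agree[OF F.generated_family_axioms G.control_family f t])
    moreover have ev: "\<forall>\<^sub>F n in sequentially. (conv (G.control (t / n)) ^^ n) f x - (conv (F (t / n)) ^^ n) f x
        \<le> u t x - conv (F t) f x"
      using eventually_gt_at_top[of "0::nat"]
    proof eventually_elim
      case (elim n)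
      then show ?case
        using iterate[of n "t / n" x] F.conv_power[OF _ LipI[OF f], of "t / n" n] t by simp
    qed
    ultimately have "0 \<le> u t x - conv (F t) f x"
      by (rule tendsto_upperbound) simp
    then show ?thesis by simp
  qed
qed

section \<open>The algebra of test functions\<close>

text \<open>Powers of \<open>1 + norm x + norm y\<close> multiply by adding exponents and increase
  with the exponent, which makes closure under sums and products immediate.\<close>

lemma C_lLip_iff:
  "\<phi> \<in> C_lLip norm \<longleftrightarrow> (\<exists>C m. \<forall>x y. \<bar>\<phi> x - \<phi> y\<bar> \<le> C * (1 + norm x + norm y) ^ m * norm (x - y))"
  for \<phi> :: "'a::real_normed_vector \<Rightarrow> real"
proof
  assume "\<phi> \<in> C_lLip norm"
  then obtain C m where C: "C > 0"
    and b: "\<And>x y. \<bar>\<phi> x - \<phi> y\<bar> \<le> C * (1 + norm x ^ m + norm y ^ m) * norm (x - y)"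
    unfolding C_lLip_def by blast
  have "\<bar>\<phi> x - \<phi> y\<bar> \<le> (3 * C) * (1 + norm x + norm y) ^ m * norm (x - y)" for x y
  proof -
    have "1 \<le> (1 + norm x + norm y) ^ m" by (rule one_le_power) simp
    moreover have "norm x ^ m \<le> (1 + norm x + norm y) ^ m"
      "norm y ^ m \<le> (1 + norm x + norm y) ^ m"
      by (intro power_mono; simp)+
    ultimately have "1 + norm x ^ m + norm y ^ m \<le> 3 * (1 + norm x + norm y) ^ m" by linarith
    then have "C * (1 + norm x ^ m + norm y ^ m) \<le> C * (3 * (1 + norm x + norm y) ^ m)"
      using C by (intro mult_left_mono) auto
    from mult_right_mono[OF this, of "norm (x - y)"] b[of x y] show ?thesis by (simp add: mult_ac)
  qed
  then show "\<exists>C m. \<forall>x y. \<bar>\<phi> x - \<phi> y\<bar> \<le> C * (1 + norm x + norm y) ^ m * norm (x - y)" by blast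
next
  assume "\<exists>C m. \<forall>x y. \<bar>\<phi> x - \<phi> y\<bar> \<le> C * (1 + norm x + norm y) ^ m * norm (x - y)"
  then obtain C m where b: "\<And>x y. \<bar>\<phi> x - \<phi> y\<bar> \<le> C * (1 + norm x + norm y) ^ m * norm (x - y)"
    by blast
  have "\<bar>\<phi> x - \<phi> y\<bar> \<le> ((\<bar>C\<bar> + 1) * 3 ^ m) * (1 + norm x ^ m + norm y ^ m) * norm (x - y)" for x y
  proof -
    let ?M = "max 1 (max (norm x) (norm y))"
    have "(1 + norm x + norm y) ^ m \<le> (3 * ?M) ^ m" by (intro power_mono) auto
    also have "\<dots> = 3 ^ m * ?M ^ m" by (simp add: power_mult_distrib)
    also have "?M ^ m \<le> 1 + norm x ^ m + norm y ^ m" by (auto simp: max_def)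
    finally have s: "(1 + norm x + norm y) ^ m \<le> 3 ^ m * (1 + norm x ^ m + norm y ^ m)" by simp
    have "\<bar>\<phi> x - \<phi> y\<bar> \<le> C * (1 + norm x + norm y) ^ m * norm (x - y)" by (rule b)
    also have "\<dots> \<le> (\<bar>C\<bar> + 1) * (3 ^ m * (1 + norm x ^ m + norm y ^ m)) * norm (x - y)"
      using s by (intro mult_right_mono mult_mono) auto
    finally show ?thesis by (simp add: mult_ac)
  qed
  moreover have "(\<bar>C\<bar> + 1) * 3 ^ m > 0" by (simp add: add_nonneg_pos)
  ultimately show "\<phi> \<in> C_lLip norm" unfolding C_lLip_def by blast
qed

lemma C_lLipD:
  fixes \<phi> :: "'a::real_normed_vector \<Rightarrow> real"
  assumes "\<phi> \<in> C_lLip norm"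
  obtains C m where "C \<ge> 0"
    "\<And>x y. \<bar>\<phi> x - \<phi> y\<bar> \<le> C * (1 + norm x + norm y) ^ m * norm (x - y)"
    "\<And>x. \<bar>\<phi> x\<bar> \<le> C * (1 + norm x) ^ m"
proof -
  obtain C m where b: "\<And>x y. \<bar>\<phi> x - \<phi> y\<bar> \<le> C * (1 + norm x + norm y) ^ m * norm (x - y)"
    using assms unfolding C_lLip_iff by blast
  define D where "D = \<bar>C\<bar> + \<bar>\<phi> 0\<bar>"
  show ?thesis
  proof (rule that[of D "Suc m"])
    show "D \<ge> 0" by (simp add: D_def)
    show "\<bar>\<phi> x - \<phi> y\<bar> \<le> D * (1 + norm x + norm y) ^ Suc m * norm (x - y)" for x y
    proof -
      have "C * (1 + norm x + norm y) ^ m \<le> D * (1 + norm x + norm y) ^ Suc m"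
        by (intro mult_mono power_increasing) (auto simp: D_def)
      from mult_right_mono[OF this, of "norm (x - y)"] b[of x y] show ?thesis by simp
    qed
    show "\<bar>\<phi> x\<bar> \<le> D * (1 + norm x) ^ Suc m" for x
    proof -
      have "\<bar>\<phi> x\<bar> \<le> \<bar>\<phi> 0\<bar> + C * (1 + norm x) ^ m * norm x" using b[of x 0] by simp
      also have "\<dots> \<le> \<bar>\<phi> 0\<bar> * (1 + norm x) ^ Suc m + \<bar>C\<bar> * (1 + norm x) ^ m * (1 + norm x)"
        using mult_left_mono[OF one_le_power[of "1 + norm x" "Suc m"], of "\<bar>\<phi> 0\<bar>"]
        by (intro add_mono mult_mono) auto
      finally show ?thesis by (simp add: D_def algebra_simps)
    qed
  qed
qed

lemma lipschitz_C_lLip: "L-lipschitz_on UNIV f \<Longrightarrow> f \<in> C_lLip norm"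
  for f :: "'a::real_normed_vector \<Rightarrow> real"
  unfolding C_lLip_iff using lipschitz_realD by (intro exI[of _ L] exI[of _ 0]) auto

lemma Lip_C_lLip: "Lip f \<Longrightarrow> f \<in> C_lLip norm"
  using lipschitz_C_lLip by (auto simp: Lip_def)

lemma C_lLip_const: "(\<lambda>_. c) \<in> C_lLip (norm :: 'a::real_normed_vector \<Rightarrow> real)"
  by (rule Lip_C_lLip[OF Lip_const])

lemma C_lLip_mult:
  fixes \<phi> \<psi> :: "'a::real_normed_vector \<Rightarrow> real"
  assumes "\<phi> \<in> C_lLip norm" "\<psi> \<in> C_lLip norm"
  shows "(\<lambda>x. \<phi> x * \<psi> x) \<in> C_lLip norm"
proof -
  obtain C m where 1: "C \<ge> 0"
    "\<And>x y. \<bar>\<phi> x - \<phi> y\<bar> \<le> C * (1 + norm x + norm y) ^ m * norm (x - y)"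
    "\<And>x. \<bar>\<phi> x\<bar> \<le> C * (1 + norm x) ^ m" by (rule C_lLipD[OF assms(1)]) (rule that)
  obtain D n where 2: "D \<ge> 0"
    "\<And>x y. \<bar>\<psi> x - \<psi> y\<bar> \<le> D * (1 + norm x + norm y) ^ n * norm (x - y)"
    "\<And>x. \<bar>\<psi> x\<bar> \<le> D * (1 + norm x) ^ n" by (rule C_lLipD[OF assms(2)]) (rule that)
  have "\<bar>\<phi> x * \<psi> x - \<phi> y * \<psi> y\<bar> \<le> (2 * C * D) * (1 + norm x + norm y) ^ (m + n) * norm (x - y)" for x y
  proof -
    let ?s = "1 + norm x + norm y"
    have "\<bar>\<phi> x\<bar> \<le> C * ?s ^ m"
      using order_trans[OF 1(3) mult_left_mono[OF power_mono 1(1)], of x ?s] by simp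
    then have a: "\<bar>\<phi> x\<bar> * \<bar>\<psi> x - \<psi> y\<bar> \<le> (C * ?s ^ m) * (D * ?s ^ n * norm (x - y))"
      using 2 1 by (intro mult_mono) auto
    have "\<bar>\<psi> y\<bar> \<le> D * ?s ^ n"
      using order_trans[OF 2(3) mult_left_mono[OF power_mono 2(1)], of y ?s] by simp
    then have b: "\<bar>\<phi> x - \<phi> y\<bar> * \<bar>\<psi> y\<bar> \<le> (C * ?s ^ m * norm (x - y)) * (D * ?s ^ n)"
      using 2 1 by (intro mult_mono) auto
    have "\<phi> x * \<psi> x - \<phi> y * \<psi> y = \<phi> x * (\<psi> x - \<psi> y) + (\<phi> x - \<phi> y) * \<psi> y"
      by (simp add: algebra_simps)
    then have "\<bar>\<phi> x * \<psi> x - \<phi> y * \<psi> y\<bar> \<le> \<bar>\<phi> x\<bar> * \<bar>\<psi> x - \<psi> y\<bar> + \<bar>\<phi> x - \<phi> y\<bar> * \<bar>\<psi> y\<bar>"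
      by (metis abs_mult abs_triangle_ineq)
    with a b show ?thesis by (simp add: power_add mult_ac)
  qed
  then show ?thesis unfolding C_lLip_iff by blast
qed

lemma C_lLip_cmult: "\<phi> \<in> C_lLip norm \<Longrightarrow> (\<lambda>x. c * \<phi> x) \<in> C_lLip norm"
  for \<phi> :: "'a::real_normed_vector \<Rightarrow> real"
  by (rule C_lLip_mult[OF C_lLip_const])

lemma C_lLip_power: "\<phi> \<in> C_lLip norm \<Longrightarrow> (\<lambda>x. \<phi> x ^ n) \<in> C_lLip norm"
  for \<phi> :: "'a::real_normed_vector \<Rightarrow> real"
  by (induction n) (auto intro: C_lLip_const C_lLip_mult)

lemma C_lLip_add:
  fixes \<phi> \<psi> :: "'a::real_normed_vector \<Rightarrow> real"
  assumes "\<phi> \<in> C_lLip norm" "\<psi> \<in> C_lLip norm"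
  shows "(\<lambda>x. \<phi> x + \<psi> x) \<in> C_lLip norm"
proof -
  obtain C m where 1: "C \<ge> 0"
    "\<And>x y. \<bar>\<phi> x - \<phi> y\<bar> \<le> C * (1 + norm x + norm y) ^ m * norm (x - y)"
    "\<And>x. \<bar>\<phi> x\<bar> \<le> C * (1 + norm x) ^ m" by (rule C_lLipD[OF assms(1)]) (rule that)
  obtain D n where 2: "D \<ge> 0"
    "\<And>x y. \<bar>\<psi> x - \<psi> y\<bar> \<le> D * (1 + norm x + norm y) ^ n * norm (x - y)"
    "\<And>x. \<bar>\<psi> x\<bar> \<le> D * (1 + norm x) ^ n" by (rule C_lLipD[OF assms(2)]) (rule that)
  have "\<bar>(\<phi> x + \<psi> x) - (\<phi> y + \<psi> y)\<bar> \<le> (C + D) * (1 + norm x + norm y) ^ (m + n) * norm (x - y)" for x y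
  proof -
    let ?s = "1 + norm x + norm y"
    have "C * ?s ^ m * norm (x - y) \<le> C * ?s ^ (m + n) * norm (x - y)"
      "D * ?s ^ n * norm (x - y) \<le> D * ?s ^ (m + n) * norm (x - y)"
      using 1(1) 2(1) by (intro mult_right_mono mult_left_mono power_increasing; simp)+
    then show ?thesis using 1(2)[of x y] 2(2)[of x y] unfolding distrib_right by linarith
  qed
  then show ?thesis unfolding C_lLip_iff by blast
qed

lemma C_lLip_compose_linear:
  fixes L :: "'a::real_normed_vector \<Rightarrow> 'b::real_normed_vector"
  shows "\<phi> \<in> C_lLip norm \<Longrightarrow> bounded_linear L \<Longrightarrow> (\<lambda>x. \<phi> (L x)) \<in> C_lLip norm"
  using C_lLip_affine[of \<phi> L 0] by simp

lemma C_lLip_norm_linear: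
  fixes L :: "'a::real_normed_vector \<Rightarrow> 'b::real_normed_vector"
  shows "bounded_linear L \<Longrightarrow> (\<lambda>x. norm (L x)) \<in> C_lLip norm"
  by (rule C_lLip_compose_linear[OF lipschitz_C_lLip[OF lipschitz_norm]])

lemma C_lLip_linear: "bounded_linear L \<Longrightarrow> L \<in> C_lLip norm"
  for L :: "'a::real_normed_vector \<Rightarrow> real"
  using bounded_linear.lipschitz_boundE[of L] lipschitz_C_lLip by metis


section \<open>Pairs of random vectors on a sublinear expectation space\<close>

lemma random_vector_Pair:
  fixes X :: "'w \<Rightarrow> 'a::euclidean_space" and Y :: "'w \<Rightarrow> 'b::euclidean_space"
  assumes "random_vector H X" "random_vector H Y"
  shows "random_vector H (\<lambda>\<omega>. (X \<omega>, Y \<omega>))"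
  using assms unfolding random_vector_def Basis_prod_def by auto

lemma (in sublinear_expectation) uminus_ge:
  assumes U: "U \<in> H"
  shows "0 \<le> E U + E (\<lambda>\<omega>. - U \<omega>)"
proof -
  have m: "(\<lambda>\<omega>. - U \<omega>) \<in> H" using scale_in[OF U, of "-1"] by simp
  show ?thesis using subadd[OF U m] const[of 0] by simp
qed

lemma (in sublinear_expectation) random_vector_inner:
  assumes "random_vector H Z"
  shows "(\<lambda>\<omega>. p \<bullet> Z \<omega>) \<in> H"
  by (rule comp_in[OF assms C_lLip_linear[OF bounded_linear_inner_right]])

text \<open>Subadditivity over the coordinates gives only an upper bound; applied to
  \<open>p\<close> and \<open>- p\<close> and combined with \<open>uminus_ge\<close>, it gives
  equality. Negative coefficients use the mean of \<open>- Z\<close>.\<close>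

lemma (in sublinear_expectation) mean_zero:
  fixes Z :: "'w \<Rightarrow> real ^ 'd"
  assumes Z: "random_vector H Z"
    and z: "vec_expectation E Z = 0" "vec_expectation E (\<lambda>\<omega>. - Z \<omega>) = 0"
  shows "E (\<lambda>\<omega>. p \<bullet> Z \<omega>) = 0"
proof -
  have zi: "(\<lambda>\<omega>. Z \<omega> $ i) \<in> H" for i
    using random_vector_inner[OF Z, of "axis i 1"] by (simp add: inner_axis')
  have e: "E (\<lambda>\<omega>. c * Z \<omega> $ i) = 0" for c i
  proof (cases "c \<ge> 0")
    case True
    then show ?thesis using pos_homog[OF zi, of c i] z(1) by (simp add: vec_expectation_def vec_eq_iff)
  next
    case False
    have "(\<lambda>\<omega>. - Z \<omega> $ i) \<in> H" using scale_in[OF zi, of "-1" i] by simp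
    from pos_homog[OF this, of "- c"] False z(2) show ?thesis
      by (simp add: vec_expectation_def vec_eq_iff)
  qed
  have le: "E (\<lambda>\<omega>. q \<bullet> Z \<omega>) \<le> 0" for q
  proof -
    have "(\<lambda>\<omega>. \<Sum>i\<in>S. q $ i * Z \<omega> $ i) \<in> H \<and> E (\<lambda>\<omega>. \<Sum>i\<in>S. q $ i * Z \<omega> $ i) \<le> 0" if "finite S" for S
      using that
    proof induction
      case empty
      show ?case using const_in[of 0] const[of 0] by simp
    next
      case (insert i S)
      have q: "(\<lambda>\<omega>. q $ i * Z \<omega> $ i) \<in> H" by (rule scale_in[OF zi])
      show ?case
        using insert add_in[OF q, of "\<lambda>\<omega>. \<Sum>i\<in>S. q $ i * Z \<omega> $ i"]
          subadd[OF q, of "\<lambda>\<omega>. \<Sum>i\<in>S. q $ i * Z \<omega> $ i"] e[of "q $ i" i] by simp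
    qed
    from this[of UNIV] show ?thesis by (simp add: inner_vec_def)
  qed
  show ?thesis
    using le[of p] le[of "- p"] uminus_ge[OF random_vector_inner[OF Z, of p]] by simp
qed

locale expectation_pair = sublinear_expectation H E
  for H :: "('w \<Rightarrow> real) set" and E :: "('w \<Rightarrow> real) \<Rightarrow> real" +
  fixes X Y :: "'w \<Rightarrow> real ^ 'd"
  assumes X: "random_vector H X" and Y: "random_vector H Y"
    and X_mean: "E (\<lambda>\<omega>. p \<bullet> X \<omega>) = 0"
begin

definition law :: "real \<Rightarrow> (real ^ 'd \<Rightarrow> real) \<Rightarrow> real" where
  "law h f = E (\<lambda>\<omega>. f (sqrt h *\<^sub>R X \<omega> + h *\<^sub>R Y \<omega>))"

lemma comp_pair_in: "\<psi> \<in> C_lLip norm \<Longrightarrow> (\<lambda>\<omega>. \<psi> (X \<omega>, Y \<omega>)) \<in> H"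
  by (rule comp_in[OF random_vector_Pair[OF X Y]])

lemma bounded_linear_combination: "bounded_linear (\<lambda>z :: (real ^ 'd) \<times> (real ^ 'd). a *\<^sub>R fst z + b *\<^sub>R snd z)"
  by (intro bounded_linear_intros)

lemma comp_step_in:
  assumes "\<phi> \<in> C_lLip norm"
  shows "(\<lambda>\<omega>. \<phi> (x + (a *\<^sub>R X \<omega> + b *\<^sub>R Y \<omega>))) \<in> H"
  using comp_pair_in[OF C_lLip_affine[OF assms bounded_linear_combination[of a b], of x]]
  by (simp add: add.commute)

lemma comp_step_in': "\<phi> \<in> C_lLip norm \<Longrightarrow> (\<lambda>\<omega>. \<phi> (a *\<^sub>R X \<omega> + b *\<^sub>R Y \<omega>)) \<in> H"
  using comp_step_in[of \<phi> 0] by simp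

text \<open>A single variable dominating both vectors. Its powers are test functions of the pair, so
  all its moments are finite; these are the constants in the estimates below.\<close>

definition size :: "nat \<Rightarrow> 'w \<Rightarrow> real" where
  "size k \<omega> = (norm (X \<omega>) + norm (Y \<omega>)) ^ k"

lemma size_in: "size k \<in> H"
proof -
  have "(\<lambda>z :: (real ^ 'd) \<times> (real ^ 'd). (norm (fst z) + norm (snd z)) ^ k) \<in> C_lLip norm"
    by (intro C_lLip_power C_lLip_add C_lLip_norm_linear bounded_linear_fst bounded_linear_snd)
  from comp_pair_in[OF this] show ?thesis by (simp add: size_def[abs_def])
qed

lemma E_size_nonneg: "0 \<le> E (size k)"
  using mono[OF size_in const_in[of 0], of k] const[of 0] by (simp add: size_def)

lemma step_norm_le:
  assumes "0 \<le> h" "h \<le> 1"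
  shows "norm (sqrt h *\<^sub>R X \<omega> + h *\<^sub>R Y \<omega>) \<le> sqrt h * (norm (X \<omega>) + norm (Y \<omega>))"
proof -
  have "norm (sqrt h *\<^sub>R X \<omega> + h *\<^sub>R Y \<omega>) \<le> sqrt h * norm (X \<omega>) + h * norm (Y \<omega>)"
    using norm_triangle_ineq[of "sqrt h *\<^sub>R X \<omega>" "h *\<^sub>R Y \<omega>"] assms by simp
  also have "\<dots> \<le> sqrt h * norm (X \<omega>) + sqrt h * norm (Y \<omega>)"
    using sqrt_bounds(1)[OF assms] by (intro add_left_mono mult_right_mono) auto
  finally show ?thesis by (simp add: algebra_simps)
qed

text \<open>Both signs of a linear functional of \<open>X\<close> have expectation 0, so
  subadditivity can be used to add the term and to remove it again.\<close>

lemma E_add_mean_zero: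
  assumes U: "U \<in> H"
  shows "E (\<lambda>\<omega>. U \<omega> + p \<bullet> X \<omega>) = E U"
proof (rule antisym)
  have pX: "(\<lambda>\<omega>. q \<bullet> X \<omega>) \<in> H" for q by (rule random_vector_inner[OF X])
  show "E (\<lambda>\<omega>. U \<omega> + p \<bullet> X \<omega>) \<le> E U" using subadd[OF U pX[of p]] X_mean by simp
  show "E U \<le> E (\<lambda>\<omega>. U \<omega> + p \<bullet> X \<omega>)"
    using subadd[OF add_in[OF U pX[of p]] pX[of "- p"]] X_mean[of "- p"] by simp
qed

lemma E_add_const:
  assumes U: "U \<in> H"
  shows "E (\<lambda>\<omega>. c + U \<omega>) = c + E U"
proof (rule antisym)
  show "E (\<lambda>\<omega>. c + U \<omega>) \<le> c + E U" using subadd[OF const_in[of c] U] const by simp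
  show "c + E U \<le> E (\<lambda>\<omega>. c + U \<omega>)"
    using subadd[OF const_in[of "- c"] add_in[OF const_in[of c] U]] const[of "- c"] by simp
qed

abbreviation "G \<equiv> G_function E X Y"

lemma quadratic_in: "(\<lambda>\<omega>. p \<bullet> Y \<omega> + 1/2 * ((A *v X \<omega>) \<bullet> X \<omega>)) \<in> H"
proof -
  have lin: "bounded_linear (\<lambda>z :: (real ^ 'd) \<times> (real ^ 'd). q \<bullet> fst z)"
    "bounded_linear (\<lambda>z :: (real ^ 'd) \<times> (real ^ 'd). q \<bullet> snd z)" for q
    by (intro bounded_linear_inner_right_comp bounded_linear_fst bounded_linear_snd)+
  have "(\<lambda>z :: (real ^ 'd) \<times> (real ^ 'd). \<Sum>i\<in>S. (A $ i \<bullet> fst z) * (axis i 1 \<bullet> fst z)) \<in> C_lLip norm"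
    if "finite S" for S
    using that
  proof induction
    case empty
    show ?case using C_lLip_const[of 0] by simp
  next
    case (insert i S)
    have "(\<lambda>z :: (real ^ 'd) \<times> (real ^ 'd). (A $ i \<bullet> fst z) * (axis i 1 \<bullet> fst z)) \<in> C_lLip norm"
      by (intro C_lLip_mult C_lLip_linear lin)
    from C_lLip_add[OF this insert.IH] insert.hyps show ?case by simp
  qed
  from this[of UNIV] have "(\<lambda>z :: (real ^ 'd) \<times> (real ^ 'd). (A *v fst z) \<bullet> fst z) \<in> C_lLip norm"
    by (simp add: inner_vec_def[of "A *v _"] matrix_vector_mul_component inner_axis')
  from comp_pair_in[OF C_lLip_add[OF C_lLip_linear[OF lin(2)[of p]] C_lLip_cmult[OF this, of "1/2"]]]
  show ?thesis by simp
qed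

lemma E_affine_quadratic:
  assumes "h \<ge> 0"
  shows "E (\<lambda>\<omega>. c + (h * (p \<bullet> Y \<omega> + 1/2 * ((A *v X \<omega>) \<bullet> X \<omega>)) + q \<bullet> X \<omega>)) = c + h * G p A"
proof -
  let ?U = "\<lambda>\<omega>. h * (p \<bullet> Y \<omega> + 1/2 * ((A *v X \<omega>) \<bullet> X \<omega>))"
  have U: "?U \<in> H" by (rule scale_in[OF quadratic_in])
  have "E ?U = h * G p A"
    unfolding G_function_def by (rule pos_homog[OF quadratic_in assms])
  then show ?thesis
    using E_add_const[OF add_in[OF U random_vector_inner[OF X, of q]], of c] E_add_mean_zero[OF U, of q]
    by simp
qed

text \<open>Only the part quadratic in \<open>X\<close> has order \<open>h\<close>; the mixed terms
  have order \<open>h * sqrt h\<close> and the part quadratic in \<open>Y\<close> has order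
  \<open>h\<^sup>2\<close>.\<close>

lemma quadratic_step_error:
  assumes h: "0 \<le> h" "h \<le> 1"
  shows "\<bar>(A *v (sqrt h *\<^sub>R X \<omega> + h *\<^sub>R Y \<omega>)) \<bullet> (sqrt h *\<^sub>R X \<omega> + h *\<^sub>R Y \<omega>) / 2 - h * (1/2 * ((A *v X \<omega>) \<bullet> X \<omega>))\<bar>
    \<le> norm A * (h * sqrt h) * size 2 \<omega>"
proof -
  let ?x = "X \<omega>" and ?y = "Y \<omega>"
  have hh: "sqrt h * sqrt h = h" using h by simp
  have "(A *v (sqrt h *\<^sub>R ?x + h *\<^sub>R ?y)) \<bullet> (sqrt h *\<^sub>R ?x + h *\<^sub>R ?y)
      = (sqrt h * sqrt h) * ((A *v ?x) \<bullet> ?x) + (h * sqrt h) * ((A *v ?x) \<bullet> ?y + (A *v ?y) \<bullet> ?x) + (h * h) * ((A *v ?y) \<bullet> ?y)"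
    by (simp add: matrix_vector_right_distrib matrix_vector_mult_scaleR inner_add_left inner_add_right
        distrib_left del: real_sqrt_mult_self)
  then have "(A *v (sqrt h *\<^sub>R ?x + h *\<^sub>R ?y)) \<bullet> (sqrt h *\<^sub>R ?x + h *\<^sub>R ?y) / 2 - h * (1/2 * ((A *v ?x) \<bullet> ?x))
      = ((h * sqrt h) * ((A *v ?x) \<bullet> ?y + (A *v ?y) \<bullet> ?x) + (h * h) * ((A *v ?y) \<bullet> ?y)) / 2"
    unfolding hh by (simp add: add_divide_distrib)
  also have "\<bar>\<dots>\<bar> \<le> ((h * sqrt h) * (2 * (norm A * norm ?x * norm ?y)) + (h * sqrt h) * (norm A * norm ?y * norm ?y)) / 2"
  proof -
    have "\<bar>(A *v ?x) \<bullet> ?y + (A *v ?y) \<bullet> ?x\<bar> \<le> 2 * (norm A * norm ?x * norm ?y)"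
      using quadratic_form_le[of A ?x ?y] quadratic_form_le[of A ?y ?x] by (simp add: mult_ac)
    then have 1: "\<bar>(h * sqrt h) * ((A *v ?x) \<bullet> ?y + (A *v ?y) \<bullet> ?x)\<bar> \<le> (h * sqrt h) * (2 * (norm A * norm ?x * norm ?y))"
      using h by (simp add: abs_mult mult_left_mono)
    have hh': "h * h \<le> h * sqrt h" using sqrt_bounds(2)[OF h] by (simp only: power2_eq_square)
    have "(h * h) * \<bar>(A *v ?y) \<bullet> ?y\<bar> \<le> (h * sqrt h) * (norm A * norm ?y * norm ?y)"
      by (rule mult_mono[OF hh' quadratic_form_le]) (use h in auto)
    then have 2: "\<bar>(h * h) * ((A *v ?y) \<bullet> ?y)\<bar> \<le> (h * sqrt h) * (norm A * norm ?y * norm ?y)"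
      using h by (simp add: abs_mult)
    show ?thesis
      unfolding abs_divide abs_numeral
      by (rule divide_right_mono[OF order_trans[OF abs_triangle_ineq add_mono[OF 1 2]]]) simp
  qed
  also have "\<dots> = norm A * (h * sqrt h) * (norm ?x * norm ?y + norm ?y * norm ?y / 2)"
    by (simp add: algebra_simps)
  also have "\<dots> \<le> norm A * (h * sqrt h) * size 2 \<omega>"
  proof (rule mult_left_mono)
    have "0 \<le> norm ?x * norm ?x" "0 \<le> norm ?x * norm ?y" "0 \<le> norm ?y * norm ?y" by auto
    then show "norm ?x * norm ?y + norm ?y * norm ?y / 2 \<le> size 2 \<omega>"
      by (simp add: size_def power2_eq_square algebra_simps)
  qed (use h in auto)
  finally show ?thesis .
qed

lemma law_sublinear: "sublinear_functional (law h)"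
proof
  fix f g :: "real ^ 'd \<Rightarrow> real" and c
  show "law h (\<lambda>_. c) = c" by (simp add: law_def const)
  assume f: "Lip f"
  note fi = comp_step_in'[OF Lip_C_lLip[OF f]]
  show "law h (\<lambda>x. c * f x) = c * law h f" if "0 \<le> c"
    unfolding law_def by (rule pos_homog[OF fi that])
  assume g: "Lip g"
  note gi = comp_step_in'[OF Lip_C_lLip[OF g]]
  show "law h (\<lambda>x. f x + g x) \<le> law h f + law h g"
    unfolding law_def by (rule subadd[OF fi gi])
  show "law h f \<le> law h g" if "\<And>x. f x \<le> g x"
    unfolding law_def by (rule mono[OF gi fi that])
qed

text \<open>In the Taylor expansion at 0 the term linear in \<open>X\<close>, of order
  \<open>sqrt h\<close>, disappears under \<open>E\<close> by the mean condition; the terms of order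
  \<open>h\<close> give exactly \<open>G\<close>, and moments of \<open>size\<close> bound the
  rest.\<close>

lemma law_generator: "has_generator law G"
  unfolding has_generator_def
proof
  fix K
  define C where "C = \<bar>K\<bar> * (E (size 3) + E (size 2))"
  have "\<bar>law h g - g 0 - h * G (p 0) (A 0)\<bar> \<le> C * h * sqrt h"
    if g: "C21 K g p A" and h: "0 < h" "h \<le> 1" for g p A h
  proof -
    note K = C21_bounds[OF g]
    let ?z = "\<lambda>\<omega>. sqrt h *\<^sub>R X \<omega> + h *\<^sub>R Y \<omega>"
    let ?U = "\<lambda>\<omega>. g 0 + (h * (p 0 \<bullet> Y \<omega> + 1/2 * ((A 0 *v X \<omega>) \<bullet> X \<omega>)) + (sqrt h *\<^sub>R p 0) \<bullet> X \<omega>)"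
    let ?W = "\<lambda>\<omega>. (K * (h * sqrt h)) * (size 3 \<omega> + size 2 \<omega>)"
    have hs: "h * sqrt h \<ge> 0" using h by simp
    have le: "\<bar>g (?z \<omega>) - ?U \<omega>\<bar> \<le> ?W \<omega>" for \<omega>
    proof -
      have "K * norm (?z \<omega>) ^ 3 \<le> K * (sqrt h * (norm (X \<omega>) + norm (Y \<omega>))) ^ 3"
        using step_norm_le[of h \<omega>] h K(1) by (intro mult_left_mono power_mono) auto
      also have "\<dots> = (K * (h * sqrt h)) * size 3 \<omega>"
      proof -
        have "sqrt h ^ 3 = h * sqrt h" using h by (simp add: eval_nat_numeral)
        then show ?thesis by (simp only: size_def power_mult_distrib mult.assoc)
      qed
      finally have 1: "\<bar>g (?z \<omega>) - g 0 - p 0 \<bullet> ?z \<omega> - (A 0 *v ?z \<omega>) \<bullet> ?z \<omega> / 2\<bar> \<le> (K * (h * sqrt h)) * size 3 \<omega>"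
        using K(3)[of 0 "?z \<omega>"] by simp
      have "norm (A 0) * (h * sqrt h) * size 2 \<omega> \<le> K * (h * sqrt h) * size 2 \<omega>"
        using K(2) hs by (intro mult_right_mono) (auto simp: size_def)
      then have 2: "\<bar>(A 0 *v ?z \<omega>) \<bullet> ?z \<omega> / 2 - h * (1/2 * ((A 0 *v X \<omega>) \<bullet> X \<omega>))\<bar> \<le> (K * (h * sqrt h)) * size 2 \<omega>"
        using quadratic_step_error[of h "A 0" \<omega>] h by linarith
      have 3: "p 0 \<bullet> ?z \<omega> = h * (p 0 \<bullet> Y \<omega>) + (sqrt h *\<^sub>R p 0) \<bullet> X \<omega>" by (simp add: inner_add_right)
      show ?thesis using 1 2 3 unfolding distrib_left by linarith
    qed
    have "\<bar>E (\<lambda>\<omega>. g (?z \<omega>)) - E ?U\<bar> \<le> E ?W"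
    proof (rule abs_diff_le[OF _ _ _ le])
      show "(\<lambda>\<omega>. g (?z \<omega>)) \<in> H" by (rule comp_step_in'[OF Lip_C_lLip[OF C21_Lip[OF g]]])
      show "?U \<in> H" by (intro add_in const_in scale_in quadratic_in random_vector_inner[OF X])
      show "?W \<in> H" by (intro add_in scale_in size_in)
    qed
    also have "E ?W = (K * (h * sqrt h)) * E (\<lambda>\<omega>. size 3 \<omega> + size 2 \<omega>)"
      using K(1) hs by (intro pos_homog add_in size_in) auto
    also have "\<dots> \<le> (K * (h * sqrt h)) * (E (size 3) + E (size 2))"
      using K(1) hs by (intro mult_left_mono subadd size_in) auto
    also have "\<dots> = C * h * sqrt h" using K(1) by (simp add: C_def)
    finally have "\<bar>law h g - E ?U\<bar> \<le> C * h * sqrt h" by (simp only: law_def)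
    moreover have "E ?U = g 0 + h * G (p 0) (A 0)" using h by (intro E_affine_quadratic) simp
    ultimately show ?thesis by simp
  qed
  then show "\<exists>C. \<forall>g p A. C21 K g p A \<longrightarrow> (\<forall>h. 0 < h \<and> h \<le> 1 \<longrightarrow>
      \<bar>law h g - g 0 - h * G (p 0) (A 0)\<bar> \<le> C * h * sqrt h)" by blast
qed

lemma law_family: "generated_family law G"
  by (intro generated_family.intro law_sublinear law_generator)

lemma G_sublinear_generator: "sublinear_generator G"
proof
  fix p q :: "real ^ 'd" and A B :: "real ^ 'd ^ 'd" and c :: real
  have "G (p + q) (A + B) = E (\<lambda>\<omega>. (p \<bullet> Y \<omega> + 1/2 * ((A *v X \<omega>) \<bullet> X \<omega>)) + (q \<bullet> Y \<omega> + 1/2 * ((B *v X \<omega>) \<bullet> X \<omega>)))"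
    unfolding G_function_def
    by (simp add: inner_add_left matrix_vector_mult_add_rdistrib distrib_left add_ac)
  also have "\<dots> \<le> G p A + G q B"
    unfolding G_function_def by (rule subadd[OF quadratic_in quadratic_in])
  finally show "G (p + q) (A + B) \<le> G p A + G q B" .
  show "G (c *\<^sub>R p) (c *\<^sub>R A) = c * G p A" if "c \<ge> 0"
    using pos_homog[OF quadratic_in that, of p A]
    by (simp add: G_function_def scaleR_matrix_vector_assoc[symmetric] distrib_left mult_ac)
  show "G 0 A \<le> 0" if "\<And>z. (A *v z) \<bullet> z \<le> 0"
    using mono[OF const_in[of 0] quadratic_in[of 0 A]] that const[of 0] by (simp add: G_function_def)
  have "G p 0 \<le> E (size 1) * norm p" for p
  proof -
    have "p \<bullet> Y \<omega> \<le> norm p * size 1 \<omega>" for \<omega>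
    proof -
      have "p \<bullet> Y \<omega> \<le> norm p * norm (Y \<omega>)" by (rule norm_cauchy_schwarz)
      also have "\<dots> \<le> norm p * size 1 \<omega>" by (intro mult_left_mono) (auto simp: size_def)
      finally show ?thesis .
    qed
    then have "G p 0 \<le> E (\<lambda>\<omega>. norm p * size 1 \<omega>)"
      using mono[OF scale_in[OF size_in, of "norm p" 1] quadratic_in[of p 0]] by (simp add: G_function_def)
    then show ?thesis using pos_homog[OF size_in, of "norm p" 1] by (simp add: mult.commute)
  qed
  then show "\<exists>C. \<forall>p. G p 0 \<le> C * norm p" by blast
qed

end

section \<open>The value function of a G-distributed pair is a viscosity solution\<close>

text \<open>Mean value theorem in time at the displaced point, Taylor expansion in space at time
  \<open>t\<close>. The time step goes backwards to match the identity
  \<open>val t = val h (val (t - h))\<close> used later.\<close>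

lemma C12_test_expansion:
  fixes \<psi> :: "real \<Rightarrow> real ^ 'd \<Rightarrow> real"
  assumes \<psi>: "C12_test \<psi> \<psi>t p A" and t: "t > 0" and \<delta>: "\<delta> > 0"
  shows "\<exists>r>0. \<forall>h z. 0 < h \<and> h < r \<and> norm z < r \<longrightarrow>
    \<bar>\<psi> (t - h) (x + z) - \<psi> t x + h * \<psi>t t x - p t x \<bullet> z - (A t x *v z) \<bullet> z / 2\<bar> \<le> \<delta> * (h + (norm z)\<^sup>2)"
proof -
  have dt: "((\<lambda>s. \<psi> s y) has_real_derivative \<psi>t s y) (at s)"
    and dx: "(\<psi> s has_derivative (\<lambda>h. p s y \<bullet> h)) (at y)"
    and dp: "(p s has_derivative (\<lambda>h. A s y *v h)) (at y)" if "s > 0" for s y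
    using \<psi> that unfolding C12_test_def by blast+
  have "continuous_on ({0<..} \<times> UNIV) (\<lambda>(t, x). \<psi>t t x)" using \<psi> unfolding C12_test_def by blast
  moreover have "open (({0<..} :: real set) \<times> (UNIV :: (real ^ 'd) set))" by (intro open_Times) auto
  ultimately have "isCont (\<lambda>(t, x). \<psi>t t x) (t, x)"
    using t by (auto simp: continuous_on_eq_continuous_at)
  then obtain d1 where d1: "d1 > 0" "\<And>z. dist z (t, x) < d1 \<Longrightarrow> dist (case z of (t, x) \<Rightarrow> \<psi>t t x) (\<psi>t t x) < \<delta>"
    unfolding continuous_at_eps_delta using \<delta> by (metis case_prod_conv)
  obtain d2 where d2: "d2 > 0"
    "\<And>y. norm (y - x) < d2 \<Longrightarrow> norm (p t y - p t x - A t x *v (y - x)) \<le> \<delta> * norm (y - x)"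
    using dp[OF t, of x] \<delta> unfolding has_derivative_at_alt by blast
  define r where "r = min (min (d1 / 2) d2) t"
  show ?thesis
  proof (intro exI[of _ r] conjI allI impI)
    show "r > 0" using d1 d2 t by (simp add: r_def)
    fix h z assume "0 < h \<and> h < r \<and> norm (z :: real ^ 'd) < r"
    then have h: "0 < h" "h < d1 / 2" "h < t" and z: "norm z < d1 / 2" "norm z < d2" by (auto simp: r_def)
    have "t - h < t" "t - h > 0" using h by auto
    obtain \<xi> where \<xi>: "t - h < \<xi>" "\<xi> < t" "\<psi> t (x + z) - \<psi> (t - h) (x + z) = (t - (t - h)) * \<psi>t \<xi> (x + z)"
      using MVT2[OF \<open>t - h < t\<close>, of "\<lambda>s. \<psi> s (x + z)" "\<lambda>s. \<psi>t s (x + z)"] dt \<open>t - h > 0\<close> by auto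
    have "dist (\<xi>, x + z) (t, x) \<le> \<bar>\<xi> - t\<bar> + norm z"
      using sqrt_sum_squares_le_sum_abs[of "\<xi> - t" "norm z"] by (simp add: dist_norm norm_Pair)
    also have "\<dots> < d1" using \<xi> h z by linarith
    finally have "\<bar>\<psi>t \<xi> (x + z) - \<psi>t t x\<bar> \<le> \<delta>" using d1(2) by (fastforce simp: dist_real_def)
    then have "\<bar>h * (\<psi>t \<xi> (x + z) - \<psi>t t x)\<bar> \<le> h * \<delta>" using h by (simp add: abs_mult)
    then have 1: "\<bar>\<psi> (t - h) (x + z) - \<psi> t (x + z) + h * \<psi>t t x\<bar> \<le> \<delta> * h"
      using \<xi>(3) by (simp add: algebra_simps abs_minus_commute)
    have "\<bar>\<psi> t (x + z) - \<psi> t x - p t x \<bullet> z - (A t x *v z) \<bullet> z / 2\<bar> \<le> \<delta> * norm z * norm z"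
    proof (rule taylor_second_order[OF dx[OF t]])
      fix s :: real assume s: "s \<in> {0..1}"
      have le: "norm (s *\<^sub>R z) \<le> norm z" using s by (simp add: mult_left_le_one_le)
      then have "norm (p t (x + s *\<^sub>R z) - p t x - A t x *v (s *\<^sub>R z)) \<le> \<delta> * norm (s *\<^sub>R z)"
        using d2(2)[of "x + s *\<^sub>R z"] z by simp
      also have "\<dots> \<le> \<delta> * norm z" using le \<delta> by (intro mult_left_mono) auto
      finally show "norm (p t (x + s *\<^sub>R z) - p t x - A t x *v (s *\<^sub>R z)) \<le> \<delta> * norm z" .
    qed
    then have 2: "\<bar>\<psi> t (x + z) - \<psi> t x - p t x \<bullet> z - (A t x *v z) \<bullet> z / 2\<bar> \<le> \<delta> * (norm z)\<^sup>2"
      by (simp add: power2_eq_square mult.assoc)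
    from 1 2 show "\<bar>\<psi> (t - h) (x + z) - \<psi> t x + h * \<psi>t t x - p t x \<bullet> z - (A t x *v z) \<bullet> z / 2\<bar>
        \<le> \<delta> * (h + (norm z)\<^sup>2)"
      unfolding distrib_left by linarith
  qed
qed

text \<open>For \<open>a = b = 1\<close> and a linear test function of the first component, the
  defining identity reads \<open>m + m = sqrt 2 * m\<close>.\<close>

lemma (in sublinear_expectation) G_distributed_mean_zero:
  fixes X \<eta> :: "'w \<Rightarrow> real ^ 'd"
  assumes X: "random_vector H X" and G: "G_distributed E X \<eta>"
  shows "E (\<lambda>\<omega>. p \<bullet> X \<omega>) = 0"
proof -
  define m where "m = E (\<lambda>\<omega>. p \<bullet> X \<omega>)"
  have U: "(\<lambda>\<omega>. p \<bullet> X \<omega>) \<in> H" by (rule random_vector_inner[OF X])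
  have shift: "E (\<lambda>\<omega>. c + p \<bullet> X \<omega>) = c + m" for c
  proof (rule antisym)
    show "E (\<lambda>\<omega>. c + p \<bullet> X \<omega>) \<le> c + m" using subadd[OF const_in[of c] U] const by (simp add: m_def)
    show "c + m \<le> E (\<lambda>\<omega>. c + p \<bullet> X \<omega>)"
      using subadd[OF const_in[of "- c"] add_in[OF const_in[of c] U]] const[of "- c"] by (simp add: m_def)
  qed
  have "(\<lambda>z :: (real ^ 'd) \<times> (real ^ 'd). p \<bullet> fst z) \<in> C_lLip norm"
    by (intro C_lLip_linear bounded_linear_inner_right_comp bounded_linear_fst)
  from G[unfolded G_distributed_def, rule_format, OF _ _ this, of 1 1]
  have "E (\<lambda>\<omega>. E (\<lambda>\<omega>'. p \<bullet> (1 *\<^sub>R X \<omega> + 1 *\<^sub>R X \<omega>'))) = E (\<lambda>\<omega>. p \<bullet> (sqrt (1\<^sup>2 + 1\<^sup>2) *\<^sub>R X \<omega>))"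
    by simp
  then have "E (\<lambda>\<omega>. m + p \<bullet> X \<omega>) = E (\<lambda>\<omega>. sqrt 2 * (p \<bullet> X \<omega>))"
    by (simp add: inner_add_right shift add.commute)
  then have "m + m = sqrt 2 * m"
    using pos_homog[OF U, of "sqrt 2"] by (simp add: shift m_def)
  then have "(2 - sqrt 2) * m = 0" by (simp add: algebra_simps)
  moreover have "sqrt 2 \<noteq> 2" using real_sqrt_less_mono[of 2 4] by simp
  ultimately show ?thesis by (simp add: m_def)
qed

locale G_pair = expectation_pair H E X \<eta>
  for H :: "('w \<Rightarrow> real) set" and E :: "('w \<Rightarrow> real) \<Rightarrow> real" and X \<eta> :: "'w \<Rightarrow> real ^ 'd" +
  assumes G_distributed: "G_distributed E X \<eta>"
begin

abbreviation val :: "real \<Rightarrow> (real ^ 'd \<Rightarrow> real) \<Rightarrow> real ^ 'd \<Rightarrow> real" where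
  "val t \<equiv> conv (law t)"

lemma val_eq: "val t \<phi> x = E (\<lambda>\<omega>. \<phi> (x + (sqrt t *\<^sub>R X \<omega> + t *\<^sub>R \<eta> \<omega>)))"
  by (simp add: conv_def law_def)

lemma val_zero: "val 0 \<phi> x = \<phi> x"
  by (simp add: val_eq const)

text \<open>The defining identity with \<open>a = sqrt s\<close> and \<open>b = sqrt t\<close>,
  tested on functions of the sum of the two components: the square roots make both scalings additive
  in time.\<close>

lemma law_semigroup:
  assumes st: "0 \<le> s" "0 \<le> t" and \<phi>: "\<phi> \<in> C_lLip norm"
  shows "law (s + t) \<phi> = law s (val t \<phi>)"
proof -
  have "(\<lambda>z :: (real ^ 'd) \<times> (real ^ 'd). \<phi> (fst z + snd z)) \<in> C_lLip norm"
    by (intro C_lLip_compose_linear[OF \<phi>] bounded_linear_add bounded_linear_fst bounded_linear_snd)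
  from G_distributed[unfolded G_distributed_def, rule_format, OF _ _ this, of "sqrt s" "sqrt t"]
  have "E (\<lambda>\<omega>. E (\<lambda>\<omega>'. \<phi> ((sqrt s *\<^sub>R X \<omega> + sqrt t *\<^sub>R X \<omega>') + ((sqrt s)\<^sup>2 *\<^sub>R \<eta> \<omega> + (sqrt t)\<^sup>2 *\<^sub>R \<eta> \<omega>'))))
      = E (\<lambda>\<omega>. \<phi> (sqrt ((sqrt s)\<^sup>2 + (sqrt t)\<^sup>2) *\<^sub>R X \<omega> + ((sqrt s)\<^sup>2 + (sqrt t)\<^sup>2) *\<^sub>R \<eta> \<omega>))"
    using st by simp
  then show ?thesis using st by (simp add: law_def val_eq add_ac)
qed

lemma val_semigroup:
  assumes "0 \<le> s" "0 \<le> t" "\<phi> \<in> C_lLip norm"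
  shows "val (s + t) \<phi> x = val s (val t \<phi>) x"
proof -
  have "(\<lambda>y. \<phi> (x + y)) \<in> C_lLip norm"
    using C_lLip_affine[OF assms(3) bounded_linear_ident, of x] by (simp add: add.commute)
  from law_semigroup[OF assms(1,2) this] show ?thesis by (simp add: conv_def[abs_def] add.assoc)
qed

lemma law_generated_semigroup: "generated_semigroup law G"
proof (intro generated_semigroup.intro generated_semigroup_axioms.intro law_family)
  show "law (s + t) f = law s (conv (law t) f)" if "0 \<le> s" "0 \<le> t" "Lip f" for s t f
    by (rule law_semigroup[OF that(1,2) Lip_C_lLip[OF that(3)]])
  have "law h norm \<le> E (size 1) * sqrt h" if h: "0 \<le> h" "h \<le> 1" for h
  proof -
    have "law h norm \<le> E (\<lambda>\<omega>. sqrt h * size 1 \<omega>)"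
      unfolding law_def using step_norm_le[OF h]
      by (intro mono comp_step_in' lipschitz_C_lLip[OF lipschitz_norm] scale_in size_in) (simp add: size_def)
    then show ?thesis using pos_homog[OF size_in, of "sqrt h" 1] h by (simp add: mult.commute)
  qed
  then show "\<exists>\<kappa>. \<forall>h. 0 \<le> h \<and> h \<le> 1 \<longrightarrow> law h norm \<le> \<kappa> * sqrt h" by blast
qed

lemma poly_size_in: "(\<lambda>\<omega>. (1 + c * size 1 \<omega>) ^ m * size k \<omega>) \<in> H"
proof -
  have "(\<lambda>z :: (real ^ 'd) \<times> (real ^ 'd). (1 + c * (norm (fst z) + norm (snd z))) ^ m * (norm (fst z) + norm (snd z)) ^ k) \<in> C_lLip norm"
    by (intro C_lLip_mult C_lLip_power C_lLip_add C_lLip_const C_lLip_norm_linear bounded_linear_fst bounded_linear_snd)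
  from comp_pair_in[OF this] show ?thesis by (simp add: size_def)
qed

lemma sqrt_le_Suc: "0 \<le> t \<Longrightarrow> sqrt t \<le> 1 + t"
  using arith_geo_mean_sqrt[of t 1] by simp

lemma increment_le:
  assumes "0 \<le> t" "t \<le> T"
  shows "norm (sqrt t *\<^sub>R X \<omega> + t *\<^sub>R \<eta> \<omega>) \<le> (1 + T) * size 1 \<omega>"
proof -
  have "norm (sqrt t *\<^sub>R X \<omega> + t *\<^sub>R \<eta> \<omega>) \<le> sqrt t * norm (X \<omega>) + t * norm (\<eta> \<omega>)"
    using norm_triangle_ineq[of "sqrt t *\<^sub>R X \<omega>" "t *\<^sub>R \<eta> \<omega>"] assms by simp
  also have "\<dots> \<le> (1 + T) * norm (X \<omega>) + (1 + T) * norm (\<eta> \<omega>)"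
    using sqrt_le_Suc[of t] assms by (intro add_mono mult_right_mono) auto
  finally show ?thesis by (simp add: size_def distrib_left)
qed

text \<open>Growth passes to the value function because
  \<open>1 + norm (x + z) + norm (y + z)\<close> is at most the product of
  \<open>1 + norm x + norm y\<close> and \<open>1 + 2 * norm z\<close>. The exponent is obtained
  once for all horizons \<open>T\<close>; only the constant depends on \<open>T\<close>.\<close>

lemma val_bounds:
  assumes \<phi>: "\<phi> \<in> C_lLip norm"
  obtains m where "\<And>T. T \<ge> 0 \<Longrightarrow> \<exists>D\<ge>0. \<forall>t\<in>{0..T}.
      (\<forall>x y. \<bar>val t \<phi> x - val t \<phi> y\<bar> \<le> D * (1 + norm x + norm y) ^ m * norm (x - y)) \<and>
      (\<forall>x. \<bar>val t \<phi> x\<bar> \<le> D * (1 + norm x) ^ m)"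
proof -
  obtain C m where C: "C \<ge> 0"
    "\<And>x y. \<bar>\<phi> x - \<phi> y\<bar> \<le> C * (1 + norm x + norm y) ^ m * norm (x - y)"
    "\<And>x. \<bar>\<phi> x\<bar> \<le> C * (1 + norm x) ^ m" by (rule C_lLipD[OF \<phi>]) (rule that)
  have "\<exists>D\<ge>0. \<forall>t\<in>{0..T}.
      (\<forall>x y. \<bar>val t \<phi> x - val t \<phi> y\<bar> \<le> D * (1 + norm x + norm y) ^ m * norm (x - y)) \<and>
      (\<forall>x. \<bar>val t \<phi> x\<bar> \<le> D * (1 + norm x) ^ m)" if T: "T \<ge> 0" for T
  proof -
    let ?W = "\<lambda>\<omega>. (1 + (2 * (1 + T)) * size 1 \<omega>) ^ m"
    have W: "?W \<in> H" using poly_size_in[of "2 * (1 + T)" m 0] by (simp add: size_def)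
    have W0: "E ?W \<ge> 0"
      using mono[OF W const_in[of 0]] const[of 0] T by (simp add: size_def)
    define D where "D = C * E ?W"
    have grow: "(1 + norm (x + z) + norm (y + z)) ^ m \<le> (1 + norm x + norm y) ^ m * ?W \<omega>"
      if z: "norm z \<le> (1 + T) * size 1 \<omega>" for x y z :: "real ^ 'd" and \<omega>
    proof -
      let ?a = "norm x + norm y" and ?b = "2 * (1 + T) * size 1 \<omega>"
      have b: "?b \<ge> 0" using T by (intro mult_nonneg_nonneg) (auto simp: size_def)
      have "1 + norm (x + z) + norm (y + z) \<le> 1 + ?a + ?b"
        using norm_triangle_ineq[of x z] norm_triangle_ineq[of y z] z by linarith
      also have "\<dots> \<le> (1 + ?a) * (1 + ?b)"
      proof -
        have "0 \<le> ?a * ?b" by (rule mult_nonneg_nonneg[OF _ b]) simp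
        then show ?thesis by (simp add: distrib_left distrib_right)
      qed
      finally have "(1 + norm (x + z) + norm (y + z)) ^ m \<le> ((1 + ?a) * (1 + ?b)) ^ m"
        by (intro power_mono) auto
      then show ?thesis by (simp add: power_mult_distrib add.assoc)
    qed
    show ?thesis
    proof (intro exI[of _ D] conjI ballI allI)
      show "D \<ge> 0" using C W0 by (simp add: D_def)
      fix t x y assume t: "t \<in> {0..T}"
      let ?z = "\<lambda>\<omega>. sqrt t *\<^sub>R X \<omega> + t *\<^sub>R \<eta> \<omega>"
      have z: "norm (?z \<omega>) \<le> (1 + T) * size 1 \<omega>" for \<omega> using increment_le t by simp
      have "\<bar>val t \<phi> x - val t \<phi> y\<bar> \<le> E (\<lambda>\<omega>. (C * (1 + norm x + norm y) ^ m * norm (x - y)) * ?W \<omega>)"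
        unfolding val_eq
      proof (rule abs_diff_le[OF comp_step_in[OF \<phi>] comp_step_in[OF \<phi>] scale_in[OF W]])
        fix \<omega>
        have "\<bar>\<phi> (x + ?z \<omega>) - \<phi> (y + ?z \<omega>)\<bar> \<le> C * (1 + norm (x + ?z \<omega>) + norm (y + ?z \<omega>)) ^ m * norm (x - y)"
          using C(2)[of "x + ?z \<omega>" "y + ?z \<omega>"] by simp
        also have "\<dots> \<le> C * ((1 + norm x + norm y) ^ m * ?W \<omega>) * norm (x - y)"
          using C(1) grow[OF z] by (intro mult_right_mono mult_left_mono) auto
        finally show "\<bar>\<phi> (x + ?z \<omega>) - \<phi> (y + ?z \<omega>)\<bar> \<le> (C * (1 + norm x + norm y) ^ m * norm (x - y)) * ?W \<omega>"
          by (simp add: mult_ac)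
      qed
      also have "\<dots> = (C * (1 + norm x + norm y) ^ m * norm (x - y)) * E ?W"
        using C(1) by (intro pos_homog W) auto
      finally show "\<bar>val t \<phi> x - val t \<phi> y\<bar> \<le> D * (1 + norm x + norm y) ^ m * norm (x - y)"
        by (simp add: D_def mult_ac)
      have "\<bar>val t \<phi> x - E (\<lambda>_. 0)\<bar> \<le> E (\<lambda>\<omega>. (C * (1 + norm x) ^ m) * ?W \<omega>)"
        unfolding val_eq
      proof (rule abs_diff_le[OF comp_step_in[OF \<phi>] const_in scale_in[OF W]])
        fix \<omega>
        have "\<bar>\<phi> (x + ?z \<omega>)\<bar> \<le> C * (1 + norm (x + ?z \<omega>)) ^ m" by (rule C(3))
        also have "\<dots> \<le> C * (1 + norm (x + ?z \<omega>) + norm (0 + ?z \<omega>)) ^ m"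
          using C(1) by (intro mult_left_mono power_mono) auto
        also have "\<dots> \<le> C * ((1 + norm x + norm (0 :: real ^ 'd)) ^ m * ?W \<omega>)"
          by (rule mult_left_mono[OF grow[OF z, where x = x and y = 0] C(1)])
        finally show "\<bar>\<phi> (x + ?z \<omega>) - 0\<bar> \<le> (C * (1 + norm x) ^ m) * ?W \<omega>" by simp
      qed
      also have "\<dots> = (C * (1 + norm x) ^ m) * E ?W"
        using C(1) by (intro pos_homog W) auto
      finally show "\<bar>val t \<phi> x\<bar> \<le> D * (1 + norm x) ^ m"
        by (simp add: D_def const mult_ac)
    qed
  qed
  then show ?thesis by (rule that)
qed

lemma val_C_lLip:
  assumes "\<phi> \<in> C_lLip norm" "t \<ge> 0"
  shows "val t \<phi> \<in> C_lLip norm"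
proof -
  obtain m where "\<And>T. T \<ge> 0 \<Longrightarrow> \<exists>D\<ge>0. \<forall>t\<in>{0..T}.
      (\<forall>x y. \<bar>val t \<phi> x - val t \<phi> y\<bar> \<le> D * (1 + norm x + norm y) ^ m * norm (x - y)) \<and>
      (\<forall>x. \<bar>val t \<phi> x\<bar> \<le> D * (1 + norm x) ^ m)" by (rule val_bounds[OF assms(1)]) (rule that)
  from this[OF assms(2)] obtain D where
    "\<forall>s\<in>{0..t}. (\<forall>x y. \<bar>val s \<phi> x - val s \<phi> y\<bar> \<le> D * (1 + norm x + norm y) ^ m * norm (x - y)) \<and>
      (\<forall>x. \<bar>val s \<phi> x\<bar> \<le> D * (1 + norm x) ^ m)" by blast
  from bspec[OF this, of t] assms(2)
  have "\<forall>x y. \<bar>val t \<phi> x - val t \<phi> y\<bar> \<le> D * (1 + norm x + norm y) ^ m * norm (x - y)" by simp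
  then show ?thesis unfolding C_lLip_iff by blast
qed

text \<open>The local Lipschitz bound in space yields continuity in time: by the semigroup law a
  later value is an earlier one averaged over increments of size \<open>sqrt h\<close>.\<close>

lemma val_continuous:
  assumes \<phi>: "\<phi> \<in> C_lLip norm"
  shows "continuous_on ({0..} \<times> UNIV) (\<lambda>(t, x). val t \<phi> x)"
proof -
  obtain m where m: "\<And>T. T \<ge> 0 \<Longrightarrow> \<exists>D\<ge>0. \<forall>t\<in>{0..T}.
      (\<forall>x y. \<bar>val t \<phi> x - val t \<phi> y\<bar> \<le> D * (1 + norm x + norm y) ^ m * norm (x - y)) \<and>
      (\<forall>x. \<bar>val t \<phi> x\<bar> \<le> D * (1 + norm x) ^ m)" by (rule val_bounds[OF \<phi>]) (rule that)
  let ?W = "\<lambda>\<omega>. (1 + 1 * size 1 \<omega>) ^ m * size 1 \<omega>"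
  show ?thesis
    unfolding continuous_on_def
  proof
    fix w :: "real \<times> (real ^ 'd)" assume w: "w \<in> {0..} \<times> UNIV"
    obtain t x where tx: "w = (t, x)" by (cases w)
    have t: "t \<ge> 0" using w tx by simp
    obtain D where D: "D \<ge> 0"
      "\<And>s x y. s \<in> {0..t + 1} \<Longrightarrow> \<bar>val s \<phi> x - val s \<phi> y\<bar> \<le> D * (1 + norm x + norm y) ^ m * norm (x - y)"
      using m[of "t + 1"] t by auto
    define B where "B = D * (1 + 2 * norm x) ^ m * E ?W"
    have time: "\<bar>val (s + h) \<phi> x - val s \<phi> x\<bar> \<le> B * sqrt h"
      if s: "0 \<le> s" "s \<le> t + 1" and h: "0 \<le> h" "h \<le> 1" for s h
    proof -
      let ?z = "\<lambda>\<omega>. sqrt h *\<^sub>R X \<omega> + h *\<^sub>R \<eta> \<omega>"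
      let ?c = "D * (1 + 2 * norm x) ^ m * sqrt h"
      have v: "val s \<phi> \<in> C_lLip norm" by (rule val_C_lLip[OF \<phi> s(1)])
      have "val (s + h) \<phi> x = val h (val s \<phi>) x"
        using val_semigroup[OF h(1) s(1) \<phi>, of x] by (simp add: add.commute)
      then have "\<bar>val (s + h) \<phi> x - val s \<phi> x\<bar> = \<bar>E (\<lambda>\<omega>. val s \<phi> (x + ?z \<omega>)) - E (\<lambda>_. val s \<phi> x)\<bar>"
        by (simp add: val_eq[of h] const)
      also have "\<dots> \<le> E (\<lambda>\<omega>. ?c * ?W \<omega>)"
      proof (rule abs_diff_le[OF comp_step_in[OF v] const_in scale_in[OF poly_size_in]])
        fix \<omega>
        have z: "norm (?z \<omega>) \<le> sqrt h * size 1 \<omega>" using step_norm_le[OF h] by (simp add: size_def)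
        also have "\<dots> \<le> 1 * size 1 \<omega>" using h by (intro mult_right_mono) (auto simp: size_def)
        finally have z1: "norm (?z \<omega>) \<le> size 1 \<omega>" by simp
        have s0: "size 1 \<omega> \<ge> 0" by (simp add: size_def)
        have "1 + norm (x + ?z \<omega>) + norm x \<le> 1 + 2 * norm x + size 1 \<omega>"
          using norm_triangle_ineq[of x "?z \<omega>"] z1 by linarith
        also have "\<dots> \<le> (1 + 2 * norm x) * (1 + size 1 \<omega>)"
          using mult_nonneg_nonneg[OF norm_ge_zero[of x] s0] by (simp add: algebra_simps)
        finally have g: "(1 + norm (x + ?z \<omega>) + norm x) ^ m \<le> ((1 + 2 * norm x) * (1 + size 1 \<omega>)) ^ m"
          by (intro power_mono) auto
        have "\<bar>val s \<phi> (x + ?z \<omega>) - val s \<phi> x\<bar> \<le> D * (1 + norm (x + ?z \<omega>) + norm x) ^ m * norm (?z \<omega>)"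
          using D(2)[of s "x + ?z \<omega>" x] s by simp
        also have "\<dots> \<le> D * ((1 + 2 * norm x) * (1 + size 1 \<omega>)) ^ m * (sqrt h * size 1 \<omega>)"
          using D(1) g z s0 by (intro mult_mono) auto
        finally show "\<bar>val s \<phi> (x + ?z \<omega>) - val s \<phi> x\<bar> \<le> ?c * ?W \<omega>"
          by (simp add: power_mult_distrib mult_ac)
      qed
      also have "\<dots> = ?c * E ?W" using D(1) h by (intro pos_homog poly_size_in) auto
      finally show ?thesis by (simp add: B_def mult_ac)
    qed
    have B0: "B \<ge> 0" using order_trans[OF abs_ge_zero time[of 0 1]] t by simp
    have est: "\<bar>val s \<phi> y - val t \<phi> x\<bar> \<le> D * (1 + norm y + norm x) ^ m * norm (y - x) + B * sqrt \<bar>s - t\<bar>"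
      if s: "s \<ge> 0" "\<bar>s - t\<bar> \<le> 1" for s y
    proof -
      have "\<bar>val s \<phi> x - val t \<phi> x\<bar> \<le> B * sqrt \<bar>s - t\<bar>"
        using time[of t "s - t"] time[of s "t - s"] s t by (cases "t \<le> s") (auto simp: abs_minus_commute)
      moreover have "\<bar>val s \<phi> y - val s \<phi> x\<bar> \<le> D * (1 + norm y + norm x) ^ m * norm (y - x)"
        using s by (intro D(2)) auto
      ultimately show ?thesis by linarith
    qed
    show "((\<lambda>(t, x). val t \<phi> x) \<longlongrightarrow> (case w of (t, x) \<Rightarrow> val t \<phi> x)) (at w within {0..} \<times> UNIV)"
    proof (rule LIM_zero_cancel, rule Lim_null_comparison)
      let ?b = "\<lambda>z :: real \<times> (real ^ 'd). D * (1 + norm (snd z) + norm x) ^ m * norm (snd z - x) + B * sqrt \<bar>fst z - t\<bar>"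
      show "\<forall>\<^sub>F z in at w within {0..} \<times> UNIV. norm ((case z of (t, x) \<Rightarrow> val t \<phi> x) - (case w of (t, x) \<Rightarrow> val t \<phi> x)) \<le> ?b z"
        unfolding eventually_at
      proof (intro exI[of _ 1] conjI ballI impI)
        fix z assume z: "z \<in> {0..} \<times> (UNIV :: (real ^ 'd) set)" "z \<noteq> w \<and> dist z w < 1"
        have "\<bar>fst z - t\<bar> \<le> 1" using dist_fst_le[of z w] z(2) tx by (simp add: dist_real_def)
        then show "norm ((case z of (t, x) \<Rightarrow> val t \<phi> x) - (case w of (t, x) \<Rightarrow> val t \<phi> x)) \<le> ?b z"
          using est[of "fst z" "snd z"] z(1) tx by (auto simp: case_prod_unfold)
      qed simp
      have "(?b \<longlongrightarrow> D * (1 + norm (snd w) + norm x) ^ m * norm (snd w - x) + B * sqrt \<bar>fst w - t\<bar>) (at w within {0..} \<times> UNIV)"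
        by (intro tendsto_intros)
      then show "(?b \<longlongrightarrow> 0) (at w within {0..} \<times> UNIV)" by (simp add: tx)
    qed
  qed
qed

end

section \<open>Viscosity inequalities from one step of the semigroup\<close>

context G_pair
begin

text \<open>For a function lying on one side of a quadratic up to errors: the error with \<delta>
  keeps order \<open>h\<close>, to be removed by letting \<delta> tend to 0, while the cubic error,
  allowed to grow polynomially, has order \<open>h * sqrt h\<close>.\<close>

lemma quadratic_expectation_le:
  assumes \<phi>: "\<phi> \<in> C_lLip norm" and h: "0 \<le> h" "h \<le> 1" and \<sigma>: "\<sigma> = 1 \<or> \<sigma> = -1"
    and C: "C1 \<ge> 0" "\<delta> \<ge> 0"
    and le: "\<And>z. \<sigma> * (\<phi> (x + z) - (c + p \<bullet> z + (A *v z) \<bullet> z / 2)) \<le> \<delta> * (h + (norm z)\<^sup>2) + C1 * ((norm z) ^ 3 * (1 + norm z) ^ k)"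
  shows "\<sigma> * (val h \<phi> x - (c + h * G p A))
    \<le> \<delta> * h * (1 + E (size 2)) + (norm A * E (size 2) + C1 * E (\<lambda>\<omega>. (1 + 1 * size 1 \<omega>) ^ k * size 3 \<omega>)) * (h * sqrt h)"
proof -
  let ?z = "\<lambda>\<omega>. sqrt h *\<^sub>R X \<omega> + h *\<^sub>R \<eta> \<omega>"
  let ?Q = "\<lambda>\<omega>. c + (h * (p \<bullet> \<eta> \<omega> + 1/2 * ((A *v X \<omega>) \<bullet> X \<omega>)) + (sqrt h *\<^sub>R p) \<bullet> X \<omega>)"
  let ?P = "\<lambda>\<omega>. (1 + 1 * size 1 \<omega>) ^ k * size 3 \<omega>"
  let ?a = "\<delta> * h + norm A * (h * sqrt h)" and ?b = "C1 * (h * sqrt h)"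
  let ?R = "\<lambda>\<omega>. \<delta> * h + (?a * size 2 \<omega> + ?b * ?P \<omega>)"
  have hs: "h * sqrt h \<ge> 0" using h by simp
  have a: "?a \<ge> 0" and b: "?b \<ge> 0" using C h by auto
  have Pi: "?P \<in> H" by (rule poly_size_in)
  have Qi: "?Q \<in> H" by (intro add_in const_in scale_in quadratic_in random_vector_inner[OF X])
  have Ri: "?R \<in> H" by (intro add_in const_in scale_in size_in Pi)
  have \<phi>i: "(\<lambda>\<omega>. \<phi> (x + ?z \<omega>)) \<in> H" by (rule comp_step_in[OF \<phi>])
  have bound: "\<sigma> * (\<phi> (x + ?z \<omega>) - ?Q \<omega>) \<le> ?R \<omega>" for \<omega>
  proof -
    have zn: "norm (?z \<omega>) \<le> sqrt h * size 1 \<omega>" using step_norm_le[OF h] by (simp add: size_def)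
    have s0: "size 1 \<omega> \<ge> 0" by (simp add: size_def)
    have s1: "sqrt h * size 1 \<omega> \<le> size 1 \<omega>"
      using mult_right_mono[of "sqrt h" 1 "size 1 \<omega>"] h s0 by simp
    have "(norm (?z \<omega>))\<^sup>2 \<le> (sqrt h * size 1 \<omega>)\<^sup>2" using zn by (intro power_mono) auto
    also have "\<dots> = h * size 2 \<omega>" using h by (simp add: power_mult_distrib size_def)
    finally have "\<delta> * (h + (norm (?z \<omega>))\<^sup>2) \<le> \<delta> * (h + h * size 2 \<omega>)"
      using C by (intro mult_left_mono add_left_mono) auto
    moreover have "(norm (?z \<omega>)) ^ 3 * (1 + norm (?z \<omega>)) ^ k \<le> (sqrt h * size 1 \<omega>) ^ 3 * (1 + size 1 \<omega>) ^ k"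
      using zn s1 s0 h by (intro mult_mono power_mono) auto
    then have "C1 * ((norm (?z \<omega>)) ^ 3 * (1 + norm (?z \<omega>)) ^ k) \<le> C1 * ((sqrt h * size 1 \<omega>) ^ 3 * (1 + size 1 \<omega>) ^ k)"
      using C by (intro mult_left_mono)
    moreover have "C1 * ((sqrt h * size 1 \<omega>) ^ 3 * (1 + size 1 \<omega>) ^ k) = ?b * ?P \<omega>"
    proof -
      have "sqrt h ^ 3 = h * sqrt h" using h by (simp add: eval_nat_numeral)
      moreover have "size 1 \<omega> ^ 3 = size 3 \<omega>" by (simp add: size_def)
      ultimately show ?thesis by (simp add: power_mult_distrib mult_ac)
    qed
    ultimately have "\<sigma> * (\<phi> (x + ?z \<omega>) - (c + p \<bullet> ?z \<omega> + (A *v ?z \<omega>) \<bullet> ?z \<omega> / 2)) \<le> \<delta> * (h + h * size 2 \<omega>) + ?b * ?P \<omega>"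
      using le[of "?z \<omega>"] by linarith
    moreover have "\<bar>(A *v ?z \<omega>) \<bullet> ?z \<omega> / 2 - h * (1/2 * ((A *v X \<omega>) \<bullet> X \<omega>))\<bar> \<le> norm A * (h * sqrt h) * size 2 \<omega>"
      by (rule quadratic_step_error[OF h])
    moreover have "p \<bullet> ?z \<omega> = h * (p \<bullet> \<eta> \<omega>) + (sqrt h *\<^sub>R p) \<bullet> X \<omega>" by (simp add: inner_add_right)
    moreover have "\<sigma> * (f - (c + (h\<eta> + hA + q))) \<le> e + e'"
      if "\<sigma> * (f - (c + pz + Az)) \<le> e" "\<bar>Az - hA\<bar> \<le> e'" "pz = h\<eta> + q" for f h\<eta> hA q e e' pz Az :: real
      using that \<sigma> by auto
    ultimately have "\<sigma> * (\<phi> (x + ?z \<omega>) - (c + (h * (p \<bullet> \<eta> \<omega>) + h * (1/2 * ((A *v X \<omega>) \<bullet> X \<omega>)) + (sqrt h *\<^sub>R p) \<bullet> X \<omega>)))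
        \<le> \<delta> * (h + h * size 2 \<omega>) + ?b * ?P \<omega> + norm A * (h * sqrt h) * size 2 \<omega>"
      by blast
    then show ?thesis by (simp add: algebra_simps)
  qed
  have "\<sigma> * (E (\<lambda>\<omega>. \<phi> (x + ?z \<omega>)) - E ?Q) \<le> E ?R"
    using \<sigma>
  proof
    assume [simp]: "\<sigma> = 1"
    have "\<phi> (x + ?z \<omega>) \<le> ?Q \<omega> + ?R \<omega>" for \<omega> using bound[of \<omega>] by simp
    from mono[OF add_in[OF Qi Ri] \<phi>i this] subadd[OF Qi Ri] show ?thesis by simp
  next
    assume [simp]: "\<sigma> = -1"
    have "?Q \<omega> \<le> \<phi> (x + ?z \<omega>) + ?R \<omega>" for \<omega> using bound[of \<omega>] by simp
    from mono[OF add_in[OF \<phi>i Ri] Qi this] subadd[OF \<phi>i Ri] show ?thesis by simp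
  qed
  moreover have "E ?Q = c + h * G p A" by (rule E_affine_quadratic[OF h(1)])
  moreover have "E ?R \<le> \<delta> * h + (?a * E (size 2) + ?b * E ?P)"
  proof -
    have "E ?R = \<delta> * h + E (\<lambda>\<omega>. ?a * size 2 \<omega> + ?b * ?P \<omega>)"
      by (intro E_add_const add_in scale_in size_in Pi)
    also have "\<dots> \<le> \<delta> * h + (E (\<lambda>\<omega>. ?a * size 2 \<omega>) + E (\<lambda>\<omega>. ?b * ?P \<omega>))"
      by (intro add_left_mono subadd scale_in size_in Pi)
    finally show ?thesis using pos_homog[OF size_in a, of 2] pos_homog[OF Pi b] by simp
  qed
  ultimately show ?thesis by (simp add: val_eq algebra_simps)
qed

text \<open>The sign \<open>\<sigma>\<close> treats sub- and supersolutions simultaneously.\<close>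

lemma val_viscosity:
  assumes \<phi>: "\<phi> \<in> C_lLip norm" and \<sigma>: "\<sigma> = 1 \<or> \<sigma> = -1"
    and \<psi>: "C12_test \<psi> \<psi>t p A" and t: "t > 0"
    and max: "\<forall>\<^sub>F (s, y) in nhds (t, x). \<sigma> * (val s \<phi> y - \<psi> s y) \<le> \<sigma> * (val t \<phi> x - \<psi> t x)"
  shows "\<sigma> * (\<psi>t t x - G (p t x) (A t x)) \<le> 0"
proof -
  have \<sigma>1: "\<bar>\<sigma>\<bar> = 1" using \<sigma> by auto
  obtain m where m: "\<And>T. T \<ge> 0 \<Longrightarrow> \<exists>D\<ge>0. \<forall>t\<in>{0..T}.
      (\<forall>x y. \<bar>val t \<phi> x - val t \<phi> y\<bar> \<le> D * (1 + norm x + norm y) ^ m * norm (x - y)) \<and>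
      (\<forall>x. \<bar>val t \<phi> x\<bar> \<le> D * (1 + norm x) ^ m)" by (rule val_bounds[OF \<phi>]) (rule that)
  obtain D where D: "D \<ge> 0" "\<And>s x. s \<in> {0..t} \<Longrightarrow> \<bar>val s \<phi> x\<bar> \<le> D * (1 + norm x) ^ m"
    using m[of t] t by auto
  obtain e where e: "e > 0" "\<And>s y. dist (s, y) (t, x) < e \<Longrightarrow> \<sigma> * (val s \<phi> y - \<psi> s y) \<le> \<sigma> * (val t \<phi> x - \<psi> t x)"
    using max unfolding eventually_nhds_metric by auto
  let ?v = "val t \<phi> x" and ?p = "p t x" and ?A = "A t x" and ?\<psi>t = "\<psi>t t x"
  have main: "\<sigma> * (?\<psi>t - G ?p ?A) \<le> \<delta> * (1 + E (size 2))" if \<delta>: "\<delta> > 0" for \<delta>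
  proof -
    obtain r0 where r0: "r0 > 0" "\<And>h z. 0 < h \<Longrightarrow> h < r0 \<Longrightarrow> norm z < r0 \<Longrightarrow>
        \<bar>\<psi> (t - h) (x + z) - \<psi> t x + h * ?\<psi>t - ?p \<bullet> z - (?A *v z) \<bullet> z / 2\<bar> \<le> \<delta> * (h + (norm z)\<^sup>2)"
      using C12_test_expansion[OF \<psi> t \<delta>, of x] by blast
    define r where "r = min (min r0 (e / 2)) (min 1 t)"
    have r: "r > 0" "r \<le> r0" "r \<le> e / 2" "r \<le> 1" "r \<le> t" using r0 e t by (auto simp: r_def)
    \<comment> \<open>Away from the touching point no comparison with the test function is
      available. There \<open>B\<close> bounds all terms in units of
      \<open>(1 + norm z) ^ (m + 2)\<close>, and \<open>norm z \<ge> r\<close> lets the cubic term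
      absorb them with constant \<open>B / r ^ 3\<close>.\<close>
    define B where "B = D * (1 + norm x) ^ m + \<bar>?v\<bar> + \<bar>?\<psi>t\<bar> + norm ?p + norm ?A"
    define C1 where "C1 = B / r ^ 3"
    have B: "B \<ge> 0" using D(1) by (simp add: B_def)
    then have C1: "C1 \<ge> 0" using r by (simp add: C1_def)
    have est: "\<sigma> * (val (t - h) \<phi> (x + z) - ((?v - h * ?\<psi>t) + ?p \<bullet> z + (?A *v z) \<bullet> z / 2))
        \<le> \<delta> * (h + (norm z)\<^sup>2) + C1 * ((norm z) ^ 3 * (1 + norm z) ^ (m + 2))"
      if h: "0 < h" "h < r" for h z
    proof (cases "norm z < r")
      case True
      have "dist (t - h, x + z) (t, x) \<le> h + norm z"
        using sqrt_sum_squares_le_sum_abs[of h "norm z"] h by (simp add: dist_norm norm_Pair)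
      also have "\<dots> < e" using h True r by linarith
      finally have "\<sigma> * (val (t - h) \<phi> (x + z) - \<psi> (t - h) (x + z)) \<le> \<sigma> * (?v - \<psi> t x)" by (rule e(2))
      moreover have "\<bar>\<psi> (t - h) (x + z) - \<psi> t x + h * ?\<psi>t - ?p \<bullet> z - (?A *v z) \<bullet> z / 2\<bar> \<le> \<delta> * (h + (norm z)\<^sup>2)"
        using h True r by (intro r0(2)) auto
      moreover have "\<sigma> * (V - ((v - ht) + pz + Az)) \<le> d"
        if "\<sigma> * (V - \<Psi>) \<le> \<sigma> * (v - \<psi>0)" "\<bar>\<Psi> - \<psi>0 + ht - pz - Az\<bar> \<le> d" for V v ht pz Az \<Psi> \<psi>0 d :: real
        using that \<sigma> by auto
      ultimately have "\<sigma> * (val (t - h) \<phi> (x + z) - ((?v - h * ?\<psi>t) + ?p \<bullet> z + (?A *v z) \<bullet> z / 2))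
        \<le> \<delta> * (h + (norm z)\<^sup>2)" by blast
      moreover have "0 \<le> C1 * ((norm z) ^ 3 * (1 + norm z) ^ (m + 2))" using C1 by simp
      ultimately show ?thesis by linarith
    next
      case False
      let ?n = "1 + norm z"
      have n1: "?n ^ k \<le> ?n ^ (m + 2)" if "k \<le> m + 2" for k using that by (intro power_increasing) auto
      have "(norm z)\<^sup>2 \<le> ?n\<^sup>2" by (intro power_mono) auto
      then have n0: "1 \<le> ?n ^ (m + 2)" "norm z \<le> ?n ^ (m + 2)" "(norm z)\<^sup>2 \<le> ?n ^ (m + 2)"
        using n1[of 0] n1[of 1] order_trans[OF _ n1[of 2]] by auto
      have "\<bar>val (t - h) \<phi> (x + z)\<bar> \<le> D * (1 + norm (x + z)) ^ m" using h r by (intro D(2)) auto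
      also have "\<dots> \<le> D * ((1 + norm x) * ?n) ^ m"
      proof (intro mult_left_mono power_mono D(1))
        show "1 + norm (x + z) \<le> (1 + norm x) * ?n"
        proof -
          have "(1 + norm x) * ?n = 1 + norm x + norm z + norm x * norm z" by (simp add: algebra_simps)
          moreover have "0 \<le> norm x * norm z" by simp
          ultimately show ?thesis using norm_triangle_ineq[of x z] by linarith
        qed
      qed auto
      also have "\<dots> = D * (1 + norm x) ^ m * ?n ^ m" by (simp add: power_mult_distrib)
      also have "\<dots> \<le> D * (1 + norm x) ^ m * ?n ^ (m + 2)"
        using D(1) n1[of m] by (intro mult_left_mono) auto
      finally have 1: "\<bar>val (t - h) \<phi> (x + z)\<bar> \<le> D * (1 + norm x) ^ m * ?n ^ (m + 2)" .
      have 2: "\<bar>?v\<bar> \<le> \<bar>?v\<bar> * ?n ^ (m + 2)" using mult_left_mono[OF n0(1), of "\<bar>?v\<bar>"] by simp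
      have "\<bar>h * ?\<psi>t\<bar> \<le> 1 * \<bar>?\<psi>t\<bar>" unfolding abs_mult using h r by (intro mult_right_mono) auto
      then have 3: "\<bar>h * ?\<psi>t\<bar> \<le> \<bar>?\<psi>t\<bar> * ?n ^ (m + 2)" using mult_left_mono[OF n0(1), of "\<bar>?\<psi>t\<bar>"] by simp
      have "\<bar>?p \<bullet> z\<bar> \<le> norm ?p * norm z" by (rule Cauchy_Schwarz_ineq2)
      also have "\<dots> \<le> norm ?p * ?n ^ (m + 2)" using n0 by (intro mult_left_mono) auto
      finally have 4: "\<bar>?p \<bullet> z\<bar> \<le> norm ?p * ?n ^ (m + 2)" .
      have "\<bar>(?A *v z) \<bullet> z\<bar> \<le> norm ?A * (norm z)\<^sup>2"
        using quadratic_form_le[of ?A z z] by (simp add: power2_eq_square mult.assoc)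
      also have "\<dots> \<le> norm ?A * ?n ^ (m + 2)" using n0 by (intro mult_left_mono) auto
      finally have 5: "\<bar>(?A *v z) \<bullet> z\<bar> \<le> norm ?A * ?n ^ (m + 2)" .
      have "\<sigma> * (val (t - h) \<phi> (x + z) - ((?v - h * ?\<psi>t) + ?p \<bullet> z + (?A *v z) \<bullet> z / 2))
          \<le> \<bar>val (t - h) \<phi> (x + z)\<bar> + \<bar>?v\<bar> + \<bar>h * ?\<psi>t\<bar> + \<bar>?p \<bullet> z\<bar> + \<bar>(?A *v z) \<bullet> z\<bar>"
      proof -
        have "\<sigma> * (V - ((v - ht) + pz + Az / 2)) \<le> \<bar>V\<bar> + \<bar>v\<bar> + \<bar>ht\<bar> + \<bar>pz\<bar> + \<bar>Az\<bar>" for V v ht pz Az :: real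
          using \<sigma> by auto
        then show ?thesis .
      qed
      also have "\<dots> \<le> B * ?n ^ (m + 2)"
        unfolding B_def distrib_right by (intro add_mono 1 2 3 4 5)
      also have "\<dots> \<le> B * (((norm z) ^ 3 / r ^ 3) * ?n ^ (m + 2))"
      proof (rule mult_left_mono[OF _ B])
        have "1 \<le> (norm z) ^ 3 / r ^ 3"
          using power_mono[of r "norm z" 3] False r by simp
        from mult_right_mono[OF this, of "?n ^ (m + 2)"]
        show "?n ^ (m + 2) \<le> ((norm z) ^ 3 / r ^ 3) * ?n ^ (m + 2)" by simp
      qed
      also have "\<dots> = C1 * ((norm z) ^ 3 * ?n ^ (m + 2))" by (simp add: C1_def)
      finally have "\<sigma> * (val (t - h) \<phi> (x + z) - ((?v - h * ?\<psi>t) + ?p \<bullet> z + (?A *v z) \<bullet> z / 2))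
          \<le> C1 * ((norm z) ^ 3 * ?n ^ (m + 2))" .
      moreover have "\<delta> * (h + (norm z)\<^sup>2) \<ge> 0" using h \<delta> by simp
      ultimately show ?thesis by linarith
    qed
    define M where "M = norm ?A * E (size 2) + C1 * E (\<lambda>\<omega>. (1 + 1 * size 1 \<omega>) ^ (m + 2) * size 3 \<omega>)"
    have "\<sigma> * (?\<psi>t - G ?p ?A) \<le> \<delta> * (1 + E (size 2)) + M * sqrt h" if h: "0 < h" "h < r" for h
    proof -
      have h1: "0 \<le> h" "h \<le> 1" and th: "0 \<le> t - h" using h r by auto
      have "\<sigma> * (val h (val (t - h) \<phi>) x - ((?v - h * ?\<psi>t) + h * G ?p ?A))
        \<le> \<delta> * h * (1 + E (size 2)) + M * (h * sqrt h)"
        unfolding M_def using \<delta> C1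
        by (intro quadratic_expectation_le val_C_lLip \<phi> th h1 \<sigma> est h) auto
      \<comment> \<open>Dynamic programming: the values cancel, and what remains is \<open>h\<close>
        times the equation at the touching point.\<close>
      moreover have "val h (val (t - h) \<phi>) x = ?v" using val_semigroup[OF h1(1) th \<phi>, of x] by simp
      ultimately have "h * (\<sigma> * (?\<psi>t - G ?p ?A)) \<le> h * (\<delta> * (1 + E (size 2)) + M * sqrt h)"
        by (simp add: algebra_simps)
      then show ?thesis using h(1) by (simp only: mult_le_cancel_left_pos)
    qed
    then have ev: "\<forall>\<^sub>F h in at_right 0. \<sigma> * (?\<psi>t - G ?p ?A) \<le> \<delta> * (1 + E (size 2)) + M * sqrt h"
      unfolding eventually_at_right_field using r(1) by (intro exI[of _ r]) auto
    have "((\<lambda>h. \<delta> * (1 + E (size 2)) + M * sqrt h) \<longlongrightarrow> \<delta> * (1 + E (size 2)) + M * sqrt 0) (at_right 0)"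
      by (intro tendsto_intros)
    from tendsto_lowerbound[OF this ev] show ?thesis by simp
  qed
  have ev: "\<forall>\<^sub>F \<delta> in at_right 0. \<sigma> * (?\<psi>t - G ?p ?A) \<le> \<delta> * (1 + E (size 2))"
    unfolding eventually_at_right_field using main by (intro exI[of _ 1]) auto
  have "((\<lambda>\<delta>. \<delta> * (1 + E (size 2))) \<longlongrightarrow> 0 * (1 + E (size 2))) (at_right 0)"
    by (intro tendsto_intros)
  from tendsto_lowerbound[OF this ev] show ?thesis by simp
qed

theorem val_G_heat_solution:
  assumes \<phi>: "\<phi> \<in> C_lLip norm"
  shows "G_heat_solution G \<phi> (\<lambda>t. val t \<phi>)"
  unfolding G_heat_solution_def
proof (intro conjI allI impI)
  show "continuous_on ({0..} \<times> UNIV) (\<lambda>(t, x). val t \<phi> x)" by (rule val_continuous[OF \<phi>])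
  show "val 0 \<phi> x = \<phi> x" for x by (rule val_zero)
  show "viscosity_subsolution G (\<lambda>t. val t \<phi>)"
    unfolding viscosity_subsolution_def using val_viscosity[OF \<phi>, of 1] by simp
  show "viscosity_supersolution G (\<lambda>t. val t \<phi>)"
    unfolding viscosity_supersolution_def
  proof (intro allI impI)
    fix \<psi> \<psi>t p A and t :: real and x
    assume \<psi>: "C12_test \<psi> \<psi>t p A" and t: "t > 0"
      and min: "\<forall>\<^sub>F (s, y) in nhds (t, x). val s \<phi> y - \<psi> s y \<ge> val t \<phi> x - \<psi> t x"
    have "\<forall>\<^sub>F (s, y) in nhds (t, x). - 1 * (val s \<phi> y - \<psi> s y) \<le> - 1 * (val t \<phi> x - \<psi> t x)"
      using min by eventually_elim auto
    from val_viscosity[OF \<phi> _ \<psi> t this] show "\<psi>t t x - G (p t x) (A t x) \<ge> 0" by simp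
  qed
  fix T :: real assume T: "T > 0"
  obtain m where m: "\<And>T. T \<ge> 0 \<Longrightarrow> \<exists>D\<ge>0. \<forall>t\<in>{0..T}.
      (\<forall>x y. \<bar>val t \<phi> x - val t \<phi> y\<bar> \<le> D * (1 + norm x + norm y) ^ m * norm (x - y)) \<and>
      (\<forall>x. \<bar>val t \<phi> x\<bar> \<le> D * (1 + norm x) ^ m)" by (rule val_bounds[OF \<phi>]) (rule that)
  obtain D where D: "D \<ge> 0" "\<And>s x. s \<in> {0..T} \<Longrightarrow> \<bar>val s \<phi> x\<bar> \<le> D * (1 + norm x) ^ m"
    using m[of T] T by auto
  have "\<bar>val t \<phi> x\<bar> \<le> (D * 2 ^ m) * (1 + norm x ^ m)" if "t \<in> {0..T}" for t x
    using order_trans[OF D(2)[OF that] mult_left_mono[OF one_plus_power_le[OF norm_ge_zero] D(1)]]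
    by (simp add: mult.assoc)
  then show "\<exists>C m. \<forall>t\<in>{0..T}. \<forall>x. \<bar>val t \<phi> x\<bar> \<le> C * (1 + norm x ^ m)" by blast
qed

end


section \<open>Uniqueness in the class of polynomial growth\<close>

text \<open>The exponent \<open>n + 2\<close> keeps the exponents in the first two derivatives
  natural and leaves room above both the growth \<open>norm x ^ m\<close>, \<open>m \<le> n\<close>,
  and the quadratic term required by the comparison.\<close>

definition weight :: "nat \<Rightarrow> real ^ 'd \<Rightarrow> real" where
  "weight n x = (1 + x \<bullet> x) ^ (n + 2)"

definition weight_grad :: "nat \<Rightarrow> real ^ 'd \<Rightarrow> real ^ 'd" where
  "weight_grad n x = (2 * real (n + 2) * (1 + x \<bullet> x) ^ (n + 1)) *\<^sub>R x"

definition weight_hess :: "nat \<Rightarrow> real ^ 'd \<Rightarrow> real ^ 'd ^ 'd" where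
  "weight_hess n x = (\<chi> i j. (if i = j then 2 * real (n + 2) * (1 + x \<bullet> x) ^ (n + 1) else 0)
     + 4 * real (n + 2) * real (n + 1) * (1 + x \<bullet> x) ^ n * (x $ i * x $ j))"

lemma weight_hess_mult:
  "weight_hess n x *v h = (2 * real (n + 2) * (1 + x \<bullet> x) ^ (n + 1)) *\<^sub>R h
     + (4 * real (n + 2) * real (n + 1) * (1 + x \<bullet> x) ^ n * (x \<bullet> h)) *\<^sub>R x"
proof -
  have "(weight_hess n x *v h) $ i = (2 * real (n + 2) * (1 + x \<bullet> x) ^ (n + 1)) * h $ i
     + (4 * real (n + 2) * real (n + 1) * (1 + x \<bullet> x) ^ n * (x \<bullet> h)) * x $ i" for i
  proof -
    let ?a = "2 * real (n + 2) * (1 + x \<bullet> x) ^ (n + 1)" and ?b = "4 * real (n + 2) * real (n + 1) * (1 + x \<bullet> x) ^ n"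
    have "(weight_hess n x *v h) $ i = (\<Sum>j\<in>UNIV. (if i = j then ?a * h $ j else 0) + ?b * (x $ i * x $ j) * h $ j)"
      unfolding weight_hess_def matrix_vector_mult_def by (auto intro!: sum.cong simp: distrib_right)
    also have "\<dots> = ?a * h $ i + (\<Sum>j\<in>UNIV. ?b * (x $ i * x $ j) * h $ j)"
      by (simp add: sum.distrib)
    also have "(\<Sum>j\<in>UNIV. ?b * (x $ i * x $ j) * h $ j) = ?b * (x \<bullet> h) * x $ i"
      by (simp add: inner_vec_def sum_distrib_left sum_distrib_right mult_ac)
    finally show ?thesis .
  qed
  then show ?thesis by (simp add: vec_eq_iff)
qed

lemma weight_C12_test:
  "C12_test (\<lambda>t x. c * (exp (K * t) * weight n x)) (\<lambda>t x. c * (K * exp (K * t) * weight n x))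
     (\<lambda>t x. (c * exp (K * t)) *\<^sub>R weight_grad n x) (\<lambda>t x. (c * exp (K * t)) *\<^sub>R weight_hess n (x :: real ^ 'd))"
proof -
  have q: "((\<lambda>x. (1 + x \<bullet> x) ^ Suc k) has_derivative (\<lambda>h. real (Suc k) * (2 * (x \<bullet> h)) * (1 + x \<bullet> x) ^ k)) (at x)"
    for k and x :: "real ^ 'd"
    by (rule has_derivative_eq_rhs, (rule derivative_intros)+) (simp add: fun_eq_iff inner_commute mult_ac)
  have w: "(weight n has_derivative (\<lambda>h. weight_grad n x \<bullet> h)) (at x)" for x :: "real ^ 'd"
    using q[of "n + 1" x] by (simp add: weight_def[abs_def] weight_grad_def mult_ac)
  have g: "(weight_grad n has_derivative (\<lambda>h. weight_hess n x *v h)) (at x)" for x :: "real ^ 'd"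
    unfolding weight_grad_def[abs_def] weight_hess_mult
    using has_derivative_scaleR[OF has_derivative_mult_right[OF q[of n x], of "2 * real (n + 2)"] has_derivative_ident]
    by (simp add: algebra_simps)
  have "continuous_on UNIV (\<lambda>x :: real ^ 'd. if i = j then 2 * real (n + 2) * (1 + x \<bullet> x) ^ (n + 1) else 0)"
    for i j :: 'd
    by (cases "i = j") (auto intro!: continuous_intros)
  then have c: "continuous_on UNIV (weight_hess n :: real ^ 'd \<Rightarrow> _)"
    unfolding weight_hess_def by (intro continuous_on_vec_lambda continuous_on_add) (auto intro!: continuous_intros)
  show ?thesis
    unfolding C12_test_def case_prod_unfold
  proof (intro conjI allI impI)
    fix t :: real and x :: "real ^ 'd"
    show "((\<lambda>s. c * (exp (K * s) * weight n x)) has_real_derivative c * (K * exp (K * t) * weight n x)) (at t)"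
      by (auto intro!: derivative_eq_intros)
    show "((\<lambda>y. c * (exp (K * t) * weight n y)) has_derivative (\<lambda>h. ((c * exp (K * t)) *\<^sub>R weight_grad n x) \<bullet> h)) (at x)"
      by (auto intro!: derivative_eq_intros w)
    show "((\<lambda>y. (c * exp (K * t)) *\<^sub>R weight_grad n y) has_derivative (\<lambda>h. ((c * exp (K * t)) *\<^sub>R weight_hess n x) *v h)) (at x)"
      using has_derivative_scaleR_right[OF g, of "c * exp (K * t)" x] by (simp add: scaleR_matrix_vector_assoc)
  next
    show "continuous_on ({0<..} \<times> UNIV) (\<lambda>z :: real \<times> (real ^ 'd). c * (K * exp (K * fst z) * weight n (snd z)))"
      unfolding weight_def by (intro continuous_intros)
    show "continuous_on ({0<..} \<times> UNIV) (\<lambda>z :: real \<times> (real ^ 'd). (c * exp (K * fst z)) *\<^sub>R weight_grad n (snd z))"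
      unfolding weight_grad_def by (intro continuous_intros)
    show "continuous_on ({0<..} \<times> UNIV) (\<lambda>z :: real \<times> (real ^ 'd). (c * exp (K * fst z)) *\<^sub>R weight_hess n (snd z))"
      by (intro continuous_intros continuous_on_compose2[OF c]) auto
  qed
qed

lemma C12_test_add:
  assumes "C12_test \<psi> \<psi>t p A" "C12_test \<psi>' \<psi>t' p' A'"
  shows "C12_test (\<lambda>t x. \<psi> t x + \<psi>' t x) (\<lambda>t x. \<psi>t t x + \<psi>t' t x) (\<lambda>t x. p t x + p' t x) (\<lambda>t x. A t x + A' t x)"
  using assms unfolding C12_test_def case_prod_unfold
  by (auto intro!: derivative_eq_intros continuous_on_add simp: fun_eq_iff inner_add_left matrix_vector_mult_add_rdistrib)

text \<open>Each differentiation lowers the exponent of \<open>1 + x \<bullet> x\<close> by one or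
  adds a factor compensated by it. Hence \<open>exp (K * t) * weight n x\<close> satisfies the
  supersolution inequality.\<close>

lemma (in expectation_pair) weight_generator_bound:
  "\<exists>K\<ge>0. \<forall>x. G (weight_grad n x) (weight_hess n x) \<le> K * weight n x"
proof -
  \<comment> \<open>Large enough for all combinatorial factors that arise from differentiating the
    weight twice.\<close>
  define N where "N = 4 * real (n + 2) * real (n + 2)"
  have N: "N \<ge> 0" by (simp add: N_def)
  define K where "K = N * (E (size 1) + E (size 2))"
  have "G (weight_grad n x) (weight_hess n x) \<le> K * weight n x" for x
  proof -
    let ?s = "1 + x \<bullet> x"
    have s: "?s \<ge> 1" by simp
    have nx: "norm x \<le> ?s" "(norm x)\<^sup>2 \<le> ?s"
    proof -
      have "2 * norm x \<le> 1 + x \<bullet> x" using sum_squares_bound[of "norm x" 1] by (simp add: power2_norm_eq_inner)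
      then show "norm x \<le> ?s" using norm_ge_zero[of x] by linarith
    qed (simp add: power2_norm_eq_inner)
    let ?w = "weight n x"
    have w0: "?w \<ge> 0" by (simp add: weight_def add_nonneg_nonneg)
    have le: "weight_grad n x \<bullet> Y \<omega> + 1/2 * ((weight_hess n x *v X \<omega>) \<bullet> X \<omega>) \<le> (N * ?w) * (size 1 \<omega> + size 2 \<omega>)" for \<omega>
    proof -
      have "weight_grad n x \<bullet> Y \<omega> = (2 * real (n + 2) * ?s ^ (n + 1)) * (x \<bullet> Y \<omega>)"
        by (simp add: weight_grad_def)
      also have "\<dots> \<le> (2 * real (n + 2) * ?s ^ (n + 1)) * (?s * norm (Y \<omega>))"
        using s order_trans[OF norm_cauchy_schwarz[of x "Y \<omega>"] mult_right_mono[OF nx(1)]]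
        by (intro mult_left_mono) auto
      also have "\<dots> = 2 * real (n + 2) * (?w * norm (Y \<omega>))" by (simp add: weight_def)
      also have "\<dots> \<le> N * (?w * size 1 \<omega>)"
      proof (intro mult_mono)
        show "2 * real (n + 2) \<le> N"
        proof -
          have "2 * r \<le> 4 * r * r" if "r \<ge> 1" for r :: real
            using mult_left_mono[of 1 r "4 * r"] that by simp
          from this[of "real (n + 2)"] show ?thesis unfolding N_def by (auto simp del: of_nat_add)
        qed
      qed (use w0 N in \<open>auto simp: size_def\<close>)
      finally have 1: "weight_grad n x \<bullet> Y \<omega> \<le> N * (?w * size 1 \<omega>)" .
      have xx: "X \<omega> \<bullet> X \<omega> \<le> size 2 \<omega>"
        by (simp add: size_def power2_norm_eq_inner[symmetric] power2_sum)
      have s2: "size 2 \<omega> \<ge> 0" by (simp add: size_def)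
      have "(x \<bullet> X \<omega>)\<^sup>2 \<le> (x \<bullet> x) * (X \<omega> \<bullet> X \<omega>)" by (rule Cauchy_Schwarz_ineq)
      also have "\<dots> \<le> ?s * size 2 \<omega>" using xx by (intro mult_mono) auto
      finally have cs: "(x \<bullet> X \<omega>)\<^sup>2 \<le> ?s * size 2 \<omega>" .
      have "1/2 * ((weight_hess n x *v X \<omega>) \<bullet> X \<omega>)
          = (real (n + 2) * ?s ^ (n + 1)) * (X \<omega> \<bullet> X \<omega>) + (2 * real (n + 2) * real (n + 1) * ?s ^ n) * (x \<bullet> X \<omega>)\<^sup>2"
        by (simp add: weight_hess_mult inner_add_left power2_eq_square algebra_simps)
      also have "\<dots> \<le> (real (n + 2) * ?s ^ (n + 2)) * size 2 \<omega> + (2 * real (n + 2) * real (n + 1) * ?s ^ n) * (?s * (?s * size 2 \<omega>))"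
      proof (intro add_mono mult_mono)
        show "?s ^ (n + 1) \<le> ?s ^ (n + 2)" using s by (intro power_increasing) auto
        have "1 * (?s * size 2 \<omega>) \<le> ?s * (?s * size 2 \<omega>)" using s s2 by (intro mult_right_mono) auto
        then show "(x \<bullet> X \<omega>)\<^sup>2 \<le> ?s * (?s * size 2 \<omega>)" using cs by linarith
      qed (use xx s s2 in auto)
      also have "\<dots> = (real (n + 2) + 2 * real (n + 2) * real (n + 1)) * (?w * size 2 \<omega>)"
        by (simp add: weight_def algebra_simps)
      also have "\<dots> \<le> N * (?w * size 2 \<omega>)"
      proof (rule mult_right_mono)
        have "real (n + 2) * (1 + 2 * real (n + 1)) \<le> real (n + 2) * (4 * real (n + 2))"
          by (intro mult_left_mono) auto
        then show "real (n + 2) + 2 * real (n + 2) * real (n + 1) \<le> N"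
          unfolding N_def by (simp only: distrib_left mult_1_right mult_1_left mult_ac)
      qed (use w0 s2 in simp)
      finally show ?thesis using 1 by (simp add: algebra_simps)
    qed
    have "G (weight_grad n x) (weight_hess n x) \<le> E (\<lambda>\<omega>. (N * ?w) * (size 1 \<omega> + size 2 \<omega>))"
      unfolding G_function_def by (rule mono[OF scale_in[OF add_in[OF size_in size_in]] quadratic_in le])
    also have "\<dots> = (N * ?w) * E (\<lambda>\<omega>. size 1 \<omega> + size 2 \<omega>)"
      using N w0 by (intro pos_homog add_in size_in) auto
    also have "\<dots> \<le> (N * ?w) * (E (size 1) + E (size 2))"
      using N w0 by (intro mult_left_mono subadd size_in) auto
    finally show ?thesis by (simp add: K_def mult_ac)
  qed
  moreover have "K \<ge> 0" using N E_size_nonneg by (simp add: K_def)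
  ultimately show ?thesis by blast
qed

text \<open>The weight has one power of \<open>1 + x \<bullet> x\<close> to spare. Where \<kappa>
  times that factor exceeds \<open>b\<close> the weight wins; elsewhere the left side is bounded by
  a constant depending on \<kappa>.\<close>

lemma weight_dominates:
  fixes \<kappa> a :: real
  assumes "\<kappa> > 0" "m \<le> n"
  shows "\<exists>C. \<forall>x :: real ^ 'd. a * (1 + norm x ^ m) + (norm x)\<^sup>2 \<le> C + \<kappa> * weight n x"
proof -
  define b where "b = 2 * \<bar>a\<bar> + 1"
  have b: "b > 0" by (simp add: b_def add_nonneg_pos)
  have "a * (1 + norm x ^ m) + (norm x)\<^sup>2 \<le> b * (b / \<kappa>) ^ (n + 1) + \<kappa> * weight n x" for x :: "real ^ 'd"
  proof -
    let ?s = "1 + x \<bullet> x"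
    have s: "?s \<ge> 1" by simp
    have nx: "norm x \<le> ?s"
    proof -
      have "2 * norm x \<le> 1 + x \<bullet> x" using sum_squares_bound[of "norm x" 1] by (simp add: power2_norm_eq_inner)
      then show ?thesis using norm_ge_zero[of x] by linarith
    qed
    have "norm x ^ m \<le> ?s ^ m" using nx by (intro power_mono) auto
    also have "\<dots> \<le> ?s ^ (n + 1)" using s assms by (intro power_increasing) auto
    finally have 1: "norm x ^ m \<le> ?s ^ (n + 1)" .
    have 2: "1 \<le> ?s ^ (n + 1)" using s by (rule one_le_power)
    have "?s ^ 1 \<le> ?s ^ (n + 1)" using s by (intro power_increasing) auto
    then have 3: "(norm x)\<^sup>2 \<le> ?s ^ (n + 1)" by (simp add: power2_norm_eq_inner)
    have "a * (1 + norm x ^ m) \<le> \<bar>a\<bar> * (2 * ?s ^ (n + 1))"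
      using 1 2 by (intro mult_mono) auto
    with 3 have "a * (1 + norm x ^ m) + (norm x)\<^sup>2 \<le> b * ?s ^ (n + 1)"
      by (simp add: b_def algebra_simps)
    also have "\<dots> \<le> b * (b / \<kappa>) ^ (n + 1) + \<kappa> * weight n x"
    proof (cases "b \<le> \<kappa> * ?s")
      case True
      then have "b * ?s ^ (n + 1) \<le> (\<kappa> * ?s) * ?s ^ (n + 1)" using s by (intro mult_right_mono) auto
      then show ?thesis using b assms by (simp add: weight_def mult_ac add_increasing)
    next
      case False
      then have "?s \<le> b / \<kappa>" using assms by (simp add: field_simps)
      then have "b * ?s ^ (n + 1) \<le> b * (b / \<kappa>) ^ (n + 1)"
        using b s by (intro mult_left_mono power_mono) auto
      moreover have "\<kappa> * weight n x \<ge> 0" using assms s by (simp add: weight_def)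
      ultimately show ?thesis by linarith
    qed
    finally show ?thesis .
  qed
  then show ?thesis by blast
qed

section \<open>Truncation of initial values and perturbation by the weight\<close>

lemma ball_projection:
  fixes K :: real
  assumes "K \<ge> 0"
  obtains P :: "'a::euclidean_space \<Rightarrow> 'a" where "\<And>x. norm (P x) \<le> K" "\<And>x. norm x \<le> K \<Longrightarrow> P x = x"
    "\<And>x y. norm (P x - P y) \<le> norm (x - y)"
proof (rule that[of "closest_point (cball 0 K)"])
  have ne: "cball (0::'a) K \<noteq> {}" using assms by auto
  show "norm (closest_point (cball 0 K) x) \<le> K" for x :: 'a
    using closest_point_in_set[OF closed_cball ne, of x] by simp
  show "closest_point (cball 0 K) x = x" if "norm x \<le> K" for x :: 'a
    using that by (simp add: closest_point_self)
  show "norm (closest_point (cball 0 K) x - closest_point (cball 0 K) y) \<le> norm (x - y)" for x y :: 'a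
    using closest_point_lipschitz[OF convex_cball closed_cball ne] by (simp add: dist_norm)
qed

text \<open>Composing with the projection onto a ball leaves only the Lipschitz constant of \<phi>
  on that ball. Outside, the error has degree \<open>m + 1\<close>, and replacing one radius
  \<open>K\<close> by \<open>norm x\<close> makes it small against the weight.\<close>

lemma C_lLip_truncation:
  fixes \<phi> :: "real ^ 'd \<Rightarrow> real"
  assumes b: "\<And>x y. \<bar>\<phi> x - \<phi> y\<bar> \<le> C * (1 + norm x + norm y) ^ m * norm (x - y)"
    and C: "C \<ge> 0" and mn: "m \<le> n" and \<kappa>: "\<kappa> > 0"
  shows "\<exists>L f. L-lipschitz_on UNIV f \<and> (\<forall>x. \<bar>\<phi> x - f x\<bar> \<le> \<kappa> * weight n x)"
proof -
  \<comment> \<open>For \<open>norm x \<ge> 1\<close> the error is at most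
    \<open>(2 * C * 3 ^ m) * norm x ^ (m + 1)\<close>; this radius absorbs that coefficient into
    \<open>\<kappa> * K\<close>.\<close>
  define K where "K = max 1 (2 * C * 3 ^ m / \<kappa>)"
  have K: "K \<ge> 1" "2 * C * 3 ^ m \<le> \<kappa> * K"
    using \<kappa> by (auto simp: K_def max_def field_simps)
  obtain P :: "real ^ 'd \<Rightarrow> real ^ 'd" where P: "\<And>x. norm (P x) \<le> K" "\<And>x. norm x \<le> K \<Longrightarrow> P x = x"
    "\<And>x y. norm (P x - P y) \<le> norm (x - y)"
    using ball_projection[of K] K by auto
  have w0: "weight n x \<ge> 0" for x :: "real ^ 'd" by (simp add: weight_def add_nonneg_nonneg)
  have "(C * (1 + K + K) ^ m)-lipschitz_on UNIV (\<lambda>x. \<phi> (P x))"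
  proof (rule lipschitz_realI)
    fix x y
    have "\<bar>\<phi> (P x) - \<phi> (P y)\<bar> \<le> C * (1 + norm (P x) + norm (P y)) ^ m * norm (P x - P y)" by (rule b)
    also have "\<dots> \<le> C * (1 + K + K) ^ m * norm (x - y)"
      using C K P by (intro mult_mono mult_left_mono power_mono add_mono) auto
    finally show "\<bar>\<phi> (P x) - \<phi> (P y)\<bar> \<le> C * (1 + K + K) ^ m * norm (x - y)" .
  qed (use C K in auto)
  moreover have "\<bar>\<phi> x - \<phi> (P x)\<bar> \<le> \<kappa> * weight n x" for x
  proof (cases "norm x \<le> K")
    case True
    then show ?thesis using P(2) w0 \<kappa> by simp
  next
    case False
    then have x1: "norm x \<ge> 1" and Px: "norm (P x) \<le> norm x" using K P(1)[of x] by auto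
    let ?s = "1 + x \<bullet> x"
    have nx: "norm x \<le> ?s"
    proof -
      have "2 * norm x \<le> 1 + x \<bullet> x" using sum_squares_bound[of "norm x" 1] by (simp add: power2_norm_eq_inner)
      then show ?thesis using norm_ge_zero[of x] by linarith
    qed
    have "\<bar>\<phi> x - \<phi> (P x)\<bar> \<le> C * (1 + norm x + norm (P x)) ^ m * norm (x - P x)" by (rule b)
    also have "\<dots> \<le> C * (3 * norm x) ^ m * (2 * norm x)"
      using C x1 Px norm_triangle_ineq4[of x "P x"] by (intro mult_mono mult_left_mono power_mono) auto
    also have "\<dots> = (2 * C * 3 ^ m) * norm x ^ (m + 1)" by (simp add: power_mult_distrib)
    also have "\<dots> \<le> (\<kappa> * K) * norm x ^ (m + 1)" using K by (intro mult_right_mono) auto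
    also have "\<dots> \<le> (\<kappa> * norm x) * norm x ^ (m + 1)"
      using False \<kappa> by (intro mult_right_mono mult_left_mono) auto
    also have "\<dots> = \<kappa> * norm x ^ (m + 2)" by simp
    also have "\<dots> \<le> \<kappa> * ?s ^ (m + 2)" using nx \<kappa> by (intro mult_left_mono power_mono) auto
    also have "\<dots> \<le> \<kappa> * weight n x"
      unfolding weight_def using \<kappa> mn by (intro mult_left_mono power_increasing) auto
    finally show ?thesis .
  qed
  ultimately show ?thesis by blast
qed

text \<open>The weight is moved into the test function; its time derivative pays for its
  contribution to \<open>G\<close>, which subadditivity separates from the rest.\<close>

lemma (in expectation_pair) perturbed_subsolution:
  assumes K: "\<And>x. G (weight_grad n x) (weight_hess n x) \<le> K * weight n x" and \<kappa>: "\<kappa> \<ge> 0"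
    and w: "viscosity_subsolution G w"
  shows "viscosity_subsolution G (\<lambda>t x. w t x - \<kappa> * (exp (K * t) * weight n x))"
  unfolding viscosity_subsolution_def
proof (intro allI impI)
  interpret G: sublinear_generator G by (rule G_sublinear_generator)
  fix \<psi> \<psi>t p A and t :: real and x
  assume \<psi>: "C12_test \<psi> \<psi>t p A" and t: "t > 0"
    and max: "\<forall>\<^sub>F (s, y) in nhds (t, x). w s y - \<kappa> * (exp (K * s) * weight n y) - \<psi> s y
      \<le> w t x - \<kappa> * (exp (K * t) * weight n x) - \<psi> t x"
  have max': "\<forall>\<^sub>F (s, y) in nhds (t, x). w s y - (\<psi> s y + \<kappa> * (exp (K * s) * weight n y))
      \<le> w t x - (\<psi> t x + \<kappa> * (exp (K * t) * weight n x))"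
    using max by eventually_elim auto
  let ?e = "\<kappa> * exp (K * t)"
  from w[unfolded viscosity_subsolution_def, rule_format, OF C12_test_add[OF \<psi> weight_C12_test] t max']
  have "\<psi>t t x + \<kappa> * (K * exp (K * t) * weight n x)
      \<le> G (p t x + ?e *\<^sub>R weight_grad n x) (A t x + ?e *\<^sub>R weight_hess n x)" by simp
  also have "\<dots> \<le> G (p t x) (A t x) + ?e * G (weight_grad n x) (weight_hess n x)"
    using G.G_add[of "p t x" "?e *\<^sub>R weight_grad n x" "A t x" "?e *\<^sub>R weight_hess n x"]
      G.G_scale[of ?e "weight_grad n x" "weight_hess n x"] \<kappa> by simp
  also have "\<dots> \<le> G (p t x) (A t x) + ?e * (K * weight n x)"
    using K[of x] \<kappa> by (intro add_left_mono mult_left_mono) auto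
  finally show "\<psi>t t x - G (p t x) (A t x) \<le> 0" by (simp add: mult_ac)
qed

text \<open>Here subadditivity is read backwards: \<open>G\<close> at the given derivatives is at
  most \<open>G\<close> at the derivatives reduced by those of the weight, plus \<open>G\<close> at
  the latter.\<close>

lemma (in expectation_pair) perturbed_supersolution:
  assumes K: "\<And>x. G (weight_grad n x) (weight_hess n x) \<le> K * weight n x" and \<kappa>: "\<kappa> \<ge> 0"
    and w: "viscosity_supersolution G w"
  shows "viscosity_supersolution G (\<lambda>t x. w t x + \<kappa> * (exp (K * t) * weight n x))"
  unfolding viscosity_supersolution_def
proof (intro allI impI)
  interpret G: sublinear_generator G by (rule G_sublinear_generator)
  fix \<psi> \<psi>t p A and t :: real and x
  assume \<psi>: "C12_test \<psi> \<psi>t p A" and t: "t > 0"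
    and min: "\<forall>\<^sub>F (s, y) in nhds (t, x). w s y + \<kappa> * (exp (K * s) * weight n y) - \<psi> s y
      \<ge> w t x + \<kappa> * (exp (K * t) * weight n x) - \<psi> t x"
  have min': "\<forall>\<^sub>F (s, y) in nhds (t, x). w s y - (\<psi> s y + - \<kappa> * (exp (K * s) * weight n y))
      \<ge> w t x - (\<psi> t x + - \<kappa> * (exp (K * t) * weight n x))"
    using min by eventually_elim auto
  let ?e = "\<kappa> * exp (K * t)"
  let ?q = "p t x + (- \<kappa> * exp (K * t)) *\<^sub>R weight_grad n x" and ?B = "A t x + (- \<kappa> * exp (K * t)) *\<^sub>R weight_hess n x"
  have "G (p t x) (A t x) \<le> G ?q ?B + ?e * G (weight_grad n x) (weight_hess n x)"
    using G.G_add[of ?q "?e *\<^sub>R weight_grad n x" ?B "?e *\<^sub>R weight_hess n x"]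
      G.G_scale[of ?e "weight_grad n x" "weight_hess n x"] \<kappa> by simp
  also have "\<dots> \<le> G ?q ?B + ?e * (K * weight n x)"
    using K[of x] \<kappa> by (intro add_left_mono mult_left_mono) auto
  also have "G ?q ?B \<le> \<psi>t t x + - \<kappa> * (K * exp (K * t) * weight n x)"
    using w[unfolded viscosity_supersolution_def, rule_format, OF C12_test_add[OF \<psi> weight_C12_test] t min'] by simp
  finally show "\<psi>t t x - G (p t x) (A t x) \<ge> 0" by (simp add: mult_ac)
qed

context G_pair
begin

lemma weight_C_lLip: "weight n \<in> C_lLip (norm :: real ^ 'd \<Rightarrow> real)"
proof -
  have "(\<lambda>x :: real ^ 'd. (1 + norm x ^ 2) ^ (n + 2)) \<in> C_lLip norm"
    by (intro C_lLip_power C_lLip_add C_lLip_const lipschitz_C_lLip[OF lipschitz_norm])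
  then show ?thesis by (simp add: weight_def[abs_def] power2_norm_eq_inner)
qed

lemma val_perturb:
  assumes f: "f \<in> C_lLip norm" and g: "g \<in> C_lLip norm" and \<kappa>: "\<kappa> \<ge> 0"
    and le: "\<And>x. f x \<le> g x + \<kappa> * weight n x"
  shows "val t f x \<le> val t g x + \<kappa> * val t (weight n) x"
proof -
  let ?z = "\<lambda>\<omega>. x + (sqrt t *\<^sub>R X \<omega> + t *\<^sub>R \<eta> \<omega>)"
  have "val t f x \<le> E (\<lambda>\<omega>. g (?z \<omega>) + \<kappa> * weight n (?z \<omega>))"
    unfolding val_eq using le
    by (intro mono add_in scale_in comp_step_in f g weight_C_lLip)
  also have "\<dots> \<le> val t g x + E (\<lambda>\<omega>. \<kappa> * weight n (?z \<omega>))"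
    unfolding val_eq by (intro subadd scale_in comp_step_in g weight_C_lLip)
  also have "E (\<lambda>\<omega>. \<kappa> * weight n (?z \<omega>)) = \<kappa> * val t (weight n) x"
    unfolding val_eq by (intro pos_homog comp_step_in weight_C_lLip \<kappa>)
  finally show ?thesis .
qed

text \<open>Upper and lower bounds come from the two comparison theorems for the perturbed
  \<open>w\<close>, with the same Lipschitz truncation \<open>f\<close>. The gap is
  \<open>\<kappa> * M\<close> at a fixed point, with \<open>M\<close> independent of
  \<kappa>.\<close>

theorem G_heat_solution_unique:
  assumes \<phi>: "\<phi> \<in> C_lLip norm" and w: "G_heat_solution G \<phi> w" and t: "t \<ge> 0"
  shows "w t x = val t \<phi> x"
proof -
  interpret S: generated_semigroup law G by (rule law_generated_semigroup)
  obtain C m where C: "C \<ge> 0"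
    "\<And>x y. \<bar>\<phi> x - \<phi> y\<bar> \<le> C * (1 + norm x + norm y) ^ m * norm (x - y)" by (rule C_lLipD[OF \<phi>]) (rule that)
  have cw: "continuous_on ({0..} \<times> UNIV) (\<lambda>(t, x). w t x)" and w0: "\<And>x. w 0 x = \<phi> x"
    and sub: "viscosity_subsolution G w" and super: "viscosity_supersolution G w"
    using w unfolding G_heat_solution_def by blast+
  \<comment> \<open>The extra unit of time is the room that the comparison needs for its
    penalty.\<close>
  have "\<exists>C. \<exists>m::nat. \<forall>s\<in>{0..t + 1}. \<forall>x. \<bar>w s x\<bar> \<le> C * (1 + norm x ^ m)"
    using w t unfolding G_heat_solution_def by (simp add: add_nonneg_pos)
  then obtain a k where a: "\<And>s x. s \<in> {0..t + 1} \<Longrightarrow> \<bar>w s x\<bar> \<le> a * (1 + norm x ^ k)" by blast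
  define n where "n = max m k"
  obtain K where K: "K \<ge> 0" "\<And>x. G (weight_grad n x) (weight_hess n x) \<le> K * weight n x"
    using weight_generator_bound[of n] by blast
  \<comment> \<open>Cost per unit of \<kappa>: the perturbation at \<open>(t, x)\<close> itself and
    the initial truncation error propagated by the semigroup.\<close>
  define M where "M = exp (K * t) * weight n x + val t (weight n) x"
  have wn0: "weight n y \<ge> 0" for y :: "real ^ 'd" by (simp add: weight_def add_nonneg_nonneg)
  have cp: "continuous_on ({0..} \<times> UNIV) (\<lambda>z :: real \<times> (real ^ 'd). c * (exp (K * fst z) * weight n (snd z)))" for c
    unfolding weight_def by (intro continuous_intros)
  have both: "\<bar>w t x - val t \<phi> x\<bar> \<le> \<kappa> * M" if \<kappa>: "\<kappa> > 0" for \<kappa>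
  proof -
    let ?p = "\<lambda>s y. \<kappa> * (exp (K * s) * weight n y)"
    obtain L f where f: "L-lipschitz_on UNIV f" and close: "\<And>y. \<bar>\<phi> y - f y\<bar> \<le> \<kappa> * weight n y"
      using C_lLip_truncation[OF C(2) C(1) _ \<kappa>, of n] by (auto simp: n_def)
    obtain B where B: "\<And>y :: real ^ 'd. a * (1 + norm y ^ k) + (norm y)\<^sup>2 \<le> B + \<kappa> * weight n y"
      using weight_dominates[OF \<kappa>, of k n a] by (auto simp: n_def)
    have grow: "\<bar>w s y\<bar> + (norm y)\<^sup>2 \<le> B + ?p s y" if s: "s \<in> {0..t + 1}" for s y
    proof -
      have "1 * weight n y \<le> exp (K * s) * weight n y"
        using wn0 K(1) s by (intro mult_right_mono) auto
      then have "\<kappa> * weight n y \<le> ?p s y" using \<kappa> by (intro mult_left_mono) auto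
      then show ?thesis using a[OF s, of y] B[of y] by linarith
    qed
    have le0: "f y \<le> \<phi> y + \<kappa> * weight n y" "\<phi> y \<le> f y + \<kappa> * weight n y" for y
      using close[of y] by linarith+
    have "w t x - ?p t x \<le> conv (law (t - 0)) f x"
    proof (rule S.subsolution_le[where C = B, OF perturbed_subsolution[OF K(2) less_imp_le[OF \<kappa>] sub]])
      show "continuous_on ({0..} \<times> UNIV) (\<lambda>(s, y). w s y - ?p s y)"
        using cw cp[of \<kappa>] unfolding case_prod_unfold by (intro continuous_on_diff)
      show "w s y - ?p s y \<le> B - (norm y)\<^sup>2" if "s \<in> {0..t + 1}" for s y
        using grow[OF that, of y] by linarith
      show "w 0 y - ?p 0 y \<le> f y" for y using le0(2)[of y] by (simp add: w0)
    qed (use f t in auto)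
    also have "\<dots> \<le> val t \<phi> x + \<kappa> * val t (weight n) x"
      using val_perturb[OF lipschitz_C_lLip[OF f] \<phi> less_imp_le[OF \<kappa>] le0(1), of t x] by simp
    finally have 1: "w t x - val t \<phi> x \<le> \<kappa> * M" by (simp add: M_def algebra_simps)
    have "conv (law t) f x \<le> w t x + ?p t x"
    proof (rule supersolution_ge[where C = B, OF law_generated_semigroup G_sublinear_generator
          perturbed_supersolution[OF K(2) less_imp_le[OF \<kappa>] super]])
      show "continuous_on ({0..} \<times> UNIV) (\<lambda>(s, y). w s y + ?p s y)"
        using cw cp[of \<kappa>] unfolding case_prod_unfold by (intro continuous_on_add)
      show "(norm y)\<^sup>2 - B \<le> w s y + ?p s y" if "s \<in> {0..t + 1}" for s y
        using grow[OF that, of y] by linarith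
      show "f y \<le> w 0 y + ?p 0 y" for y using le0(1)[of y] by (simp add: w0)
    qed (use f t in auto)
    moreover have "val t \<phi> x \<le> val t f x + \<kappa> * val t (weight n) x"
      by (rule val_perturb[OF \<phi> lipschitz_C_lLip[OF f] less_imp_le[OF \<kappa>] le0(2)])
    ultimately have 2: "val t \<phi> x - w t x \<le> \<kappa> * M" by (simp add: M_def algebra_simps)
    from 1 2 show ?thesis by linarith
  qed
  have ev: "\<forall>\<^sub>F \<kappa> in at_right 0. \<bar>w t x - val t \<phi> x\<bar> \<le> \<kappa> * M"
    unfolding eventually_at_right_field using both by (intro exI[of _ 1]) auto
  have "((\<lambda>\<kappa>. \<kappa> * M) \<longlongrightarrow> 0 * M) (at_right 0)" by (intro tendsto_intros)
  from tendsto_lowerbound[OF this ev] show ?thesis by simp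
qed

end


section \<open>Test functions of linear growth\<close>

text \<open>A single approximation with its error bound suffices: it is compared with a defining
  sequence of the extension, whose own error tends to 0.\<close>

lemma (in sublinear_expectation) ext_expectation_approx:
  fixes Z :: "'w \<Rightarrow> 'a::euclidean_space"
  assumes Z: "random_vector H Z" and cont: "continuous_on UNIV \<phi>" and bound: "\<And>x. \<bar>\<phi> x\<bar> \<le> C * (1 + norm x)"
    and \<Phi>: "\<Phi> \<in> C_lLip norm" and \<Psi>: "\<Psi> \<in> C_lLip norm" and close: "\<And>x. \<bar>\<phi> x - \<Phi> x\<bar> \<le> \<Psi> x"
  shows "\<bar>ext_expectation E Z \<phi> - E (\<lambda>\<omega>. \<Phi> (Z \<omega>))\<bar> \<le> E (\<lambda>\<omega>. \<Psi> (Z \<omega>))"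
proof -
  obtain \<Phi>' \<Psi>' where 2: "\<And>k. \<Phi>' k \<in> C_lLip norm" "\<And>k. \<Psi>' k \<in> C_lLip norm"
      "\<And>k x. \<bar>\<phi> x - \<Phi>' k x\<bar> \<le> \<Psi>' k x"
      "(\<lambda>k. E (\<lambda>\<omega>. \<Psi>' k (Z \<omega>))) \<longlonglongrightarrow> 0" "(\<lambda>k. E (\<lambda>\<omega>. \<Phi>' k (Z \<omega>))) \<longlonglongrightarrow> ext_expectation E Z \<phi>"
    using ext_expectation_is_ext_expectation[OF Z cont bound] unfolding ext_expectation_is_def by blast
  have le: "\<bar>E (\<lambda>\<omega>. \<Phi>' k (Z \<omega>)) - E (\<lambda>\<omega>. \<Phi> (Z \<omega>))\<bar> \<le> E (\<lambda>\<omega>. \<Psi>' k (Z \<omega>)) + E (\<lambda>\<omega>. \<Psi> (Z \<omega>))" for k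
  proof -
    have "\<bar>\<Phi>' k (Z \<omega>) - \<Phi> (Z \<omega>)\<bar> \<le> \<Psi>' k (Z \<omega>) + \<Psi> (Z \<omega>)" for \<omega>
      using close[of "Z \<omega>"] 2(3)[of "Z \<omega>" k] by linarith
    then have "\<bar>E (\<lambda>\<omega>. \<Phi>' k (Z \<omega>)) - E (\<lambda>\<omega>. \<Phi> (Z \<omega>))\<bar> \<le> E (\<lambda>\<omega>. \<Psi>' k (Z \<omega>) + \<Psi> (Z \<omega>))"
      by (intro abs_diff_le add_in comp_in[OF Z] \<Phi> \<Psi> 2)
    also have "\<dots> \<le> E (\<lambda>\<omega>. \<Psi>' k (Z \<omega>)) + E (\<lambda>\<omega>. \<Psi> (Z \<omega>))"
      by (intro subadd comp_in[OF Z] \<Psi> 2)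
    finally show ?thesis .
  qed
  have "(\<lambda>k. \<bar>E (\<lambda>\<omega>. \<Phi>' k (Z \<omega>)) - E (\<lambda>\<omega>. \<Phi> (Z \<omega>))\<bar>) \<longlonglongrightarrow> \<bar>ext_expectation E Z \<phi> - E (\<lambda>\<omega>. \<Phi> (Z \<omega>))\<bar>"
    by (intro tendsto_intros 2)
  moreover have "(\<lambda>k. E (\<lambda>\<omega>. \<Psi>' k (Z \<omega>)) + E (\<lambda>\<omega>. \<Psi> (Z \<omega>))) \<longlonglongrightarrow> 0 + E (\<lambda>\<omega>. \<Psi> (Z \<omega>))"
    by (intro tendsto_intros 2)
  ultimately show ?thesis
    using LIMSEQ_le[of _ "\<bar>ext_expectation E Z \<phi> - E (\<lambda>\<omega>. \<Phi> (Z \<omega>))\<bar>" _ "0 + E (\<lambda>\<omega>. \<Psi> (Z \<omega>))"] le by auto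
qed

text \<open>The Lipschitz approximation is an infimal convolution of the truncated function.\<close>

lemma linear_growth_approximation:
  fixes \<phi> :: "'a::euclidean_space \<Rightarrow> real"
  assumes cont: "continuous_on UNIV \<phi>" and bound: "\<And>x. \<bar>\<phi> x\<bar> \<le> C * (1 + norm x)"
    and \<epsilon>: "\<epsilon> > 0" and K: "K \<ge> 1"
  shows "\<exists>\<Phi>. Lip \<Phi> \<and> (\<forall>x. \<bar>\<phi> x - \<Phi> x\<bar> \<le> \<epsilon> + 4 * C * max 0 (2 * norm x - K))"
proof -
  have C: "C \<ge> 0" using bound[of 0] by simp
  obtain P :: "'a \<Rightarrow> 'a" where P: "\<And>x. norm (P x) \<le> K" "\<And>x. norm x \<le> K \<Longrightarrow> P x = x"
    "\<And>x y. norm (P x - P y) \<le> norm (x - y)"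
    using ball_projection[of K] K by auto
  define g where "g x = \<phi> (P x)" for x
  define B where "B = C * (1 + K)"
  have gB: "\<bar>g x\<bar> \<le> B" for x
    using bound[of "P x"] P(1)[of x] C mult_left_mono[of "1 + norm (P x)" "1 + K" C] by (simp add: g_def B_def)
  have "uniformly_continuous_on (cball 0 K) \<phi>"
    by (intro compact_uniformly_continuous continuous_on_subset[OF cont]) auto
  then obtain d where d: "d > 0" "\<And>x y. x \<in> cball 0 K \<Longrightarrow> y \<in> cball 0 K \<Longrightarrow> dist y x < d \<Longrightarrow> dist (\<phi> y) (\<phi> x) < \<epsilon>"
    unfolding uniformly_continuous_on_def using \<epsilon> by metis
  have gu: "\<bar>g y - g x\<bar> < \<epsilon>" if "norm (y - x) < d" for x y
    using d(2)[of "P x" "P y"] P(1) P(3)[of y x] that by (simp add: g_def dist_norm)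
  \<comment> \<open>At distance at least \<open>d\<close> the cone has risen by
    \<open>2 * B\<close>, the largest possible oscillation of \<open>g\<close>; nearer than
    \<open>d\<close>, \<open>g\<close> varies by less than \<epsilon>.\<close>
  define N where "N = 2 * B / d"
  have N: "N \<ge> 0" using gB[of 0] d by (simp add: N_def)
  define \<Phi> where "\<Phi> x = (INF y. g y + N * norm (x - y))" for x
  have bdd: "bdd_below (range (\<lambda>y. g y + N * norm (x - y)))" for x
  proof (rule bdd_belowI2)
    show "- B \<le> g y + N * norm (x - y)" for y
      using gB[of y] mult_nonneg_nonneg[OF N norm_ge_zero[of "x - y"]] by linarith
  qed
  have up: "\<Phi> x \<le> g y + N * norm (x - y)" for x y
    unfolding \<Phi>_def by (rule cINF_lower[OF bdd]) simp
  have low: "g x - \<epsilon> \<le> \<Phi> x" for x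
    unfolding \<Phi>_def
  proof (rule cINF_greatest)
    fix y
    show "g x - \<epsilon> \<le> g y + N * norm (x - y)"
    proof (cases "norm (x - y) < d")
      case True
      then show ?thesis using gu[of x y] mult_nonneg_nonneg[OF N norm_ge_zero[of "x - y"]] by linarith
    next
      case False
      then have "N * d \<le> N * norm (x - y)" using N by (intro mult_left_mono) auto
      moreover have "N * d = 2 * B" using d by (simp add: N_def)
      ultimately show ?thesis using gB[of x] gB[of y] \<epsilon> by linarith
    qed
  qed simp
  have "N-lipschitz_on UNIV \<Phi>"
  proof (rule lipschitz_realI)
    have *: "\<Phi> x \<le> \<Phi> y + N * norm (x - y)" for x y
    proof -
      have "\<Phi> x - N * norm (x - y) \<le> g z + N * norm (y - z)" for z
        using up[of x z] mult_left_mono[OF norm_triangle_ineq[of "x - y" "y - z"] N] by (simp add: distrib_left)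
      then have "\<Phi> x - N * norm (x - y) \<le> \<Phi> y" unfolding \<Phi>_def[of y] by (intro cINF_greatest) auto
      then show ?thesis by linarith
    qed
    show "\<bar>\<Phi> x - \<Phi> y\<bar> \<le> N * norm (x - y)" for x y
      using *[of x y] *[of y x] by (simp add: norm_minus_commute abs_le_iff)
  qed (rule N)
  moreover have "\<bar>\<phi> x - \<Phi> x\<bar> \<le> \<epsilon> + 4 * C * max 0 (2 * norm x - K)" for x
  proof -
    have 1: "\<bar>g x - \<Phi> x\<bar> \<le> \<epsilon>" using up[of x x] low[of x] \<epsilon> by (simp add: abs_le_iff)
    have "\<bar>\<phi> x - g x\<bar> \<le> 4 * C * max 0 (2 * norm x - K)"
    proof (cases "norm x \<le> K")
      case True
      then show ?thesis using P(2) C by (simp add: g_def)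
    next
      case False
      have "\<bar>\<phi> x - g x\<bar> \<le> C * (1 + norm x) + C * (1 + norm (P x))"
        using bound[of x] bound[of "P x"] unfolding g_def by linarith
      also have "\<dots> \<le> C * (2 * norm x) + C * (2 * norm x)"
        using False K P(1)[of x] C by (intro add_mono mult_left_mono) auto
      also have "\<dots> = 4 * C * norm x" by simp
      also have "\<dots> \<le> 4 * C * max 0 (2 * norm x - K)"
        using False C by (intro mult_left_mono) auto
      finally show ?thesis .
    qed
    with 1 show ?thesis by linarith
  qed
  ultimately show ?thesis using LipI by blast
qed


section \<open>Sums of independent random vectors\<close>

text \<open>Certifies the partial sum plus the next increment as a test function for independence,
  which is formulated through a seminorm on tuples.\<close>

lemma tuple_sum_C_lLip:
  fixes f :: "real ^ 'd \<Rightarrow> real" and a b :: real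
  assumes f: "L-lipschitz_on UNIV f" and I: "finite I"
  shows "(\<lambda>z :: ('i \<Rightarrow> (real ^ 'd) \<times> (real ^ 'd)) \<times> ((real ^ 'd) \<times> (real ^ 'd)).
      f (x + (\<Sum>i\<in>I. a *\<^sub>R fst (fst z i) + b *\<^sub>R snd (fst z i)) + (a *\<^sub>R fst (snd z) + b *\<^sub>R snd (snd z))))
    \<in> C_lLip (pair_norm (tuple_norm I) norm)"
proof -
  have L: "L \<ge> 0" by (rule lipschitz_on_nonneg[OF f])
  define l where "l v = a *\<^sub>R fst v + b *\<^sub>R snd v" for v :: "(real ^ 'd) \<times> (real ^ 'd)"
  have ld: "l (u - v) = l u - l v" for u v by (simp add: l_def algebra_simps)
  have ln: "norm (l v) \<le> (\<bar>a\<bar> + \<bar>b\<bar>) * norm v" for v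
  proof -
    have "norm (l v) \<le> \<bar>a\<bar> * norm (fst v) + \<bar>b\<bar> * norm (snd v)"
      unfolding l_def using norm_triangle_ineq[of "a *\<^sub>R fst v" "b *\<^sub>R snd v"] by simp
    also have "\<dots> \<le> \<bar>a\<bar> * norm v + \<bar>b\<bar> * norm v"
      using norm_fst_le[of "fst v" "snd v"] norm_snd_le[of "snd v" "fst v"]
      by (intro add_mono mult_left_mono) auto
    finally show ?thesis by (simp add: distrib_right)
  qed
  define D where "D = L * ((\<bar>a\<bar> + \<bar>b\<bar>) * (card I + 1)) + 1"
  have D: "D > 0" using L by (simp add: D_def add_nonneg_pos)
  let ?N = "pair_norm (tuple_norm I) norm"
  let ?g = "\<lambda>z. f (x + (\<Sum>i\<in>I. l (fst z i)) + l (snd z))"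
  have "\<bar>?g z - ?g w\<bar> \<le> D * (1 + ?N z ^ 0 + ?N w ^ 0) * ?N (z - w)" for z w
  proof -
    have N0: "?N (z - w) \<ge> 0" by (simp add: pair_norm_def)
    have "norm (fst z i - fst w i) \<le> tuple_norm I (fst (z - w))" if "i \<in> I" for i
      unfolding tuple_norm_def using member_le_L2_set[OF I that, of "\<lambda>i. norm (fst (z - w) i)"] by simp
    also have "tuple_norm I (fst (z - w)) \<le> ?N (z - w)"
      unfolding pair_norm_def by (rule real_le_rsqrt) simp
    finally have n1: "norm (fst z i - fst w i) \<le> ?N (z - w)" if "i \<in> I" for i using that .
    have n2: "norm (snd z - snd w) \<le> ?N (z - w)"
      unfolding pair_norm_def by (rule real_le_rsqrt) simp
    have "\<bar>?g z - ?g w\<bar> \<le> L * norm ((\<Sum>i\<in>I. l (fst z i - fst w i)) + l (snd z - snd w))"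
      using lipschitz_realD[OF f, of "x + (\<Sum>i\<in>I. l (fst z i)) + l (snd z)" "x + (\<Sum>i\<in>I. l (fst w i)) + l (snd w)"]
      by (simp add: ld sum_subtractf algebra_simps)
    also have "\<dots> \<le> L * ((\<Sum>i\<in>I. (\<bar>a\<bar> + \<bar>b\<bar>) * ?N (z - w)) + (\<bar>a\<bar> + \<bar>b\<bar>) * ?N (z - w))"
    proof (intro mult_left_mono L order_trans[OF norm_triangle_ineq] add_mono order_trans[OF norm_sum] sum_mono)
      show "norm (l (fst z i - fst w i)) \<le> (\<bar>a\<bar> + \<bar>b\<bar>) * ?N (z - w)" if "i \<in> I" for i
        using order_trans[OF ln mult_left_mono[OF n1[OF that]]] by simp
      show "norm (l (snd z - snd w)) \<le> (\<bar>a\<bar> + \<bar>b\<bar>) * ?N (z - w)"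
        using order_trans[OF ln mult_left_mono[OF n2]] by simp
    qed
    also have "\<dots> = (D - 1) * ?N (z - w)" by (simp add: D_def algebra_simps)
    also have "\<dots> \<le> (D * 3) * ?N (z - w)" using D N0 by (intro mult_right_mono) auto
    finally show ?thesis by simp
  qed
  then show ?thesis
    unfolding C_lLip_def l_def using D by blast
qed

text \<open>Independence freezes the first \<open>n\<close> summands and integrates the last one,
  which replaces \<open>f\<close> by one step of the scheme; hence the induction runs over all
  Lipschitz \<open>f\<close>.\<close>

lemma iid_sum_expectation:
  fixes X Y :: "nat \<Rightarrow> 'w \<Rightarrow> real ^ 'd" and h x
  assumes E: "expectation_pair H E (X 1) (Y 1)"
    and law: "\<And>i. 1 \<le> i \<Longrightarrow> same_law E (\<lambda>\<omega>. (X (Suc i) \<omega>, Y (Suc i) \<omega>)) E (\<lambda>\<omega>. (X i \<omega>, Y i \<omega>))"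
    and ind: "\<And>i. 1 \<le> i \<Longrightarrow> independent_from (tuple_norm {1..i}) E
        (\<lambda>\<omega> j. (X j \<omega>, Y j \<omega>)) (\<lambda>\<omega>. (X (Suc i) \<omega>, Y (Suc i) \<omega>))"
    and f: "L-lipschitz_on UNIV f"
  shows "E (\<lambda>\<omega>. f (x + (\<Sum>i=1..n. sqrt h *\<^sub>R X i \<omega> + h *\<^sub>R Y i \<omega>)))
    = (conv (expectation_pair.law E (X 1) (Y 1) h) ^^ n) f x"
proof -
  interpret E: expectation_pair H E "X 1" "Y 1" by (rule E)
  have same: "same_law E (\<lambda>\<omega>. (X (Suc i) \<omega>, Y (Suc i) \<omega>)) E (\<lambda>\<omega>. (X 1 \<omega>, Y 1 \<omega>))" for i
  proof (induction i)
    case 0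
    show ?case by (simp add: same_law_def)
  next
    case (Suc i)
    then show ?case using law[of "Suc i"] by (simp add: same_law_def)
  qed
  have step: "E (\<lambda>\<omega>. g (y + (sqrt h *\<^sub>R X (Suc i) \<omega> + h *\<^sub>R Y (Suc i) \<omega>))) = conv (E.law h) g y"
    if g: "M-lipschitz_on UNIV g" for M g i y
  proof -
    have "(\<lambda>z. g ((sqrt h *\<^sub>R fst z + h *\<^sub>R snd z) + y)) \<in> C_lLip norm"
      by (rule C_lLip_affine[OF lipschitz_C_lLip[OF g] E.bounded_linear_combination])
    from bspec[OF same[unfolded same_law_def] this] show ?thesis
      unfolding conv_def E.law_def by (simp add: add.commute)
  qed
  show ?thesis
    using f
  proof (induction n arbitrary: f)
    case 0
    show ?case by (simp add: E.const)
  next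
    case (Suc n)
    let ?S = "\<lambda>\<omega>. \<Sum>i=1..n. sqrt h *\<^sub>R X i \<omega> + h *\<^sub>R Y i \<omega>"
    have "E (\<lambda>\<omega>. f (x + (\<Sum>i=1..Suc n. sqrt h *\<^sub>R X i \<omega> + h *\<^sub>R Y i \<omega>)))
        = E (\<lambda>\<omega>. f ((x + ?S \<omega>) + (sqrt h *\<^sub>R X (Suc n) \<omega> + h *\<^sub>R Y (Suc n) \<omega>)))"
      by (simp add: add.assoc)
    also have "\<dots> = E (\<lambda>\<omega>. E (\<lambda>\<omega>'. f ((x + ?S \<omega>) + (sqrt h *\<^sub>R X (Suc n) \<omega>' + h *\<^sub>R Y (Suc n) \<omega>'))))"
    \<comment> \<open>Independence is assumed from index 1 on; with an empty sum the outer
      expectation is that of a constant.\<close>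
    proof (cases "n = 0")
      case True
      then show ?thesis by (simp add: E.const)
    next
      case False
      then have n: "1 \<le> n" by simp
      from bspec[OF ind[OF n, unfolded independent_from_def]
          tuple_sum_C_lLip[OF Suc.prems finite_atLeastAtMost, where x = x and a = "sqrt h" and b = h]]
      show ?thesis by simp
    qed
    also have "\<dots> = E (\<lambda>\<omega>. conv (E.law h) f (x + ?S \<omega>))"
      by (simp only: step[OF Suc.prems])
    also have "\<dots> = (conv (E.law h) ^^ n) (conv (E.law h) f) x"
      by (rule Suc.IH[OF sublinear_functional.conv_lipschitz[OF E.law_sublinear Suc.prems]])
    finally show ?case by (simp add: funpow_swap1)
  qed
qed

lemma Lip_ramp: "Lip (\<lambda>x :: 'a::real_normed_vector. max 0 (2 * norm x - K))"
proof (rule LipI, rule lipschitz_realI)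
  show "\<bar>max 0 (2 * norm x - K) - max 0 (2 * norm y - K)\<bar> \<le> 2 * norm (x - y)" for x y :: 'a
    using norm_triangle_ineq3[of x y] by (simp add: max_def abs_if split: if_splits)
qed simp

text \<open>From \<open>0 \<le> (r - K)\<^sup>2\<close> the ramp is at most
  \<open>r\<^sup>2 / K\<close>, so second moments control the tail. The ramp is used instead of this
  quadratic bound because it is Lipschitz, so that the limit theorem applies to the error term as
  well.\<close>

lemma (in expectation_pair) ramp_le:
  assumes K: "K > 0"
  shows "E (\<lambda>\<omega>. max 0 (2 * norm (X \<omega> + Y \<omega>) - K)) \<le> E (size 2) / K"
proof -
  have ramp: "Lip (\<lambda>x :: real ^ 'd. max 0 (2 * norm x - K))"
    by (rule Lip_ramp)
  have "(\<lambda>\<omega>. max 0 (2 * norm (1 *\<^sub>R X \<omega> + 1 *\<^sub>R Y \<omega>) - K)) \<in> H"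
    by (rule comp_step_in'[OF Lip_C_lLip[OF ramp]])
  moreover have "max 0 (2 * norm (X \<omega> + Y \<omega>) - K) \<le> 1 / K * size 2 \<omega>" for \<omega>
  proof -
    let ?r = "norm (X \<omega> + Y \<omega>)"
    have "0 \<le> (?r - K)\<^sup>2" by simp
    then have "(2 * ?r - K) * K \<le> ?r\<^sup>2" by (simp add: power2_eq_square algebra_simps)
    moreover have "?r\<^sup>2 \<le> size 2 \<omega>"
      unfolding size_def by (intro power_mono norm_triangle_ineq) auto
    ultimately have "2 * ?r - K \<le> 1 / K * size 2 \<omega>" using K by (simp add: le_divide_eq)
    then show ?thesis using K by (simp add: size_def)
  qed
  ultimately have "E (\<lambda>\<omega>. max 0 (2 * norm (X \<omega> + Y \<omega>) - K)) \<le> E (\<lambda>\<omega>. 1 / K * size 2 \<omega>)"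
    by (intro mono scale_in size_in) simp_all
  then show ?thesis using pos_homog[OF size_in, of "1 / K" 2] K by simp
qed

theorem theorem3p5:
  fixes H :: "('w \<Rightarrow> real) set" and E :: "('w \<Rightarrow> real) \<Rightarrow> real"
    and X Y :: "nat \<Rightarrow> 'w \<Rightarrow> real ^ 'd"
    and H' :: "('v \<Rightarrow> real) set" and E' :: "('v \<Rightarrow> real) \<Rightarrow> real"
    and X' \<eta> :: "'v \<Rightarrow> real ^ 'd"
  assumes "sublinear_expectation H E"
    and "\<And>i. 1 \<le> i \<Longrightarrow> random_vector H (X i)"
    and "\<And>i. 1 \<le> i \<Longrightarrow> random_vector H (Y i)"
    and "\<And>i. 1 \<le> i \<Longrightarrow>
           same_law E (\<lambda>\<omega>. (X (Suc i) \<omega>, Y (Suc i) \<omega>)) E (\<lambda>\<omega>. (X i \<omega>, Y i \<omega>))"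
    and "\<And>i. 1 \<le> i \<Longrightarrow>
           independent_from (tuple_norm {1..i}) E
             (\<lambda>\<omega> j. (X j \<omega>, Y j \<omega>)) (\<lambda>\<omega>. (X (Suc i) \<omega>, Y (Suc i) \<omega>))"
    and "vec_expectation E (X 1) = 0"
    and "vec_expectation E (\<lambda>\<omega>. - X 1 \<omega>) = 0"
    and "sublinear_expectation H' E'"
    and "random_vector H' X'"
    and "random_vector H' \<eta>"
    and "G_distributed E' X' \<eta>"
    and "\<And>p A. transpose A = A \<Longrightarrow> G_function E' X' \<eta> p A = G_function E (X 1) (Y 1) p A"
  shows
    "(\<forall>\<phi>. continuous_on UNIV \<phi> \<and> (\<exists>C. \<forall>x. \<bar>\<phi> x\<bar> \<le> C * (1 + norm x)) \<longrightarrow>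
        (\<lambda>n. ext_expectation E
               (\<lambda>\<omega>. \<Sum>i=1..n. (1 / sqrt (real n)) *\<^sub>R X i \<omega> + (1 / real n) *\<^sub>R Y i \<omega>) \<phi>)
          \<longlonglongrightarrow> ext_expectation E' (\<lambda>\<omega>. X' \<omega> + \<eta> \<omega>) \<phi>)
     \<and> (\<forall>\<phi> \<in> C_lLip norm. \<exists>v.
          G_heat_solution (G_function E (X 1) (Y 1)) \<phi> v \<and>
          (\<forall>w. G_heat_solution (G_function E (X 1) (Y 1)) \<phi> w \<longrightarrow>
                 (\<forall>t\<ge>0. \<forall>x. w t x = v t x)) \<and>
          E' (\<lambda>\<omega>. \<phi> (X' \<omega> + \<eta> \<omega>)) = v 1 0)"
proof (intro conjI allI impI ballI)
  interpret E: expectation_pair H E "X 1" "Y 1"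
    using assms(1) assms(2,3)[of 1] sublinear_expectation.mean_zero[OF assms(1) assms(2)[of 1] assms(6,7)]
    by (intro expectation_pair.intro expectation_pair_axioms.intro) simp_all
  interpret E': G_pair H' E' X' \<eta>
    using assms(8-11) sublinear_expectation.G_distributed_mean_zero[OF assms(8,9,11)]
    by (intro G_pair.intro expectation_pair.intro expectation_pair_axioms.intro G_pair_axioms.intro) simp_all
  interpret S: generated_semigroup E'.law E'.G by (rule E'.law_generated_semigroup)
  \<comment> \<open>Equality is assumed for symmetric matrices; a quadratic form sees only the
    symmetric part \<open>B\<close>, so the equality extends to all matrices.\<close>
  have G: "E'.G = E.G"
  proof (intro ext)
    fix p and A :: "real ^ 'd ^ 'd"
    define B where "B = (1/2) *\<^sub>R (A + transpose A)"
    have tA: "(transpose A *v z) \<bullet> z = (A *v z) \<bullet> z" for z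
      by (metis dot_lmul_matrix inner_commute transpose_matrix_vector)
    have q: "(B *v z) \<bullet> z = (A *v z) \<bullet> z" for z
      using tA[of z] by (simp add: B_def scaleR_matrix_vector_assoc[symmetric] matrix_vector_mult_add_rdistrib inner_add_left)
    have "transpose B = B"
      by (simp add: B_def transpose_def vec_eq_iff add.commute)
    from assms(12)[OF this, of p] show "E'.G p A = E.G p A" by (simp add: G_function_def q)
  qed
  let ?S = "\<lambda>n \<omega>. \<Sum>i=1..n. (1 / sqrt (real n)) *\<^sub>R X i \<omega> + (1 / real n) *\<^sub>R Y i \<omega>"
  have S_rv: "random_vector H (?S n)" for n
  proof -
    have "(\<lambda>\<omega>. (\<Sum>i\<in>I. (1 / sqrt (real n)) *\<^sub>R X i \<omega> + (1 / real n) *\<^sub>R Y i \<omega>) \<bullet> b) \<in> H"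
      if "finite I" "I \<subseteq> {1..}" for I b
      using that
    proof induction
      case empty
      show ?case using E.const_in[of 0] by simp
    next
      case (insert i I)
      have "(\<lambda>\<omega>. b \<bullet> X i \<omega>) \<in> H" "(\<lambda>\<omega>. b \<bullet> Y i \<omega>) \<in> H"
        using insert.prems assms(2,3)[of i] by (auto intro: E.random_vector_inner)
      then have "(\<lambda>\<omega>. (1 / sqrt (real n)) * (b \<bullet> X i \<omega>) + (1 / real n) * (b \<bullet> Y i \<omega>)) \<in> H"
        by (intro E.add_in E.scale_in)
      from E.add_in[OF this insert.IH] insert show ?case
        by (simp add: inner_add_left inner_commute[of b])
    qed
    from this[of "{1..n}"] show ?thesis unfolding random_vector_def by auto
  qed
  have Z_rv: "random_vector H' (\<lambda>\<omega>. X' \<omega> + \<eta> \<omega>)"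
  proof -
    have "(\<lambda>\<omega>. b \<bullet> X' \<omega> + b \<bullet> \<eta> \<omega>) \<in> H'" for b
      by (intro E'.add_in E'.random_vector_inner assms(9,10))
    then show ?thesis unfolding random_vector_def by (simp add: inner_add_left inner_add_right inner_commute)
  qed
  have clt: "(\<lambda>n. E (\<lambda>\<omega>. f (?S n \<omega>))) \<longlonglongrightarrow> E' (\<lambda>\<omega>. f (X' \<omega> + \<eta> \<omega>))" if f: "L-lipschitz_on UNIV f" for L f
  proof -
    \<comment> \<open>The schemes are compared at time 1. For the G-distributed pair the scheme is
      an exact semigroup, so its iterate does not depend on \<open>n\<close>.\<close>
    have "(\<lambda>n. (conv (E.law (1 / real n)) ^^ n) f 0 - (conv (E'.law (1 / real n)) ^^ n) f 0) \<longlonglongrightarrow> 0"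
      using generated_families_agree[OF E'.law_family E.law_family[folded G] f, of 1 0] by simp
    moreover have "\<forall>\<^sub>F n in sequentially. (conv (E.law (1 / real n)) ^^ n) f 0 - (conv (E'.law (1 / real n)) ^^ n) f 0
        = E (\<lambda>\<omega>. f (?S n \<omega>)) - E' (\<lambda>\<omega>. f (X' \<omega> + \<eta> \<omega>))"
      using eventually_gt_at_top[of "0::nat"]
    proof eventually_elim
      case (elim n)
      have "E (\<lambda>\<omega>. f (?S n \<omega>)) = (conv (E.law (1 / real n)) ^^ n) f 0"
        using iid_sum_expectation[OF E.expectation_pair_axioms assms(4,5) f, where x = 0 and n = n and h = "1 / real n"]
        by (simp add: real_sqrt_divide)
      moreover have "(conv (E'.law (1 / real n)) ^^ n) f 0 = E' (\<lambda>\<omega>. f (X' \<omega> + \<eta> \<omega>))"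
        using S.conv_power[of "1 / real n" f n] LipI[OF f] elim by (simp add: E'.val_eq)
      ultimately show ?case by simp
    qed
    ultimately have "(\<lambda>n. E (\<lambda>\<omega>. f (?S n \<omega>)) - E' (\<lambda>\<omega>. f (X' \<omega> + \<eta> \<omega>))) \<longlonglongrightarrow> 0"
      by (rule Lim_transform_eventually)
    then show ?thesis by (simp add: LIM_zero_iff)
  qed
  {
    fix \<phi> :: "real ^ 'd \<Rightarrow> real"
    assume "continuous_on UNIV \<phi> \<and> (\<exists>C. \<forall>x. \<bar>\<phi> x\<bar> \<le> C * (1 + norm x))"
    then obtain C where cont: "continuous_on UNIV \<phi>" and C: "\<And>x. \<bar>\<phi> x\<bar> \<le> C * (1 + norm x)" by blast
    have C0: "C \<ge> 0" using C[of 0] by simp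
    let ?a = "\<lambda>n. ext_expectation E (?S n) \<phi>" and ?b = "ext_expectation E' (\<lambda>\<omega>. X' \<omega> + \<eta> \<omega>) \<phi>"
    show "?a \<longlonglongrightarrow> ?b"
    proof (rule LIMSEQ_I)
      fix r :: real assume r: "r > 0"
      \<comment> \<open>For large \<open>n\<close> the error is below \<open>4 * \<delta>\<close>:
        less than \<open>2 * \<delta>\<close> for approximation under the law of the sum, \<delta>
        for convergence and \<delta> for approximation under the limit law.\<close>
      define \<delta> where "\<delta> = r / 5"
      have \<delta>: "\<delta> > 0" using r by (simp add: \<delta>_def)
      define K where "K = max 1 (8 * C * E' (E'.size 2) / \<delta>)"
      have K: "K \<ge> 1" "4 * C * (E' (E'.size 2) / K) \<le> \<delta> / 2"
        using \<delta> by (auto simp: K_def field_simps max_def)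
      obtain \<Phi> where \<Phi>: "Lip \<Phi>"
        and close: "\<And>x. \<bar>\<phi> x - \<Phi> x\<bar> \<le> \<delta> / 2 + 4 * C * max 0 (2 * norm x - K)"
        using linear_growth_approximation[OF cont C _ K(1), of "\<delta> / 2"] \<delta> by auto
      \<comment> \<open>The error bound is itself Lipschitz: its expectation under the sums
        converges, so a tail estimate under the limit law alone is enough.\<close>
      define \<Psi> where "\<Psi> x = \<delta> / 2 + 4 * C * max 0 (2 * norm x - K)" for x :: "real ^ 'd"
      have \<Psi>: "Lip \<Psi>" unfolding \<Psi>_def by (intro Lip_add Lip_const Lip_cmult Lip_ramp)
      have E\<Psi>: "E' (\<lambda>\<omega>. \<Psi> (X' \<omega> + \<eta> \<omega>)) \<le> \<delta>"
      proof -
        have ramp: "(\<lambda>\<omega>. max 0 (2 * norm (X' \<omega> + \<eta> \<omega>) - K)) \<in> H'"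
          by (rule E'.comp_in[OF Z_rv Lip_C_lLip[OF Lip_ramp]])
        have "E' (\<lambda>\<omega>. \<Psi> (X' \<omega> + \<eta> \<omega>)) = \<delta> / 2 + 4 * C * E' (\<lambda>\<omega>. max 0 (2 * norm (X' \<omega> + \<eta> \<omega>) - K))"
          unfolding \<Psi>_def using E'.E_add_const[OF E'.scale_in[OF ramp]] E'.pos_homog[OF ramp, of "4 * C"] C0 by simp
        also have "\<dots> \<le> \<delta> / 2 + 4 * C * (E' (E'.size 2) / K)"
          using E'.ramp_le[of K] K C0 by (intro add_left_mono mult_left_mono) auto
        finally show ?thesis using K by linarith
      qed
      have "(\<lambda>n. E (\<lambda>\<omega>. \<Phi> (?S n \<omega>))) \<longlonglongrightarrow> E' (\<lambda>\<omega>. \<Phi> (X' \<omega> + \<eta> \<omega>))"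
        using \<Phi> clt unfolding Lip_def by blast
      from LIMSEQ_D[OF this \<delta>] obtain N1 where N1: "\<And>n. n \<ge> N1 \<Longrightarrow>
          \<bar>E (\<lambda>\<omega>. \<Phi> (?S n \<omega>)) - E' (\<lambda>\<omega>. \<Phi> (X' \<omega> + \<eta> \<omega>))\<bar> < \<delta>" by auto
      have "(\<lambda>n. E (\<lambda>\<omega>. \<Psi> (?S n \<omega>))) \<longlonglongrightarrow> E' (\<lambda>\<omega>. \<Psi> (X' \<omega> + \<eta> \<omega>))"
        using \<Psi> clt unfolding Lip_def by blast
      from LIMSEQ_D[OF this \<delta>] obtain N2 where N2: "\<And>n. n \<ge> N2 \<Longrightarrow>
          \<bar>E (\<lambda>\<omega>. \<Psi> (?S n \<omega>)) - E' (\<lambda>\<omega>. \<Psi> (X' \<omega> + \<eta> \<omega>))\<bar> < \<delta>" by auto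
      have "norm (?a n - ?b) < r" if n: "n \<ge> max N1 N2" for n
      proof -
        have "\<bar>?a n - E (\<lambda>\<omega>. \<Phi> (?S n \<omega>))\<bar> \<le> E (\<lambda>\<omega>. \<Psi> (?S n \<omega>))"
          using close unfolding \<Psi>_def[symmetric]
          by (intro E.ext_expectation_approx[OF S_rv cont C] Lip_C_lLip \<Phi> \<Psi>)
        moreover have "\<bar>?b - E' (\<lambda>\<omega>. \<Phi> (X' \<omega> + \<eta> \<omega>))\<bar> \<le> E' (\<lambda>\<omega>. \<Psi> (X' \<omega> + \<eta> \<omega>))"
          using close unfolding \<Psi>_def[symmetric]
          by (intro E'.ext_expectation_approx[OF Z_rv cont C] Lip_C_lLip \<Phi> \<Psi>)
        moreover have "n \<ge> N1" "n \<ge> N2" using n by auto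
        ultimately show ?thesis
          using N1[of n] N2[of n] E\<Psi> unfolding real_norm_def \<delta>_def by linarith
      qed
      then show "\<exists>N. \<forall>n\<ge>N. norm (?a n - ?b) < r" by blast
    qed
  next
    fix \<phi> :: "real ^ 'd \<Rightarrow> real" assume \<phi>: "\<phi> \<in> C_lLip norm"
    show "\<exists>v. G_heat_solution (G_function E (X 1) (Y 1)) \<phi> v \<and>
        (\<forall>w. G_heat_solution (G_function E (X 1) (Y 1)) \<phi> w \<longrightarrow> (\<forall>t\<ge>0. \<forall>x. w t x = v t x)) \<and>
        E' (\<lambda>\<omega>. \<phi> (X' \<omega> + \<eta> \<omega>)) = v 1 0"
      unfolding G[symmetric]
      using E'.val_G_heat_solution[OF \<phi>] E'.G_heat_solution_unique[OF \<phi>]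
      by (intro exI[of _ "\<lambda>t. E'.val t \<phi>"]) (simp add: E'.val_eq)
  }
qed

end
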